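(* Let $H$ be a closed subgroup of $SO(5)$ isomorphic to $SO(3)$, and let $M=SO(5)/H$ be endowed with an $SO(5)$-invariant Riemannian metric. Assume that $M$ has co-index of symmetry $4$ and that the universal cover of $M$ does not have a symmetric de Rham factor. Then $H$ is conjugate in $SO(5)$ to the subgroup $$\left\{\begin{pmatrix}A&0&0\\0&1&0\\0&0&1\end{pmatrix}:A\in SO(3)\right\}\subset SO(5).$$
   Context: Let $M$ be a compact homogeneous Riemannian manifold with Levi-Civita connection $\nabla$, and let $\mathfrak K(M)$ be the Lie algebra of all Killing vector fields on $M$ (the Lie algebra of the full isometry group $I(M)$). For $q\in M$ put $\mathfrak p^q=\{X\in\mathfrak K(M):(\nabla X)_q=0\}$ and $\mathfrak s_q=\{X_q:X\in\mathfrak p^q\}\subset T_qM$. The dimension of $\mathfrak s_q$ does not depend on $q$; it is called the index of symmetry $i_{\mathfrak s}(M)$ of $M$. The co-index of symmetry of $M$ is $\dim M-i_{\mathfrak s}(M)$. A symmetric de Rham factor is a (positive-dimensional) factor in a Riemannian product decomposition of the universal cover (de Rham decomposition) that is a Riemannian symmetric space. *)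

theory Defs
  imports
    "HOL-Analysis.Analysis"
    "HOL-Algebra.Left_Coset"
    "HOL-Library.Function_Algebras"
begin

section \<open>Smooth functions on open sets\<close>

text \<open>Points of \<open>\<real>\<^sup>n\<close> are the elements of \<open>topspace (Euclidean_space n)\<close>, that is, functions
  \<open>nat \<Rightarrow> real\<close> vanishing at all indices \<open>\<ge> n\<close>. Changing a coordinate below \<open>n\<close> stays in this set.\<close>

definition partial_deriv :: "nat \<Rightarrow> ((nat \<Rightarrow> real) \<Rightarrow> real) \<Rightarrow> (nat \<Rightarrow> real) \<Rightarrow> real" where
  "partial_deriv i f x = deriv (\<lambda>t. f (x(i := t))) (x i)"

primrec Ck_on :: "nat \<Rightarrow> nat \<Rightarrow> (nat \<Rightarrow> real) set \<Rightarrow> ((nat \<Rightarrow> real) \<Rightarrow> real) \<Rightarrow> bool" where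
  "Ck_on n 0 V f \<longleftrightarrow> continuous_map (subtopology (Euclidean_space n) V) euclideanreal f"
| "Ck_on n (Suc k) V f \<longleftrightarrow>
     continuous_map (subtopology (Euclidean_space n) V) euclideanreal f \<and>
     (\<forall>i<n. (\<forall>x\<in>V. (\<lambda>t. f (x(i := t))) differentiable (at (x i))) \<and>
            Ck_on n k V (partial_deriv i f))"

text \<open>\<open>V\<close> is meant to be an open subset of \<open>\<real>\<^sup>n\<close>.\<close>

definition smooth_on :: "nat \<Rightarrow> (nat \<Rightarrow> real) set \<Rightarrow> ((nat \<Rightarrow> real) \<Rightarrow> real) \<Rightarrow> bool" where
  "smooth_on n V f \<longleftrightarrow> (\<forall>k. Ck_on n k V f)"

text \<open>The same notion on open subsets of a Euclidean space given as a type (used for matrices).\<close>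

primrec Ck_on_type :: "nat \<Rightarrow> 'e::euclidean_space set \<Rightarrow> ('e \<Rightarrow> real) \<Rightarrow> bool" where
  "Ck_on_type 0 W f \<longleftrightarrow> continuous_on W f"
| "Ck_on_type (Suc k) W f \<longleftrightarrow>
     continuous_on W f \<and>
     (\<forall>b\<in>Basis. (\<forall>x\<in>W. (\<lambda>t::real. f (x + t *\<^sub>R b)) differentiable (at 0)) \<and>
                Ck_on_type k W (\<lambda>x. deriv (\<lambda>t. f (x + t *\<^sub>R b)) 0))"

text \<open>Smoothness on an arbitrary subset \<open>S\<close>: locally the restriction of a smooth function. For an
  embedded submanifold \<open>S\<close> this is smoothness with respect to the submanifold structure.\<close>

definition smooth_on_subset :: "'e::euclidean_space set \<Rightarrow> ('e \<Rightarrow> real) \<Rightarrow> bool" where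
  "smooth_on_subset S f \<longleftrightarrow>
     (\<forall>a\<in>S. \<exists>W F. open W \<and> a \<in> W \<and> (\<forall>k. Ck_on_type k W F) \<and> (\<forall>x\<in>W \<inter> S. F x = f x))"

section \<open>Smooth manifolds\<close>

record 'a mfd =
  mtop :: "'a topology"
  mdim :: nat
  charts :: "('a set \<times> ('a \<Rightarrow> nat \<Rightarrow> real)) set"

abbreviation points :: "('a, 'z) mfd_scheme \<Rightarrow> 'a set" where
  "points M \<equiv> topspace (mtop M)"

text \<open>The atlas \<open>charts M\<close> need not be maximal; no notion below depends on more than the smooth
  structure it generates.\<close>

definition smooth_manifold :: "('a, 'z) mfd_scheme \<Rightarrow> bool" where
  "smooth_manifold M \<longleftrightarrow>
     Hausdorff_space (mtop M) \<and>
     (\<exists>\<B>. countable \<B> \<and> (\<forall>B\<in>\<B>. openin (mtop M) B) \<and>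
          (\<forall>U x. openin (mtop M) U \<and> x \<in> U \<longrightarrow> (\<exists>B\<in>\<B>. x \<in> B \<and> B \<subseteq> U))) \<and>
     (\<forall>(U, \<phi>)\<in>charts M. openin (mtop M) U \<and> openin (Euclidean_space (mdim M)) (\<phi> ` U) \<and>
        homeomorphic_map (subtopology (mtop M) U) (subtopology (Euclidean_space (mdim M)) (\<phi> ` U)) \<phi>) \<and>
     (\<Union>(U, \<phi>)\<in>charts M. U) = points M \<and>
     (\<forall>(U, \<phi>)\<in>charts M. \<forall>(V, \<psi>)\<in>charts M. \<forall>i<mdim M.
        smooth_on (mdim M) (\<phi> ` (U \<inter> V)) (\<lambda>x. \<psi> (inv_into U \<phi> x) i))"

text \<open>Smoothness of a real function on an open subset \<open>A\<close> of \<open>M\<close>.\<close>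

definition smooth_fun_on :: "('a, 'z) mfd_scheme \<Rightarrow> 'a set \<Rightarrow> ('a \<Rightarrow> real) \<Rightarrow> bool" where
  "smooth_fun_on M A f \<longleftrightarrow>
     (\<forall>(U, \<phi>)\<in>charts M. smooth_on (mdim M) (\<phi> ` (U \<inter> A)) (\<lambda>x. f (inv_into U \<phi> x)))"

text \<open>The algebra \<open>C\<^sup>\<infinity>(M)\<close>. A function on \<open>M\<close> is represented by its extension by zero to the whole
  type, so that functions on \<open>M\<close> that agree on \<open>M\<close> are equal.\<close>

definition smooth_funs :: "('a, 'z) mfd_scheme \<Rightarrow> ('a \<Rightarrow> real) set" where
  "smooth_funs M = {f. smooth_fun_on M (points M) f \<and> (\<forall>x. x \<notin> points M \<longrightarrow> f x = 0)}"

definition smooth_map :: "('a, 'y) mfd_scheme \<Rightarrow> ('b, 'z) mfd_scheme \<Rightarrow> ('a \<Rightarrow> 'b) \<Rightarrow> bool" where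
  "smooth_map M N F \<longleftrightarrow>
     continuous_map (mtop M) (mtop N) F \<and>
     (\<forall>(U, \<phi>)\<in>charts M. \<forall>(V, \<psi>)\<in>charts N. \<forall>i<mdim N.
        smooth_on (mdim M) (\<phi> ` {x\<in>U. F x \<in> V}) (\<lambda>x. \<psi> (F (inv_into U \<phi> x)) i))"

section \<open>Tangent vectors and vector fields\<close>

text \<open>\<open>T\<^sub>qM\<close> is the space of derivations at \<open>q\<close> of \<open>C\<^sup>\<infinity>(M)\<close>; a derivation is extended by zero to
  arguments outside \<open>C\<^sup>\<infinity>(M)\<close>. Sums of tangent vectors are the pointwise sums of
  \<^theory>\<open>HOL-Library.Function_Algebras\<close>.\<close>

type_synonym 'a tvec = "('a \<Rightarrow> real) \<Rightarrow> real"
type_synonym 'a vfield = "'a \<Rightarrow> 'a tvec"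

definition tscale :: "real \<Rightarrow> 'a tvec \<Rightarrow> 'a tvec" where
  "tscale c v = (\<lambda>f. c * v f)"

lemma vector_space_tscale: "vector_space (tscale :: real \<Rightarrow> 'a tvec \<Rightarrow> 'a tvec)"
  by unfold_locales (auto simp: tscale_def fun_eq_iff algebra_simps)

definition tdim :: "'a tvec set \<Rightarrow> nat" where
  "tdim S = vector_space.dim tscale S"

definition tangent_space :: "('a, 'z) mfd_scheme \<Rightarrow> 'a \<Rightarrow> 'a tvec set" where
  "tangent_space M q = {v.
     (\<forall>f\<in>smooth_funs M. \<forall>g\<in>smooth_funs M. v (f + g) = v f + v g) \<and>
     (\<forall>c. \<forall>f\<in>smooth_funs M. v (\<lambda>x. c * f x) = c * v f) \<and>
     (\<forall>f\<in>smooth_funs M. \<forall>g\<in>smooth_funs M. v (\<lambda>x. f x * g x) = f q * v g + g q * v f) \<and>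
     (\<forall>f. f \<notin> smooth_funs M \<longrightarrow> v f = 0)}"

definition differential ::
    "('a, 'y) mfd_scheme \<Rightarrow> ('b, 'z) mfd_scheme \<Rightarrow> ('a \<Rightarrow> 'b) \<Rightarrow> 'a tvec \<Rightarrow> 'b tvec" where
  "differential M N F v =
     (\<lambda>f. if f \<in> smooth_funs N then v (\<lambda>x. if x \<in> points M then f (F x) else 0) else 0)"

definition vfields :: "('a, 'z) mfd_scheme \<Rightarrow> 'a vfield set" where
  "vfields M = {X. (\<forall>q\<in>points M. X q \<in> tangent_space M q) \<and> (\<forall>q. q \<notin> points M \<longrightarrow> X q = 0) \<and>
                   (\<forall>f\<in>smooth_funs M. (\<lambda>q. X q f) \<in> smooth_funs M)}"

definition vf_apply :: "'a vfield \<Rightarrow> ('a \<Rightarrow> real) \<Rightarrow> ('a \<Rightarrow> real)" where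
  "vf_apply X f = (\<lambda>q. X q f)"

definition vf_scale :: "('a \<Rightarrow> real) \<Rightarrow> 'a vfield \<Rightarrow> 'a vfield" where
  "vf_scale f X = (\<lambda>q. tscale (f q) (X q))"

definition lie_bracket :: "'a vfield \<Rightarrow> 'a vfield \<Rightarrow> 'a vfield" where
  "lie_bracket X Y = (\<lambda>q f. X q (vf_apply Y f) - Y q (vf_apply X f))"

section \<open>Riemannian manifolds\<close>

record 'a rmfd = "'a mfd" +
  metric :: "'a \<Rightarrow> 'a tvec \<Rightarrow> 'a tvec \<Rightarrow> real"

definition vf_inner :: "'a rmfd \<Rightarrow> 'a vfield \<Rightarrow> 'a vfield \<Rightarrow> 'a \<Rightarrow> real" where
  "vf_inner M X Y = (\<lambda>q. if q \<in> points M then metric M q (X q) (Y q) else 0)"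

definition riemannian_manifold :: "'a rmfd \<Rightarrow> bool" where
  "riemannian_manifold M \<longleftrightarrow>
     smooth_manifold M \<and>
     (\<forall>q\<in>points M. \<forall>u\<in>tangent_space M q. \<forall>v\<in>tangent_space M q.
        metric M q u v = metric M q v u \<and>
        (\<forall>w\<in>tangent_space M q. metric M q (u + v) w = metric M q u w + metric M q v w) \<and>
        (\<forall>c. metric M q (tscale c u) v = c * metric M q u v) \<and>
        (u \<noteq> 0 \<longrightarrow> metric M q u u > 0)) \<and>
     (\<forall>X\<in>vfields M. \<forall>Y\<in>vfields M. vf_inner M X Y \<in> smooth_funs M)"

text \<open>\<open>D X Y\<close> stands for \<open>\<nabla>\<^sub>X Y\<close>.\<close>

definition is_levi_civita :: "'a rmfd \<Rightarrow> ('a vfield \<Rightarrow> 'a vfield \<Rightarrow> 'a vfield) \<Rightarrow> bool" where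
  "is_levi_civita M D \<longleftrightarrow>
     (\<forall>X\<in>vfields M. \<forall>Y\<in>vfields M.
        D X Y \<in> vfields M \<and>
        D X Y - D Y X = lie_bracket X Y \<and>
        (\<forall>f\<in>smooth_funs M.
           D (vf_scale f X) Y = vf_scale f (D X Y) \<and>
           D X (vf_scale f Y) = vf_scale (vf_apply X f) Y + vf_scale f (D X Y)) \<and>
        (\<forall>Z\<in>vfields M.
           D (X + Y) Z = D X Z + D Y Z \<and>
           D X (Y + Z) = D X Y + D X Z \<and>
           vf_apply X (vf_inner M Y Z) = vf_inner M (D X Y) Z + vf_inner M Y (D X Z)))"

text \<open>The defining properties determine \<open>levi_civita M\<close> uniquely on \<open>vfields M\<close>; only its values
  there are used.\<close>

definition levi_civita :: "'a rmfd \<Rightarrow> 'a vfield \<Rightarrow> 'a vfield \<Rightarrow> 'a vfield" where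
  "levi_civita M = (SOME D. is_levi_civita M D)"

text \<open>Vanishing of the Lie derivative of the metric along \<open>X\<close>. Completeness of \<open>X\<close> is not
  required here; it is automatic on compact manifolds.\<close>

definition killing_fields :: "'a rmfd \<Rightarrow> 'a vfield set" where
  "killing_fields M = {X \<in> vfields M. \<forall>Y\<in>vfields M. \<forall>Z\<in>vfields M.
     vf_apply X (vf_inner M Y Z) = vf_inner M (lie_bracket X Y) Z + vf_inner M Y (lie_bracket X Z)}"

section \<open>Index of symmetry\<close>

definition transvections_at :: "'a rmfd \<Rightarrow> 'a \<Rightarrow> 'a vfield set" where
  "transvections_at M q = {X \<in> killing_fields M. \<forall>Y\<in>vfields M. levi_civita M Y X q = 0}"

definition symmetry_subspace :: "'a rmfd \<Rightarrow> 'a \<Rightarrow> 'a tvec set" where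
  "symmetry_subspace M q = (\<lambda>X. X q) ` transvections_at M q"

text \<open>Well defined when the dimension does not depend on the point, as on homogeneous manifolds.\<close>

definition index_of_symmetry :: "'a rmfd \<Rightarrow> nat" where
  "index_of_symmetry M = (THE k. \<forall>q\<in>points M. tdim (symmetry_subspace M q) = k)"

definition coindex_of_symmetry :: "'a rmfd \<Rightarrow> nat" where
  "coindex_of_symmetry M = mdim M - index_of_symmetry M"

section \<open>Isometries, coverings, products and symmetric spaces\<close>

definition local_isometry :: "'a rmfd \<Rightarrow> 'b rmfd \<Rightarrow> ('a \<Rightarrow> 'b) \<Rightarrow> bool" where
  "local_isometry M N F \<longleftrightarrow>
     smooth_map M N F \<and>
     (\<forall>q\<in>points M.
        bij_betw (differential M N F) (tangent_space M q) (tangent_space N (F q)) \<and>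
        (\<forall>u\<in>tangent_space M q. \<forall>v\<in>tangent_space M q.
           metric N (F q) (differential M N F u) (differential M N F v) = metric M q u v))"

definition isometry :: "'a rmfd \<Rightarrow> 'b rmfd \<Rightarrow> ('a \<Rightarrow> 'b) \<Rightarrow> bool" where
  "isometry M N F \<longleftrightarrow>
     bij_betw F (points M) (points N) \<and> local_isometry M N F \<and> smooth_map N M (inv_into (points M) F)"

text \<open>The library notions \<^const>\<open>covering_space\<close> and \<^const>\<open>simply_connected\<close>, transferred from
  subsets of topological types to abstract topologies.\<close>

definition covering_map :: "'a topology \<Rightarrow> 'b topology \<Rightarrow> ('a \<Rightarrow> 'b) \<Rightarrow> bool" where
  "covering_map X Y p \<longleftrightarrow>
     continuous_map X Y p \<and> p ` topspace X = topspace Y \<and>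
     (\<forall>y\<in>topspace Y. \<exists>T. y \<in> T \<and> openin Y T \<and>
        (\<exists>\<V>. \<Union>\<V> = {x \<in> topspace X. p x \<in> T} \<and> (\<forall>V\<in>\<V>. openin X V) \<and> pairwise disjnt \<V> \<and>
             (\<forall>V\<in>\<V>. homeomorphic_map (subtopology X V) (subtopology Y T) p)))"

definition simply_connected_space :: "'a topology \<Rightarrow> bool" where
  "simply_connected_space X \<longleftrightarrow>
     (\<forall>p q. pathin X p \<and> p 1 = p 0 \<and> pathin X q \<and> q 1 = q 0 \<longrightarrow>
        homotopic_with (\<lambda>r. r 1 = r 0) (top_of_set {0..1}) X p q)"

definition riemannian_universal_cover :: "'a rmfd \<Rightarrow> 'b rmfd \<Rightarrow> ('a \<Rightarrow> 'b) \<Rightarrow> bool" where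
  "riemannian_universal_cover N M p \<longleftrightarrow>
     riemannian_manifold N \<and> simply_connected_space (mtop N) \<and>
     covering_map (mtop N) (mtop M) p \<and> local_isometry N M p"

text \<open>The Riemannian product; the metric is the sum of the pullbacks under the two projections.\<close>

definition product_mfd :: "('a, 'y) mfd_scheme \<Rightarrow> ('b, 'z) mfd_scheme \<Rightarrow> ('a \<times> 'b) mfd" where
  "product_mfd M N = \<lparr>
     mtop = prod_topology (mtop M) (mtop N),
     mdim = mdim M + mdim N,
     charts = {(U \<times> V, \<lambda>(x, y) i. if i < mdim M then \<phi> x i else \<psi> y (i - mdim M)) | U \<phi> V \<psi>.
                 (U, \<phi>) \<in> charts M \<and> (V, \<psi>) \<in> charts N}\<rparr>"

definition product_rmfd :: "'a rmfd \<Rightarrow> 'b rmfd \<Rightarrow> ('a \<times> 'b) rmfd" where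
  "product_rmfd M N = mfd.extend (product_mfd M N) (rmfd.fields (\<lambda>(a, b) v w.
     metric M a (differential (product_mfd M N) M fst v) (differential (product_mfd M N) M fst w) +
     metric N b (differential (product_mfd M N) N snd v) (differential (product_mfd M N) N snd w)))"

definition symmetric_space :: "'a rmfd \<Rightarrow> bool" where
  "symmetric_space M \<longleftrightarrow>
     riemannian_manifold M \<and> connected_space (mtop M) \<and>
     (\<forall>q\<in>points M. \<exists>\<sigma>. isometry M M \<sigma> \<and> \<sigma> q = q \<and>
        (\<forall>v\<in>tangent_space M q. differential M M \<sigma> v = - v))"

text \<open>Letting the carriers of the factors range over subsets of the type of \<open>N\<close> is no restriction:
  a factor of a nonempty product is isometric to a slice, which is a subset of the product.
  The complementary factor \<open>N\<^sub>2\<close> may be a point, namely when \<open>N\<close> itself is symmetric.\<close>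

definition has_symmetric_factor :: "'a rmfd \<Rightarrow> bool" where
  "has_symmetric_factor N \<longleftrightarrow>
     (\<exists>(N\<^sub>1 :: 'a rmfd) (N\<^sub>2 :: 'a rmfd) F.
        symmetric_space N\<^sub>1 \<and> mdim N\<^sub>1 > 0 \<and> riemannian_manifold N\<^sub>2 \<and>
        isometry N (product_rmfd N\<^sub>1 N\<^sub>2) F)"

section \<open>Special orthogonal groups and their homogeneous spaces\<close>

definition SO :: "(real^'n^'n) monoid" where
  "SO = \<lparr>carrier = {A. rotation_matrix A}, monoid.mult = (**), one = mat 1\<rparr>"

text \<open>Isomorphism of Lie groups between closed groups of matrices: a group isomorphism that is
  a homeomorphism (continuous homomorphisms of Lie groups are smooth).\<close>

definition lie_group_isomorphic ::
    "('a::topological_space) monoid \<Rightarrow> ('b::topological_space) monoid \<Rightarrow> bool" where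
  "lie_group_isomorphic G K \<longleftrightarrow>
     (\<exists>\<theta>\<in>iso G K. homeomorphic_map (top_of_set (carrier G)) (top_of_set (carrier K)) \<theta>)"

text \<open>\<open>M\<close> is the set of left cosets of \<open>H\<close> in \<open>SO(n)\<close> with the quotient topology and the
  smooth structure of a homogeneous space, which is the unique one for which the projection is
  smooth and admits smooth local sections around every point.\<close>

definition coset_manifold :: "(real^'n^'n) set \<Rightarrow> ((real^'n^'n) set, 'z) mfd_scheme \<Rightarrow> bool" where
  "coset_manifold H M \<longleftrightarrow>
     smooth_manifold M \<and>
     points M = lcosets\<^bsub>SO\<^esub> H \<and>
     quotient_map (top_of_set (carrier SO)) (mtop M) (\<lambda>a. a <#\<^bsub>SO\<^esub> H) \<and>
     (\<forall>(U, \<phi>)\<in>charts M. \<forall>i<mdim M.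
        smooth_on_subset {a \<in> carrier SO. a <#\<^bsub>SO\<^esub> H \<in> U} (\<lambda>a. \<phi> (a <#\<^bsub>SO\<^esub> H) i)) \<and>
     (\<forall>x\<in>points M. \<exists>U \<sigma>. openin (mtop M) U \<and> x \<in> U \<and>
        (\<forall>y\<in>U. \<sigma> y \<in> carrier SO \<and> \<sigma> y <#\<^bsub>SO\<^esub> H = y) \<and>
        (\<forall>i j. smooth_fun_on M U (\<lambda>y. \<sigma> y $ i $ j)))"

definition SO_invariant_metric :: "((real^'n^'n) set) rmfd \<Rightarrow> bool" where
  "SO_invariant_metric M \<longleftrightarrow> (\<forall>a\<in>carrier SO. isometry M M (\<lambda>x. a <#\<^bsub>SO\<^esub> x))"

definition block3 :: "real^3^3 \<Rightarrow> real^5^5" where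
  "block3 A = vector [
     vector [A$1$1, A$1$2, A$1$3, 0, 0],
     vector [A$2$1, A$2$2, A$2$3, 0, 0],
     vector [A$3$1, A$3$2, A$3$3, 0, 0],
     vector [0, 0, 0, 1, 0],
     vector [0, 0, 0, 0, 1]]"

end

theory Submission
  imports Defs "HOL-Computational_Algebra.Polynomial"
begin

text \<open>The hypothesis \<open>H \<cong> SO(3)\<close> provides an injective continuous representation of \<open>SO(3)\<close> on
  \<open>\<real>\<^sup>5\<close>. Its complexification contains no factor of half-integral spin, so \<open>\<real>\<^sup>5\<close> is either
  \<open>3 + 1 + 1\<close>, which is the assertion, or irreducible. In the irreducible case \<open>so(5)\<close> is the sum
  of the isotropy algebra and a seven-dimensional irreducible representation, so a subspace of
  \<open>so(5)\<close> which contains the isotropy algebra and is invariant under \<open>H\<close> is one of the two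
  extremes. The space \<open>\<s>\<^sub>q\<close> is invariant under the isotropy group, hence it is zero or the whole
  seven-dimensional tangent space, and the co-index of symmetry is 7 or 0 but not 4.

  The Levi-Civita connection enters only through its existence and the Koszul formula. By Schur's
  lemma the fundamental vector fields of an orthonormal basis of \<open>so(5)\<close> form a tight frame at every
  point, and such a global frame solves the Koszul formula without recourse to local frames.\<close>

section \<open>Calculus in Euclidean space\<close>

text \<open>No Lie theory is presupposed, and this shapes the argument. A continuous homomorphism is
  at first differentiable only along one-parameter groups, by integrating it; the bracket relations
  of its generators come from an explicit factorisation of a conjugated rotation into rotations
  about the three axes. Complexification is avoided by treating a weight vector x + i y as a pair of
  real vectors. Constituents are then recognised by the Casimir operator alone: spin l has
  eigenvalue l (l + 1) and dimension at least 2 l + 1, and l is an integer because a full turn is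
  the identity in SO(3). Thus R^5 of spin 2 has eigenvalue 6; its second exterior power, which is
  so(5), contains spin 1 (eigenvalue 2) and spin 3 (eigenvalue 12), and 3 + 7 = 10 leaves no room
  for more.

  On the geometric side tangent vectors are derivations of global functions, so that even the
  dimension of the tangent space rests on Hadamard's lemma and bump functions. Functions on M are
  differentiated after extending their lifts to open sets of matrices, where ordinary calculus
  applies.\<close>

abbreviation eucl :: "nat \<Rightarrow> (nat \<Rightarrow> real) set" where
  "eucl n \<equiv> topspace (Euclidean_space n)"

lemma Euclidean_space_eq: "Euclidean_space n = top_of_set (eucl n)"
  by (simp add: Euclidean_space_def euclidean_product_topology topspace_Euclidean_space)

lemma openin_Euclidean_space_iff:
  "openin (Euclidean_space n) V \<longleftrightarrow> (\<exists>T. open T \<and> V = eucl n \<inter> T)"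
  by (subst Euclidean_space_eq) (rule openin_open)

lemma subtopology_Euclidean_space_eq:
  "V \<subseteq> eucl n \<Longrightarrow> subtopology (Euclidean_space n) V = top_of_set V"
  by (metis Euclidean_space_eq subtopology_subtopology inf.absorb_iff2)

text \<open>Cubes instead of Euclidean balls: the topology is a product topology, and in a cube the
  coordinates can be moved one at a time towards another point without leaving it.\<close>

definition cube :: "nat \<Rightarrow> (nat \<Rightarrow> real) \<Rightarrow> real \<Rightarrow> (nat \<Rightarrow> real) set" where
  "cube n x e = {y \<in> eucl n. \<forall>i<n. \<bar>y i - x i\<bar> < e}"

lemma openin_cube: "openin (Euclidean_space n) (cube n x e)"
proof -
  have "open {y::nat\<Rightarrow>real. \<bar>y i - x i\<bar> < e}" for i
    by (intro open_Collect_less continuous_intros) auto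
  then have "open (\<Inter>i\<in>{..<n}. {y::nat\<Rightarrow>real. \<bar>y i - x i\<bar> < e})"
    by (intro open_INT) auto
  moreover have "cube n x e = eucl n \<inter> (\<Inter>i\<in>{..<n}. {y. \<bar>y i - x i\<bar> < e})"
    unfolding cube_def by blast
  ultimately show ?thesis
    unfolding openin_Euclidean_space_iff by blast
qed

lemma openin_imp_cube:
  assumes "openin (Euclidean_space n) V" "x \<in> V"
  obtains e where "e > 0" "cube n x e \<subseteq> V"
proof -
  obtain T where T: "open T" "V = eucl n \<inter> T"
    using assms(1) unfolding openin_Euclidean_space_iff by auto
  have xn: "x \<in> eucl n" "x \<in> T" using assms(2) T by auto
  have "openin (product_topology (\<lambda>i::nat. euclideanreal) UNIV) T"
    using T(1) by (simp add: euclidean_product_topology)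
  from product_topology_open_contains_basis[OF this xn(2)]
  obtain X where X: "x \<in> (\<Pi>\<^sub>E i\<in>UNIV. X i)" "\<And>i. openin euclideanreal (X i)"
    "(\<Pi>\<^sub>E i\<in>UNIV. X i) \<subseteq> T" by blast
  have "\<forall>i. \<exists>e>0. ball (x i) e \<subseteq> X i"
    using X(1,2) by (simp add: open_contains_ball PiE_def Pi_def)
  then obtain r where r: "\<And>i. r i > 0" "\<And>i. ball (x i) (r i) \<subseteq> X i" by metis
  \<comment> \<open>Only the radii below \<open>n\<close> count, since the points of
    \<open>eucl n\<close> agree beyond; the 1 keeps the minimum defined for
    \<open>n = 0\<close>.\<close>
  define e where "e = Min (insert 1 (r ` {..<n}))"
  have "e > 0" using r(1) by (auto simp: e_def)
  moreover have er: "e \<le> r i" if "i < n" for i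
    using that by (auto simp: e_def)
  have "cube n x e \<subseteq> V"
  proof
    fix y assume y: "y \<in> cube n x e"
    have "y i \<in> X i" for i
    proof (cases "i < n")
      case True
      then have "dist (x i) (y i) < r i"
        using y er[OF True] by (force simp: cube_def dist_real_def)
      then show ?thesis using r(2) by (auto simp: subset_iff)
    next
      case False
      then have "y i = x i" using y xn(1) by (simp add: cube_def topspace_Euclidean_space)
      then show ?thesis using X(1) by (simp add: PiE_def Pi_def)
    qed
    then have "y \<in> T" using X(3) by (auto simp: PiE_def Pi_def)
    then show "y \<in> V" using y T(2) by (simp add: cube_def)
  qed
  ultimately show ?thesis using that by blast
qed

section \<open>The chain rule along a curve, from continuous partial derivatives\<close>

lemma eucl_upd: "x \<in> eucl n \<Longrightarrow> i < n \<Longrightarrow> x(i := t) \<in> eucl n"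
  by (auto simp: topspace_Euclidean_space)

lemma tendsto_eucl:
  fixes q :: "'b \<Rightarrow> nat \<Rightarrow> real"
  assumes "\<And>i. ((\<lambda>s. q s i) \<longlongrightarrow> x i) F"
  shows "(q \<longlongrightarrow> x) F"
  using assms by (auto simp flip: limitin_canonical_iff euclidean_product_topology
      simp: limitin_componentwise)

text \<open>The two ends may come in either order or coincide. In the chain rule the sign of an
  increment of a coordinate is not under control.\<close>

lemma mvt_segment:
  fixes h :: "real \<Rightarrow> real"
  assumes "\<And>t. t \<in> closed_segment a b \<Longrightarrow> (h has_real_derivative h' t) (at t)"
  shows "\<exists>t\<in>closed_segment a b. h b - h a = h' t * (b - a)"
proof -
  consider "a < b" | "a = b" | "b < a" by linarith
  then show ?thesis
  proof cases
    case 1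
    then obtain z where "a < z" "z < b" "h b - h a = (b - a) * h' z"
      using MVT2[of a b h h'] assms by (auto simp: closed_segment_eq_real_ivl)
    then show ?thesis using 1 by (intro bexI[of _ z]) (auto simp: closed_segment_eq_real_ivl)
  next
    case 3
    then obtain z where "b < z" "z < a" "h a - h b = (a - b) * h' z"
      using MVT2[of b a h h'] assms by (auto simp: closed_segment_eq_real_ivl)
    then show ?thesis using 3
      by (intro bexI[of _ z]) (auto simp: closed_segment_eq_real_ivl algebra_simps)
  qed auto
qed

text \<open>No total derivative is available. The coordinates are moved from \<open>x\<close> to
  \<open>g s\<close> one after the other; each move is an application of the mean value theorem, and
  continuity of the partial derivatives at \<open>x\<close> gives the limit of the difference
  quotient.\<close>

lemma chain_curve:
  assumes V: "openin (Euclidean_space n) V" "x \<in> V"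
    and diff: "\<And>i y. i < n \<Longrightarrow> y \<in> V \<Longrightarrow> (\<lambda>t. f (y(i := t))) differentiable (at (y i))"
    and cont: "\<And>i. i < n \<Longrightarrow> continuous_on V (partial_deriv i f)"
    and g: "g s0 = x" "\<And>s. g s \<in> eucl n"
    and dg: "\<And>i. i < n \<Longrightarrow> ((\<lambda>s. g s i) has_real_derivative d i) (at s0)"
  shows "((\<lambda>s. f (g s)) has_real_derivative (\<Sum>i<n. partial_deriv i f x * d i)) (at s0)"
proof -
  obtain e where e: "e > 0" "cube n x e \<subseteq> V" using openin_imp_cube[OF V] .
  have xE: "x \<in> eucl n" using V openin_subset by blast
  define p where "p j s = (\<lambda>i. if i < j then g s i else x i)" for j :: nat and s
  have gt: "((\<lambda>s. g s i) \<longlongrightarrow> x i) (at s0)" for i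
  proof (cases "i < n")
    case True
    then show ?thesis using DERIV_isCont[OF dg[OF True]] g(1) by (auto simp: isCont_def)
  next
    case False
    then show ?thesis using g(2) xE by (simp add: topspace_Euclidean_space)
  qed
  have ev: "\<forall>\<^sub>F s in at s0. \<forall>i<n. \<bar>g s i - x i\<bar> < e"
  proof -
    have "\<forall>\<^sub>F s in at s0. \<forall>i\<in>{..<n}. dist (g s i) (x i) < e"
      using gt e(1) by (subst eventually_ball_finite_distrib) (auto intro: tendstoD)
    then show ?thesis by (simp add: dist_real_def Ball_def)
  qed
  have claim: "j \<le> n \<Longrightarrow>
    ((\<lambda>s. f (p j s)) has_real_derivative (\<Sum>i<j. partial_deriv i f x * d i)) (at s0)" for j
  proof (induction j)
    case 0
    then show ?case by (simp add: p_def)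
  next
    case (Suc j)
    then have j: "j < n" by simp
    \<comment> \<open>The intermediate point of the mean value theorem for the move of coordinate
      \<open>j\<close>; it is meaningful for \<open>s\<close> near \<open>s0\<close>, where the
      segment stays in the cube.\<close>
    define T where "T s = (SOME t. t \<in> closed_segment (x j) (g s j) \<and>
      f (p (Suc j) s) - f (p j s) = partial_deriv j f ((p j s)(j := t)) * (g s j - x j))" for s
    have T: "T s \<in> closed_segment (x j) (g s j) \<and>
      f (p (Suc j) s) - f (p j s) = partial_deriv j f ((p j s)(j := T s)) * (g s j - x j) \<and>
      (p j s)(j := T s) \<in> V"
      if s: "\<forall>i<n. \<bar>g s i - x i\<bar> < e" for s
    proof -
      have inV: "(p j s)(j := t) \<in> V" if "t \<in> closed_segment (x j) (g s j)" for t
      proof -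
        have "\<bar>t - x j\<bar> \<le> \<bar>g s j - x j\<bar>"
          using that by (auto simp: closed_segment_eq_real_ivl split: if_splits)
        then have "(p j s)(j := t) \<in> cube n x e"
          using s j e(1) xE g(2)
          by (auto simp: cube_def p_def topspace_Euclidean_space)
        then show ?thesis using e(2) by blast
      qed
      have "\<exists>t\<in>closed_segment (x j) (g s j).
        f ((p j s)(j := g s j)) - f ((p j s)(j := x j)) =
        partial_deriv j f ((p j s)(j := t)) * (g s j - x j)"
      proof (rule mvt_segment)
        fix t assume t: "t \<in> closed_segment (x j) (g s j)"
        from diff[OF j inV[OF t]] show "((\<lambda>t. f ((p j s)(j := t))) has_real_derivative
          partial_deriv j f ((p j s)(j := t))) (at t)"
          by (simp add: partial_deriv_def DERIV_deriv_iff_real_differentiable)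
      qed
      moreover have "(p j s)(j := g s j) = p (Suc j) s" "(p j s)(j := x j) = p j s"
        by (auto simp: p_def fun_eq_iff less_Suc_eq)
      ultimately have "\<exists>t. t \<in> closed_segment (x j) (g s j) \<and>
         f (p (Suc j) s) - f (p j s) = partial_deriv j f ((p j s)(j := t)) * (g s j - x j)"
        by auto
      from someI_ex[OF this] show ?thesis using inV unfolding T_def by blast
    qed
    have evT: "\<forall>\<^sub>F s in at s0. T s \<in> closed_segment (x j) (g s j) \<and>
      f (p (Suc j) s) - f (p j s) = partial_deriv j f ((p j s)(j := T s)) * (g s j - x j) \<and>
      (p j s)(j := T s) \<in> V"
      using ev by (rule eventually_mono) (use T in blast)
    have Tlim: "(T \<longlongrightarrow> x j) (at s0)"
    proof (rule LIM_zero_cancel, rule Lim_null_comparison)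
      show "\<forall>\<^sub>F s in at s0. norm (T s - x j) \<le> \<bar>g s j - x j\<bar>"
        using evT by (rule eventually_mono)
          (auto simp: closed_segment_eq_real_ivl split: if_splits)
      show "((\<lambda>s. \<bar>g s j - x j\<bar>) \<longlongrightarrow> 0) (at s0)"
        using gt[of j] by (simp add: tendsto_rabs_zero_iff LIM_zero_iff)
    qed
    have "((\<lambda>s. partial_deriv j f ((p j s)(j := T s))) \<longlongrightarrow> partial_deriv j f x) (at s0)"
    proof (rule continuous_on_tendsto_compose[OF cont[OF j] _ V(2)])
      show "((\<lambda>s. (p j s)(j := T s)) \<longlongrightarrow> x) (at s0)"
        by (rule tendsto_eucl, rename_tac i, case_tac "i = j"; case_tac "i < j")
          (simp_all add: p_def Tlim gt)
      show "\<forall>\<^sub>F s in at s0. (p j s)(j := T s) \<in> V" using evT by (rule eventually_mono) auto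
    qed
    moreover have "((\<lambda>s. (g s j - x j) / (s - s0)) \<longlongrightarrow> d j) (at s0)"
      using dg[OF j] g(1) by (simp add: has_field_derivative_iff)
    ultimately have lim: "((\<lambda>s. partial_deriv j f ((p j s)(j := T s)) * ((g s j - x j) / (s - s0)))
        \<longlongrightarrow> partial_deriv j f x * d j) (at s0)"
      by (rule tendsto_mult)
    have p0: "p (Suc j) s0 = x" "p j s0 = x" using g(1) by (auto simp: p_def fun_eq_iff)
    have "((\<lambda>s. f (p (Suc j) s) - f (p j s)) has_real_derivative partial_deriv j f x * d j) (at s0)"
      unfolding has_field_derivative_iff
    proof (rule Lim_transform_eventually[OF lim])
      show "\<forall>\<^sub>F s in at s0. partial_deriv j f ((p j s)(j := T s)) * ((g s j - x j) / (s - s0)) =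
         (f (p (Suc j) s) - f (p j s) - (f (p (Suc j) s0) - f (p j s0))) / (s - s0)"
        using evT by (rule eventually_mono) (auto simp: p0)
    qed
    from DERIV_add[OF Suc.IH this] j show ?case by (simp add: algebra_simps)
  qed
  have "p n s = g s" for s
    using g(2)[of s] xE by (auto simp: p_def fun_eq_iff topspace_Euclidean_space)
  then show ?thesis using claim[of n] by simp
qed

section \<open>Closure properties of k-fold continuous differentiability\<close>

lemma Ck_on_0_iff: "V \<subseteq> eucl n \<Longrightarrow> Ck_on n 0 V f \<longleftrightarrow> continuous_on V f"
  by (simp add: subtopology_Euclidean_space_eq Ck_on.simps)

lemma Ck_on_imp_continuous_on: "V \<subseteq> eucl n \<Longrightarrow> Ck_on n k V f \<Longrightarrow> continuous_on V f"
  by (cases k) (auto simp: subtopology_Euclidean_space_eq Ck_on.simps)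

lemma Ck_on_SucD:
  assumes "Ck_on n (Suc k) V f" "i < n"
  shows "Ck_on n k V (partial_deriv i f)"
    and "x \<in> V \<Longrightarrow> ((\<lambda>t. f (x(i := t))) has_real_derivative partial_deriv i f x) (at (x i))"
    and "x \<in> V \<Longrightarrow> (\<lambda>t. f (x(i := t))) differentiable (at (x i))"
  using assms by (auto simp: partial_deriv_def DERIV_deriv_iff_real_differentiable Ck_on.simps)

declare Ck_on.simps [simp del]

lemma eventually_upd:
  assumes "openin (Euclidean_space n) V" "x \<in> V" "i < n"
  shows "\<forall>\<^sub>F t in nhds (x i). x(i := t) \<in> V"
proof -
  obtain e where e: "e > 0" "cube n x e \<subseteq> V" using openin_imp_cube assms(1,2) by blast
  have x: "x \<in> eucl n" using assms openin_subset by blast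
  have "x(i := t) \<in> V" if "dist t (x i) < e" for t
    using that e x assms(3) eucl_upd[OF x assms(3), of t]
    by (intro subsetD[OF e(2)]) (auto simp: cube_def dist_real_def)
  then show ?thesis using e(1) by (auto simp: eventually_nhds_metric)
qed

lemma has_real_derivative_upd_cong:
  assumes "openin (Euclidean_space n) V" "x \<in> V" "i < n" "\<And>x. x \<in> V \<Longrightarrow> f x = g x"
  shows "((\<lambda>t. f (x(i := t))) has_real_derivative D) (at (x i)) \<longleftrightarrow>
         ((\<lambda>t. g (x(i := t))) has_real_derivative D) (at (x i))"
  by (rule DERIV_cong_ev[OF refl _ refl])
    (use eventually_upd[OF assms(1-3)] in eventually_elim, simp add: assms(4))

lemma partial_deriv_cong:
  assumes "openin (Euclidean_space n) V" "x \<in> V" "i < n" "\<And>x. x \<in> V \<Longrightarrow> f x = g x"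
  shows "partial_deriv i f x = partial_deriv i g x"
  unfolding partial_deriv_def deriv_def using has_real_derivative_upd_cong[OF assms(1-3), of f g] assms(4) by simp

lemma Ck_on_cong:
  assumes "openin (Euclidean_space n) V" "\<And>x. x \<in> V \<Longrightarrow> f x = g x" "Ck_on n k V f"
  shows "Ck_on n k V g"
  using assms(2,3)
proof (induction k arbitrary: f g)
  case 0
  then show ?case
    using openin_subset[OF assms(1)] continuous_on_cong[OF refl, of V f g]
    by (simp add: Ck_on_0_iff)
next
  case (Suc k)
  have "continuous_on V g"
    using Ck_on_imp_continuous_on[OF openin_subset[OF assms(1)] Suc.prems(2)] Suc.prems(1)
    continuous_on_cong[OF refl, of V f g] by simp
  moreover have "(\<lambda>t. g (x(i := t))) differentiable at (x i)" if "i < n" "x \<in> V" for i x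
    using Ck_on_SucD(2)[OF Suc.prems(2) that]
      iffD1[OF has_real_derivative_upd_cong[OF assms(1) that(2,1), of f g]] Suc.prems(1)
    unfolding real_differentiable_def by blast
  moreover have "Ck_on n k V (partial_deriv i g)" if "i < n" for i
    using partial_deriv_cong[OF assms(1) _ that Suc.prems(1)] Ck_on_SucD(1)[OF Suc.prems(2) that]
    by (rule Suc.IH) auto
  ultimately show ?case
    using openin_subset[OF assms(1)] by (simp add: subtopology_Euclidean_space_eq Ck_on.simps)
qed

text \<open>The partial derivatives may be given by formulas that are correct on \<open>V\<close>
  only; by \<open>Ck_on_cong\<close> the values elsewhere do not matter.\<close>

lemma Ck_on_SucI:
  assumes V: "openin (Euclidean_space n) V" and "continuous_on V f"
    and d: "\<And>i x. i < n \<Longrightarrow> x \<in> V \<Longrightarrow> ((\<lambda>t. f (x(i := t))) has_real_derivative g i x) (at (x i))"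
    and "\<And>i. i < n \<Longrightarrow> Ck_on n k V (g i)"
  shows "Ck_on n (Suc k) V f"
proof -
  have "Ck_on n k V (partial_deriv i f)" if "i < n" for i
    by (rule Ck_on_cong[OF V _ assms(4)[OF that]])
      (use DERIV_imp_deriv[OF d[OF that], symmetric] in \<open>simp add: partial_deriv_def\<close>)
  moreover have "(\<lambda>t. f (x(i := t))) differentiable at (x i)" if "i < n" "x \<in> V" for i x
    using d[OF that] by (auto simp: real_differentiable_def)
  ultimately show ?thesis
    using assms(2) openin_subset[OF V] by (simp add: subtopology_Euclidean_space_eq Ck_on.simps)
qed

lemma Ck_on_Suc_imp: "openin (Euclidean_space n) V \<Longrightarrow> Ck_on n (Suc k) V f \<Longrightarrow> Ck_on n k V f"
proof (induction k arbitrary: f)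
  case 0
  then show ?case by (simp add: Ck_on.simps)
next
  case (Suc k)
  show ?case
    by (rule Ck_on_SucI[OF Suc.prems(1) _ Ck_on_SucD(2)[OF Suc.prems(2)]
      Suc.IH[OF Suc.prems(1) Ck_on_SucD(1)[OF Suc.prems(2)]]])
      (rule Ck_on_imp_continuous_on[OF openin_subset[OF Suc.prems(1)] Suc.prems(2)])
qed

context
  fixes n :: nat and V :: "(nat \<Rightarrow> real) set"
  assumes V: "openin (Euclidean_space n) V"
begin

lemmas VE = openin_subset[OF V]

lemma Ck_on_const: "Ck_on n k V (\<lambda>x. c)"
  by (induction k arbitrary: c) (auto simp: Ck_on_0_iff[OF VE] 
      intro!: Ck_on_SucI[OF V, where g = "\<lambda>_ _. 0"])

lemma Ck_on_coord: "Ck_on n k V (\<lambda>x. x i)"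
proof (cases k)
  case 0
  then show ?thesis
    using continuous_on_subset[OF continuous_on_product_coordinates] by (auto simp: Ck_on_0_iff[OF VE])
next
  case (Suc m)
  show ?thesis unfolding Suc
  proof (rule Ck_on_SucI[OF V, where g = "\<lambda>j _. if i = j then 1 else 0"])
    show "continuous_on V (\<lambda>x. x i)"
      using continuous_on_subset[OF continuous_on_product_coordinates] by auto
  qed (auto simp: Ck_on_const)
qed

lemma Ck_on_add: "Ck_on n k V f \<Longrightarrow> Ck_on n k V g \<Longrightarrow> Ck_on n k V (\<lambda>x. f x + g x)"
proof (induction k arbitrary: f g)
  case 0
  then show ?case by (simp only: Ck_on_0_iff[OF VE] continuous_on_add)
next
  case (Suc k)
  show ?case
    by (rule Ck_on_SucI[OF V _ DERIV_add[OF Ck_on_SucD(2)[OF Suc.prems(1)] Ck_on_SucD(2)[OF Suc.prems(2)]]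
          Suc.IH[OF Ck_on_SucD(1)[OF Suc.prems(1)] Ck_on_SucD(1)[OF Suc.prems(2)]]])
      (intro continuous_on_add Ck_on_imp_continuous_on[OF VE Suc.prems(1)]
        Ck_on_imp_continuous_on[OF VE Suc.prems(2)] | assumption)+
qed

lemma Ck_on_mult: "Ck_on n k V f \<Longrightarrow> Ck_on n k V g \<Longrightarrow> Ck_on n k V (\<lambda>x. f x * g x)"
proof (induction k arbitrary: f g)
  case 0
  then show ?case by (simp only: Ck_on_0_iff[OF VE] continuous_on_mult)
next
  case (Suc k)
  have D: "((\<lambda>t. f (x(i := t)) * g (x(i := t))) has_real_derivative
     partial_deriv i f x * g x + partial_deriv i g x * f x) (at (x i))" if "i < n" "x \<in> V" for i x
    using DERIV_mult[OF Ck_on_SucD(2)[OF Suc.prems(1) that] Ck_on_SucD(2)[OF Suc.prems(2) that]]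
    by (simp only: fun_upd_triv)
  show ?case
  proof (rule Ck_on_SucI[OF V _ D])
    show "continuous_on V (\<lambda>x. f x * g x)"
      by (intro continuous_on_mult Ck_on_imp_continuous_on[OF VE Suc.prems(1)]
          Ck_on_imp_continuous_on[OF VE Suc.prems(2)])
    show "Ck_on n k V (\<lambda>x. partial_deriv i f x * g x + partial_deriv i g x * f x)" if "i < n" for i
      by (rule Ck_on_add[OF Suc.IH[OF Ck_on_SucD(1)[OF Suc.prems(1) that] Ck_on_Suc_imp[OF V Suc.prems(2)]]
            Suc.IH[OF Ck_on_SucD(1)[OF Suc.prems(2) that] Ck_on_Suc_imp[OF V Suc.prems(1)]]])
  qed
qed

lemma Ck_on_sum: "(\<And>a. a \<in> A \<Longrightarrow> Ck_on n k V (f a)) \<Longrightarrow> Ck_on n k V (\<lambda>x. \<Sum>a\<in>A. f a x)"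
  by (induction A rule: infinite_finite_induct) (simp_all add: Ck_on_const Ck_on_add)

lemma Ck_on_prod: "(\<And>a. a \<in> A \<Longrightarrow> Ck_on n k V (f a)) \<Longrightarrow> Ck_on n k V (\<lambda>x. \<Prod>a\<in>A. f a x)"
  by (induction A rule: infinite_finite_induct) (simp_all add: Ck_on_const Ck_on_mult)

lemma Ck_on_cmult: "Ck_on n k V f \<Longrightarrow> Ck_on n k V (\<lambda>x. c * f x)"
  by (rule Ck_on_mult[OF Ck_on_const])

lemma Ck_on_diff:
  assumes "Ck_on n k V f" "Ck_on n k V g"
  shows "Ck_on n k V (\<lambda>x. f x - g x)"
  using Ck_on_add[OF assms(1) Ck_on_cmult[OF assms(2), of "-1"]] by simp

lemma Ck_on_subset:
  assumes "openin (Euclidean_space n) V'" "V \<subseteq> V'" "Ck_on n k V' f"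
  shows "Ck_on n k V f"
  using assms(3)
proof (induction k arbitrary: f)
  case 0
  then show ?case
    using continuous_on_subset assms(2) by (auto simp: Ck_on_0_iff VE openin_subset[OF assms(1)] )
next
  case (Suc k)
  show ?case
  proof (rule Ck_on_SucI[OF V, where g = "\<lambda>i. partial_deriv i f"])
    show "continuous_on V f"
      using Ck_on_imp_continuous_on[OF openin_subset[OF assms(1)] Suc.prems] continuous_on_subset assms(2)
      by blast
    show "((\<lambda>t. f (x(i := t))) has_real_derivative partial_deriv i f x) (at (x i))"
      if "i < n" "x \<in> V" for i x using Ck_on_SucD(2)[OF Suc.prems that(1)] that(2) assms(2) by blast
    show "Ck_on n k V (partial_deriv i f)" if "i < n" for i
      by (rule Suc.IH[OF Ck_on_SucD(1)[OF Suc.prems that]])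
  qed
qed

lemma Ck_on_local:
  assumes "\<And>x. x \<in> V \<Longrightarrow> \<exists>V'. openin (Euclidean_space n) V' \<and> x \<in> V' \<and> Ck_on n k V' f"
  shows "Ck_on n k V f"
  using assms
proof (induction k arbitrary: f)
  case 0
  obtain S where S: "open S" "V = eucl n \<inter> S" using V unfolding openin_Euclidean_space_iff by auto
  have "continuous_on V f"
  proof (rule continuous_on_eq_continuous_within[THEN iffD2], rule ballI)
    fix x assume "x \<in> V"
    from 0[OF this] obtain V' where V': "openin (Euclidean_space n) V'" "x \<in> V'" "Ck_on n 0 V' f" by blast
    then obtain T where T: "open T" "V' = eucl n \<inter> T" unfolding openin_Euclidean_space_iff by auto
    have "continuous (at x within V') f"
      using V' Ck_on_0_iff[OF openin_subset[OF V'(1)]] continuous_on_eq_continuous_within by blast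
    \<comment> \<open>Relative to \<open>eucl n\<close> both \<open>V\<close> and \<open>V'\<close>
      are neighbourhoods of \<open>x\<close>, so each restricts to the same filter as the
      intersection.\<close>
    moreover have "at x within V' = at x within V' \<inter> V"
      by (rule at_within_nhd[of _ "S"]) (use S \<open>x \<in> V\<close> VE openin_subset[OF V'(1)] in auto)
    moreover have "at x within V = at x within V' \<inter> V"
      by (rule at_within_nhd[of _ "T"]) (use T V'(2) VE openin_subset[OF V'(1)] in auto)
    ultimately show "continuous (at x within V) f" by simp
  qed
  then show ?case by (simp add: Ck_on_0_iff VE)
next
  case (Suc k)
  have c: "Ck_on n k V f"
  proof (rule Suc.IH)
    fix x assume "x \<in> V"
    then obtain V' where V': "openin (Euclidean_space n) V'" "x \<in> V'" "Ck_on n (Suc k) V' f"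
      using Suc.prems by blast
    then show "\<exists>V'. openin (Euclidean_space n) V' \<and> x \<in> V' \<and> Ck_on n k V' f"
      using Ck_on_Suc_imp[OF V'(1,3)] by blast
  qed
  show ?case
  proof (rule Ck_on_SucI[OF V, where g = "\<lambda>i. partial_deriv i f"])
    show "continuous_on V f" using c Ck_on_imp_continuous_on[OF VE] by blast
    show "((\<lambda>t. f (x(i := t))) has_real_derivative partial_deriv i f x) (at (x i))"
      if "i < n" "x \<in> V" for i x 
    proof -
      from Suc.prems[OF that(2)] obtain V' where "x \<in> V'" "Ck_on n (Suc k) V' f" by blast
      then show ?thesis using Ck_on_SucD(2)[OF _ that(1)] by blast
    qed
    show "Ck_on n k V (partial_deriv i f)" if "i < n" for i
    proof (rule Suc.IH)
      fix x assume "x \<in> V"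
      then obtain V' where V': "openin (Euclidean_space n) V'" "x \<in> V'" "Ck_on n (Suc k) V' f"
        using Suc.prems by blast
      then show "\<exists>V'. openin (Euclidean_space n) V' \<and> x \<in> V' \<and> Ck_on n k V' (partial_deriv i f)"
        using Ck_on_SucD(1)[OF V'(3) that] by blast
    qed
  qed
qed

lemma continuous_on_eucl_map:
  "(\<And>j. j < m \<Longrightarrow> continuous_on V (g j)) \<Longrightarrow>
    continuous_on V (\<lambda>x j. if j < (m::nat) then g j x else (0::real))"
  by (rule continuous_on_coordinatewise_then_product, rename_tac i, case_tac "i < m") auto

text \<open>By the chain rule a partial derivative of the composite is a sum of products of
  \<open>partial_deriv j F\<close> composed with the same inner map, to which the induction
  hypothesis applies, and of derivatives of \<open>g j\<close>. The conditional pads the tuple by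
  zeros to a point of \<open>eucl m\<close>.\<close>

lemma Ck_on_compose:
  assumes W: "openin (Euclidean_space m) W" and "Ck_on m k W F"
    and "\<And>j. j < m \<Longrightarrow> Ck_on n k V (g j)"
    and "\<And>x. x \<in> V \<Longrightarrow> (\<lambda>j. if j < m then g j x else 0) \<in> W"
  shows "Ck_on n k V (\<lambda>x. F (\<lambda>j. if j < m then g j x else 0))"
  using assms(2,3)
proof (induction k arbitrary: F)
  case 0
  have c1: "continuous_on V (\<lambda>x j. if j < m then g j x else 0)"
    using 0(2) by (intro continuous_on_eucl_map) (simp add: Ck_on_0_iff VE)
  have "continuous_on W F"
    using 0(1) openin_subset[OF W] by (simp add: Ck_on_0_iff)
  from continuous_on_compose2[OF this c1]
  have "continuous_on V (\<lambda>x. F (\<lambda>j. if j < m then g j x else 0))"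
    using assms(4) by blast
  then show ?case by (simp add: Ck_on_0_iff VE)
next
  case (Suc k)
  define G where "G x = (\<lambda>j. if j < m then g j x else 0)" for x
  have "continuous_on V G" unfolding G_def
    using Suc.prems(2) by (intro continuous_on_eucl_map) (auto intro: Ck_on_imp_continuous_on[OF VE])
  then have c: "continuous_on V (\<lambda>x. F (G x))"
    by (rule continuous_on_compose2[OF Ck_on_imp_continuous_on[OF openin_subset[OF W] Suc.prems(1)]])
      (use assms(4) in \<open>unfold G_def, blast\<close>)
  have D: "((\<lambda>t. F (G (x(i := t)))) has_real_derivative
      (\<Sum>j<m. partial_deriv j F (G x) * partial_deriv i (g j) x)) (at (x i))"
    if "i < n" "x \<in> V" for i x
  proof (rule chain_curve[OF W])
    show "G x \<in> W" using assms(4) that by (simp add: G_def)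
    show "G (x(i := x i)) = G x" by simp
    show "G (x(i := s)) \<in> eucl m" for s by (simp add: G_def topspace_Euclidean_space)
    show "((\<lambda>s. G (x(i := s)) j) has_real_derivative partial_deriv i (g j) x) (at (x i))"
      if "j < m" for j
    proof -
      have "(\<lambda>s. G (x(i := s)) j) = (\<lambda>s. g j (x(i := s)))" using that by (simp add: G_def)
      then show ?thesis
        using Ck_on_SucD(2)[OF Suc.prems(2)[OF that] \<open>i < n\<close> \<open>x \<in> V\<close>] by (simp only:)
    qed
    show "(\<lambda>t. F (y(j := t))) differentiable at (y j)" if "j < m" "y \<in> W" for j y
      by (rule Ck_on_SucD(3)[OF Suc.prems(1) that])
    show "continuous_on W (partial_deriv j F)" if "j < m" for j
      using Ck_on_SucD(1)[OF Suc.prems(1) that] Ck_on_imp_continuous_on[OF openin_subset[OF W]] by blast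
  qed
  have K: "Ck_on n k V (\<lambda>x. partial_deriv j F (G x) * partial_deriv i (g j) x)"
    if "i < n" "j < m" for i j
  proof (rule Ck_on_mult)
    show "Ck_on n k V (\<lambda>x. partial_deriv j F (G x))" unfolding G_def
      by (rule Suc.IH[OF Ck_on_SucD(1)[OF Suc.prems(1) that(2)] Ck_on_Suc_imp[OF V Suc.prems(2)]])
    show "Ck_on n k V (partial_deriv i (g j))"
      by (rule Ck_on_SucD(1)[OF Suc.prems(2)[OF that(2)] that(1)])
  qed
  show ?case unfolding G_def[symmetric]
  proof (rule Ck_on_SucI[OF V c D])
    show "Ck_on n k V (\<lambda>x. \<Sum>j<m. partial_deriv j F (G x) * partial_deriv i (g j) x)"
      if "i < n" for i by (rule Ck_on_sum) (use K that in simp)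
  qed
qed

text \<open>Here \<open>h j\<close> plays the role of the \<open>j\<close>-th derivative of \<open>h 0\<close>.\<close>

lemma Ck_on_real_compose:
  assumes "\<And>j t. (h j has_real_derivative h (Suc j) t) (at t)" "Ck_on n k V f"
  shows "Ck_on n k V (\<lambda>x. h j (f x))"
  using assms(2)
proof (induction k arbitrary: j)
  case 0
  have "continuous_on UNIV (h j)"
    using assms(1) by (intro DERIV_continuous_on) (auto intro: DERIV_subset)
  then show ?case using 0 
    by (auto simp: Ck_on_0_iff VE  intro: continuous_on_compose2)
next
  case (Suc k)
  have "continuous_on UNIV (h j)"
    using assms(1) by (intro DERIV_continuous_on) (auto intro: DERIV_subset)
  then have c: "continuous_on V (\<lambda>x. h j (f x))"
    using Ck_on_imp_continuous_on[OF VE Suc.prems] by (auto intro: continuous_on_compose2)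
  show ?case
  proof (rule Ck_on_SucI[OF V c])
    show "((\<lambda>t. h j (f (x(i := t)))) has_real_derivative h (Suc j) (f x) * partial_deriv i f x) (at (x i))"
      if "i < n" "x \<in> V" for i x
      using DERIV_chain2[of "h j" _ "\<lambda>t. f (x(i := t))" "x i", OF _ Ck_on_SucD(2)[OF Suc.prems that]] assms(1)
      by simp
    show "Ck_on n k V (\<lambda>x. h (Suc j) (f x) * partial_deriv i f x)" if "i < n" for i
      by (rule Ck_on_mult[OF Suc.IH[OF Ck_on_Suc_imp[OF V Suc.prems]] Ck_on_SucD(1)[OF Suc.prems that]])
  qed
qed

end

section \<open>Hadamard's lemma\<close>

lemma cubeI: "x \<in> eucl n \<Longrightarrow> (\<And>i. i < n \<Longrightarrow> \<bar>x i - c i\<bar> < e) \<Longrightarrow> x \<in> cube n c e"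
  by (simp add: cube_def)

definition ray :: "(nat \<Rightarrow> real) \<Rightarrow> (nat \<Rightarrow> real) \<Rightarrow> real \<Rightarrow> nat \<Rightarrow> real" where
  "ray c x t = (\<lambda>i. c i + t * (x i - c i))"

lemma ray_in_cube:
  assumes "c \<in> eucl n" "x \<in> cube n c e" "0 \<le> t" "t \<le> 1"
  shows "ray c x t \<in> cube n c e"
proof (rule cubeI)
  show "ray c x t \<in> eucl n" using assms(1,2) by (simp add: ray_def cube_def topspace_Euclidean_space)
  fix i assume "i < n"
  then have "\<bar>x i - c i\<bar> < e" using assms(2) by (simp add: cube_def)
  moreover have "\<bar>t * (x i - c i)\<bar> \<le> 1 * \<bar>x i - c i\<bar>"
    unfolding abs_mult using assms(3,4) by (intro mult_right_mono) auto
  ultimately show "\<bar>ray c x t i - c i\<bar> < e" by (simp add: ray_def)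
qed

lemma continuous_on_ray_integrand:
  assumes "c \<in> eucl n" "continuous_on (cube n c e) F"
  shows "continuous_on (cube n c e \<times> cbox 0 1) (\<lambda>(x, t). t ^ m * F (ray c x t))"
proof -
  have "continuous_on (cube n c e \<times> cbox 0 (1::real)) (\<lambda>p. ray c (fst p) (snd p))"
    unfolding ray_def
  proof (rule continuous_on_coordinatewise_then_product)
    fix i
    have "continuous_on (cube n c e \<times> cbox 0 (1::real)) (\<lambda>p. fst p i)"
      by (rule continuous_on_compose2[OF continuous_on_product_coordinates continuous_on_fst])
        (auto intro: continuous_on_id)
    then show "continuous_on (cube n c e \<times> cbox 0 (1::real)) (\<lambda>p. c i + snd p * (fst p i - c i))"
      by (intro continuous_intros)
  qed
  from continuous_on_compose2[OF assms(2) this]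
  have "continuous_on (cube n c e \<times> cbox 0 1) (\<lambda>p. F (ray c (fst p) (snd p)))"
    using ray_in_cube[OF assms(1)] by force
  then show ?thesis unfolding case_prod_beta by (intro continuous_intros)
qed

text \<open>Differentiation under the integral sign. Each derivative in \<open>x\<close> brings out
  a factor \<open>t\<close>, so the power \<open>t ^ m\<close> has to be part of the claim for the
  induction to close.\<close>

lemma Ck_on_ray_integral:
  assumes c: "c \<in> eucl n" and "\<And>j. Ck_on n j (cube n c e) F"
  shows "Ck_on n k (cube n c e) (\<lambda>x. integral (cbox 0 1) (\<lambda>t. t ^ m * F (ray c x t)))"
  using assms(2)
proof (induction k arbitrary: F m)
  note Q = openin_cube[of n c e]
  note QE = openin_subset[OF Q]
  have cont: "continuous_on (cube n c e) (\<lambda>x. integral (cbox 0 1) (\<lambda>t. t ^ m * F (ray c x t)))"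
    if "\<And>j. Ck_on n j (cube n c e) F" for F m
    using continuous_on_ray_integrand[OF c Ck_on_imp_continuous_on[OF QE that]]
    by (rule integral_continuous_on_param)
  {
    case 0
    then show ?case using cont[of F m] by (simp add: Ck_on_0_iff[OF QE])
  next
    case (Suc k)
    show ?case
    proof (rule Ck_on_SucI[OF Q cont])
      show "Ck_on n j (cube n c e) F" for j by (rule Suc.prems)
      show "Ck_on n k (cube n c e) (\<lambda>x. integral (cbox 0 1) (\<lambda>t. t ^ Suc m * partial_deriv i F (ray c x t)))"
        if "i < n" for i
        by (rule Suc.IH) (rule Ck_on_SucD(1)[OF Suc.prems that])
      fix i x assume i: "i < n" and x: "x \<in> cube n c e"
      let ?U = "{c i - e<..<c i + e}"
      have upd: "x(i := s) \<in> cube n c e" if "s \<in> ?U" for s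
        using that x i eucl_upd[of x n i s] by (auto simp: cube_def abs_less_iff)
      have xU: "x i \<in> ?U" using x i by (auto simp: cube_def abs_less_iff)
      have di: "Ck_on n 0 (cube n c e) (partial_deriv i F)" by (rule Ck_on_SucD(1)[OF Suc.prems i])
      have "((\<lambda>s. integral (cbox 0 1) (\<lambda>t. t ^ m * F (ray c (x(i := s)) t))) has_field_derivative
          integral (cbox 0 1) (\<lambda>t. t ^ Suc m * partial_deriv i F (ray c (x(i := x i)) t))) (at (x i) within ?U)"
      proof (rule leibniz_rule_field_derivative)
        fix s t assume s: "s \<in> ?U" and t: "t \<in> cbox 0 (1::real)"
        let ?y = "ray c (x(i := s)) t"
        have y: "?y \<in> cube n c e" using ray_in_cube[OF c upd[OF s]] t by auto
        have "((\<lambda>r. F (?y(i := r))) has_real_derivative partial_deriv i F ?y) (at (?y i))"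
          by (rule Ck_on_SucD(2)[OF Suc.prems i y])
        moreover have "?y i = c i + t * (s - c i)" by (simp add: ray_def)
        moreover have "((\<lambda>s. c i + t * (s - c i)) has_real_derivative t) (at s)"
          by (auto intro!: derivative_eq_intros)
        ultimately have "((\<lambda>s. F (?y(i := c i + t * (s - c i)))) has_real_derivative
            partial_deriv i F ?y * t) (at s)"
          using DERIV_chain2[of "\<lambda>r. F (?y(i := r))" _ "\<lambda>s. c i + t * (s - c i)" s t] by simp
        moreover have "(\<lambda>s'. F (?y(i := c i + t * (s' - c i)))) = (\<lambda>s'. F (ray c (x(i := s')) t))"
        proof
          fix s'
          have "?y(i := c i + t * (s' - c i)) = ray c (x(i := s')) t"
            by (rule ext) (simp add: ray_def)
          then show "F (?y(i := c i + t * (s' - c i))) = F (ray c (x(i := s')) t)" by (rule arg_cong)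
        qed
        ultimately have "((\<lambda>s. F (ray c (x(i := s)) t)) has_real_derivative partial_deriv i F ?y * t) (at s)"
          by (simp only:)
        from DERIV_cmult[OF this, of "t ^ m"]
        show "((\<lambda>s. t ^ m * F (ray c (x(i := s)) t)) has_field_derivative
            t ^ Suc m * partial_deriv i F ?y) (at s within ?U)"
          using has_field_derivative_at_within by (simp add: mult_ac)
      next
        fix s assume s: "s \<in> ?U"
        have "continuous_on ({x(i := s)} \<times> cbox 0 1) (\<lambda>(x, t). t ^ m * F (ray c x t))"
          by (rule continuous_on_subset[OF continuous_on_ray_integrand[OF c
            Ck_on_imp_continuous_on[OF QE Suc.prems]]]) (use upd[OF s] in auto)
        from continuous_on_compose2[OF this, of "cbox 0 1" "\<lambda>t. (x(i := s), t)"]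
        have "continuous_on (cbox 0 1) (\<lambda>t. t ^ m * F (ray c (x(i := s)) t))"
          using continuous_on_Pair[OF continuous_on_const continuous_on_id] by auto
        then show "(\<lambda>t. t ^ m * F (ray c (x(i := s)) t)) integrable_on cbox 0 1"
          by (rule integrable_continuous)
      next
        have "continuous_on (?U \<times> cbox 0 (1::real)) (\<lambda>p. (x(i := fst p), snd p))"
        proof (intro continuous_on_Pair continuous_on_coordinatewise_then_product)
          show "continuous_on (?U \<times> cbox 0 (1::real)) (\<lambda>p. (x(i := fst p)) j)" for j
            by (cases "j = i") (auto intro!: continuous_intros)
        qed (intro continuous_intros)
        from continuous_on_compose2[OF continuous_on_ray_integrand[OF c Ck_on_imp_continuous_on[OF QE di],
            of "Suc m"] this]
        show "continuous_on (?U \<times> cbox 0 (1::real))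
          (\<lambda>(s, t). t ^ Suc m * partial_deriv i F (ray c (x(i := s)) t))"
          using upd by (force simp: case_prod_beta)
      qed (use xU in auto)
      then show "((\<lambda>s. integral (cbox 0 1) (\<lambda>t. t ^ m * F (ray c (x(i := s)) t))) has_real_derivative
          integral (cbox 0 1) (\<lambda>t. t ^ Suc m * partial_deriv i F (ray c x t))) (at (x i))"
        using at_within_open[OF xU] by simp
    qed
  }
qed

text \<open>The derivative of \<open>F\<close> along the segment from \<open>c\<close> to
  \<open>x\<close> is integrated; \<open>g i\<close> is the mean of the i-th partial derivative over
  this segment. The remainder-free expansion is what makes every derivation a combination of partial
  derivatives.\<close>

lemma hadamard:
  assumes c: "c \<in> eucl n" and e: "e > 0" and F: "smooth_on n (cube n c e) F"
  obtains g where "\<And>i. i < n \<Longrightarrow> smooth_on n (cube n c e) (g i)"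
    "\<And>i. i < n \<Longrightarrow> g i c = partial_deriv i F c"
    "\<And>x. x \<in> cube n c e \<Longrightarrow> F x = F c + (\<Sum>i<n. (x i - c i) * g i x)"
proof -
  note Q = openin_cube[of n c e]
  note QE = openin_subset[OF Q]
  have Fk: "Ck_on n k (cube n c e) F" for k using F by (simp add: smooth_on_def)
  define g where "g i x = integral (cbox 0 1) (\<lambda>t. t ^ 0 * partial_deriv i F (ray c x t))" for i x
  have "smooth_on n (cube n c e) (g i)" if "i < n" for i
    unfolding smooth_on_def g_def
    by (intro allI Ck_on_ray_integral[OF c]) (rule Ck_on_SucD(1)[OF Fk that])
  moreover have "g i c = partial_deriv i F c" for i
    by (simp add: g_def ray_def)
  moreover have "F x = F c + (\<Sum>i<n. (x i - c i) * g i x)" if x: "x \<in> cube n c e" for x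
  proof -
    have di: "continuous_on (cube n c e) (partial_deriv i F)" if "i < n" for i
      by (rule Ck_on_imp_continuous_on[OF QE Ck_on_SucD(1)[OF Fk[of "Suc 0"] that]])
    have "((\<lambda>t. F (ray c x t)) has_real_derivative
        (\<Sum>i<n. partial_deriv i F (ray c x t) * (x i - c i))) (at t)" if "t \<in> {0..1}" for t
    proof (rule chain_curve[OF Q])
      show "ray c x t \<in> cube n c e" using ray_in_cube[OF c x] that by auto
      show "(\<lambda>t. F (y(i := t))) differentiable at (y i)" if "i < n" "y \<in> cube n c e" for i y
        by (rule Ck_on_SucD(3)[OF Fk that])
      show "ray c x s \<in> eucl n" for s
        using c x by (simp add: ray_def cube_def topspace_Euclidean_space)
      show "((\<lambda>s. ray c x s i) has_real_derivative x i - c i) (at t)" for i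
        unfolding ray_def by (auto intro!: derivative_eq_intros)
    qed (use di in auto)
    then have "((\<lambda>t. \<Sum>i<n. partial_deriv i F (ray c x t) * (x i - c i)) has_integral
        (F (ray c x 1) - F (ray c x 0))) {0..1}"
      by (intro fundamental_theorem_of_calculus, simp)
        (rule has_vector_derivative_at_within,
          simp only: has_real_derivative_iff_has_vector_derivative[symmetric])
    moreover have "((\<lambda>t. \<Sum>i<n. partial_deriv i F (ray c x t) * (x i - c i)) has_integral
        (\<Sum>i<n. g i x * (x i - c i))) {0..1}"
    proof (intro has_integral_sum has_integral_mult_left)
      fix i assume "i \<in> {..<n}"
      then have i: "i < n" by simp
      have "continuous_on ({x} \<times> cbox 0 1) (\<lambda>(x, t). t ^ 0 * partial_deriv i F (ray c x t))"
        by (rule continuous_on_subset[OF continuous_on_ray_integrand[OF c di[OF i]]]) (use x in auto)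
      from continuous_on_compose2[OF this, of "cbox 0 1" "\<lambda>t. (x, t)"]
      have "continuous_on (cbox 0 1) (\<lambda>t. t ^ 0 * partial_deriv i F (ray c x t))"
        using continuous_on_Pair[OF continuous_on_const continuous_on_id] by auto
      from integrable_integral[OF integrable_continuous[OF this]]
      show "((\<lambda>t. partial_deriv i F (ray c x t)) has_integral g i x) {0..1}"
        by (simp add: g_def)
    qed simp
    ultimately have "F (ray c x 1) - F (ray c x 0) = (\<Sum>i<n. g i x * (x i - c i))"
      by (rule has_integral_unique)
    then show ?thesis by (simp add: ray_def algebra_simps)
  qed
  ultimately show ?thesis using that by blast
qed

section \<open>Smooth bump functions\<close>

lemma poly_times_exp_minus_tendsto_0: "((\<lambda>y. poly p y * exp (- y)) \<longlongrightarrow> (0::real)) at_top"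
proof -
  have "((\<lambda>y. \<Sum>i\<le>degree p. coeff p i * (y ^ i / exp y)) \<longlongrightarrow> (\<Sum>i\<le>degree p. coeff p i * 0)) at_top"
    by (intro tendsto_sum tendsto_mult tendsto_const tendsto_power_div_exp_0)
  then show ?thesis
    by (simp add: poly_altdef sum_divide_distrib exp_minus field_simps)
qed

text \<open>The function exp (- 1 / t) for t > 0, extended by zero. The sequence of all its
  derivatives is produced at once, in the form that \<open>Ck_on_real_compose\<close>
  accepts.\<close>

lemma smooth_flat_function:
  obtains h :: "nat \<Rightarrow> real \<Rightarrow> real" where
    "\<And>j t. (h j has_real_derivative h (Suc j) t) (at t)"
    "\<And>t. t \<le> 0 \<Longrightarrow> h 0 t = 0" "\<And>t. t > 0 \<Longrightarrow> h 0 t > 0"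
proof -
  \<comment> \<open>The j-th derivative is P_j (1 / t) exp (- 1 / t) for t > 0. Differentiating with
    y = 1 / t gives the recursion P_(j+1) (y) = y^2 (P_j (y) - P_j' (y)).\<close>
  define P where "P = rec_nat (1::real poly) (\<lambda>_ p. [:0, 0, 1:] * (p - pderiv p))"
  define h where "h j t = (if t \<le> 0 then 0 else poly (P j) (1 / t) * exp (- (1 / t)))" for j and t :: real
  have PS: "P (Suc j) = [:0, 0, 1:] * (P j - pderiv (P j))" for j by (simp add: P_def)
  have "(h j has_real_derivative h (Suc j) t) (at t)" for j t
  proof (cases t "0 :: real" rule: linorder_cases)
    case less
    have "(h j has_real_derivative 0) (at t)"
      by (rule has_field_derivative_transform_within_open[of "\<lambda>_. 0" _ _ "{..<0}"])
        (use less in \<open>auto simp: h_def\<close>)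
    then show ?thesis using less by (simp add: h_def)
  next
    case greater
    have "((\<lambda>t. poly (P j) (1 / t) * exp (- (1 / t))) has_real_derivative
      poly (P (Suc j)) (1 / t) * exp (- (1 / t))) (at t)"
      using greater
      by (auto intro!: derivative_eq_intros simp: PS power2_eq_square divide_simps) (simp add: algebra_simps)?
    then have "(h j has_real_derivative poly (P (Suc j)) (1 / t) * exp (- (1 / t))) (at t)"
      by (rule has_field_derivative_transform_within_open[of _ _ _ "{0<..}"])
        (use greater in \<open>auto simp: h_def\<close>)
    then show ?thesis using greater by (simp add: h_def)
  next
    case equal
    \<comment> \<open>With y = 1 / s the difference quotient of \<open>h j\<close> at 0 from the
      right is y P_j (y) exp (- y); this is the origin of the factor
      \<open>[:0, 1:]\<close>.\<close>
    have "((\<lambda>y. poly ([:0, 1:] * P j) y * exp (- y)) \<longlongrightarrow> 0) at_top"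
      by (rule poly_times_exp_minus_tendsto_0)
    then have "((\<lambda>s. poly ([:0, 1:] * P j) (inverse s) * exp (- inverse s)) \<longlongrightarrow> 0) (at_right 0)"
      by (rule filterlim_compose) (rule filterlim_inverse_at_top_right)
    moreover have "\<forall>\<^sub>F s in at_right 0. poly ([:0, 1:] * P j) (inverse s) * exp (- inverse s) = h j s / s"
      using eventually_at_right_less[of "0::real"]
      by eventually_elim (simp add: h_def field_simps)
    ultimately have "((\<lambda>s. h j s / s) \<longlongrightarrow> 0) (at_right 0)"
      by (rule Lim_transform_eventually)
    moreover have "((\<lambda>s. h j s / s) \<longlongrightarrow> 0) (at_left 0)"
    proof (rule Lim_transform_eventually[OF tendsto_const])
      show "\<forall>\<^sub>F s in at_left 0. 0 = h j s / s"
        unfolding eventually_at_filter by (simp add: h_def)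
    qed
    ultimately have "((\<lambda>s. h j s / s) \<longlongrightarrow> 0) (at 0)"
      by (simp add: filterlim_split_at)
    then show ?thesis using equal by (simp add: has_field_derivative_iff h_def)
  qed
  moreover have "h 0 t > 0" if "t > 0" for t using that by (simp add: h_def P_def)
  moreover have "h 0 t = 0" if "t \<le> 0" for t using that by (simp add: h_def)
  ultimately show ?thesis using that[of h] by blast
qed

lemma bump_eucl:
  assumes c: "c \<in> eucl n" and "e > 0"
  obtains b :: "(nat \<Rightarrow> real) \<Rightarrow> real" where "smooth_on n (eucl n) b" "b c = 1"
    "\<And>x. x \<in> eucl n \<Longrightarrow> b x \<noteq> 0 \<Longrightarrow> \<forall>i<n. \<bar>x i - c i\<bar> \<le> e"
proof -
  obtain h :: "nat \<Rightarrow> real \<Rightarrow> real" where h: "\<And>j t. (h j has_real_derivative h (Suc j) t) (at t)"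
    "\<And>t. t \<le> 0 \<Longrightarrow> h 0 t = 0" "\<And>t. t > 0 \<Longrightarrow> h 0 t > 0"
    by (rule smooth_flat_function) blast
  \<comment> \<open>A product over the coordinates; each factor vanishes unless the i-th coordinate
    is within \<open>e\<close> of the centre and is normalised to 1 at the centre.\<close>
  define b where "b x = (\<Prod>i<n. inverse (h 0 (e\<^sup>2)) * h 0 (e\<^sup>2 - (x i - c i) * (x i - c i)))" for x
  have V: "openin (Euclidean_space n) (eucl n)" by (simp add: openin_topspace)
  have "smooth_on n (eucl n) b" unfolding smooth_on_def b_def
    by (intro allI Ck_on_prod[OF V] Ck_on_cmult[OF V] Ck_on_real_compose[OF V, of h, OF h(1)]
        Ck_on_diff[OF V] Ck_on_mult[OF V] Ck_on_const[OF V] Ck_on_coord[OF V])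
  moreover have "b c = 1" using h(3)[of "e\<^sup>2"] assms(2) by (simp add: b_def)
  moreover have "\<forall>i<n. \<bar>x i - c i\<bar> \<le> e" if "b x \<noteq> 0" for x
  proof (intro allI impI)
    fix i assume "i < n"
    then have "h 0 (e\<^sup>2 - (x i - c i) * (x i - c i)) \<noteq> 0"
      using that by (auto simp: b_def)
    then have "\<not> e\<^sup>2 - (x i - c i) * (x i - c i) \<le> 0" using h(2) by blast
    then have "(x i - c i)\<^sup>2 < e\<^sup>2" by (simp add: power2_eq_square)
    then show "\<bar>x i - c i\<bar> \<le> e" using assms(2) power2_less_imp_less[of "\<bar>x i - c i\<bar>" e] by simp
  qed
  ultimately show ?thesis using that by blast
qed

section \<open>Smoothness on Euclidean types, transferred through an enumeration of the
  basis\<close>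

definition bas :: "nat \<Rightarrow> 'e::euclidean_space" where
  "bas = (SOME b. bij_betw b {..<DIM('e)} (Basis :: 'e set))"

lemma bij_betw_bas: "bij_betw (bas :: nat \<Rightarrow> 'e::euclidean_space) {..<DIM('e)} Basis"
proof -
  have "\<exists>b. bij_betw b {..<DIM('e)} (Basis :: 'e set)"
    using ex_bij_betw_nat_finite[of "Basis :: 'e set"] by (simp add: atLeast0LessThan)
  then show ?thesis unfolding bas_def by (rule someI_ex)
qed

lemma bas_in_Basis: "i < DIM('e) \<Longrightarrow> (bas i :: 'e::euclidean_space) \<in> Basis"
  using bij_betw_bas by (auto simp: bij_betw_def)

lemma sum_bas: "(\<Sum>i<DIM('e). f (bas i :: 'e)) = (\<Sum>b\<in>(Basis :: 'e::euclidean_space set). f b)"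
  by (rule sum.reindex_bij_betw[OF bij_betw_bas])

lemma inner_bas: "i < DIM('e) \<Longrightarrow> j < DIM('e) \<Longrightarrow>
    (bas i :: 'e::euclidean_space) \<bullet> bas j = (if i = j then 1 else 0)"
  using bij_betw_bas[where 'e = 'e] by (auto simp: bij_betw_def inj_on_def inner_Basis bas_in_Basis)

definition vec_of :: "(nat \<Rightarrow> real) \<Rightarrow> 'e::euclidean_space" where
  "vec_of x = (\<Sum>i<DIM('e). x i *\<^sub>R bas i)"

definition coords :: "'e::euclidean_space \<Rightarrow> nat \<Rightarrow> real" where
  "coords v = (\<lambda>i. if i < DIM('e) then v \<bullet> bas i else 0)"

lemma coords_in_eucl: "coords (v :: 'e::euclidean_space) \<in> eucl DIM('e)"
  by (simp add: coords_def topspace_Euclidean_space)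

lemma vec_of_coords [simp]: "vec_of (coords (v :: 'e::euclidean_space)) = v"
proof -
  have "(vec_of (coords v) :: 'e) = (\<Sum>i<DIM('e). (v \<bullet> bas i) *\<^sub>R bas i)"
    by (simp add: vec_of_def coords_def)
  also have "\<dots> = v" unfolding sum_bas[of "\<lambda>b. (v \<bullet> b) *\<^sub>R b"] by (rule euclidean_representation)
  finally show ?thesis .
qed

lemma coords_vec_of: "x \<in> eucl DIM('e) \<Longrightarrow> coords (vec_of x :: 'e::euclidean_space) = x"
  by (auto simp: coords_def vec_of_def fun_eq_iff topspace_Euclidean_space inner_sum_left inner_bas
      if_distrib[of "\<lambda>a. _ * a"] cong: if_cong)

lemma vec_of_upd: "i < DIM('e) \<Longrightarrow> vec_of (x(i := t)) = (vec_of x + (t - x i) *\<^sub>R bas i :: 'e::euclidean_space)"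
  unfolding vec_of_def
  by (subst (1 2) sum.remove[of _ i]) (auto simp: algebra_simps)

lemma coords_image: "coords ` W = {x \<in> eucl DIM('e). vec_of x \<in> (W :: 'e::euclidean_space set)}"
proof (intro equalityI subsetI)
  fix x assume "x \<in> {x \<in> eucl DIM('e). vec_of x \<in> W}"
  then show "x \<in> coords ` W" using coords_vec_of[of x] by (metis (lifting) image_eqI mem_Collect_eq)
qed (auto simp: coords_in_eucl)

lemma openin_coords_image:
  assumes "open (W :: 'e::euclidean_space set)"
  shows "openin (Euclidean_space DIM('e)) (coords ` W)"
proof -
  have "continuous_on UNIV (vec_of :: _ \<Rightarrow> 'e)" unfolding vec_of_def
    by (intro continuous_intros continuous_on_product_coordinates)
  then have "open (vec_of -` W :: (nat \<Rightarrow> real) set)" using assms by (simp add: open_vimage)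
  moreover have "coords ` W = eucl DIM('e) \<inter> vec_of -` W" by (auto simp: coords_image)
  ultimately show ?thesis unfolding openin_Euclidean_space_iff by blast
qed

lemma continuous_on_coords_image_iff:
  "continuous_on (coords ` W) (\<lambda>x. f (vec_of x)) \<longleftrightarrow> continuous_on (W :: 'e::euclidean_space set) f"
proof
  assume "continuous_on (coords ` W) (\<lambda>x. f (vec_of x))"
  moreover have "continuous_on W coords" unfolding coords_def
    by (rule continuous_on_coordinatewise_then_product, rename_tac i, case_tac "i < DIM('e)")
      (auto intro!: continuous_intros)
  ultimately have "continuous_on W (\<lambda>v. f (vec_of (coords v :: nat \<Rightarrow> real)))"
    by (rule continuous_on_compose2) auto
  then show "continuous_on W f" by (simp add: vec_of_coords)
next
  assume "continuous_on W f"
  moreover have "continuous_on (coords ` W) (vec_of :: _ \<Rightarrow> 'e)" unfolding vec_of_def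
    by (intro continuous_intros continuous_on_subset[OF continuous_on_product_coordinates]) auto
  ultimately show "continuous_on (coords ` W) (\<lambda>x. f (vec_of x))"
    by (rule continuous_on_compose2) (auto simp: vec_of_coords)
qed

lemma has_real_derivative_vec_of_upd:
  assumes "i < DIM('e::euclidean_space)"
  shows "((\<lambda>t. f (vec_of (x(i := t)) :: 'e)) has_real_derivative D) (at (x i)) \<longleftrightarrow>
         ((\<lambda>t. f (vec_of x + t *\<^sub>R bas i)) has_real_derivative D) (at 0)"
  using DERIV_shift[of "\<lambda>t. f (vec_of (x(i := t)))" D 0 "x i"]
  by (simp add: vec_of_upd[OF assms])

lemma partial_deriv_vec_of:
  assumes "i < DIM('e::euclidean_space)"
  shows "partial_deriv i (\<lambda>x. f (vec_of x :: 'e)) x = deriv (\<lambda>t. f (vec_of x + t *\<^sub>R bas i)) 0"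
  unfolding partial_deriv_def deriv_def has_real_derivative_vec_of_upd[OF assms] ..

text \<open>The two notions differ in the parameter of the coordinate line, which starts at 0 in one
  and at the coordinate in the other. A shift identifies them, and all closure properties carry over
  to functions of matrices.\<close>

lemma Ck_on_type_iff:
  assumes "open (W :: 'e::euclidean_space set)"
  shows "Ck_on_type k W f \<longleftrightarrow> Ck_on DIM('e) k (coords ` W) (\<lambda>x. f (vec_of x))"
proof (induction k arbitrary: f)
  case 0
  then show ?case
    by (simp add: Ck_on_0_iff[OF openin_subset[OF openin_coords_image[OF assms]]]
        continuous_on_coords_image_iff)
next
  case (Suc k)
  have V: "coords ` W \<subseteq> eucl DIM('e)" by (rule openin_subset[OF openin_coords_image[OF assms]])
  have "(\<forall>b\<in>Basis. (\<forall>x\<in>W. (\<lambda>t. f (x + t *\<^sub>R b)) differentiable at 0) \<and>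
            Ck_on_type k W (\<lambda>x. deriv (\<lambda>t. f (x + t *\<^sub>R b)) 0)) \<longleftrightarrow>
        (\<forall>i<DIM('e). (\<forall>x\<in>W. (\<lambda>t. f (x + t *\<^sub>R bas i)) differentiable at 0) \<and>
            Ck_on_type k W (\<lambda>x. deriv (\<lambda>t. f (x + t *\<^sub>R bas i)) 0))"
    using bij_betw_bas[where 'e = 'e] by (force simp: bij_betw_def)
  also have "\<dots> \<longleftrightarrow> (\<forall>i<DIM('e). (\<forall>x\<in>coords ` W. (\<lambda>t. f (vec_of (x(i := t)))) differentiable at (x i)) \<and>
         Ck_on DIM('e) k (coords ` W) (partial_deriv i (\<lambda>x. f (vec_of x))))"
  proof (intro all_cong conj_cong)
    fix i assume i: "i < DIM('e)"
    show "(\<forall>x\<in>W. (\<lambda>t. f (x + t *\<^sub>R bas i)) differentiable at 0) \<longleftrightarrow>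
        (\<forall>x\<in>coords ` W. (\<lambda>t. f (vec_of (x(i := t)))) differentiable at (x i))"
      by (simp add: real_differentiable_def has_real_derivative_vec_of_upd[OF i] vec_of_coords)
    show "Ck_on_type k W (\<lambda>x. deriv (\<lambda>t. f (x + t *\<^sub>R bas i)) 0) \<longleftrightarrow>
        Ck_on DIM('e) k (coords ` W) (partial_deriv i (\<lambda>x. f (vec_of x)))"
      unfolding Suc.IH partial_deriv_vec_of[OF i, abs_def] ..
  qed
  finally show ?case
    by (simp add: Ck_on.simps subtopology_Euclidean_space_eq[OF V] continuous_on_coords_image_iff)
qed

definition smooth_on_type :: "'e::euclidean_space set \<Rightarrow> ('e \<Rightarrow> real) \<Rightarrow> bool" where
  "smooth_on_type W f \<longleftrightarrow> (\<forall>k. Ck_on_type k W f)"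

lemma smooth_on_type_iff:
  "open (W :: 'e::euclidean_space set) \<Longrightarrow>
    smooth_on_type W f \<longleftrightarrow> smooth_on DIM('e) (coords ` W) (\<lambda>x. f (vec_of x))"
  by (simp add: smooth_on_type_def smooth_on_def Ck_on_type_iff)

lemma smooth_onD: "smooth_on n V f \<Longrightarrow> Ck_on n k V f"
  by (simp add: smooth_on_def)

lemma smooth_on_cong:
  assumes "openin (Euclidean_space n) V" "\<And>x. x \<in> V \<Longrightarrow> f x = g x" "smooth_on n V f"
  shows "smooth_on n V g"
  unfolding smooth_on_def by (intro allI Ck_on_cong[OF assms(1,2) smooth_onD[OF assms(3)]])

lemma smooth_on_local:
  assumes "openin (Euclidean_space n) V"
    and "\<And>x. x \<in> V \<Longrightarrow> \<exists>V'. openin (Euclidean_space n) V' \<and> x \<in> V' \<and> smooth_on n V' f"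
  shows "smooth_on n V f"
  unfolding smooth_on_def
proof
  fix k
  show "Ck_on n k V f"
  proof (rule Ck_on_local[OF assms(1)])
    fix x assume "x \<in> V"
    then show "\<exists>V'. openin (Euclidean_space n) V' \<and> x \<in> V' \<and> Ck_on n k V' f"
      using assms(2)[of x] unfolding smooth_on_def by meson
  qed
qed

lemma smooth_on_compose:
  assumes V: "openin (Euclidean_space n) V" and W: "openin (Euclidean_space m) W"
    and F: "smooth_on m W F" and g: "\<And>j. j < m \<Longrightarrow> smooth_on n V (g j)"
    and "\<And>x. x \<in> V \<Longrightarrow> (\<lambda>j. if j < m then g j x else 0) \<in> W"
  shows "smooth_on n V (\<lambda>x. F (\<lambda>j. if j < m then g j x else 0))"
  unfolding smooth_on_def
  by (intro allI Ck_on_compose[OF V W smooth_onD[OF F] smooth_onD[OF g] assms(5)])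

context
  fixes n :: nat and V :: "(nat \<Rightarrow> real) set"
  assumes V: "openin (Euclidean_space n) V"
begin

lemma smooth_on_const: "smooth_on n V (\<lambda>x. c)"
  by (simp add: smooth_on_def Ck_on_const[OF V])

lemma smooth_on_coord: "smooth_on n V (\<lambda>x. x i)"
  by (simp add: smooth_on_def Ck_on_coord[OF V])

lemma smooth_on_add: "smooth_on n V f \<Longrightarrow> smooth_on n V g \<Longrightarrow> smooth_on n V (\<lambda>x. f x + g x)"
  by (simp add: smooth_on_def Ck_on_add[OF V])

lemma smooth_on_diff: "smooth_on n V f \<Longrightarrow> smooth_on n V g \<Longrightarrow> smooth_on n V (\<lambda>x. f x - g x)"
  by (simp add: smooth_on_def Ck_on_diff[OF V])

lemma smooth_on_mult: "smooth_on n V f \<Longrightarrow> smooth_on n V g \<Longrightarrow> smooth_on n V (\<lambda>x. f x * g x)"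
  by (simp add: smooth_on_def Ck_on_mult[OF V])

lemma smooth_on_sum: "(\<And>a. a \<in> A \<Longrightarrow> smooth_on n V (f a)) \<Longrightarrow> smooth_on n V (\<lambda>x. \<Sum>a\<in>A. f a x)"
  by (simp add: smooth_on_def Ck_on_sum[OF V])

lemma smooth_on_subset:
  assumes "openin (Euclidean_space n) V'" "V \<subseteq> V'" "smooth_on n V' f"
  shows "smooth_on n V f"
  using Ck_on_subset[OF V assms(1,2)] assms(3) by (simp add: smooth_on_def)

end

lemma smooth_on_chain_curve:
  assumes "openin (Euclidean_space n) V" "g s0 \<in> V" "smooth_on n V f" "\<And>s. g s \<in> eucl n"
    and "\<And>i. i < n \<Longrightarrow> ((\<lambda>s. g s i) has_real_derivative d i) (at s0)"
  shows "((\<lambda>s. f (g s)) has_real_derivative (\<Sum>i<n. partial_deriv i f (g s0) * d i)) (at s0)"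
proof (rule chain_curve[OF assms(1,2) _ _ refl assms(4,5)])
  show "(\<lambda>t. f (y(i := t))) differentiable at (y i)" if "i < n" "y \<in> V" for i y
    by (rule Ck_on_SucD(3)[OF smooth_onD[OF assms(3)] that])
  show "continuous_on V (partial_deriv i f)" if "i < n" for i
    by (rule Ck_on_imp_continuous_on[OF openin_subset[OF assms(1)]
          Ck_on_SucD(1)[OF smooth_onD[OF assms(3), of "Suc 0"] that]])
qed

context
  fixes W :: "'e::euclidean_space set"
  assumes W: "open W"
begin

lemmas smooth_on_type_iff' = smooth_on_type_iff[OF W]

lemma smooth_on_type_mult:
  "smooth_on_type W f \<Longrightarrow> smooth_on_type W g \<Longrightarrow> smooth_on_type W (\<lambda>x. f x * g x)"
  by (simp add: smooth_on_type_iff' smooth_on_mult[OF openin_coords_image[OF W]])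

lemma smooth_on_type_sum:
  "(\<And>a. a \<in> A \<Longrightarrow> smooth_on_type W (f a)) \<Longrightarrow> smooth_on_type W (\<lambda>x. \<Sum>a\<in>A. f a x)"
  by (simp add: smooth_on_type_iff' smooth_on_sum[OF openin_coords_image[OF W]])

lemma smooth_on_type_subset:
  assumes "open W'" "W \<subseteq> W'" "smooth_on_type W' f"
  shows "smooth_on_type W f"
  using assms(3) smooth_on_subset[OF openin_coords_image[OF W] openin_coords_image[OF assms(1)]] assms(2)
  by (auto simp: smooth_on_type_iff' smooth_on_type_iff[OF assms(1)])

lemma smooth_on_type_deriv:
  "smooth_on_type W f \<Longrightarrow> b \<in> Basis \<Longrightarrow> smooth_on_type W (\<lambda>x. deriv (\<lambda>t. f (x + t *\<^sub>R b)) 0)"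
  unfolding smooth_on_type_def by (metis Ck_on_type.simps(2))

lemma smooth_on_type_linear:
  assumes "linear (f :: 'e \<Rightarrow> real)"
  shows "smooth_on_type W f"
proof -
  have "f (vec_of x) = (\<Sum>i<DIM('e). x i * f (bas i))" for x
    using assms by (simp add: vec_of_def linear_sum linear_cmul)
  then show ?thesis
    by (simp add: smooth_on_type_iff' smooth_on_sum[OF openin_coords_image[OF W]]
        smooth_on_mult[OF openin_coords_image[OF W]] smooth_on_coord[OF openin_coords_image[OF W]]
        smooth_on_const[OF openin_coords_image[OF W]])
qed

lemma smooth_on_type_continuous: "smooth_on_type W f \<Longrightarrow> continuous_on W f"
  unfolding smooth_on_type_def by (metis Ck_on_type.simps(1))

lemma smooth_on_type_compose_eucl:
  assumes V: "openin (Euclidean_space m) V" and "smooth_on m V F"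
    and "\<And>j. j < m \<Longrightarrow> smooth_on_type W (g j)"
    and "\<And>x. x \<in> W \<Longrightarrow> (\<lambda>j. if j < m then g j x else 0) \<in> V"
  shows "smooth_on_type W (\<lambda>x. F (\<lambda>j. if j < m then g j x else 0))"
  unfolding smooth_on_type_iff'
  by (rule smooth_on_compose[OF openin_coords_image[OF W] V assms(2)])
    (use assms(3,4) in \<open>auto simp: smooth_on_type_iff'\<close>)

lemma smooth_on_compose_type:
  assumes V: "openin (Euclidean_space n) V" and F: "smooth_on_type W F"
    and "\<And>b. b \<in> Basis \<Longrightarrow> smooth_on n V (\<lambda>x. g x \<bullet> b)" and gW: "\<And>x. x \<in> V \<Longrightarrow> g x \<in> W"
  shows "smooth_on n V (\<lambda>x. F (g x))"
proof -
  have "smooth_on n V (\<lambda>x. (\<lambda>y. F (vec_of y)) (\<lambda>j. if j < DIM('e) then g x \<bullet> bas j else 0))"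
  proof (rule smooth_on_compose[OF V openin_coords_image[OF W]])
    show "smooth_on DIM('e) (coords ` W) (\<lambda>y. F (vec_of y))"
      using F by (simp add: smooth_on_type_iff')
    show "smooth_on n V (\<lambda>x. g x \<bullet> bas j)" if "j < DIM('e)" for j
      using assms(3) bas_in_Basis that by blast
    show "(\<lambda>j. if j < DIM('e) then g x \<bullet> bas j else 0) \<in> coords ` W" if "x \<in> V" for x
      using gW[OF that] unfolding coords_def[symmetric] by blast
  qed
  then show ?thesis by (simp add: coords_def[symmetric])
qed

lemma smooth_on_type_chain_curve:
  assumes F: "smooth_on_type W F" and "g s0 \<in> W" and g: "(g has_vector_derivative v) (at s0)"
  shows "((\<lambda>s. F (g s)) has_real_derivative
    (\<Sum>b\<in>Basis. deriv (\<lambda>t. F (g s0 + t *\<^sub>R b)) 0 * (v \<bullet> b))) (at s0)"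
proof -
  have "((\<lambda>s. F (vec_of (coords (g s) :: nat \<Rightarrow> real))) has_real_derivative
     (\<Sum>i<DIM('e). partial_deriv i (\<lambda>y. F (vec_of y)) (coords (g s0)) * (v \<bullet> bas i))) (at s0)"
  proof (rule smooth_on_chain_curve[OF openin_coords_image[OF W]])
    show "coords (g s0) \<in> coords ` W" using assms(2) by blast
    show "smooth_on DIM('e) (coords ` W) (\<lambda>y. F (vec_of y))"
      using F by (simp add: smooth_on_type_iff')
    show "((\<lambda>s. coords (g s) i) has_real_derivative v \<bullet> bas i) (at s0)" if "i < DIM('e)" for i
      using bounded_linear.has_vector_derivative[OF bounded_linear_inner_left g, of "bas i"] that
      by (simp add: coords_def has_real_derivative_iff_has_vector_derivative)
  qed (rule coords_in_eucl)
  moreover have "(\<Sum>i<DIM('e). partial_deriv i (\<lambda>y. F (vec_of y)) (coords (g s0)) * (v \<bullet> bas i)) =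
     (\<Sum>i<DIM('e). deriv (\<lambda>t. F (g s0 + t *\<^sub>R bas i)) 0 * (v \<bullet> bas i))"
    by (intro sum.cong) (simp_all add: partial_deriv_vec_of)
  ultimately show ?thesis using sum_bas[of "\<lambda>b. deriv (\<lambda>t. F (g s0 + t *\<^sub>R b)) 0 * (v \<bullet> b)"] by simp
qed

end

section \<open>Tangent spaces\<close>

locale mfd =
  fixes M :: "('a, 'z) mfd_scheme"
  assumes smooth_mfd: "smooth_manifold M"
begin

abbreviation n where "n \<equiv> mdim M"

lemma Hausdorff: "Hausdorff_space (mtop M)"
  using smooth_mfd by (simp add: smooth_manifold_def)

lemma chart_cover: "x \<in> points M \<Longrightarrow> \<exists>U \<phi>. (U, \<phi>) \<in> charts M \<and> x \<in> U"
  using smooth_mfd unfolding smooth_manifold_def by blast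

lemma transition_smooth:
  assumes "(U, \<phi>) \<in> charts M" "(V, \<psi>) \<in> charts M" "i < n"
  shows "smooth_on n (\<phi> ` (U \<inter> V)) (\<lambda>x. \<psi> (inv_into U \<phi> x) i)"
proof -
  have *: "\<forall>(U, \<phi>)\<in>charts M. \<forall>(V, \<psi>)\<in>charts M. \<forall>i<n.
      smooth_on n (\<phi> ` (U \<inter> V)) (\<lambda>x. \<psi> (inv_into U \<phi> x) i)"
    using smooth_mfd unfolding smooth_manifold_def by (elim conjE)
  show ?thesis
    using bspec[OF bspec[OF * assms(1), unfolded prod.case] assms(2), unfolded prod.case] assms(3) by blast
qed

context
  fixes U \<phi>
  assumes chart: "(U, \<phi>) \<in> charts M"
begin

lemma chart_open: "openin (mtop M) U"
  and chart_image_open: "openin (Euclidean_space n) (\<phi> ` U)"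
  and chart_homeomorphic:
    "homeomorphic_map (subtopology (mtop M) U) (subtopology (Euclidean_space n) (\<phi> ` U)) \<phi>"
proof -
  have *: "\<forall>(U, \<phi>)\<in>charts M. openin (mtop M) U \<and> openin (Euclidean_space n) (\<phi> ` U) \<and>
      homeomorphic_map (subtopology (mtop M) U) (subtopology (Euclidean_space n) (\<phi> ` U)) \<phi>"
    using smooth_mfd unfolding smooth_manifold_def by (elim conjE)
  from bspec[OF * chart, unfolded prod.case]
  show "openin (mtop M) U" "openin (Euclidean_space n) (\<phi> ` U)"
    "homeomorphic_map (subtopology (mtop M) U) (subtopology (Euclidean_space n) (\<phi> ` U)) \<phi>" by blast+
qed

lemma chart_subset: "U \<subseteq> points M"
  by (rule openin_subset[OF chart_open])

lemma chart_inj: "inj_on \<phi> U"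
  using homeomorphic_imp_injective_map[OF chart_homeomorphic] chart_subset by (simp add: inf_absorb2)

lemma chart_inv [simp]: "x \<in> U \<Longrightarrow> inv_into U \<phi> (\<phi> x) = x"
  by (simp add: chart_inj)

lemma chart_image_openin:
  assumes "openin (mtop M) A" "A \<subseteq> U"
  shows "openin (Euclidean_space n) (\<phi> ` A)"
proof -
  have "openin (subtopology (mtop M) U) A"
    using assms chart_open by (simp add: openin_open_subtopology)
  then have "openin (subtopology (Euclidean_space n) (\<phi> ` U)) (\<phi> ` A)"
    using homeomorphic_imp_open_map[OF chart_homeomorphic] by (simp add: open_map_def)
  then show ?thesis using chart_image_open by (simp add: openin_open_subtopology)
qed

lemma chart_continuous: "continuous_map (subtopology (mtop M) U) (Euclidean_space n) \<phi>"
  using homeomorphic_imp_continuous_map[OF chart_homeomorphic] by (simp add: continuous_map_in_subtopology)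

lemma chart_preimage_openin:
  assumes "openin (Euclidean_space n) W"
  shows "openin (mtop M) {x \<in> U. \<phi> x \<in> W}"
proof -
  have "openin (subtopology (mtop M) U) {x \<in> topspace (subtopology (mtop M) U). \<phi> x \<in> W}"
    by (rule openin_continuous_map_preimage[OF chart_continuous assms])
  then show ?thesis using chart_open chart_subset by (simp add: openin_open_subtopology inf_absorb2)
qed

lemma chart_in_eucl: "x \<in> U \<Longrightarrow> \<phi> x \<in> eucl n"
  using openin_subset[OF chart_image_open] by blast

text \<open>Removes the padding by zeros that \<open>smooth_on_compose\<close> puts around the
  components of a chart.\<close>

lemma chart_eta: "x \<in> U \<Longrightarrow> (\<lambda>j. if j < n then \<phi> x j else 0) = \<phi> x"
  using chart_in_eucl by (fastforce simp: topspace_Euclidean_space)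

lemma continuous_map_chart_inv:
  "continuous_map (subtopology (Euclidean_space n) (\<phi> ` U)) (subtopology (mtop M) U) (inv_into U \<phi>)"
proof -
  obtain g where g: "homeomorphic_maps (subtopology (mtop M) U) (subtopology (Euclidean_space n) (\<phi> ` U)) \<phi> g"
    using chart_homeomorphic homeomorphic_map_maps by blast
  then have "continuous_map (subtopology (Euclidean_space n) (\<phi> ` U)) (subtopology (mtop M) U) g"
    by (simp add: homeomorphic_maps_def)
  moreover have "g y = inv_into U \<phi> y" if "y \<in> topspace (subtopology (Euclidean_space n) (\<phi> ` U))" for y
    using g that chart_subset by (force simp: homeomorphic_maps_def)
  ultimately show ?thesis by (rule continuous_map_eq)
qed

end

text \<open>One chart around each point is enough to test smoothness: any other chart differs from
  it by a smooth transition map.\<close>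

lemma smooth_fun_on_local:
  assumes A: "openin (mtop M) A"
    and "\<And>x. x \<in> A \<Longrightarrow> \<exists>U \<phi> B. (U, \<phi>) \<in> charts M \<and> openin (mtop M) B \<and> x \<in> B \<and> B \<subseteq> U \<and>
      smooth_on n (\<phi> ` B) (\<lambda>y. f (inv_into U \<phi> y))"
  shows "smooth_fun_on M A f"
  unfolding smooth_fun_on_def
proof safe
  fix V \<psi> assume ch: "(V, \<psi>) \<in> charts M"
  have VA: "openin (mtop M) (V \<inter> A)" using A chart_open[OF ch] by blast
  show "smooth_on n (\<psi> ` (V \<inter> A)) (\<lambda>x. f (inv_into V \<psi> x))"
  proof (rule smooth_on_local)
    show "openin (Euclidean_space n) (\<psi> ` (V \<inter> A))"
      by (rule chart_image_openin[OF ch VA]) simp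
    fix y assume "y \<in> \<psi> ` (V \<inter> A)"
    then obtain x where x: "x \<in> V" "x \<in> A" "y = \<psi> x" by blast
    obtain U \<phi> B where B: "(U, \<phi>) \<in> charts M" "openin (mtop M) B" "x \<in> B" "B \<subseteq> U"
      "smooth_on n (\<phi> ` B) (\<lambda>y. f (inv_into U \<phi> y))" using assms(2)[OF x(2)] by blast
    have VB: "openin (mtop M) (V \<inter> B)" using B(2) chart_open[OF ch] by blast
    have VU: "openin (mtop M) (V \<inter> U)" using chart_open[OF B(1)] chart_open[OF ch] by blast
    have o: "openin (Euclidean_space n) (\<psi> ` (V \<inter> B))"
      by (rule chart_image_openin[OF ch VB]) simp
    have "smooth_on n (\<psi> ` (V \<inter> B))
      (\<lambda>x. (\<lambda>y. f (inv_into U \<phi> y)) (\<lambda>j. if j < n then \<phi> (inv_into V \<psi> x) j else 0))"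
    proof (rule smooth_on_compose[OF o chart_image_openin[OF B(1,2,4)] B(5)])
      show "smooth_on n (\<psi> ` (V \<inter> B)) (\<lambda>x. \<phi> (inv_into V \<psi> x) j)" if "j < n" for j
        by (rule smooth_on_subset[OF o _ _ transition_smooth[OF ch B(1) that]])
          (use B(4) chart_image_openin[OF ch VU] in auto)
      show "(\<lambda>j. if j < n then \<phi> (inv_into V \<psi> x) j else 0) \<in> \<phi> ` B" if "x \<in> \<psi> ` (V \<inter> B)" for x
        using that B(4) ch by (auto simp: chart_eta[OF B(1)] subset_iff)
    qed
    then have "smooth_on n (\<psi> ` (V \<inter> B)) (\<lambda>x. f (inv_into V \<psi> x))"
      by (rule smooth_on_cong[OF o, rotated])
        (use B(4) ch in \<open>auto simp: chart_eta[OF B(1)] chart_inv[OF B(1)] subset_iff\<close>)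
    then show "\<exists>V'. openin (Euclidean_space n) V' \<and> y \<in> V' \<and> smooth_on n V' (\<lambda>x. f (inv_into V \<psi> x))"
      using o x B(3) by blast
  qed
qed

lemma smooth_funsI:
  assumes "\<And>x. x \<notin> points M \<Longrightarrow> f x = 0"
    and "\<And>x. x \<in> points M \<Longrightarrow> \<exists>U \<phi> B. (U, \<phi>) \<in> charts M \<and> openin (mtop M) B \<and> x \<in> B \<and> B \<subseteq> U \<and>
      smooth_on n (\<phi> ` B) (\<lambda>y. f (inv_into U \<phi> y))"
  shows "f \<in> smooth_funs M"
  using smooth_fun_on_local[OF openin_topspace assms(2)] assms(1) by (simp add: smooth_funs_def)

lemma smooth_funs_chart:
  assumes "f \<in> smooth_funs M" "(U, \<phi>) \<in> charts M"
  shows "smooth_on n (\<phi> ` U) (\<lambda>y. f (inv_into U \<phi> y))"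
proof -
  have "U \<inter> points M = U" using chart_subset[OF assms(2)] by blast
  then show ?thesis using assms by (auto simp: smooth_funs_def smooth_fun_on_def)
qed

lemma smooth_funs_charts_iff:
  "f \<in> smooth_funs M \<longleftrightarrow> (\<forall>x. x \<notin> points M \<longrightarrow> f x = 0) \<and>
     (\<forall>(U, \<phi>)\<in>charts M. smooth_on n (\<phi> ` U) (\<lambda>y. f (inv_into U \<phi> y)))"
proof -
  have "U \<inter> points M = U" if "(U, \<phi>) \<in> charts M" for U \<phi> using chart_subset[OF that] by blast
  then show ?thesis by (auto simp: smooth_funs_def smooth_fun_on_def)
qed

lemma smooth_funs_outside: "f \<in> smooth_funs M \<Longrightarrow> x \<notin> points M \<Longrightarrow> f x = 0"
  by (simp add: smooth_funs_def)

lemma smooth_funs_add: "f \<in> smooth_funs M \<Longrightarrow> g \<in> smooth_funs M \<Longrightarrow> (\<lambda>x. f x + g x) \<in> smooth_funs M"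
  by (auto simp: smooth_funs_charts_iff intro: smooth_on_add[OF chart_image_open])

lemma smooth_funs_diff: "f \<in> smooth_funs M \<Longrightarrow> g \<in> smooth_funs M \<Longrightarrow> (\<lambda>x. f x - g x) \<in> smooth_funs M"
  by (auto simp: smooth_funs_charts_iff intro: smooth_on_diff[OF chart_image_open])

lemma smooth_funs_mult: "f \<in> smooth_funs M \<Longrightarrow> g \<in> smooth_funs M \<Longrightarrow> (\<lambda>x. f x * g x) \<in> smooth_funs M"
  by (auto simp: smooth_funs_charts_iff intro: smooth_on_mult[OF chart_image_open])

lemma smooth_funs_cmult: "f \<in> smooth_funs M \<Longrightarrow> (\<lambda>x. c * f x) \<in> smooth_funs M"
  by (auto simp: smooth_funs_charts_iff intro!: smooth_on_mult[OF chart_image_open] smooth_on_const[OF chart_image_open])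

lemma smooth_funs_0: "(\<lambda>x. 0) \<in> smooth_funs M"
  by (auto simp: smooth_funs_charts_iff intro!: smooth_on_const[OF chart_image_open])

lemma smooth_funs_sum: "(\<And>a. a \<in> A \<Longrightarrow> f a \<in> smooth_funs M) \<Longrightarrow> (\<lambda>x. \<Sum>a\<in>A. f a x) \<in> smooth_funs M"
  by (induction A rule: infinite_finite_induct) (simp_all add: smooth_funs_0 smooth_funs_add)

lemma smooth_funs_const: "(\<lambda>x. if x \<in> points M then c else 0) \<in> smooth_funs M"
proof -
  have "smooth_on n (\<phi> ` U) (\<lambda>y. if inv_into U \<phi> y \<in> points M then c else 0)"
    if "(U, \<phi>) \<in> charts M" for U \<phi>
    by (rule smooth_on_cong[OF chart_image_open[OF that] _ smooth_on_const[OF chart_image_open[OF that], of c]])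
      (use chart_subset[OF that] in \<open>auto simp: chart_inv[OF that]\<close>)
  then show ?thesis by (auto simp: smooth_funs_charts_iff)
qed

text \<open>The last clause extends a function known only in coordinates on \<open>O'\<close> to all
  of \<open>M\<close>, as is required for applying a derivation to it. The extension is smooth
  because the support lies in a compact set, which is closed by the Hausdorff property.\<close>

lemma bump_function:
  assumes ch: "(U, \<phi>) \<in> charts M" and O: "openin (mtop M) O'" "O' \<subseteq> U" "q \<in> O'"
  obtains b where "b \<in> smooth_funs M" "b q = 1" "\<And>x. b x \<noteq> 0 \<Longrightarrow> x \<in> O'"
    "\<And>h. smooth_on n (\<phi> ` O') h \<Longrightarrow> (\<lambda>x. if x \<in> O' then b x * h (\<phi> x) else 0) \<in> smooth_funs M"
proof -
  let ?c = "\<phi> q"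
  have oi: "openin (Euclidean_space n) (\<phi> ` O')" by (rule chart_image_openin[OF ch O(1,2)])
  obtain e where e: "e > 0" "cube n ?c e \<subseteq> \<phi> ` O'" using openin_imp_cube[OF oi, of ?c] O(3) by blast
  have cE: "?c \<in> eucl n" using chart_in_eucl[OF ch] O by blast
  obtain \<beta> where \<beta>: "smooth_on n (eucl n) \<beta>" "\<beta> ?c = 1"
    "\<And>x. x \<in> eucl n \<Longrightarrow> \<beta> x \<noteq> 0 \<Longrightarrow> \<forall>i<n. \<bar>x i - ?c i\<bar> \<le> e / 2"
    using bump_eucl[OF cE, of "e / 2"] e(1) by auto
  define K where "K = {x \<in> eucl n. \<forall>i<n. \<bar>x i - ?c i\<bar> \<le> e / 2}"
  have KO: "K \<subseteq> \<phi> ` O'" using e by (fastforce simp: K_def cube_def)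
  \<comment> \<open>As a subset of the full product, \<open>K\<close> has the factor {0} at every
    index from \<open>n\<close> on, so Tychonoff's theorem applies.\<close>
  have "K = (\<Pi>\<^sub>E i\<in>UNIV. if i < n then cball (?c i) (e / 2) else {0})"
    by (auto simp: K_def PiE_def Pi_def topspace_Euclidean_space dist_real_def abs_minus_commute not_less
      split: if_splits)
  then have "compactin (powertop_real UNIV) K" by (simp add: compactin_PiE)
  then have "compactin (Euclidean_space n) K"
    by (auto simp: Euclidean_space_def compactin_subtopology K_def topspace_Euclidean_space)
  then have "compactin (subtopology (Euclidean_space n) (\<phi> ` U)) K"
    using KO O(2) by (auto simp: compactin_subtopology)
  then have "compactin (subtopology (mtop M) U) (inv_into U \<phi> ` K)"
    using image_compactin continuous_map_chart_inv[OF ch] by blast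
  then have "compactin (mtop M) (inv_into U \<phi> ` K)" by (simp add: compactin_subtopology)
  then have cl: "closedin (mtop M) (inv_into U \<phi> ` K)"
    using compactin_imp_closedin Hausdorff by blast
  have invK: "inv_into U \<phi> ` K = {x \<in> O'. \<phi> x \<in> K}"
  proof (intro equalityI subsetI)
    fix x assume "x \<in> inv_into U \<phi> ` K"
    then obtain y where y: "y \<in> K" "x = inv_into U \<phi> y" by blast
    then obtain z where "z \<in> O'" "y = \<phi> z" using KO by blast
    moreover from this have "x = z" using y(2) chart_inv[OF ch] O(2) by blast
    ultimately show "x \<in> {x \<in> O'. \<phi> x \<in> K}" using y(1) by simp
  next
    fix x assume "x \<in> {x \<in> O'. \<phi> x \<in> K}"
    then show "x \<in> inv_into U \<phi> ` K" using chart_inv[OF ch, of x] O(2) by (metis (no_types, lifting) image_eqI mem_Collect_eq subsetD)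
  qed
  have main: "(\<lambda>x. if x \<in> O' then \<beta> (\<phi> x) * h (\<phi> x) else 0) \<in> smooth_funs M" (is "?g \<in> _")
    if h: "smooth_on n (\<phi> ` O') h" for h
  proof (rule smooth_funsI)
    show "?g x = 0" if "x \<notin> points M" for x using that openin_subset[OF O(1)] by auto
    fix x assume x: "x \<in> points M"
    show "\<exists>U \<phi> B. (U, \<phi>) \<in> charts M \<and> openin (mtop M) B \<and> x \<in> B \<and> B \<subseteq> U \<and>
      smooth_on n (\<phi> ` B) (\<lambda>y. ?g (inv_into U \<phi> y))"
    proof (cases "x \<in> O'")
      case True
      have "smooth_on n (\<phi> ` O') (\<lambda>y. \<beta> y * h y)"
        by (rule smooth_on_mult[OF oi smooth_on_subset[OF oi _ _ \<beta>(1)] h])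
          (use openin_subset[OF oi] in \<open>auto simp: openin_topspace\<close>)
      then have "smooth_on n (\<phi> ` O') (\<lambda>y. ?g (inv_into U \<phi> y))"
        by (rule smooth_on_cong[OF oi, rotated]) (use O(2) ch in \<open>auto simp: subset_iff\<close>)
      then show ?thesis using ch O(1,2) True by blast
    next
      case False
      obtain V \<psi> where V: "(V, \<psi>) \<in> charts M" "x \<in> V" using chart_cover[OF x] by blast
      \<comment> \<open>A neighbourhood of \<open>x\<close> that misses the compact set; the
        extended function is identically zero on it.\<close>
      let ?B = "V - inv_into U \<phi> ` K"
      have B: "openin (mtop M) ?B" using chart_open[OF V(1)] cl by blast
      have oB: "openin (Euclidean_space n) (\<psi> ` ?B)" by (rule chart_image_openin[OF V(1) B]) blast
      have g0: "?g y = 0" if "y \<in> ?B" for y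
      proof (rule ccontr)
        assume a: "?g y \<noteq> 0"
        then have "y \<in> O'" "\<beta> (\<phi> y) \<noteq> 0" by (auto split: if_splits)
        then have "\<phi> y \<in> K" using \<beta>(3)[of "\<phi> y"] chart_in_eucl[OF ch] O(2) by (auto simp: K_def)
        then show False using that \<open>y \<in> O'\<close> invK by blast
      qed
      have "0 = ?g (inv_into V \<psi> y)" if "y \<in> \<psi> ` ?B" for y
      proof -
        obtain z where z: "z \<in> ?B" "y = \<psi> z" using \<open>y \<in> \<psi> ` ?B\<close> by blast
        then have "inv_into V \<psi> y = z" using chart_inv[OF V(1), of z] by simp
        then show ?thesis using g0[OF z(1)] by (simp only:)
      qed
      then have "smooth_on n (\<psi> ` ?B) (\<lambda>y. ?g (inv_into V \<psi> y))"
        by (rule smooth_on_cong[OF oB _ smooth_on_const[OF oB, of 0]])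
      moreover have "x \<in> ?B" using False V(2) invK by blast
      ultimately show ?thesis using V(1) B by blast
    qed
  qed
  define b where "b x = (if x \<in> O' then \<beta> (\<phi> x) else 0)" for x
  have "b \<in> smooth_funs M" using main[OF smooth_on_const[OF oi, of 1]] by (simp add: b_def[abs_def] cong: if_cong)
  moreover have "b q = 1" using O(3) \<beta>(2) by (simp add: b_def)
  moreover have "x \<in> O'" if "b x \<noteq> 0" for x using that by (auto simp: b_def split: if_splits)
  moreover have "(\<lambda>x. if x \<in> O' then b x * h (\<phi> x) else 0) \<in> smooth_funs M"
    if "smooth_on n (\<phi> ` O') h" for h
    using main[OF that] by (simp add: b_def cong: if_cong)
  ultimately show ?thesis using that by blast
qed

end

interpretation tv: vector_space "tscale :: real \<Rightarrow> 'a tvec \<Rightarrow> 'a tvec"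
  by (rule vector_space_tscale)

lemma sum_fun_apply: "(\<Sum>i\<in>A. (v i :: 'b \<Rightarrow> 'c::comm_monoid_add)) x = (\<Sum>i\<in>A. v i x)"
  by (induction A rule: infinite_finite_induct) (simp_all add: zero_fun_def plus_fun_def)

section \<open>Derivations at a point and the dimension of the tangent space\<close>

context mfd
begin

lemma tangentD:
  assumes "v \<in> tangent_space M q"
  shows tangent_add: "f \<in> smooth_funs M \<Longrightarrow> g \<in> smooth_funs M \<Longrightarrow> v (\<lambda>x. f x + g x) = v f + v g"
    and tangent_cmult: "f \<in> smooth_funs M \<Longrightarrow> v (\<lambda>x. c * f x) = c * v f"
    and tangent_mult: "f \<in> smooth_funs M \<Longrightarrow> g \<in> smooth_funs M \<Longrightarrow>
      v (\<lambda>x. f x * g x) = f q * v g + g q * v f"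
    and tangent_nonsmooth: "f \<notin> smooth_funs M \<Longrightarrow> v f = 0"
proof -
  have *: "(\<forall>f\<in>smooth_funs M. \<forall>g\<in>smooth_funs M. v (f + g) = v f + v g) \<and>
     (\<forall>c. \<forall>f\<in>smooth_funs M. v (\<lambda>x. c * f x) = c * v f) \<and>
     (\<forall>f\<in>smooth_funs M. \<forall>g\<in>smooth_funs M. v (\<lambda>x. f x * g x) = f q * v g + g q * v f) \<and>
     (\<forall>f. f \<notin> smooth_funs M \<longrightarrow> v f = 0)"
    using assms by (simp only: tangent_space_def mem_Collect_eq)
  show "v (\<lambda>x. f x + g x) = v f + v g" if "f \<in> smooth_funs M" "g \<in> smooth_funs M"
    using conjunct1[OF *] that unfolding plus_fun_def by blast
  show "v (\<lambda>x. c * f x) = c * v f" if "f \<in> smooth_funs M"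
    using conjunct1[OF conjunct2[OF *]] that by blast
  show "v (\<lambda>x. f x * g x) = f q * v g + g q * v f" if "f \<in> smooth_funs M" "g \<in> smooth_funs M"
    using conjunct1[OF conjunct2[OF conjunct2[OF *]]] that by blast
  show "v f = 0" if "f \<notin> smooth_funs M"
    using conjunct2[OF conjunct2[OF conjunct2[OF *]]] that by blast
qed

lemma tangent_spaceI:
  assumes "\<And>f g. f \<in> smooth_funs M \<Longrightarrow> g \<in> smooth_funs M \<Longrightarrow> v (\<lambda>x. f x + g x) = v f + v g"
    and "\<And>c f. f \<in> smooth_funs M \<Longrightarrow> v (\<lambda>x. c * f x) = c * v f"
    and "\<And>f g. f \<in> smooth_funs M \<Longrightarrow> g \<in> smooth_funs M \<Longrightarrow> v (\<lambda>x. f x * g x) = f q * v g + g q * v f"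
    and "\<And>f. f \<notin> smooth_funs M \<Longrightarrow> v f = 0"
  shows "v \<in> tangent_space M q"
  unfolding tangent_space_def mem_Collect_eq plus_fun_def using assms by blast

lemma tangent_diff:
  assumes "v \<in> tangent_space M q" "f \<in> smooth_funs M" "g \<in> smooth_funs M"
  shows "v (\<lambda>x. f x - g x) = v f - v g"
  using tangent_add[OF assms(1,2) smooth_funs_cmult[OF assms(3), of "-1"]]
    tangent_cmult[OF assms(1,3), of "-1"] by simp

lemma tangent_zero_fun:
  assumes "v \<in> tangent_space M q"
  shows "v (\<lambda>x. 0) = 0"
  using tangent_cmult[OF assms smooth_funs_0, of 0] by simp

lemma tangent_sum:
  assumes "v \<in> tangent_space M q" "\<And>a. a \<in> A \<Longrightarrow> f a \<in> smooth_funs M"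
  shows "v (\<lambda>x. \<Sum>a\<in>A. f a x) = (\<Sum>a\<in>A. v (f a))"
  using assms(2)
proof (induction A rule: infinite_finite_induct)
  case (insert a A)
  have "v (\<lambda>x. f a x + (\<Sum>a\<in>A. f a x)) = v (f a) + v (\<lambda>x. \<Sum>a\<in>A. f a x)"
    by (rule tangent_add[OF assms(1)]) (use insert.prems in \<open>auto intro: smooth_funs_sum\<close>)
  then show ?case using insert by simp
qed (simp_all add: tangent_zero_fun[OF assms(1)])

lemma subspace_tangent_space: "tv.subspace (tangent_space M q)"
proof (rule tv.subspaceI)
  show "0 \<in> tangent_space M q" by (rule tangent_spaceI) simp_all
  show "u + v \<in> tangent_space M q" if "u \<in> tangent_space M q" "v \<in> tangent_space M q" for u v
    by (rule tangent_spaceI) (simp_all add: tangentD[OF that(1)] tangentD[OF that(2)] algebra_simps)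
  show "tscale c v \<in> tangent_space M q" if "v \<in> tangent_space M q" for c v
    by (rule tangent_spaceI) (simp_all add: tscale_def tangentD[OF that] algebra_simps)
qed

lemmas tangent_space_0 = tv.subspace_0[OF subspace_tangent_space]
  and tangent_space_add = tv.subspace_add[OF subspace_tangent_space]
  and tangent_space_diff = tv.subspace_diff[OF subspace_tangent_space]
  and tangent_space_scale = tv.subspace_scale[OF subspace_tangent_space]
  and tangent_space_sum = tv.subspace_sum[OF subspace_tangent_space]

text \<open>The Leibniz rule for e * e = e, where e is 1 on \<open>points M\<close>. Constants are
  cut off outside \<open>points M\<close> so as to lie in \<open>smooth_funs M\<close>.\<close>

lemma tangent_const:
  assumes "v \<in> tangent_space M q" "q \<in> points M"
  shows "v (\<lambda>x. if x \<in> points M then c else 0) = 0"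
proof -
  let ?e = "\<lambda>x. if x \<in> points M then 1 else (0::real)"
  have "(\<lambda>x. ?e x * ?e x) = ?e" by auto
  then have "v ?e = 0"
    using tangent_mult[OF assms(1) smooth_funs_const smooth_funs_const, of 1 1] assms(2) by simp
  moreover have "(\<lambda>x. c * ?e x) = (\<lambda>x. if x \<in> points M then c else 0)" by auto
  ultimately show ?thesis using tangent_cmult[OF assms(1) smooth_funs_const, of c 1] by simp
qed

text \<open>The coordinate vector d/dx_k at \<open>q\<close>, as a derivation of global
  functions.\<close>

definition chartvec where
  "chartvec U \<phi> q k f = (if f \<in> smooth_funs M then partial_deriv k (\<lambda>y. f (inv_into U \<phi> y)) (\<phi> q) else 0)"

context
  fixes U \<phi> q
  assumes ch: "(U, \<phi>) \<in> charts M" and q: "q \<in> U"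
begin

lemma chartvec_deriv:
  assumes "f \<in> smooth_funs M" "k < n"
  shows "((\<lambda>t. f (inv_into U \<phi> ((\<phi> q)(k := t)))) has_real_derivative chartvec U \<phi> q k f) (at (\<phi> q k))"
  using Ck_on_SucD(2)[OF smooth_onD[OF smooth_funs_chart[OF assms(1) ch]] assms(2) imageI[OF q]] assms(1)
  by (simp only: chartvec_def if_True)

lemma chartvec_eqI:
  assumes "f \<in> smooth_funs M"
    and "((\<lambda>t. f (inv_into U \<phi> ((\<phi> q)(k := t)))) has_real_derivative D) (at (\<phi> q k))"
  shows "chartvec U \<phi> q k f = D"
  using DERIV_imp_deriv[OF assms(2)] assms(1) by (simp only: chartvec_def if_True partial_deriv_def)

lemma inv_upd_self: "inv_into U \<phi> ((\<phi> q)(k := \<phi> q k)) = q"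
  using chart_inv[OF ch q] by (simp only: fun_upd_triv)

lemma chartvec_tangent:
  assumes k: "k < n"
  shows "chartvec U \<phi> q k \<in> tangent_space M q"
proof (rule tangent_spaceI)
  fix f g assume f: "f \<in> smooth_funs M" and g: "g \<in> smooth_funs M"
  show "chartvec U \<phi> q k (\<lambda>x. f x + g x) = chartvec U \<phi> q k f + chartvec U \<phi> q k g"
    by (rule chartvec_eqI[OF smooth_funs_add[OF f g] DERIV_add[OF chartvec_deriv[OF f k] chartvec_deriv[OF g k]]])
  show "chartvec U \<phi> q k (\<lambda>x. f x * g x) = f q * chartvec U \<phi> q k g + g q * chartvec U \<phi> q k f"
    using chartvec_eqI[OF smooth_funs_mult[OF f g] DERIV_mult[OF chartvec_deriv[OF f k] chartvec_deriv[OF g k]]]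
    unfolding inv_upd_self by simp
next
  fix c f assume f: "f \<in> smooth_funs M"
  show "chartvec U \<phi> q k (\<lambda>x. c * f x) = c * chartvec U \<phi> q k f"
    by (rule chartvec_eqI[OF smooth_funs_cmult[OF f] DERIV_cmult[OF chartvec_deriv[OF f k]]])
qed (simp add: chartvec_def)

text \<open>The functions \<open>c k\<close> are the coordinates centred at \<open>q\<close>, cut off by a bump function.\<close>

lemma chart_coordinates:
  obtains c where "\<And>k. c k \<in> smooth_funs M"
    "\<And>j k. j < n \<Longrightarrow> chartvec U \<phi> q j (c k) = (if j = k then 1 else 0)"
    "\<And>v. v \<in> tangent_space M q \<Longrightarrow> v = (\<Sum>k<n. tscale (v (c k)) (chartvec U \<phi> q k))"
proof -
  let ?c = "\<phi> q"
  have qM: "q \<in> points M" using chart_subset[OF ch] q by blast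
  have cE: "?c \<in> eucl n" by (rule chart_in_eucl[OF ch q])
  obtain e where e: "e > 0" "cube n ?c e \<subseteq> \<phi> ` U"
    using openin_imp_cube[OF chart_image_open[OF ch] imageI[OF q]] by blast
  \<comment> \<open>The part of the chart domain over a cube, which is the domain on which
    \<open>hadamard\<close> is stated.\<close>
  define B where "B = {x \<in> U. \<phi> x \<in> cube n ?c e}"
  have BU: "B \<subseteq> U" by (auto simp: B_def)
  have Bo: "openin (mtop M) B" unfolding B_def by (rule chart_preimage_openin[OF ch openin_cube])
  have Bim: "\<phi> ` B = cube n ?c e" using e(2) by (auto simp: B_def)
  have qc: "?c \<in> cube n ?c e" using cE e(1) by (simp add: cube_def)
  then have qB: "q \<in> B" using q by (simp add: B_def)
  obtain b where b: "b \<in> smooth_funs M" "b q = 1" "\<And>x. b x \<noteq> 0 \<Longrightarrow> x \<in> B"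
    "\<And>h. smooth_on n (\<phi> ` B) h \<Longrightarrow> (\<lambda>x. if x \<in> B then b x * h (\<phi> x) else 0) \<in> smooth_funs M"
    using bump_function[OF ch Bo BU qB] by blast
  define c where "c k x = (if x \<in> B then b x * (\<phi> x k - ?c k) else 0)" for k x
  have c: "c k \<in> smooth_funs M" for k
    unfolding c_def[abs_def] Bim
    by (rule b(4)) (unfold Bim, intro smooth_on_diff[OF openin_cube] smooth_on_coord[OF openin_cube]
        smooth_on_const[OF openin_cube])
  have dc: "chartvec U \<phi> q j (c k) = (if j = k then 1 else 0)" if j: "j < n" for j k
  proof (rule chartvec_eqI[OF c])
    let ?u = "\<lambda>t. (?c)(j := t)"
    have ev: "\<forall>\<^sub>F t in nhds (?c j). ?u t \<in> \<phi> ` B"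
      unfolding Bim by (rule eventually_upd[OF openin_cube qc j])
    have cu: "c k (inv_into U \<phi> (?u t)) = b (inv_into U \<phi> (?u t)) * (?u t k - ?c k)" if ut: "?u t \<in> \<phi> ` B" for t
    proof -
      obtain z where z: "z \<in> B" "?u t = \<phi> z" using ut by blast
      then have "inv_into U \<phi> (?u t) = z" using chart_inv[OF ch, of z] BU by auto
      then show ?thesis using z by (simp add: c_def)
    qed
    have "((\<lambda>t. ?u t k - ?c k) has_real_derivative (if j = k then 1 else 0)) (at (?c j))"
      by (auto intro!: derivative_eq_intros)
    from DERIV_mult[OF chartvec_deriv[OF b(1) j] this]
    have D: "((\<lambda>t. b (inv_into U \<phi> (?u t)) * (?u t k - ?c k)) has_real_derivative (if j = k then 1 else 0)) (at (?c j))"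
      unfolding inv_upd_self using b(2) by simp
    have E: "\<forall>\<^sub>F t in nhds (?c j). b (inv_into U \<phi> (?u t)) * (?u t k - ?c k) = c k (inv_into U \<phi> (?u t))"
      using ev by (rule eventually_mono) (simp only: cu)
    show "((\<lambda>t. c k (inv_into U \<phi> (?u t))) has_real_derivative (if j = k then 1 else 0)) (at (?c j))"
      by (rule iffD1[OF DERIV_cong_ev[OF refl E refl] D])
  qed
  have exp: "v = (\<Sum>k<n. tscale (v (c k)) (chartvec U \<phi> q k))" if v: "v \<in> tangent_space M q" for v
  proof
    fix f
    show "v f = (\<Sum>k<n. tscale (v (c k)) (chartvec U \<phi> q k)) f"
    proof (cases "f \<in> smooth_funs M")
      case False
      then show ?thesis
        by (simp add: tangent_nonsmooth[OF v] sum_fun_apply tscale_def chartvec_def)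
    next
      case True
      define F where "F y = f (inv_into U \<phi> y)" for y
      have Fs: "smooth_on n (cube n ?c e) F"
        using smooth_on_subset[OF openin_cube chart_image_open[OF ch] e(2) smooth_funs_chart[OF True ch]]
        by (simp add: F_def[abs_def])
      obtain g where g: "\<And>i. i < n \<Longrightarrow> smooth_on n (cube n ?c e) (g i)"
        "\<And>i. i < n \<Longrightarrow> g i ?c = partial_deriv i F ?c"
        "\<And>x. x \<in> cube n ?c e \<Longrightarrow> F x = F ?c + (\<Sum>i<n. (x i - ?c i) * g i x)"
        using hadamard[OF cE e(1) Fs] by blast
      define G where "G i x = (if x \<in> B then b x * g i (\<phi> x) else 0)" for i x
      have G: "G i \<in> smooth_funs M" if "i < n" for i
        unfolding G_def[abs_def] by (rule b(4)) (unfold Bim, rule g(1)[OF that])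
      let ?f0 = "\<lambda>x. f x - (if x \<in> points M then f q else 0)"
      have f0: "?f0 \<in> smooth_funs M" by (rule smooth_funs_diff[OF True smooth_funs_const])
      have f0v: "v ?f0 = v f"
        by (simp only: tangent_diff[OF v True smooth_funs_const] tangent_const[OF v qM] diff_zero)
      have f0q: "?f0 q = 0" using qM by simp
      \<comment> \<open>Hadamard's expansion multiplied by \<open>b\<close> twice, once for
        \<open>c i\<close> and once for \<open>G i\<close>, so that every factor is a global
        function. By the Leibniz rule \<open>v\<close> does not notice the two factors
        \<open>b\<close>, since \<open>b q = 1\<close> and \<open>?f0 q = 0\<close>.\<close>
      have "(\<lambda>x. b x * (b x * ?f0 x)) = (\<lambda>x. \<Sum>i<n. c i x * G i x)"
      proof
        fix x
        show "b x * (b x * ?f0 x) = (\<Sum>i<n. c i x * G i x)"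
        proof (cases "x \<in> B")
          case xB: True
          then have x: "x \<in> U" "\<phi> x \<in> cube n ?c e" "x \<in> points M"
            using BU Bim chart_subset[OF ch] by blast+
          have "f x = f q + (\<Sum>i<n. (\<phi> x i - ?c i) * g i (\<phi> x))"
            using g(3)[OF x(2)] chart_inv[OF ch x(1)] chart_inv[OF ch q] by (simp add: F_def)
          then have "?f0 x = (\<Sum>i<n. (\<phi> x i - ?c i) * g i (\<phi> x))" using x(3) by simp
          then show ?thesis using xB
            by (simp add: c_def G_def sum_distrib_left algebra_simps del: sum.lessThan_Suc)
        next
          case False
          then show ?thesis using b(3) by (auto simp: c_def)
        qed
      qed
      then have "v (\<lambda>x. b x * (b x * ?f0 x)) = v (\<lambda>x. \<Sum>i<n. c i x * G i x)" by (rule arg_cong)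
      moreover have "v (\<lambda>x. b x * (b x * ?f0 x)) = v f"
        using tangent_mult[OF v b(1) smooth_funs_mult[OF b(1) f0]] tangent_mult[OF v b(1) f0] b(2) f0q f0v
        by simp
      moreover have "v (\<lambda>x. \<Sum>i<n. c i x * G i x) = (\<Sum>i<n. v (\<lambda>x. c i x * G i x))"
        by (rule tangent_sum[OF v smooth_funs_mult[OF c G]]) simp
      moreover have "(\<Sum>i<n. v (\<lambda>x. c i x * G i x)) = (\<Sum>i<n. v (c i) * chartvec U \<phi> q i f)"
      proof (rule sum.cong[OF refl])
        fix i assume "i \<in> {..<n}"
        then have i: "i < n" by simp
        have "c i q = 0" by (simp add: c_def)
        moreover have "G i q = chartvec U \<phi> q i f"
          using qB b(2) g(2)[OF i] True by (simp add: G_def chartvec_def F_def[abs_def])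
        ultimately show "v (\<lambda>x. c i x * G i x) = v (c i) * chartvec U \<phi> q i f"
          using tangent_mult[OF v c G[OF i]] by simp
      qed
      ultimately show ?thesis by (simp add: sum_fun_apply tscale_def)
    qed
  qed
  show ?thesis using that[of c] c dc exp by blast
qed

lemma tangent_space_chartvec_span: "tangent_space M q = tv.span (chartvec U \<phi> q ` {..<n})"
proof
  show "tv.span (chartvec U \<phi> q ` {..<n}) \<subseteq> tangent_space M q"
    by (rule tv.span_minimal[OF _ subspace_tangent_space]) (auto intro: chartvec_tangent)
  show "tangent_space M q \<subseteq> tv.span (chartvec U \<phi> q ` {..<n})"
  proof
    fix v assume v: "v \<in> tangent_space M q"
    obtain c where "\<And>v. v \<in> tangent_space M q \<Longrightarrow> v = (\<Sum>k<n. tscale (v (c k)) (chartvec U \<phi> q k))"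
      by (rule chart_coordinates) blast
    moreover have "(\<Sum>k<n. tscale (v (c k)) (chartvec U \<phi> q k)) \<in> tv.span (chartvec U \<phi> q ` {..<n})"
      by (rule tv.span_sum, rule tv.span_scale, rule tv.span_base, rule imageI)
    ultimately show "v \<in> tv.span (chartvec U \<phi> q ` {..<n})" using v by (simp only:)
  qed
qed

text \<open>The cut-off coordinates are dual to the coordinate vectors, which yields independence;
  spanning was Hadamard's lemma.\<close>

lemma tdim_tangent_space_chart: "tdim (tangent_space M q) = n"
proof -
  obtain c where c: "\<And>k. c k \<in> smooth_funs M"
    "\<And>j k. j < n \<Longrightarrow> chartvec U \<phi> q j (c k) = (if j = k then 1 else 0)"
    by (rule chart_coordinates) blast
  have inj: "inj_on (chartvec U \<phi> q) {..<n}"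
  proof (rule inj_onI)
    fix i j assume i: "i \<in> {..<n}" "j \<in> {..<n}" and eq: "chartvec U \<phi> q i = chartvec U \<phi> q j"
    have "(if i = i then 1 else 0 :: real) = (if j = i then 1 else 0)"
      using c(2)[of i i] c(2)[of j i] i eq by (simp only: lessThan_iff)
    then show "i = j" by (simp split: if_splits)
  qed
  have z: "r x = 0" if s: "(\<Sum>x\<in>chartvec U \<phi> q ` {..<n}. tscale (r x) x) = 0"
      and x: "x \<in> chartvec U \<phi> q ` {..<n}" for r :: "'a tvec \<Rightarrow> real" and x
  proof -
    obtain j where j: "j < n" "x = chartvec U \<phi> q j" using x by auto
    have "(\<Sum>k<n. tscale (r (chartvec U \<phi> q k)) (chartvec U \<phi> q k)) = 0"
      using s by (simp add: sum.reindex[OF inj])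
    then have "(\<Sum>k<n. tscale (r (chartvec U \<phi> q k)) (chartvec U \<phi> q k)) (c j) = 0" by simp
    then have "(\<Sum>k<n. r (chartvec U \<phi> q k) * chartvec U \<phi> q k (c j)) = 0"
      by (simp add: sum_fun_apply tscale_def)
    also have "(\<Sum>k<n. r (chartvec U \<phi> q k) * chartvec U \<phi> q k (c j)) =
        (\<Sum>k<n. if k = j then r (chartvec U \<phi> q k) else 0)"
      by (rule sum.cong) (simp_all add: c(2))
    finally show "r x = 0" using j by simp
  qed
  have ind: "tv.independent (chartvec U \<phi> q ` {..<n})"
  proof
    assume "tv.dependent (chartvec U \<phi> q ` {..<n})"
    then obtain r where "\<exists>x\<in>chartvec U \<phi> q ` {..<n}. r x \<noteq> 0"
      and r: "(\<Sum>x\<in>chartvec U \<phi> q ` {..<n}. tscale (r x) x) = 0"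
      unfolding tv.dependent_finite[OF finite_imageI[OF finite_lessThan]] by (elim exE conjE)
    then obtain x where x: "x \<in> chartvec U \<phi> q ` {..<n}" "r x \<noteq> 0" by (elim bexE)
    show False using z[OF r x(1)] x(2) by (rule notE[rotated])
  qed
  have "tv.dim (tangent_space M q) = n"
  proof (rule tv.dim_unique[OF _ _ ind])
    show "chartvec U \<phi> q ` {..<n} \<subseteq> tangent_space M q"
      unfolding tangent_space_chartvec_span by (rule tv.span_superset)
    show "tangent_space M q \<subseteq> tv.span (chartvec U \<phi> q ` {..<n})"
      by (rule equalityD1[OF tangent_space_chartvec_span])
    show "card (chartvec U \<phi> q ` {..<n}) = n" using card_image[OF inj] by simp
  qed
  then show ?thesis by (simp add: tdim_def)
qed

end

lemma tdim_tangent_space: "q \<in> points M \<Longrightarrow> tdim (tangent_space M q) = n"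
  by (meson chart_cover tdim_tangent_space_chart)

end

section \<open>Vector fields\<close>

context mfd
begin

lemma vfields_tangent: "X \<in> vfields M \<Longrightarrow> q \<in> points M \<Longrightarrow> X q \<in> tangent_space M q"
  and vfields_outside: "X \<in> vfields M \<Longrightarrow> q \<notin> points M \<Longrightarrow> X q = 0"
  and vfields_smooth: "X \<in> vfields M \<Longrightarrow> f \<in> smooth_funs M \<Longrightarrow> (\<lambda>q. X q f) \<in> smooth_funs M"
  by (simp_all add: vfields_def)

lemma vfieldsI:
  assumes "\<And>q. q \<in> points M \<Longrightarrow> X q \<in> tangent_space M q" "\<And>q. q \<notin> points M \<Longrightarrow> X q = 0"
    "\<And>f. f \<in> smooth_funs M \<Longrightarrow> (\<lambda>q. X q f) \<in> smooth_funs M"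
  shows "X \<in> vfields M"
  using assms by (simp add: vfields_def)

lemma vfields_nonsmooth:
  assumes "X \<in> vfields M" "f \<notin> smooth_funs M"
  shows "X q f = 0"
  using tangent_nonsmooth[OF vfields_tangent[OF assms(1)] assms(2)] vfields_outside[OF assms(1)]
  by (cases "q \<in> points M") simp_all

lemma vfields_add:
  assumes X: "X \<in> vfields M" and Y: "Y \<in> vfields M"
  shows "X + Y \<in> vfields M"
proof (rule vfieldsI)
  show "(X + Y) q = 0" if "q \<notin> points M" for q
    by (rule ext) (simp add: vfields_outside[OF X that] vfields_outside[OF Y that])
qed (simp_all add: vfields_tangent[OF X] vfields_tangent[OF Y] tangent_space_add vfields_smooth[OF X]
    vfields_smooth[OF Y] smooth_funs_add)

lemma vfields_diff: "X \<in> vfields M \<Longrightarrow> Y \<in> vfields M \<Longrightarrow> X - Y \<in> vfields M"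
  by (rule vfieldsI) (simp_all add: vfields_tangent tangent_space_diff vfields_outside vfields_smooth smooth_funs_diff)

lemma vfields_0: "0 \<in> vfields M"
  by (rule vfieldsI) (simp_all add: tangent_space_0 smooth_funs_0)

lemma vfields_sum: "(\<And>a. a \<in> A \<Longrightarrow> X a \<in> vfields M) \<Longrightarrow> (\<Sum>a\<in>A. X a) \<in> vfields M"
  by (induction A rule: infinite_finite_induct) (simp_all add: vfields_0 vfields_add)

lemma vf_scale_vfields:
  assumes "f \<in> smooth_funs M" "X \<in> vfields M"
  shows "vf_scale f X \<in> vfields M"
proof (rule vfieldsI)
  show "vf_scale f X q \<in> tangent_space M q" if "q \<in> points M" for q
    using that by (simp add: vf_scale_def tangent_space_scale vfields_tangent[OF assms(2)])
  show "vf_scale f X q = 0" if "q \<notin> points M" for q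
    using vfields_outside[OF assms(2) that] by (simp add: vf_scale_def)
  show "(\<lambda>q. vf_scale f X q g) \<in> smooth_funs M" if "g \<in> smooth_funs M" for g
    using smooth_funs_mult[OF assms(1) vfields_smooth[OF assms(2) that]] by (simp add: vf_scale_def tscale_def)
qed

lemma vf_apply_add:
  assumes "X \<in> vfields M" "f \<in> smooth_funs M" "g \<in> smooth_funs M"
  shows "X q (\<lambda>x. f x + g x) = X q f + X q g"
  using tangent_add[OF vfields_tangent[OF assms(1)] assms(2,3)] vfields_outside[OF assms(1)]
  by (cases "q \<in> points M") simp_all

lemma vf_apply_cmult:
  assumes "X \<in> vfields M" "f \<in> smooth_funs M"
  shows "X q (\<lambda>x. c * f x) = c * X q f"
  using tangent_cmult[OF vfields_tangent[OF assms(1)] assms(2)] vfields_outside[OF assms(1)]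
  by (cases "q \<in> points M") simp_all

lemma vf_apply_mult:
  assumes "X \<in> vfields M" "f \<in> smooth_funs M" "g \<in> smooth_funs M"
  shows "X q (\<lambda>x. f x * g x) = f q * X q g + g q * X q f"
  using tangent_mult[OF vfields_tangent[OF assms(1)] assms(2,3)] vfields_outside[OF assms(1)]
  by (cases "q \<in> points M") simp_all

lemma lie_bracket_vfields:
  assumes X: "X \<in> vfields M" and Y: "Y \<in> vfields M"
  shows "lie_bracket X Y \<in> vfields M"
proof (rule vfieldsI)
  note s = vfields_smooth[OF X] vfields_smooth[OF Y]
  fix q assume "q \<in> points M"
  show "lie_bracket X Y q \<in> tangent_space M q"
  proof (rule tangent_spaceI)
    fix f g assume f: "f \<in> smooth_funs M" and g: "g \<in> smooth_funs M"
    show "lie_bracket X Y q (\<lambda>x. f x + g x) = lie_bracket X Y q f + lie_bracket X Y q g"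
      unfolding lie_bracket_def vf_apply_def
      by (simp add: vf_apply_add[OF X] vf_apply_add[OF Y] f g s)
    show "lie_bracket X Y q (\<lambda>x. f x * g x) = f q * lie_bracket X Y q g + g q * lie_bracket X Y q f"
      unfolding lie_bracket_def vf_apply_def
      by (simp add: vf_apply_add[OF X] vf_apply_add[OF Y] vf_apply_mult[OF X] vf_apply_mult[OF Y]
          f g s smooth_funs_mult algebra_simps)
  next
    fix c f assume f: "f \<in> smooth_funs M"
    show "lie_bracket X Y q (\<lambda>x. c * f x) = c * lie_bracket X Y q f"
      unfolding lie_bracket_def vf_apply_def
      by (simp add: vf_apply_cmult[OF X] vf_apply_cmult[OF Y] f s algebra_simps)
  next
    fix f assume f: "f \<notin> smooth_funs M"
    show "lie_bracket X Y q f = 0"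
      \<comment> \<open>For non-smooth \<open>f\<close> both inner functions are the zero function,
        which \<open>X\<close> and \<open>Y\<close> kill by homogeneity with factor 0.\<close>
      using vf_apply_cmult[OF X smooth_funs_0, of q 0] vf_apply_cmult[OF Y smooth_funs_0, of q 0]
      by (simp add: lie_bracket_def vf_apply_def vfields_nonsmooth[OF X f] vfields_nonsmooth[OF Y f])
  qed
next
  fix q assume "q \<notin> points M"
  then show "lie_bracket X Y q = 0"
    by (simp add: lie_bracket_def vfields_outside[OF X] vfields_outside[OF Y] zero_fun_def)
next
  fix f assume f: "f \<in> smooth_funs M"
  show "(\<lambda>q. lie_bracket X Y q f) \<in> smooth_funs M"
    unfolding lie_bracket_def vf_apply_def
    by (intro smooth_funs_diff vfields_smooth[OF X] vfields_smooth[OF Y] f)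
qed

lemma lie_bracket_scale_right:
  assumes X: "X \<in> vfields M" and Z: "Z \<in> vfields M" and f: "f \<in> smooth_funs M"
  shows "lie_bracket X (vf_scale f Z) = vf_scale (vf_apply X f) Z + vf_scale f (lie_bracket X Z)"
proof (intro ext)
  fix q g
  show "lie_bracket X (vf_scale f Z) q g = (vf_scale (vf_apply X f) Z + vf_scale f (lie_bracket X Z)) q g"
  proof (cases "g \<in> smooth_funs M")
    case True
    then show ?thesis
      unfolding lie_bracket_def vf_apply_def vf_scale_def tscale_def plus_fun_def
      by (simp add: vf_apply_mult[OF X f vfields_smooth[OF Z True]] algebra_simps)
  next
    case False
    have "lie_bracket X (vf_scale f Z) q g = 0"
      by (rule vfields_nonsmooth[OF lie_bracket_vfields[OF X vf_scale_vfields[OF f Z]] False])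
    moreover have "(vf_scale (vf_apply X f) Z + vf_scale f (lie_bracket X Z)) q g = 0"
      by (simp add: vfields_nonsmooth[OF lie_bracket_vfields[OF X Z] False] vfields_nonsmooth[OF Z False]
        vf_scale_def tscale_def)
    ultimately show ?thesis by simp
  qed
qed

lemma lie_bracket_antisym: "lie_bracket Y X = - lie_bracket X Y"
  by (intro ext) (simp add: lie_bracket_def)

lemma lie_bracket_add_right:
  assumes X: "X \<in> vfields M" and Y: "Y \<in> vfields M" and Z: "Z \<in> vfields M"
  shows "lie_bracket X (Y + Z) = lie_bracket X Y + lie_bracket X Z"
proof (intro ext)
  fix q g
  show "lie_bracket X (Y + Z) q g = (lie_bracket X Y + lie_bracket X Z) q g"
  proof (cases "g \<in> smooth_funs M")
    case True
    then show ?thesis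
      unfolding lie_bracket_def vf_apply_def plus_fun_def
      by (simp add: vf_apply_add[OF X vfields_smooth[OF Y True] vfields_smooth[OF Z True]])
  next
    case False
    then show ?thesis
      by (simp add: vfields_nonsmooth[OF lie_bracket_vfields[OF X vfields_add[OF Y Z]] False]
        vfields_nonsmooth[OF lie_bracket_vfields[OF X Z] False] 
        vfields_nonsmooth[OF lie_bracket_vfields[OF X Y] False])
  qed
qed

end

section \<open>The Levi-Civita connection\<close>

locale riem =
  fixes M :: "'a rmfd"
  assumes riem: "riemannian_manifold M"
begin

sublocale mfd M
  using riem by unfold_locales (simp add: riemannian_manifold_def)

lemma riem_axioms':
  assumes "q \<in> points M" "u \<in> tangent_space M q" "v \<in> tangent_space M q"
  shows metric_sym: "metric M q u v = metric M q v u"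
    and metric_add_left: "w \<in> tangent_space M q \<Longrightarrow> metric M q (u + v) w = metric M q u w + metric M q v w"
    and metric_scale_left: "metric M q (tscale c u) v = c * metric M q u v"
    and metric_pos: "u \<noteq> 0 \<Longrightarrow> metric M q u u > 0"
proof -
  have *: "\<forall>q\<in>points M. \<forall>u\<in>tangent_space M q. \<forall>v\<in>tangent_space M q.
        metric M q u v = metric M q v u \<and>
        (\<forall>w\<in>tangent_space M q. metric M q (u + v) w = metric M q u w + metric M q v w) \<and>
        (\<forall>c. metric M q (tscale c u) v = c * metric M q u v) \<and>
        (u \<noteq> 0 \<longrightarrow> metric M q u u > 0)"
    using riem unfolding riemannian_manifold_def by (elim conjE)
  note ** = bspec[OF bspec[OF bspec[OF * assms(1)] assms(2)] assms(3)]
  show "metric M q u v = metric M q v u" using ** by (elim conjE)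
  show "w \<in> tangent_space M q \<Longrightarrow> metric M q (u + v) w = metric M q u w + metric M q v w"
    using conjunct1[OF conjunct2[OF **]] by (rule bspec)
  show "metric M q (tscale c u) v = c * metric M q u v"
    using conjunct1[OF conjunct2[OF conjunct2[OF **]]] by (rule spec)
  show "u \<noteq> 0 \<Longrightarrow> metric M q u u > 0"
    using conjunct2[OF conjunct2[OF conjunct2[OF **]]] by (rule mp)
qed

lemma metric_add_right:
  assumes q: "q \<in> points M" and u: "u \<in> tangent_space M q" and v: "v \<in> tangent_space M q"
    and w: "w \<in> tangent_space M q"
  shows "metric M q w (u + v) = metric M q w u + metric M q w v"
  using metric_add_left[OF q u v w] metric_sym[OF q w u] metric_sym[OF q w v]
    metric_sym[OF q w tangent_space_add[OF u v]] by (simp only:)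

lemma metric_scale_right:
  assumes q: "q \<in> points M" and u: "u \<in> tangent_space M q" and v: "v \<in> tangent_space M q"
  shows "metric M q u (tscale c v) = c * metric M q u v"
  using metric_scale_left[OF q v u] metric_sym[OF q u v] metric_sym[OF q u tangent_space_scale[OF v]]
  by (simp only:)

lemma tscale_minus1: "tscale (- 1) v = - v"
  by (simp add: tscale_def fun_eq_iff)

lemma metric_diff_left:
  assumes q: "q \<in> points M" and u: "u \<in> tangent_space M q" and v: "v \<in> tangent_space M q"
    and w: "w \<in> tangent_space M q"
  shows "metric M q (u - v) w = metric M q u w - metric M q v w"
proof -
  have *: "u - v = u + tscale (- 1) v" by (simp add: tscale_minus1)
  show ?thesis
    unfolding * metric_add_left[OF q u tangent_space_scale[OF v] w] metric_scale_left[OF q v w] by simp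
qed

lemma metric_zero_left:
  assumes q: "q \<in> points M" and u: "u \<in> tangent_space M q"
  shows "metric M q 0 u = 0"
  using metric_diff_left[OF q u u u] by simp

lemma metric_sum_left:
  assumes q: "q \<in> points M" and w: "w \<in> tangent_space M q"
    and "\<And>a. a \<in> A \<Longrightarrow> u a \<in> tangent_space M q"
  shows "metric M q (\<Sum>a\<in>A. u a) w = (\<Sum>a\<in>A. metric M q (u a) w)"
  using assms(3)
proof (induction A rule: infinite_finite_induct)
  case (insert a A)
  have "metric M q (u a + (\<Sum>a\<in>A. u a)) w = metric M q (u a) w + metric M q (\<Sum>a\<in>A. u a) w"
    using insert.prems by (intro metric_add_left[OF q _ _ w] tangent_space_sum) auto
  moreover have "metric M q (\<Sum>a\<in>A. u a) w = (\<Sum>a\<in>A. metric M q (u a) w)"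
    using insert by blast
  ultimately show ?case by (simp only: sum.insert[OF insert.hyps])
qed (simp_all only: sum.infinite sum.empty metric_zero_left[OF q w] not_False_eq_True)

lemma metric_eqI:
  assumes q: "q \<in> points M" and u: "u \<in> tangent_space M q" and v: "v \<in> tangent_space M q"
    and "\<And>w. w \<in> tangent_space M q \<Longrightarrow> metric M q u w = metric M q v w"
  shows "u = v"
proof (rule ccontr)
  assume "u \<noteq> v"
  then have "metric M q (u - v) (u - v) > 0"
    by (intro metric_pos[OF q tangent_space_diff[OF u v] tangent_space_diff[OF u v]]) simp
  then show False
    using metric_diff_left[OF q u v tangent_space_diff[OF u v]] assms(4)[OF tangent_space_diff[OF u v]]
    by simp
qed

lemma vf_inner_smooth: "X \<in> vfields M \<Longrightarrow> Y \<in> vfields M \<Longrightarrow> vf_inner M X Y \<in> smooth_funs M"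
  using riem by (simp add: riemannian_manifold_def)

lemma vf_inner_sym:
  assumes "X \<in> vfields M" "Y \<in> vfields M"
  shows "vf_inner M X Y = vf_inner M Y X"
proof
  fix q
  show "vf_inner M X Y q = vf_inner M Y X q"
    using metric_sym[OF _ vfields_tangent[OF assms(1)] vfields_tangent[OF assms(2)], of q]
    by (simp add: vf_inner_def)
qed

lemma vf_inner_add_left:
  assumes "X \<in> vfields M" "Y \<in> vfields M" "Z \<in> vfields M"
  shows "vf_inner M (X + Y) Z = (\<lambda>q. vf_inner M X Z q + vf_inner M Y Z q)"
proof
  fix q
  show "vf_inner M (X + Y) Z q = vf_inner M X Z q + vf_inner M Y Z q"
    using metric_add_left[OF _ vfields_tangent[OF assms(1)] vfields_tangent[OF assms(2)]
        vfields_tangent[OF assms(3)], of q]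
    by (cases "q \<in> points M") (simp_all add: vf_inner_def)
qed

lemma vf_inner_add_right:
  assumes "X \<in> vfields M" "Y \<in> vfields M" "Z \<in> vfields M"
  shows "vf_inner M Z (X + Y) = (\<lambda>q. vf_inner M Z X q + vf_inner M Z Y q)"
  using vf_inner_add_left[OF assms] vf_inner_sym[OF assms(1,3)] vf_inner_sym[OF assms(2,3)]
    vf_inner_sym[OF vfields_add[OF assms(1,2)] assms(3)] by (simp only:)

lemma vf_inner_scale_left:
  assumes "X \<in> vfields M" "Y \<in> vfields M"
  shows "vf_inner M (vf_scale f X) Y = (\<lambda>q. f q * vf_inner M X Y q)"
proof
  fix q
  show "vf_inner M (vf_scale f X) Y q = f q * vf_inner M X Y q"
    using metric_scale_left[OF _ vfields_tangent[OF assms(1)] vfields_tangent[OF assms(2)], where q = q]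
    by (cases "q \<in> points M") (simp_all add: vf_inner_def vf_scale_def)
qed

lemma vf_inner_scale_right:
  assumes "X \<in> vfields M" "Y \<in> vfields M" "f \<in> smooth_funs M"
  shows "vf_inner M X (vf_scale f Y) = (\<lambda>q. f q * vf_inner M X Y q)"
  using vf_inner_scale_left[OF assms(2,1), of f] vf_inner_sym[OF assms(1,2)]
    vf_inner_sym[OF assms(1) vf_scale_vfields[OF assms(3,2)]] by (simp only:)

lemma vf_inner_uminus_left:
  assumes "X \<in> vfields M" "Y \<in> vfields M"
  shows "vf_inner M (- X) Y = (\<lambda>q. - vf_inner M X Y q)"
proof
  fix q
  show "vf_inner M (- X) Y q = - vf_inner M X Y q"
    using metric_scale_left[OF _ vfields_tangent[OF assms(1)] vfields_tangent[OF assms(2)],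
        where q = q and c = "-1"]
    by (cases "q \<in> points M") (simp_all add: vf_inner_def tscale_minus1)
qed

text \<open>The value that a torsion-free metric connection must give to the inner product of
  nabla_X Y with Z, by Koszul's formula.\<close>

definition koszul :: "'a vfield \<Rightarrow> 'a vfield \<Rightarrow> 'a vfield \<Rightarrow> 'a \<Rightarrow> real" where
  "koszul X Y Z q = (X q (vf_inner M Y Z) + Y q (vf_inner M X Z) - Z q (vf_inner M X Y)
     + vf_inner M (lie_bracket X Y) Z q - vf_inner M (lie_bracket X Z) Y q
     - vf_inner M (lie_bracket Y Z) X q) / 2"

lemma koszul_smooth:
  assumes "X \<in> vfields M" "Y \<in> vfields M" "Z \<in> vfields M"
  shows "koszul X Y Z \<in> smooth_funs M"
proof -
  have "(\<lambda>q. (1/2) * (X q (vf_inner M Y Z) + Y q (vf_inner M X Z) - Z q (vf_inner M X Y)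
     + vf_inner M (lie_bracket X Y) Z q - vf_inner M (lie_bracket X Z) Y q
     - vf_inner M (lie_bracket Y Z) X q)) \<in> smooth_funs M"
    by (intro smooth_funs_cmult smooth_funs_diff smooth_funs_add vf_inner_smooth
        vfields_smooth[OF assms(1) vf_inner_smooth[OF assms(2,3)]]
        vfields_smooth[OF assms(2) vf_inner_smooth[OF assms(1,3)]]
        vfields_smooth[OF assms(3) vf_inner_smooth[OF assms(1,2)]] lie_bracket_vfields assms)
  then show ?thesis by (simp add: koszul_def[abs_def])
qed

text \<open>Tensoriality in the last argument: the derivatives of \<open>f\<close> in the first two
  terms cancel against those in the brackets with \<open>vf_scale f Z\<close>. This permits an
  expansion of \<open>Z\<close> in a frame with functions as coefficients.\<close>

lemma koszul_scale_right:
  assumes X: "X \<in> vfields M" and Y: "Y \<in> vfields M" and Z: "Z \<in> vfields M" and f: "f \<in> smooth_funs M"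
  shows "koszul X Y (vf_scale f Z) q = f q * koszul X Y Z q"
proof -
  note fZ = vf_scale_vfields[OF f Z]
  note XZ = lie_bracket_vfields[OF X Z] and YZ = lie_bracket_vfields[OF Y Z]
    and XY = lie_bracket_vfields[OF X Y]
  have Xf: "vf_apply X f \<in> smooth_funs M" "vf_apply Y f \<in> smooth_funs M"
    using vfields_smooth[OF X f] vfields_smooth[OF Y f] by (simp_all add: vf_apply_def)
  have 1: "X q (vf_inner M Y (vf_scale f Z)) = f q * X q (vf_inner M Y Z) + vf_inner M Y Z q * X q f"
    unfolding vf_inner_scale_right[OF Y Z f] by (rule vf_apply_mult[OF X f vf_inner_smooth[OF Y Z]])
  have 2: "Y q (vf_inner M X (vf_scale f Z)) = f q * Y q (vf_inner M X Z) + vf_inner M X Z q * Y q f"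
    unfolding vf_inner_scale_right[OF X Z f] by (rule vf_apply_mult[OF Y f vf_inner_smooth[OF X Z]])
  have 3: "vf_scale f Z q (vf_inner M X Y) = f q * Z q (vf_inner M X Y)"
    by (simp add: vf_scale_def tscale_def)
  have 4: "vf_inner M (lie_bracket X (vf_scale f Z)) Y q =
      X q f * vf_inner M Z Y q + f q * vf_inner M (lie_bracket X Z) Y q"
    unfolding lie_bracket_scale_right[OF X Z f]
      vf_inner_add_left[OF vf_scale_vfields[OF Xf(1) Z] vf_scale_vfields[OF f XZ] Y]
      vf_inner_scale_left[OF Z Y] vf_inner_scale_left[OF XZ Y] by (simp add: vf_apply_def)
  have 5: "vf_inner M (lie_bracket Y (vf_scale f Z)) X q =
      Y q f * vf_inner M Z X q + f q * vf_inner M (lie_bracket Y Z) X q"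
    unfolding lie_bracket_scale_right[OF Y Z f]
      vf_inner_add_left[OF vf_scale_vfields[OF Xf(2) Z] vf_scale_vfields[OF f YZ] X]
      vf_inner_scale_left[OF Z X] vf_inner_scale_left[OF YZ X] by (simp add: vf_apply_def)
  have 6: "vf_inner M (lie_bracket X Y) (vf_scale f Z) q = f q * vf_inner M (lie_bracket X Y) Z q"
    unfolding vf_inner_scale_right[OF XY Z f] ..
  show ?thesis
    unfolding koszul_def 1 2 3 4 5 6
    by (simp add: vf_inner_sym[OF Z X] vf_inner_sym[OF Z Y] field_simps)
qed

lemma koszul_add_right:
  assumes X: "X \<in> vfields M" and Y: "Y \<in> vfields M" and Z: "Z \<in> vfields M" and W: "W \<in> vfields M"
  shows "koszul X Y (Z + W) q = koszul X Y Z q + koszul X Y W q"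
proof -
  note br = lie_bracket_vfields[OF X Y] lie_bracket_vfields[OF X Z] lie_bracket_vfields[OF X W]
    lie_bracket_vfields[OF Y Z] lie_bracket_vfields[OF Y W]
  have 1: "X q (vf_inner M Y (Z + W)) = X q (vf_inner M Y Z) + X q (vf_inner M Y W)"
    unfolding vf_inner_add_right[OF Z W Y]
    by (rule vf_apply_add[OF X vf_inner_smooth[OF Y Z] vf_inner_smooth[OF Y W]])
  have 2: "Y q (vf_inner M X (Z + W)) = Y q (vf_inner M X Z) + Y q (vf_inner M X W)"
    unfolding vf_inner_add_right[OF Z W X]
    by (rule vf_apply_add[OF Y vf_inner_smooth[OF X Z] vf_inner_smooth[OF X W]])
  show ?thesis
    unfolding koszul_def 1 2 lie_bracket_add_right[OF X Z W] lie_bracket_add_right[OF Y Z W]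
      vf_inner_add_left[OF br(2,3) Y] vf_inner_add_left[OF br(4,5) X] vf_inner_add_right[OF Z W br(1)]
    by (simp add: field_simps)
qed

lemma koszul_sum_right:
  assumes X: "X \<in> vfields M" and Y: "Y \<in> vfields M" and "finite A" and "\<And>a. a \<in> A \<Longrightarrow> Z a \<in> vfields M"
  shows "koszul X Y (\<Sum>a\<in>A. Z a) q = (\<Sum>a\<in>A. koszul X Y (Z a) q)"
  using assms(3,4)
proof (induction A)
  case empty
  have "koszul X Y (0 + 0) q = koszul X Y 0 q + koszul X Y 0 q"
    by (rule koszul_add_right[OF X Y vfields_0 vfields_0])
  then have "koszul X Y 0 q = 0" by (simp only: add_0_left)
  then show ?case by (simp only: sum.empty)
next
  case (insert a A)
  have "koszul X Y (Z a + (\<Sum>a\<in>A. Z a)) q = koszul X Y (Z a) q + koszul X Y (\<Sum>a\<in>A. Z a) q"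
    by (rule koszul_add_right[OF X Y]) (use insert.prems in \<open>blast intro: vfields_sum\<close>)+
  moreover have "koszul X Y (\<Sum>a\<in>A. Z a) q = (\<Sum>a\<in>A. koszul X Y (Z a) q)"
    using insert by blast
  ultimately show ?case by (simp only: sum.insert[OF insert.hyps])
qed

text \<open>The uniqueness half of the fundamental theorem: torsion-freeness replaces the brackets,
  compatibility replaces the derivatives of the metric, and all but one covariant derivative
  cancel.\<close>

lemma koszul_levi_civita:
  assumes D: "is_levi_civita M D" and X: "X \<in> vfields M" and Y: "Y \<in> vfields M" and Z: "Z \<in> vfields M"
  shows "vf_inner M (D X Y) Z q = koszul X Y Z q"
proof -
  have c: "D A B \<in> vfields M" if "A \<in> vfields M" "B \<in> vfields M" for A B
    using bspec[OF bspec[OF D[unfolded is_levi_civita_def] that(1)] that(2)] by (elim conjE)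
  have t: "lie_bracket A B = D A B - D B A" if "A \<in> vfields M" "B \<in> vfields M" for A B
    using bspec[OF bspec[OF D[unfolded is_levi_civita_def] that(1)] that(2)] by (elim conjE) simp
  have m: "A q (vf_inner M B C) = vf_inner M (D A B) C q + vf_inner M B (D A C) q"
    if "A \<in> vfields M" "B \<in> vfields M" "C \<in> vfields M" for A B C
  proof -
    have "vf_apply A (vf_inner M B C) = vf_inner M (D A B) C + vf_inner M B (D A C)"
      using bspec[OF bspec[OF D[unfolded is_levi_civita_def] that(1)] that(2)] that(3) by (elim conjE) (drule (1) bspec, elim conjE)
    then show ?thesis by (simp add: vf_apply_def fun_eq_iff)
  qed
  have i: "vf_inner M (A - B) C q = vf_inner M A C q - vf_inner M B C q"
    if "A \<in> vfields M" "B \<in> vfields M" "C \<in> vfields M" for A B C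
    using metric_diff_left[OF _ vfields_tangent[OF that(1)] vfields_tangent[OF that(2)]
        vfields_tangent[OF that(3)], of q] by (cases "q \<in> points M") (simp_all add: vf_inner_def)
  show ?thesis
    unfolding koszul_def m[OF X Y Z] m[OF Y X Z] m[OF Z X Y] t[OF X Y] t[OF X Z] t[OF Y Z]
      i[OF c[OF X Y] c[OF Y X] Z] i[OF c[OF X Z] c[OF Z X] Y] i[OF c[OF Y Z] c[OF Z Y] X]
    by (simp add: vf_inner_sym[OF Y c[OF X Z]] vf_inner_sym[OF X c[OF Y Z]] vf_inner_sym[OF X c[OF Z Y]])
qed

lemma vfields_eqI:
  assumes X: "X \<in> vfields M" and Y: "Y \<in> vfields M"
    and "\<And>Z q. Z \<in> vfields M \<Longrightarrow> vf_inner M X Z q = vf_inner M Y Z q"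
  shows "X = Y"
proof
  fix q
  show "X q = Y q"
  proof (cases "q \<in> points M")
    case True
    show ?thesis
    proof (rule ccontr)
      assume ne: "X q \<noteq> Y q"
      note t = vfields_tangent[OF X True] vfields_tangent[OF Y True]
      have "metric M q (X q - Y q) (X q - Y q) > 0"
        by (rule metric_pos[OF True tangent_space_diff[OF t] tangent_space_diff[OF t]]) (use ne in simp)
      moreover have "metric M q (X q) ((X - Y) q) = metric M q (Y q) ((X - Y) q)"
        using assms(3)[OF vfields_diff[OF X Y], of q] True by (simp add: vf_inner_def)
      ultimately show False
        using metric_diff_left[OF True t tangent_space_diff[OF t]] by simp
    qed
  next
    case False
    then show ?thesis using vfields_outside[OF X] vfields_outside[OF Y] by simp
  qed
qed

text \<open>A finite family of vector fields which is, at every point, a tight frame makes the Koszul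
  formula solvable: it dualises the linear form given by the right-hand side.\<close>

lemma levi_civita_exists:
  assumes A: "finite A" and xi: "\<And>a. a \<in> A \<Longrightarrow> \<xi> a \<in> vfields M"
    and frame: "\<And>q Z. q \<in> points M \<Longrightarrow> Z \<in> tangent_space M q \<Longrightarrow>
      Z = (\<Sum>a\<in>A. tscale (c * metric M q Z (\<xi> a q)) (\<xi> a q))"
  shows "\<exists>D. is_levi_civita M D"
proof -
  \<comment> \<open>The frame expansion of a field whose inner product with each
    \<open>\<xi> a\<close> would be \<open>koszul X Y (\<xi> a)\<close>.\<close>
  define D where "D X Y = (\<Sum>a\<in>A. vf_scale (\<lambda>q. c * koszul X Y (\<xi> a) q) (\<xi> a))" for X Y
  have fs: "(\<lambda>q. c * koszul X Y (\<xi> a) q) \<in> smooth_funs M"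
    if "X \<in> vfields M" "Y \<in> vfields M" "a \<in> A" for X Y a
    by (intro smooth_funs_cmult koszul_smooth that xi)
  have Dv: "D X Y \<in> vfields M" if "X \<in> vfields M" "Y \<in> vfields M" for X Y
    unfolding D_def by (intro vfields_sum vf_scale_vfields fs that xi)
  have ins: "vf_inner M (\<Sum>a\<in>A. vf_scale (g a) (\<xi> a)) Z q = (\<Sum>a\<in>A. g a q * vf_inner M (\<xi> a) Z q)"
    if "Z \<in> vfields M" "\<And>a. a \<in> A \<Longrightarrow> g a \<in> smooth_funs M" for g Z q
  proof (cases "q \<in> points M")
    case True
    have "metric M q (\<Sum>a\<in>A. vf_scale (g a) (\<xi> a) q) (Z q) = (\<Sum>a\<in>A. metric M q (vf_scale (g a) (\<xi> a) q) (Z q))"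
      by (rule metric_sum_left[OF True vfields_tangent[OF that(1) True]])
        (use xi that(2) True in \<open>auto intro!: vfields_tangent vf_scale_vfields\<close>)
    also have "\<dots> = (\<Sum>a\<in>A. g a q * metric M q (\<xi> a q) (Z q))"
      using metric_scale_left[OF True vfields_tangent[OF xi True] vfields_tangent[OF that(1) True]]
      by (intro sum.cong) (simp_all add: vf_scale_def)
    finally show ?thesis using True by (simp add: vf_inner_def sum_fun_apply)
  qed (simp add: vf_inner_def)
  have exp: "Z = (\<Sum>a\<in>A. vf_scale (\<lambda>q. c * vf_inner M Z (\<xi> a) q) (\<xi> a))" if Z: "Z \<in> vfields M" for Z
  proof
    fix q
    show "Z q = (\<Sum>a\<in>A. vf_scale (\<lambda>q. c * vf_inner M Z (\<xi> a) q) (\<xi> a)) q"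
    proof (cases "q \<in> points M")
      case True
      have "Z q = (\<Sum>a\<in>A. tscale (c * metric M q (Z q) (\<xi> a q)) (\<xi> a q))"
        by (rule frame[OF True vfields_tangent[OF Z True]])
      also have "\<dots> = (\<Sum>a\<in>A. vf_scale (\<lambda>q. c * vf_inner M Z (\<xi> a) q) (\<xi> a) q)"
        using True by (simp add: vf_scale_def vf_inner_def)
      finally show ?thesis by (simp only: sum_fun_apply)
    next
      case False
      have "\<xi> a q = 0" if "a \<in> A" for a by (rule vfields_outside[OF xi[OF that] False])
      then show ?thesis
        using vfields_outside[OF Z False] by (simp add: sum_fun_apply vf_scale_def)
    qed
  qed
  \<comment> \<open>The frame is in general not independent, so this is not immediate for
    \<open>Z = \<xi> a\<close> either; expanding \<open>Z\<close> in the frame and using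
    tensoriality gives it for all \<open>Z\<close>. Every axiom below then reduces to an identity
    between Koszul expressions.\<close>
  have DK: "vf_inner M (D X Y) Z q = koszul X Y Z q"
    if X: "X \<in> vfields M" and Y: "Y \<in> vfields M" and Z: "Z \<in> vfields M" for X Y Z q
  proof -
    have fz: "(\<lambda>q. c * vf_inner M Z (\<xi> a) q) \<in> smooth_funs M" if "a \<in> A" for a
      by (intro smooth_funs_cmult vf_inner_smooth Z xi that)
    have "koszul X Y Z q = koszul X Y (\<Sum>a\<in>A. vf_scale (\<lambda>q. c * vf_inner M Z (\<xi> a) q) (\<xi> a)) q"
      using arg_cong[OF exp[OF Z]] by (rule fun_cong)
    also have "\<dots> = (\<Sum>a\<in>A. koszul X Y (vf_scale (\<lambda>q. c * vf_inner M Z (\<xi> a) q) (\<xi> a)) q)"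
      by (rule koszul_sum_right[OF X Y A]) (intro vf_scale_vfields fz xi)
    also have "\<dots> = (\<Sum>a\<in>A. c * vf_inner M Z (\<xi> a) q * koszul X Y (\<xi> a) q)"
      by (intro sum.cong refl koszul_scale_right[OF X Y] xi fz)
    also have "\<dots> = (\<Sum>a\<in>A. (c * koszul X Y (\<xi> a) q) * vf_inner M (\<xi> a) Z q)"
      by (intro sum.cong refl) (simp add: vf_inner_sym[OF Z xi])
    also have "\<dots> = vf_inner M (D X Y) Z q"
      unfolding D_def by (rule ins[OF Z fs[OF X Y], symmetric])
    finally show ?thesis by simp
  qed
  have inadd: "vf_inner M (A + B) C q = vf_inner M A C q + vf_inner M B C q"
    if "A \<in> vfields M" "B \<in> vfields M" "C \<in> vfields M" for A B C q
    by (simp add: vf_inner_add_left[OF that])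
  have indiff: "vf_inner M (A - B) C q = vf_inner M A C q - vf_inner M B C q"
    if "A \<in> vfields M" "B \<in> vfields M" "C \<in> vfields M" for A B C q
    using inadd[OF vfields_diff[OF that(1,2)] that(2,3)] by simp
  have "is_levi_civita M D"
    unfolding is_levi_civita_def
  proof (intro ballI conjI)
    fix X Y assume X: "X \<in> vfields M" and Y: "Y \<in> vfields M"
    note br = lie_bracket_vfields
    show "D X Y \<in> vfields M" by (rule Dv[OF X Y])
    show "D X Y - D Y X = lie_bracket X Y"
    proof (rule vfields_eqI[OF vfields_diff[OF Dv[OF X Y] Dv[OF Y X]] br[OF X Y]])
      fix Z q assume Z: "Z \<in> vfields M"
      show "vf_inner M (D X Y - D Y X) Z q = vf_inner M (lie_bracket X Y) Z q"
        unfolding indiff[OF Dv[OF X Y] Dv[OF Y X] Z] DK[OF X Y Z] DK[OF Y X Z] koszul_def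
          lie_bracket_antisym[of Y X] vf_inner_uminus_left[OF br[OF X Y] Z]
        by (simp add: vf_inner_sym[OF Y X] field_simps)
    qed
    fix f assume f: "f \<in> smooth_funs M"
    note fX = vf_scale_vfields[OF f X] and fY = vf_scale_vfields[OF f Y]
    have Xf: "vf_apply A f \<in> smooth_funs M" if "A \<in> vfields M" for A
      using vfields_smooth[OF that f] by (simp add: vf_apply_def)
    have brs: "vf_inner M (lie_bracket B C) P q = - vf_inner M (lie_bracket C B) P q"
      if "B \<in> vfields M" "C \<in> vfields M" "P \<in> vfields M" for B C P q
      unfolding lie_bracket_antisym[of B C] vf_inner_uminus_left[OF br[OF that(2,1)] that(3)] by simp
    have b_r: "vf_inner M (lie_bracket B (vf_scale f A)) C q =
        f q * vf_inner M (lie_bracket B A) C q + B q f * vf_inner M A C q"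
      if "A \<in> vfields M" "B \<in> vfields M" "C \<in> vfields M" for A B C q
      unfolding lie_bracket_scale_right[OF that(2,1) f]
        inadd[OF vf_scale_vfields[OF Xf[OF that(2)] that(1)] vf_scale_vfields[OF f br[OF that(2,1)]] that(3)]
        vf_inner_scale_left[OF that(1,3)] vf_inner_scale_left[OF br[OF that(2,1)] that(3)]
      by (simp add: vf_apply_def)
    have bl: "vf_inner M (lie_bracket (vf_scale f A) B) C q =
        f q * vf_inner M (lie_bracket A B) C q - B q f * vf_inner M A C q"
      if "A \<in> vfields M" "B \<in> vfields M" "C \<in> vfields M" for A B C q
      using b_r[OF that] brs[OF vf_scale_vfields[OF f that(1)] that(2,3)] brs[OF that] by simp
    have ap: "A q (\<lambda>q. f q * vf_inner M B C q) = f q * A q (vf_inner M B C) + vf_inner M B C q * A q f"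
      if "A \<in> vfields M" "B \<in> vfields M" "C \<in> vfields M" for A B C q
      by (rule vf_apply_mult[OF that(1) f vf_inner_smooth[OF that(2,3)]])
    show "D (vf_scale f X) Y = vf_scale f (D X Y)"
    proof (rule vfields_eqI[OF Dv[OF fX Y] vf_scale_vfields[OF f Dv[OF X Y]]])
      fix Z q assume Z: "Z \<in> vfields M"
      show "vf_inner M (D (vf_scale f X) Y) Z q = vf_inner M (vf_scale f (D X Y)) Z q"
        unfolding DK[OF fX Y Z] vf_inner_scale_left[OF Dv[OF X Y] Z] DK[OF X Y Z] koszul_def
          bl[OF X Y Z] bl[OF X Z Y] vf_inner_scale_left[OF X Z] vf_inner_scale_left[OF X Y]
          ap[OF Y X Z] ap[OF Z X Y] vf_inner_scale_right[OF br[OF Y Z] X f]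
        by (simp add: vf_scale_def tscale_def vf_inner_sym[OF Y X] field_simps)
    qed
    show "D X (vf_scale f Y) = vf_scale (vf_apply X f) Y + vf_scale f (D X Y)"
    proof (rule vfields_eqI[OF Dv[OF X fY] vfields_add[OF vf_scale_vfields[OF Xf[OF X] Y]
            vf_scale_vfields[OF f Dv[OF X Y]]]])
      fix Z q assume Z: "Z \<in> vfields M"
      show "vf_inner M (D X (vf_scale f Y)) Z q =
          vf_inner M (vf_scale (vf_apply X f) Y + vf_scale f (D X Y)) Z q"
        unfolding DK[OF X fY Z] inadd[OF vf_scale_vfields[OF Xf[OF X] Y] vf_scale_vfields[OF f Dv[OF X Y]] Z]
          vf_inner_scale_left[OF Dv[OF X Y] Z] DK[OF X Y Z] koszul_def
          bl[OF Y Z X] b_r[OF Y X Z] vf_inner_scale_left[OF Y Z] vf_inner_scale_right[OF X Y f]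
          ap[OF X Y Z] ap[OF Z X Y] vf_inner_scale_right[OF br[OF X Z] Y f]
        by (simp add: vf_scale_def tscale_def vf_apply_def vf_inner_sym[OF Y X] field_simps)
    qed
  next
    fix X Y Z assume X: "X \<in> vfields M" and Y: "Y \<in> vfields M" and Z: "Z \<in> vfields M"
    note br = lie_bracket_vfields
    have ap: "P q (\<lambda>q. vf_inner M A C q + vf_inner M B C q) = P q (vf_inner M A C) + P q (vf_inner M B C)"
      if "P \<in> vfields M" "A \<in> vfields M" "B \<in> vfields M" "C \<in> vfields M" for P A B C q
      by (rule vf_apply_add[OF that(1) vf_inner_smooth[OF that(2,4)] vf_inner_smooth[OF that(3,4)]])
    have ap': "P q (\<lambda>q. vf_inner M C A q + vf_inner M C B q) = P q (vf_inner M C A) + P q (vf_inner M C B)"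
      if "P \<in> vfields M" "A \<in> vfields M" "B \<in> vfields M" "C \<in> vfields M" for P A B C q
      by (rule vf_apply_add[OF that(1) vf_inner_smooth[OF that(4,2)] vf_inner_smooth[OF that(4,3)]])
    have lal: "lie_bracket (A + B) C = lie_bracket A C + lie_bracket B C"
      if "A \<in> vfields M" "B \<in> vfields M" "C \<in> vfields M" for A B C
      unfolding lie_bracket_antisym[of _ C] lie_bracket_add_right[OF that(3,1,2)] by simp
    show "D (X + Y) Z = D X Z + D Y Z"
    proof (rule vfields_eqI[OF Dv[OF vfields_add[OF X Y] Z] vfields_add[OF Dv[OF X Z] Dv[OF Y Z]]])
      fix W q assume W: "W \<in> vfields M"
      show "vf_inner M (D (X + Y) Z) W q = vf_inner M (D X Z + D Y Z) W q"
        unfolding DK[OF vfields_add[OF X Y] Z W] inadd[OF Dv[OF X Z] Dv[OF Y Z] W] DK[OF X Z W]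
          DK[OF Y Z W] koszul_def vf_inner_add_left[OF X Y W] vf_inner_add_left[OF X Y Z]
          ap[OF Z X Y W] ap[OF W X Y Z] lal[OF X Y Z] lal[OF X Y W]
          inadd[OF br[OF X Z] br[OF Y Z] W] inadd[OF br[OF X W] br[OF Y W] Z]
          vf_inner_add_right[OF X Y br[OF Z W]]
        by (simp add: field_simps)
    qed
    show "D X (Y + Z) = D X Y + D X Z"
    proof (rule vfields_eqI[OF Dv[OF X vfields_add[OF Y Z]] vfields_add[OF Dv[OF X Y] Dv[OF X Z]]])
      fix W q assume W: "W \<in> vfields M"
      show "vf_inner M (D X (Y + Z)) W q = vf_inner M (D X Y + D X Z) W q"
        unfolding DK[OF X vfields_add[OF Y Z] W] inadd[OF Dv[OF X Y] Dv[OF X Z] W] DK[OF X Y W]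
          DK[OF X Z W] koszul_def vf_inner_add_left[OF Y Z W] vf_inner_add_right[OF Y Z X]
          ap[OF X Y Z W] ap'[OF W Y Z X] lal[OF Y Z W] lie_bracket_add_right[OF X Y Z]
          inadd[OF br[OF X Y] br[OF X Z] W] inadd[OF br[OF Y W] br[OF Z W] X]
          vf_inner_add_right[OF Y Z br[OF X W]]
        by (simp add: field_simps)
    qed
    show "vf_apply X (vf_inner M Y Z) = vf_inner M (D X Y) Z + vf_inner M Y (D X Z)"
    proof
      fix q
      have a: "vf_inner M (lie_bracket B C) P q = - vf_inner M (lie_bracket C B) P q"
        if "B \<in> vfields M" "C \<in> vfields M" "P \<in> vfields M" for B C P
        unfolding lie_bracket_antisym[of B C] vf_inner_uminus_left[OF br[OF that(2,1)] that(3)] by simp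
      show "vf_apply X (vf_inner M Y Z) q = (vf_inner M (D X Y) Z + vf_inner M Y (D X Z)) q"
        unfolding vf_inner_sym[OF Y Dv[OF X Z]] plus_fun_apply DK[OF X Y Z] DK[OF X Z Y] koszul_def
          a[OF Z Y X]
        by (simp add: vf_apply_def vf_inner_sym[OF Z Y] vf_inner_sym[OF Z X] vf_inner_sym[OF Y X] field_simps)
    qed
  qed
  then show ?thesis by blast
qed

text \<open>The choice operator in \<open>levi_civita\<close> disappears. As the field
  \<open>levi_civita M Y X\<close> may serve as a test field itself, its vanishing at
  \<open>q\<close> is detected by Koszul expressions, and these are built from data that isometries
  preserve.\<close>

lemma transvections_at_koszul:
  assumes "\<exists>D. is_levi_civita M D" and q: "q \<in> points M"
  shows "transvections_at M q =
    {X \<in> killing_fields M. \<forall>Y\<in>vfields M. \<forall>Z\<in>vfields M. koszul Y X Z q = 0}"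
proof -
  have D: "is_levi_civita M (levi_civita M)"
    unfolding levi_civita_def using assms(1) by (rule someI_ex)
  have Dv: "levi_civita M A B \<in> vfields M" if "A \<in> vfields M" "B \<in> vfields M" for A B
    using bspec[OF bspec[OF D[unfolded is_levi_civita_def] that(1)] that(2)] by (elim conjE)
  have "levi_civita M Y X q = 0 \<longleftrightarrow> (\<forall>Z\<in>vfields M. koszul Y X Z q = 0)"
    if X: "X \<in> vfields M" and Y: "Y \<in> vfields M" for X Y
  proof
    assume "levi_civita M Y X q = 0"
    then have "vf_inner M (levi_civita M Y X) Z q = 0" if "Z \<in> vfields M" for Z
      using q metric_zero_left[OF q vfields_tangent[OF that q]] by (simp only: vf_inner_def if_True)
    then show "\<forall>Z\<in>vfields M. koszul Y X Z q = 0" using koszul_levi_civita[OF D Y X] by simp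
  next
    assume "\<forall>Z\<in>vfields M. koszul Y X Z q = 0"
    then have "vf_inner M (levi_civita M Y X) (levi_civita M Y X) q = 0"
      using koszul_levi_civita[OF D Y X Dv[OF Y X]] Dv[OF Y X] by simp
    then have "metric M q (levi_civita M Y X q) (levi_civita M Y X q) = 0"
      using q by (simp add: vf_inner_def)
    then show "levi_civita M Y X q = 0"
      using metric_pos[OF q vfields_tangent[OF Dv[OF Y X] q] vfields_tangent[OF Dv[OF Y X] q]]
      by (cases "levi_civita M Y X q = 0") simp_all
  qed
  moreover have "X \<in> vfields M" if "X \<in> killing_fields M" for X
    using that by (simp add: killing_fields_def)
  ultimately show ?thesis unfolding transvections_at_def by blast
qed

end

section \<open>Naturality under isometries\<close>

context mfd
begin

definition pull :: "('a \<Rightarrow> 'a) \<Rightarrow> ('a \<Rightarrow> real) \<Rightarrow> 'a \<Rightarrow> real" where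
  "pull F f = (\<lambda>x. if x \<in> points M then f (F x) else 0)"

lemma smooth_map_pull:
  assumes F: "smooth_map M M F" and f: "f \<in> smooth_funs M"
  shows "pull F f \<in> smooth_funs M"
proof (rule smooth_funsI)
  show "pull F f x = 0" if "x \<notin> points M" for x using that by (simp add: pull_def)
  have cont: "continuous_map (mtop M) (mtop M) F"
    using F unfolding smooth_map_def by (rule conjunct1)
  have sm: "\<forall>(U, \<phi>)\<in>charts M. \<forall>(V, \<psi>)\<in>charts M. \<forall>i<n.
        smooth_on n (\<phi> ` {x\<in>U. F x \<in> V}) (\<lambda>x. \<psi> (F (inv_into U \<phi> x)) i)"
    using F unfolding smooth_map_def by (rule conjunct2)
  fix x assume x: "x \<in> points M"
  have Fx: "F x \<in> points M" using cont x by (auto simp: continuous_map_def)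
  obtain U \<phi> where U: "(U, \<phi>) \<in> charts M" "x \<in> U" using chart_cover[OF x] by blast
  obtain V \<psi> where V: "(V, \<psi>) \<in> charts M" "F x \<in> V" using chart_cover[OF Fx] by blast
  define B where "B = {y \<in> U. F y \<in> V}"
  have BU: "B \<subseteq> U" by (auto simp: B_def)
  have "B = U \<inter> {y \<in> points M. F y \<in> V}" using chart_subset[OF U(1)] by (auto simp: B_def)
  then have Bo: "openin (mtop M) B"
    using openin_continuous_map_preimage[OF cont chart_open[OF V(1)]] chart_open[OF U(1)] by auto
  have Bi: "openin (Euclidean_space n) (\<phi> ` B)" by (rule chart_image_openin[OF U(1) Bo BU])
  have iv: "inv_into U \<phi> y \<in> B" if y: "y \<in> \<phi> ` B" for y
  proof -
    obtain z where "z \<in> B" "y = \<phi> z" using y by blast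
    then show ?thesis using chart_inv[OF U(1), of z] BU by auto
  qed
  have "smooth_on n (\<phi> ` B)
    (\<lambda>y. (\<lambda>z. f (inv_into V \<psi> z)) (\<lambda>j. if j < n then \<psi> (F (inv_into U \<phi> y)) j else 0))"
  proof (rule smooth_on_compose[OF Bi chart_image_open[OF V(1)] smooth_funs_chart[OF f V(1)]])
    show "smooth_on n (\<phi> ` B) (\<lambda>y. \<psi> (F (inv_into U \<phi> y)) j)" if "j < n" for j
      using bspec[OF bspec[OF sm U(1), unfolded prod.case] V(1), unfolded prod.case] that
      unfolding B_def by simp
    show "(\<lambda>j. if j < n then \<psi> (F (inv_into U \<phi> y)) j else 0) \<in> \<psi> ` V" if "y \<in> \<phi> ` B" for y
      using iv[OF that] by (auto simp: B_def chart_eta[OF V(1)])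
  qed
  then have "smooth_on n (\<phi> ` B) (\<lambda>y. pull F f (inv_into U \<phi> y))"
  proof (rule smooth_on_cong[OF Bi, rotated])
    fix y assume "y \<in> \<phi> ` B"
    from iv[OF this] have "F (inv_into U \<phi> y) \<in> V" "inv_into U \<phi> y \<in> points M"
      using chart_subset[OF U(1)] by (auto simp: B_def)
    then show "f (inv_into V \<psi> (\<lambda>j. if j < n then \<psi> (F (inv_into U \<phi> y)) j else 0)) =
        pull F f (inv_into U \<phi> y)"
      by (simp add: chart_eta[OF V(1)] chart_inv[OF V(1)] pull_def)
  qed
  then show "\<exists>U \<phi> B. (U, \<phi>) \<in> charts M \<and> openin (mtop M) B \<and> x \<in> B \<and> B \<subseteq> U \<and>
      smooth_on n (\<phi> ` B) (\<lambda>y. pull F f (inv_into U \<phi> y))"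
    using U V Bo BU unfolding B_def by blast
qed

abbreviation dmap where "dmap F \<equiv> differential M M F"

lemma dmap_apply: "f \<in> smooth_funs M \<Longrightarrow> dmap F v f = v (pull F f)"
  by (simp add: differential_def pull_def)

lemma dmap_nonsmooth: "f \<notin> smooth_funs M \<Longrightarrow> dmap F v f = 0"
  by (simp add: differential_def)

lemma dmap_add: "dmap F (u + v) = dmap F u + dmap F v"
  by (intro ext) (simp add: differential_def)

lemma dmap_scale: "dmap F (tscale c v) = tscale c (dmap F v)"
  by (intro ext) (simp add: differential_def tscale_def)

end

text \<open>The inverse is carried along as a parameter, so that each statement can be reused for it
  after swapping the two maps.\<close>

locale diffeo_pair = mfd M for M :: "('a, 'z) mfd_scheme" +
  fixes \<Phi> \<Psi> :: "'a \<Rightarrow> 'a"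
  assumes maps: "x \<in> points M \<Longrightarrow> \<Phi> x \<in> points M" "x \<in> points M \<Longrightarrow> \<Psi> x \<in> points M"
    and inverse: "x \<in> points M \<Longrightarrow> \<Psi> (\<Phi> x) = x" "x \<in> points M \<Longrightarrow> \<Phi> (\<Psi> x) = x"
    and smooth: "smooth_map M M \<Phi>" "smooth_map M M \<Psi>"
begin

lemma pull_pull: "f \<in> smooth_funs M \<Longrightarrow> pull \<Phi> (pull \<Psi> f) = f" "f \<in> smooth_funs M \<Longrightarrow> pull \<Psi> (pull \<Phi> f) = f"
  using maps inverse smooth_funs_outside by (auto simp: pull_def fun_eq_iff)

lemmas pull_smooth = smooth_map_pull[OF smooth(1)] smooth_map_pull[OF smooth(2)]

lemma dmap_dmap: "v \<in> tangent_space M q \<Longrightarrow> dmap \<Psi> (dmap \<Phi> v) = v"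
proof
  fix f assume v: "v \<in> tangent_space M q"
  show "dmap \<Psi> (dmap \<Phi> v) f = v f"
    by (cases "f \<in> smooth_funs M")
      (simp_all add: dmap_apply dmap_nonsmooth pull_smooth pull_pull tangent_nonsmooth[OF v])
qed

lemma dmap_tangent:
  assumes q: "q \<in> points M" and v: "v \<in> tangent_space M q"
  shows "dmap \<Phi> v \<in> tangent_space M (\<Phi> q)"
proof (rule tangent_spaceI)
  fix f g assume f: "f \<in> smooth_funs M" and g: "g \<in> smooth_funs M"
  note p = pull_smooth(1)[OF f] pull_smooth(1)[OF g]
  have 1: "pull \<Phi> (\<lambda>x. f x + g x) = (\<lambda>x. pull \<Phi> f x + pull \<Phi> g x)"
    and 2: "pull \<Phi> (\<lambda>x. f x * g x) = (\<lambda>x. pull \<Phi> f x * pull \<Phi> g x)"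
    by (auto simp: pull_def)
  show "dmap \<Phi> v (\<lambda>x. f x + g x) = dmap \<Phi> v f + dmap \<Phi> v g"
    unfolding dmap_apply[OF f] dmap_apply[OF g] dmap_apply[OF smooth_funs_add[OF f g]] 1
    by (rule tangent_add[OF v p])
  show "dmap \<Phi> v (\<lambda>x. f x * g x) = f (\<Phi> q) * dmap \<Phi> v g + g (\<Phi> q) * dmap \<Phi> v f"
    unfolding dmap_apply[OF f] dmap_apply[OF g] dmap_apply[OF smooth_funs_mult[OF f g]] 2
    using tangent_mult[OF v p] q by (simp add: pull_def)
next
  fix c f assume f: "f \<in> smooth_funs M"
  have 1: "pull \<Phi> (\<lambda>x. c * f x) = (\<lambda>x. c * pull \<Phi> f x)" by (auto simp: pull_def)
  show "dmap \<Phi> v (\<lambda>x. c * f x) = c * dmap \<Phi> v f"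
    unfolding dmap_apply[OF f] dmap_apply[OF smooth_funs_cmult[OF f]] 1
    by (rule tangent_cmult[OF v pull_smooth(1)[OF f]])
qed (rule dmap_nonsmooth)

lemma diffeo_pair_swap: "diffeo_pair M \<Psi> \<Phi>"
  by unfold_locales (simp_all add: maps inverse smooth)

definition push :: "'a vfield \<Rightarrow> 'a vfield" where
  "push X q = (if q \<in> points M then dmap \<Phi> (X (\<Psi> q)) else 0)"

lemma push_apply: "f \<in> smooth_funs M \<Longrightarrow> (\<lambda>q. push X q f) = pull \<Psi> (\<lambda>q. X q (pull \<Phi> f))"
  by (auto simp: push_def pull_def[of \<Psi>] dmap_apply)

lemma push_vfields:
  assumes X: "X \<in> vfields M"
  shows "push X \<in> vfields M"
proof (rule vfieldsI)
  show "push X q \<in> tangent_space M q" if q: "q \<in> points M" for q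
    using dmap_tangent[OF maps(2)[OF q] vfields_tangent[OF X maps(2)[OF q]]] q inverse(2)[OF q]
    by (simp add: push_def)
  show "push X q = 0" if "q \<notin> points M" for q using that by (simp add: push_def)
  show "(\<lambda>q. push X q f) \<in> smooth_funs M" if f: "f \<in> smooth_funs M" for f
    unfolding push_apply[OF f] by (rule pull_smooth(2)[OF vfields_smooth[OF X pull_smooth(1)[OF f]]])
qed

lemma push_at: "q \<in> points M \<Longrightarrow> push X (\<Phi> q) = dmap \<Phi> (X q)"
  by (simp add: push_def maps inverse)

lemma push_bracket:
  assumes X: "X \<in> vfields M" and Y: "Y \<in> vfields M"
  shows "lie_bracket (push X) (push Y) = push (lie_bracket X Y)"
proof (intro ext)
  fix q f
  note PX = push_vfields[OF X] and PY = push_vfields[OF Y]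
  show "lie_bracket (push X) (push Y) q f = push (lie_bracket X Y) q f"
  proof (cases "f \<in> smooth_funs M")
    case f: True
    have *: "push Z q (vf_apply (push W) f) = (if q \<in> points M then Z (\<Psi> q) (\<lambda>q. W q (pull \<Phi> f)) else 0)"
      if Z: "Z \<in> vfields M" and W: "W \<in> vfields M" for Z W
    proof -
      have s: "(\<lambda>q. W q (pull \<Phi> f)) \<in> smooth_funs M" by (rule vfields_smooth[OF W pull_smooth(1)[OF f]])
      have "vf_apply (push W) f = pull \<Psi> (\<lambda>q. W q (pull \<Phi> f))"
        unfolding vf_apply_def by (rule push_apply[OF f])
      then show ?thesis
        using pull_pull(1)[OF s] by (simp add: push_def dmap_apply[OF pull_smooth(2)[OF s]])
    qed
    have "lie_bracket (push X) (push Y) q f =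
        (if q \<in> points M then lie_bracket X Y (\<Psi> q) (pull \<Phi> f) else 0)"
      unfolding lie_bracket_def *[OF X Y] *[OF Y X] by (simp add: vf_apply_def)
    then show ?thesis by (simp add: push_def dmap_apply[OF f])
  next
    case False
    then show ?thesis
      using vfields_nonsmooth[OF lie_bracket_vfields[OF PX PY] False]
        vfields_nonsmooth[OF push_vfields[OF lie_bracket_vfields[OF X Y]] False] by simp
  qed
qed

lemma push_push_inv:
  assumes X: "X \<in> vfields M"
  shows "push (diffeo_pair.push M \<Psi> \<Phi> X) = X"
proof
  interpret inv: diffeo_pair M \<Psi> \<Phi> by (rule diffeo_pair_swap)
  fix q
  show "push (inv.push X) q = X q"
  proof (cases "q \<in> points M")
    case True
    then show ?thesis
      using inv.dmap_dmap[OF vfields_tangent[OF X True]]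
      by (simp add: push_def inv.push_def maps inverse)
  next
    case False
    then show ?thesis using vfields_outside[OF X] by (simp add: push_def)
  qed
qed

text \<open>Every vector field is the push-forward of another one, so a quantifier over test fields
  may be restricted to pushed fields. In this way the Killing and the transvection conditions are
  transported.\<close>

lemma ball_push: "(\<forall>X\<in>vfields M. P (push X)) \<longleftrightarrow> (\<forall>X\<in>vfields M. P X)"
proof
  interpret inv: diffeo_pair M \<Psi> \<Phi> by (rule diffeo_pair_swap)
  assume *: "\<forall>X\<in>vfields M. P (push X)"
  show "\<forall>X\<in>vfields M. P X"
  proof
    fix X assume X: "X \<in> vfields M"
    show "P X" using bspec[OF * inv.push_vfields[OF X]] unfolding push_push_inv[OF X] .
  qed
next
  assume *: "\<forall>X\<in>vfields M. P X"
  show "\<forall>X\<in>vfields M. P (push X)"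
    using bspec[OF * push_vfields] by (rule ballI)
qed

end

locale isometry_pair = riem M + diffeo_pair M \<Phi> \<Psi> for M :: "'a rmfd" and \<Phi> \<Psi> +
  assumes metric_preserved: "q \<in> points M \<Longrightarrow> u \<in> tangent_space M q \<Longrightarrow> v \<in> tangent_space M q \<Longrightarrow>
    metric M (\<Phi> q) (differential M M \<Phi> u) (differential M M \<Phi> v) = metric M q u v"
begin

lemma isometry_pair_swap: "isometry_pair M \<Psi> \<Phi>"
proof -
  interpret inv: diffeo_pair M \<Psi> \<Phi> by (rule diffeo_pair_swap)
  show ?thesis
  proof
    fix q u v assume q: "q \<in> points M" and u: "u \<in> tangent_space M q" and v: "v \<in> tangent_space M q"
    show "metric M (\<Psi> q) (dmap \<Psi> u) (dmap \<Psi> v) = metric M q u v"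
      using metric_preserved[OF maps(2)[OF q] inv.dmap_tangent[OF q u] inv.dmap_tangent[OF q v]]
        inv.dmap_dmap[OF u] inv.dmap_dmap[OF v] inverse(2)[OF q] by simp
  qed
qed

lemma push_inner:
  assumes X: "X \<in> vfields M" and Y: "Y \<in> vfields M"
  shows "vf_inner M (push X) (push Y) = pull \<Psi> (vf_inner M X Y)"
proof
  fix q
  show "vf_inner M (push X) (push Y) q = pull \<Psi> (vf_inner M X Y) q"
    using metric_preserved[OF maps(2) vfields_tangent[OF X maps(2)] vfields_tangent[OF Y maps(2)], of q]
      maps(2)[of q] inverse(2)[of q]
    by (simp add: vf_inner_def push_def pull_def)
qed

lemma push_derive_inner:
  assumes X: "X \<in> vfields M" and Y: "Y \<in> vfields M" and Z: "Z \<in> vfields M"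
  shows "vf_apply (push X) (vf_inner M (push Y) (push Z)) = pull \<Psi> (vf_apply X (vf_inner M Y Z))"
  unfolding push_inner[OF Y Z] vf_apply_def push_apply[OF pull_smooth(2)[OF vf_inner_smooth[OF Y Z]]]
    pull_pull(1)[OF vf_inner_smooth[OF Y Z]] ..

lemma koszul_push:
  assumes X: "X \<in> vfields M" and Y: "Y \<in> vfields M" and Z: "Z \<in> vfields M" and q: "q \<in> points M"
  shows "koszul (push X) (push Y) (push Z) (\<Phi> q) = koszul X Y Z q"
proof -
  have d: "push A (\<Phi> q) (vf_inner M (push B) (push C)) = A q (vf_inner M B C)"
    if "A \<in> vfields M" "B \<in> vfields M" "C \<in> vfields M" for A B C
    using fun_cong[OF push_derive_inner[OF that], of "\<Phi> q"] q
    by (simp add: vf_apply_def pull_def maps inverse)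
  have i: "vf_inner M (push A) (push B) (\<Phi> q) = vf_inner M A B q"
    if "A \<in> vfields M" "B \<in> vfields M" for A B
    using q by (simp add: push_inner[OF that] pull_def maps inverse)
  show ?thesis
    unfolding koszul_def d[OF X Y Z] d[OF Y X Z] d[OF Z X Y] push_bracket[OF X Y] push_bracket[OF X Z]
      push_bracket[OF Y Z] i[OF lie_bracket_vfields[OF X Y] Z] i[OF lie_bracket_vfields[OF X Z] Y]
      i[OF lie_bracket_vfields[OF Y Z] X] ..
qed

lemma killing_push:
  assumes K: "X \<in> killing_fields M"
  shows "push X \<in> killing_fields M"
proof -
  have X: "X \<in> vfields M" using K by (simp add: killing_fields_def)
  have "\<forall>Y\<in>vfields M. \<forall>Z\<in>vfields M. vf_apply (push X) (vf_inner M (push Y) (push Z)) =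
    vf_inner M (lie_bracket (push X) (push Y)) (push Z) + vf_inner M (push Y) (lie_bracket (push X) (push Z))"
  proof (intro ballI)
    fix Y Z assume Y: "Y \<in> vfields M" and Z: "Z \<in> vfields M"
    have "vf_apply X (vf_inner M Y Z) = vf_inner M (lie_bracket X Y) Z + vf_inner M Y (lie_bracket X Z)"
      using K Y Z by (simp add: killing_fields_def)
    then show "vf_apply (push X) (vf_inner M (push Y) (push Z)) =
      vf_inner M (lie_bracket (push X) (push Y)) (push Z) + vf_inner M (push Y) (lie_bracket (push X) (push Z))"
      unfolding push_derive_inner[OF X Y Z] push_bracket[OF X Y] push_bracket[OF X Z]
        push_inner[OF lie_bracket_vfields[OF X Y] Z] push_inner[OF Y lie_bracket_vfields[OF X Z]]
      by (auto simp: pull_def fun_eq_iff)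
  qed
  then have "\<forall>Y\<in>vfields M. \<forall>Z\<in>vfields M. vf_apply (push X) (vf_inner M (push Y) Z) =
    vf_inner M (lie_bracket (push X) (push Y)) Z + vf_inner M (push Y) (lie_bracket (push X) Z)"
    unfolding ball_push[of "\<lambda>Z. vf_apply (push X) (vf_inner M (push Y) Z) =
      vf_inner M (lie_bracket (push X) (push Y)) Z + vf_inner M (push Y) (lie_bracket (push X) Z)" for Y] .
  then have "\<forall>Y\<in>vfields M. \<forall>Z\<in>vfields M. vf_apply (push X) (vf_inner M Y Z) =
    vf_inner M (lie_bracket (push X) Y) Z + vf_inner M Y (lie_bracket (push X) Z)"
    unfolding ball_push[of "\<lambda>Y. \<forall>Z\<in>vfields M. vf_apply (push X) (vf_inner M Y Z) =
      vf_inner M (lie_bracket (push X) Y) Z + vf_inner M Y (lie_bracket (push X) Z)"] .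
  then show ?thesis using push_vfields[OF X] by (simp add: killing_fields_def)
qed

lemma transvections_push:
  assumes lc: "\<exists>D. is_levi_civita M D" and q: "q \<in> points M" and X: "X \<in> transvections_at M q"
  shows "push X \<in> transvections_at M (\<Phi> q)"
proof -
  have K: "X \<in> killing_fields M" and *: "\<forall>Y\<in>vfields M. \<forall>Z\<in>vfields M. koszul Y X Z q = 0"
    using X unfolding transvections_at_koszul[OF lc q] by blast+
  have Xv: "X \<in> vfields M" using K by (simp add: killing_fields_def)
  have "\<forall>Y\<in>vfields M. \<forall>Z\<in>vfields M. koszul (push Y) (push X) (push Z) (\<Phi> q) = 0"
    using * koszul_push[OF _ Xv _ q] by simp
  then have "\<forall>Y\<in>vfields M. \<forall>Z\<in>vfields M. koszul (push Y) (push X) Z (\<Phi> q) = 0"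
    unfolding ball_push[of "\<lambda>Z. koszul (push Y) (push X) Z (\<Phi> q) = 0" for Y] .
  then have "\<forall>Y\<in>vfields M. \<forall>Z\<in>vfields M. koszul Y (push X) Z (\<Phi> q) = 0"
    unfolding ball_push[of "\<lambda>Y. \<forall>Z\<in>vfields M. koszul Y (push X) Z (\<Phi> q) = 0"] .
  then show ?thesis using killing_push[OF K] unfolding transvections_at_koszul[OF lc maps(1)[OF q]] by blast
qed

lemma symmetry_subspace_image:
  assumes lc: "\<exists>D. is_levi_civita M D" and q: "q \<in> points M"
  shows "symmetry_subspace M (\<Phi> q) = dmap \<Phi> ` symmetry_subspace M q"
proof
  show "dmap \<Phi> ` symmetry_subspace M q \<subseteq> symmetry_subspace M (\<Phi> q)"
  proof
    fix v assume "v \<in> dmap \<Phi> ` symmetry_subspace M q"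
    then obtain X where X: "X \<in> transvections_at M q" "v = dmap \<Phi> (X q)" by (auto simp: symmetry_subspace_def)
    show "v \<in> symmetry_subspace M (\<Phi> q)"
      unfolding symmetry_subspace_def X(2) push_at[OF q, of X, symmetric]
      by (rule imageI[OF transvections_push[OF lc q X(1)]])
  qed
  interpret inv: isometry_pair M \<Psi> \<Phi> by (rule isometry_pair_swap)
  show "symmetry_subspace M (\<Phi> q) \<subseteq> dmap \<Phi> ` symmetry_subspace M q"
  proof
    fix v assume "v \<in> symmetry_subspace M (\<Phi> q)"
    then obtain X where X: "X \<in> transvections_at M (\<Phi> q)" "v = X (\<Phi> q)" unfolding symmetry_subspace_def by (rule imageE)
    have Xv: "X \<in> vfields M" using X(1) by (simp add: transvections_at_def killing_fields_def)
    have "inv.push X \<in> transvections_at M q"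
      using inv.transvections_push[OF lc maps(1)[OF q] X(1)] inverse(1)[OF q] by simp
    then have "inv.push X q \<in> symmetry_subspace M q" unfolding symmetry_subspace_def by (rule imageI)
    moreover have "v = dmap \<Phi> (inv.push X q)"
      using push_at[OF q, of "inv.push X"] push_push_inv[OF Xv] X(2) by simp
    ultimately show "v \<in> dmap \<Phi> ` symmetry_subspace M q" by blast
  qed
qed

end

lemma isometry_imp_isometry_pair:
  assumes M: "riemannian_manifold M" and iso: "isometry M M \<Phi>"
  shows "isometry_pair M \<Phi> (inv_into (points M) \<Phi>)"
proof -
  interpret riem M by unfold_locales (rule M)
  have bij: "bij_betw \<Phi> (points M) (points M)" and li: "local_isometry M M \<Phi>"
    and s: "smooth_map M M (inv_into (points M) \<Phi>)"
    using iso by (simp_all add: isometry_def)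
  show ?thesis
  proof unfold_locales
    show "\<Phi> x \<in> points M" if "x \<in> points M" for x using bij that by (auto simp: bij_betw_def)
    show "inv_into (points M) \<Phi> x \<in> points M" if "x \<in> points M" for x
      using bij that by (metis bij_betw_imp_surj_on inv_into_into)
    show "inv_into (points M) \<Phi> (\<Phi> x) = x" if "x \<in> points M" for x
      using bij that by (simp add: bij_betw_inv_into_left)
    show "\<Phi> (inv_into (points M) \<Phi> x) = x" if "x \<in> points M" for x
      using bij that by (simp add: bij_betw_inv_into_right)
  qed (use li s in \<open>simp_all add: local_isometry_def\<close>)
qed

text \<open>Multiplying a field by a number is \<open>vf_scale\<close> with a constant function, cut
  off outside \<open>points M\<close> to be smooth. Its derivative along any field vanishes, so the
  Leibniz terms in brackets and in the connection drop out.\<close>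

lemma subspace_symmetry_subspace:
  assumes M: "riemannian_manifold M" and lc: "\<exists>D. is_levi_civita M D" and q: "q \<in> points M"
  shows "tv.subspace (symmetry_subspace M q)" "symmetry_subspace M q \<subseteq> tangent_space M q"
proof -
  interpret riem M by unfold_locales (rule M)
  have D: "is_levi_civita M (levi_civita M)"
    unfolding levi_civita_def using lc by (rule someI_ex)
  show "symmetry_subspace M q \<subseteq> tangent_space M q"
    using vfields_tangent[OF _ q] by (auto simp: symmetry_subspace_def transvections_at_def killing_fields_def)
  have cs: "(\<lambda>q. if q \<in> points M then c else 0) \<in> smooth_funs M" for c by (rule smooth_funs_const)
  let ?D = "levi_civita M"
  have Dadd: "?D Y (A + B) = ?D Y A + ?D Y B" if "Y \<in> vfields M" "A \<in> vfields M" "B \<in> vfields M" for Y A B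
    using bspec[OF bspec[OF D[unfolded is_levi_civita_def] that(1)] that(2)] that(3)
    by (elim conjE) (drule (1) bspec, elim conjE)
  have Dsc: "?D Y (vf_scale f A) = vf_scale (vf_apply Y f) A + vf_scale f (?D Y A)"
    if "Y \<in> vfields M" "A \<in> vfields M" "f \<in> smooth_funs M" for Y A f
    using bspec[OF bspec[OF D[unfolded is_levi_civita_def] that(1)] that(2)] that(3)
    by (elim conjE) (drule (1) bspec, elim conjE)
  have kill_add: "A + B \<in> killing_fields M" if K: "A \<in> killing_fields M" "B \<in> killing_fields M" for A B
  proof -
    have v: "A \<in> vfields M" "B \<in> vfields M" using K by (simp_all add: killing_fields_def)
    show ?thesis unfolding killing_fields_def mem_Collect_eq
    proof (intro conjI ballI)
      fix Y Z assume Y: "Y \<in> vfields M" and Z: "Z \<in> vfields M"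
      have l: "lie_bracket (A + B) W = lie_bracket A W + lie_bracket B W" if "W \<in> vfields M" for W
        unfolding lie_bracket_antisym[of _ W] lie_bracket_add_right[OF that v] by simp
      have *: "vf_apply A (vf_inner M Y Z) = vf_inner M (lie_bracket A Y) Z + vf_inner M Y (lie_bracket A Z)"
        "vf_apply B (vf_inner M Y Z) = vf_inner M (lie_bracket B Y) Z + vf_inner M Y (lie_bracket B Z)"
        using K Y Z by (simp_all add: killing_fields_def)
      have "vf_apply (A + B) (vf_inner M Y Z) = vf_apply A (vf_inner M Y Z) + vf_apply B (vf_inner M Y Z)"
        by (simp add: vf_apply_def fun_eq_iff)
      then show "vf_apply (A + B) (vf_inner M Y Z) =
          vf_inner M (lie_bracket (A + B) Y) Z + vf_inner M Y (lie_bracket (A + B) Z)"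
        unfolding * l[OF Y] l[OF Z]
          vf_inner_add_left[OF lie_bracket_vfields[OF v(1) Y] lie_bracket_vfields[OF v(2) Y] Z]
          vf_inner_add_right[OF lie_bracket_vfields[OF v(1) Z] lie_bracket_vfields[OF v(2) Z] Y]
        by (simp add: fun_eq_iff)
    qed (rule vfields_add[OF v])
  qed
  have kill_scale: "vf_scale (\<lambda>q. if q \<in> points M then c else 0) A \<in> killing_fields M" (is "?cA \<in> _")
    if K: "A \<in> killing_fields M" for c A
  proof -
    have v: "A \<in> vfields M" using K by (simp add: killing_fields_def)
    show ?thesis unfolding killing_fields_def mem_Collect_eq
    proof (intro conjI ballI)
      fix Y Z assume Y: "Y \<in> vfields M" and Z: "Z \<in> vfields M"
      have l: "lie_bracket ?cA W = vf_scale (\<lambda>q. if q \<in> points M then c else 0) (lie_bracket A W)"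
        if W: "W \<in> vfields M" for W
      proof -
        have "vf_apply W (\<lambda>q. if q \<in> points M then c else 0) = (\<lambda>q. 0)"
          using tangent_const[OF vfields_tangent[OF W]] vfields_outside[OF W]
          by (auto simp: vf_apply_def fun_eq_iff)
        then show ?thesis
          unfolding lie_bracket_antisym[of _ W] lie_bracket_scale_right[OF W v cs]
          by (simp add: vf_scale_def tscale_def fun_eq_iff)
      qed
      have *: "vf_apply A (vf_inner M Y Z) = vf_inner M (lie_bracket A Y) Z + vf_inner M Y (lie_bracket A Z)"
        using K Y Z by (simp add: killing_fields_def)
      show "vf_apply ?cA (vf_inner M Y Z) =
          vf_inner M (lie_bracket ?cA Y) Z + vf_inner M Y (lie_bracket ?cA Z)"
        unfolding l[OF Y] l[OF Z] vf_inner_scale_left[OF lie_bracket_vfields[OF v Y] Z]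
          vf_inner_scale_right[OF Y lie_bracket_vfields[OF v Z] cs]
        using fun_cong[OF *] by (auto simp: fun_eq_iff vf_scale_def tscale_def vf_apply_def algebra_simps)
    qed (rule vf_scale_vfields[OF cs v])
  qed
  have tadd: "A + B \<in> transvections_at M q" if T: "A \<in> transvections_at M q" "B \<in> transvections_at M q" for A B
  proof -
    have K: "A \<in> killing_fields M" "B \<in> killing_fields M" using T by (simp_all add: transvections_at_def)
    then have v: "A \<in> vfields M" "B \<in> vfields M" by (simp_all add: killing_fields_def)
    have "?D Y (A + B) q = 0" if Y: "Y \<in> vfields M" for Y
    proof -
      have "?D Y A q = 0" "?D Y B q = 0" using T Y by (simp_all add: transvections_at_def)
      then show ?thesis unfolding Dadd[OF Y v] by (simp add: fun_eq_iff)
    qed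
    then show ?thesis using kill_add[OF K] by (simp add: transvections_at_def)
  qed
  have tscl: "vf_scale (\<lambda>q. if q \<in> points M then c else 0) A \<in> transvections_at M q"
    if T: "A \<in> transvections_at M q" for c A
  proof -
    have K: "A \<in> killing_fields M" using T by (simp add: transvections_at_def)
    then have v: "A \<in> vfields M" by (simp add: killing_fields_def)
    have "?D Y (vf_scale (\<lambda>q. if q \<in> points M then c else 0) A) q = 0" if Y: "Y \<in> vfields M" for Y
    proof -
      have "?D Y A q = 0" using T Y by (simp add: transvections_at_def)
      moreover have "Y q (\<lambda>q. if q \<in> points M then c else 0) = 0"
        by (rule tangent_const[OF vfields_tangent[OF Y q] q])
      ultimately show ?thesis
        unfolding Dsc[OF Y v cs] by (simp add: vf_scale_def vf_apply_def tscale_def fun_eq_iff)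
    qed
    then show ?thesis using kill_scale[OF K] by (simp add: transvections_at_def)
  qed
  have t0: "0 \<in> transvections_at M q"
  proof -
    have b0: "lie_bracket 0 Y = 0" if Y: "Y \<in> vfields M" for Y
    proof (intro ext)
      fix q f
      have "Y q (\<lambda>x. 0 * (\<lambda>x. 0) x) = 0 * Y q (\<lambda>x. 0)" by (rule vf_apply_cmult[OF Y smooth_funs_0])
      then show "lie_bracket 0 Y q f = 0 q f" by (simp add: lie_bracket_def vf_apply_def)
    qed
    have i0: "vf_inner M 0 Y = (\<lambda>q. 0)" if Y: "Y \<in> vfields M" for Y
    proof
      fix q
      show "vf_inner M 0 Y q = 0"
        using metric_zero_left[OF _ vfields_tangent[OF Y], of q] unfolding vf_inner_def zero_fun_apply by simp
    qed
    have K: "0 \<in> killing_fields M" unfolding killing_fields_def mem_Collect_eq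
    proof (intro conjI ballI)
      fix Y Z assume Y: "Y \<in> vfields M" and Z: "Z \<in> vfields M"
      show "vf_apply 0 (vf_inner M Y Z) = vf_inner M (lie_bracket 0 Y) Z + vf_inner M Y (lie_bracket 0 Z)"
        unfolding b0[OF Y] b0[OF Z] vf_inner_sym[OF Y vfields_0] i0[OF Y] i0[OF Z]
        by (simp add: vf_apply_def fun_eq_iff)
    qed (rule vfields_0)
    have "?D Y 0 q = 0" if Y: "Y \<in> vfields M" for Y
      using Dadd[OF Y vfields_0 vfields_0] by (simp add: fun_eq_iff)
    then show ?thesis using K by (simp add: transvections_at_def)
  qed
  show "tv.subspace (symmetry_subspace M q)"
  proof (rule tv.subspaceI)
    show "0 \<in> symmetry_subspace M q" unfolding symmetry_subspace_def
      by (rule image_eqI[OF _ t0]) simp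
    fix u assume "u \<in> symmetry_subspace M q"
    then obtain A where A: "A \<in> transvections_at M q" "u = A q" by (auto simp: symmetry_subspace_def)
    show "tscale c u \<in> symmetry_subspace M q" for c unfolding symmetry_subspace_def
      by (rule image_eqI[OF _ tscl[OF A(1), of c]]) (simp add: vf_scale_def A q)
    fix v assume "v \<in> symmetry_subspace M q"
    then obtain B where B: "B \<in> transvections_at M q" "v = B q" by (auto simp: symmetry_subspace_def)
    show "u + v \<in> symmetry_subspace M q" unfolding symmetry_subspace_def
      by (rule image_eqI[OF _ tadd[OF A(1) B(1)]]) (simp add: A B)
  qed
qed

interpretation tvp: vector_space_pair "tscale :: real \<Rightarrow> 'a tvec \<Rightarrow> 'a tvec"
  "tscale :: real \<Rightarrow> 'b tvec \<Rightarrow> 'b tvec"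
  by (intro vector_space_pair.intro vector_space_tscale)

text \<open>Injectivity is asked only on a subspace around \<open>S\<close>. For differentials this
  is the tangent space, on which \<open>dmap_dmap\<close> supplies an inverse.\<close>

lemma tdim_image_eq:
  fixes f :: "'a tvec \<Rightarrow> 'b tvec"
  assumes f: "\<And>u v. f (u + v) = f u + f v" "\<And>c u. f (tscale c u) = tscale c (f u)"
    and inj: "inj_on f T" and T: "tv.subspace T" and S: "S \<subseteq> T"
  shows "tdim (f ` S) = tdim S"
proof -
  have lin: "Vector_Spaces.linear tscale tscale f"
    by (intro Vector_Spaces.linear.intro vector_space_tscale module_hom.intro module_hom_axioms.intro f)
      (simp_all add: vector_space_tscale module_iff_vector_space)
  obtain B where B: "B \<subseteq> S" "tv.independent B" "S \<subseteq> tv.span B" "card B = tv.dim S"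
    by (rule tv.basis_exists)
  have spB: "tv.span B \<subseteq> T" using B(1) S T by (meson order_trans tv.span_minimal)
  have ind: "tv.independent (f ` B)"
    by (rule tvp.linear_independent_injective_image[OF lin B(2) inj_on_subset[OF inj spB]])
  have "tv.dim (f ` S) = card (f ` B)"
  proof (rule tv.dim_unique[OF _ _ ind refl])
    show "f ` B \<subseteq> f ` S" using B(1) by blast
    show "f ` S \<subseteq> tv.span (f ` B)"
      using B(3) tvp.linear_span_image[OF lin, of B] by blast
  qed
  also have "\<dots> = card B"
    by (rule card_image[OF inj_on_subset[OF inj]]) (use B(1) S in blast)
  finally show ?thesis using B(4) by (simp add: tdim_def)
qed

lemma (in isometry_pair) tdim_symmetry_subspace:
  assumes lc: "\<exists>D. is_levi_civita M D" and q: "q \<in> points M"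
  shows "tdim (symmetry_subspace M (\<Phi> q)) = tdim (symmetry_subspace M q)"
  unfolding symmetry_subspace_image[OF assms]
proof (rule tdim_image_eq[OF dmap_add dmap_scale _ subspace_tangent_space])
  show "symmetry_subspace M q \<subseteq> tangent_space M q"
    by (rule subspace_symmetry_subspace(2)[OF riem lc q])
  show "inj_on (dmap \<Phi>) (tangent_space M q)"
    by (rule inj_on_inverseI[of _ "dmap \<Psi>"]) (rule dmap_dmap)
qed

section \<open>Representations of so(3)\<close>

text \<open>The quadratic form of \<open>S\<close> attains its maximum on the unit sphere of
  \<open>U\<close>, and a maximiser is an eigenvector. The maximality is recorded too: it stops the
  raising operator and bounds the Casimir operator on all of \<open>U\<close>.\<close>

lemma self_adjoint_max_eigenvector:
  fixes S :: "'a::euclidean_space \<Rightarrow> 'a"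
  assumes S: "linear S" "\<And>x y. S x \<bullet> y = x \<bullet> S y"
    and U: "subspace U" "U \<noteq> {0}" "\<And>x. x \<in> U \<Longrightarrow> S x \<in> U"
  obtains x \<mu> where "x \<in> U" "norm x = 1" "S x = \<mu> *\<^sub>R x" "\<And>y. y \<in> U \<Longrightarrow> S y \<bullet> y \<le> \<mu> * (y \<bullet> y)"
proof -
  let ?K = "U \<inter> sphere 0 1"
  obtain u where u: "u \<in> U" "u \<noteq> 0" using U(1,2) subspace_0 by fastforce
  then have "(1 / norm u) *\<^sub>R u \<in> ?K" using subspace_scale[OF U(1)] by simp
  then have ne: "?K \<noteq> {}" by blast
  have "compact ?K" using closed_subspace[OF U(1)] compact_sphere by (rule closed_Int_compact)
  moreover have "continuous_on ?K (\<lambda>x. S x \<bullet> x)"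
    by (intro continuous_on_inner continuous_on_id linear_continuous_on
        linear_conv_bounded_linear[THEN iffD1, OF S(1)])
  ultimately obtain x where x: "x \<in> ?K" "\<And>y. y \<in> ?K \<Longrightarrow> S y \<bullet> y \<le> S x \<bullet> x"
    using continuous_attains_sup[OF _ ne] by blast
  define \<mu> where "\<mu> = S x \<bullet> x"
  have le: "S y \<bullet> y \<le> \<mu> * (y \<bullet> y)" if "y \<in> U" for y
  proof (cases "y = 0")
    case True
    then show ?thesis by simp
  next
    case False
    then have "(1 / norm y) *\<^sub>R y \<in> ?K" using subspace_scale[OF U(1) that] by simp
    from x(2)[OF this] have "(S y \<bullet> y) / (norm y * norm y) \<le> \<mu>"
      by (simp add: \<mu>_def linear_cmul[OF S(1)])
    then show ?thesis using False
      by (simp add: pos_divide_le_eq dot_square_norm power2_eq_square)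
  qed
  have xx: "x \<in> U" "norm x = 1" using x(1) by auto
  have "S x = \<mu> *\<^sub>R x"
  proof (rule ccontr)
    assume "S x \<noteq> \<mu> *\<^sub>R x"
    \<comment> \<open>If the residual were nonzero, moving from \<open>x\<close> in its direction
      would increase the Rayleigh quotient to first order.\<close>
    define h where "h = S x - \<mu> *\<^sub>R x"
    have h: "h \<in> U" "h \<noteq> 0"
      using \<open>S x \<noteq> _\<close> U(3)[OF xx(1)] subspace_scale[OF U(1) xx(1)] subspace_diff[OF U(1)] by (auto simp: h_def)
    have hh: "h \<bullet> h > 0" using h by simp
    have "S x \<bullet> h - \<mu> * (x \<bullet> h) = h \<bullet> h"
      by (simp add: h_def inner_diff_left)
    have key: "2 * t * (h \<bullet> h) \<le> t\<^sup>2 * (\<mu> * (h \<bullet> h) - S h \<bullet> h)" for t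
    proof -
      have "S (x + t *\<^sub>R h) \<bullet> (x + t *\<^sub>R h) \<le> \<mu> * ((x + t *\<^sub>R h) \<bullet> (x + t *\<^sub>R h))"
        by (rule le) (use subspace_add[OF U(1)] subspace_scale[OF U(1)] xx(1) h(1) in blast)
      moreover have "S (x + t *\<^sub>R h) \<bullet> (x + t *\<^sub>R h) = \<mu> + 2 * t * (S x \<bullet> h) + t\<^sup>2 * (S h \<bullet> h)"
        using S(2)[of h x]
        by (simp add: linear_add[OF S(1)] linear_cmul[OF S(1)] inner_add_left inner_add_right \<mu>_def
            power2_eq_square inner_commute algebra_simps)
      moreover have "(x + t *\<^sub>R h) \<bullet> (x + t *\<^sub>R h) = 1 + 2 * t * (x \<bullet> h) + t\<^sup>2 * (h \<bullet> h)"
      proof -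
        have "x \<bullet> x = 1" using xx(2) by (simp add: dot_square_norm)
        then show ?thesis
          by (simp add: inner_add_left inner_add_right power2_eq_square inner_commute algebra_simps)
      qed
      ultimately have "\<mu> + 2 * t * (S x \<bullet> h) + t\<^sup>2 * (S h \<bullet> h) \<le> \<mu> * (1 + 2 * t * (x \<bullet> h) + t\<^sup>2 * (h \<bullet> h))"
        by simp
      then have "2 * t * (S x \<bullet> h - \<mu> * (x \<bullet> h)) \<le> t\<^sup>2 * (\<mu> * (h \<bullet> h) - S h \<bullet> h)"
        by (simp add: algebra_simps)
      then show ?thesis using \<open>S x \<bullet> h - \<mu> * (x \<bullet> h) = h \<bullet> h\<close> by simp
    qed
    \<comment> \<open>\<open>K\<close> bounds the coefficient of the second-order term from above,
      and \<open>t = (h \<bullet> h) / K\<close> is small enough for the first-order term to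
      win.\<close>
    define K where "K = max 1 (\<mu> * (h \<bullet> h) - S h \<bullet> h)"
    have K: "K \<ge> 1" "\<mu> * (h \<bullet> h) - S h \<bullet> h \<le> K" by (auto simp: K_def)
    define t where "t = (h \<bullet> h) / K"
    have t: "t > 0" using hh K(1) by (simp add: t_def)
    have "2 * t * (h \<bullet> h) \<le> t\<^sup>2 * K" using key[of t] mult_left_mono[OF K(2), of "t\<^sup>2"] by simp
    then have "2 * (h \<bullet> h) \<le> t * K" using t by (simp add: power2_eq_square)
    then show False using hh K(1) by (simp add: t_def)
  qed
  then show ?thesis using that[OF xx] le by blast
qed

text \<open>Orthogonal representations of the Lie algebra so(3) on a real space. There are two
  instances: the action on column vectors and the action on matrices by commutators.\<close>

locale so3_rep =
  fixes B1 B2 B3 :: "'a::euclidean_space \<Rightarrow> 'a"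
  assumes lin: "linear B1" "linear B2" "linear B3"
    and skew: "B1 x \<bullet> y = - (x \<bullet> B1 y)" "B2 x \<bullet> y = - (x \<bullet> B2 y)" "B3 x \<bullet> y = - (x \<bullet> B3 y)"
    and comm: "B1 (B2 x) - B2 (B1 x) = B3 x" "B2 (B3 x) - B3 (B2 x) = B1 x" "B3 (B1 x) - B1 (B3 x) = B2 x"
begin

text \<open>The sign makes the operator positive semidefinite; its value on spin l is l (l +
  1).\<close>

definition casimir where "casimir x = - (B1 (B1 x) + B2 (B2 x) + B3 (B3 x))"

lemmas lin_simps =
  linear_add[OF lin(1)] linear_add[OF lin(2)] linear_add[OF lin(3)]
  linear_diff[OF lin(1)] linear_diff[OF lin(2)] linear_diff[OF lin(3)]
  linear_neg[OF lin(1)] linear_neg[OF lin(2)] linear_neg[OF lin(3)]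
  linear_cmul[OF lin(1)] linear_cmul[OF lin(2)] linear_cmul[OF lin(3)]
  linear_0[OF lin(1)] linear_0[OF lin(2)] linear_0[OF lin(3)]

lemma comm':
  "B1 (B2 x) = B2 (B1 x) + B3 x" "B2 (B3 x) = B3 (B2 x) + B1 x" "B1 (B3 x) = B3 (B1 x) - B2 x"
  using comm[of x] by (simp_all add: algebra_simps)

lemma comm'': "B3 (B1 x) = B1 (B3 x) + B2 x" "B3 (B2 x) = B2 (B3 x) - B1 x"
  using comm[of x] by (simp_all add: algebra_simps)

lemma linear_casimir: "linear casimir"
  by (rule linearI) (simp_all add: casimir_def lin_simps algebra_simps)

lemma casimir_self_adjoint: "casimir x \<bullet> y = x \<bullet> casimir y"
  by (simp add: casimir_def inner_diff_left inner_diff_right skew)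

lemma casimir_comm: "casimir (B1 x) = B1 (casimir x)" "casimir (B2 x) = B2 (casimir x)"
  "casimir (B3 x) = B3 (casimir x)"
  by (simp_all add: casimir_def lin_simps comm')

lemma casimir_inner: "casimir x \<bullet> x = B1 x \<bullet> B1 x + B2 x \<bullet> B2 x + B3 x \<bullet> B3 x"
  by (simp add: casimir_def inner_diff_left skew)

text \<open>For z = x + i y the condition reads i B3 z = m z, so this is a complex weight vector of
  weight \<open>m\<close> split into real and imaginary part.\<close>

definition weight :: "real \<Rightarrow> 'a \<Rightarrow> 'a \<Rightarrow> bool" where
  "weight m x y \<longleftrightarrow> B3 x = m *\<^sub>R y \<and> B3 y = - m *\<^sub>R x"

text \<open>The new pair is (B1 + i B2) z for z = x + i y; in the lowering counterpart it is (B1 - i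
  B2) z.\<close>

lemma weight_raise: "weight m x y \<Longrightarrow> weight (m + 1) (B1 x - B2 y) (B1 y + B2 x)"
  by (simp add: weight_def lin_simps comm'' algebra_simps)

lemma weight_lower: "weight m x y \<Longrightarrow> weight (m - 1) (B1 x + B2 y) (B1 y - B2 x)"
  by (simp add: weight_def lin_simps comm'' algebra_simps)

text \<open>For \<open>m \<noteq> 0\<close> the vector z = x + i y and its conjugate have the
  different weights m and - m and are orthogonal in the hermitian product. The two equations are the
  real and the imaginary part of this.\<close>

lemma weight_orth:
  assumes "weight m x y" "m \<noteq> 0"
  shows "x \<bullet> x = y \<bullet> y" "x \<bullet> y = 0"
proof -
  have "m * (y \<bullet> y) = m * (x \<bullet> x)" "m * (y \<bullet> x) = 0"
    using skew(3)[of x y] skew(3)[of x x] assms(1) by (simp_all add: weight_def inner_commute)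
  then show "x \<bullet> x = y \<bullet> y" "x \<bullet> y = 0" using assms(2) by (simp_all add: inner_commute)
qed

lemma weight_square: "weight m x y \<Longrightarrow> B3 (B3 x) = - (m\<^sup>2) *\<^sub>R x \<and> B3 (B3 y) = - (m\<^sup>2) *\<^sub>R y"
  by (simp add: weight_def lin_simps power2_eq_square)

text \<open>Eigenvectors of the symmetric operator B3^2 for the different eigenvalues - m^2 and -
  m'^2.\<close>

lemma weight_distinct_orth:
  assumes "weight m x y" "weight m' x' y'" "m\<^sup>2 \<noteq> m'\<^sup>2"
  shows "x \<bullet> x' = 0" "x \<bullet> y' = 0" "y \<bullet> x' = 0" "y \<bullet> y' = 0"
proof -
  have *: "u \<bullet> v = 0" if "B3 (B3 u) = - (m\<^sup>2) *\<^sub>R u" "B3 (B3 v) = - (m'\<^sup>2) *\<^sub>R v" for u v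
  proof -
    have "m\<^sup>2 * (u \<bullet> v) = m'\<^sup>2 * (u \<bullet> v)"
      using skew(3)[of "B3 u" v] skew(3)[of u "B3 v"] that by simp
    then show ?thesis using assms(3) by simp
  qed
  show "x \<bullet> x' = 0" "x \<bullet> y' = 0" "y \<bullet> x' = 0" "y \<bullet> y' = 0"
    using * weight_square[OF assms(1)] weight_square[OF assms(2)] by blast+
qed

text \<open>With \<open>z = x + \<i> y\<close> these are the identities
  \<open>|E z|\<^sup>2 = (c - m\<^sup>2 - m) |z|\<^sup>2\<close> and \<open>|F z|\<^sup>2 = (c - m\<^sup>2 + m) |z|\<^sup>2\<close> for the raising and lowering operators.\<close>

lemma weight_norms:
  assumes w: "weight m x y" and c: "casimir x = c *\<^sub>R x" "casimir y = c *\<^sub>R y"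
  shows "(B1 x - B2 y) \<bullet> (B1 x - B2 y) + (B1 y + B2 x) \<bullet> (B1 y + B2 x) = (c - m\<^sup>2 - m) * (x \<bullet> x + y \<bullet> y)"
    and "(B1 x + B2 y) \<bullet> (B1 x + B2 y) + (B1 y - B2 x) \<bullet> (B1 y - B2 x) = (c - m\<^sup>2 + m) * (x \<bullet> x + y \<bullet> y)"
proof -
  have n: "B1 x \<bullet> B1 x + B2 x \<bullet> B2 x = c * (x \<bullet> x) - m\<^sup>2 * (y \<bullet> y)"
    "B1 y \<bullet> B1 y + B2 y \<bullet> B2 y = c * (y \<bullet> y) - m\<^sup>2 * (x \<bullet> x)"
    using casimir_inner[of x] casimir_inner[of y] c w by (simp_all add: weight_def power2_eq_square)
  have 1: "B1 x \<bullet> B2 y = - (x \<bullet> B1 (B2 y))" "B1 y \<bullet> B2 x = - (x \<bullet> B2 (B1 y))"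
    "x \<bullet> B3 y = - m * (x \<bullet> x)"
    using skew(1)[of x "B2 y"] skew(2)[of x "B1 y"] w by (simp_all add: weight_def inner_commute)
  \<comment> \<open>The cross terms combine to the commutator of \<open>B1\<close> and
    \<open>B2\<close>, which is \<open>B3\<close>; this is the origin of the term linear in
    \<open>m\<close>.\<close>
  have cr: "B1 y \<bullet> B2 x - B1 x \<bullet> B2 y = - m * (x \<bullet> x)"
    using 1 comm'(1)[of y] by (simp add: inner_add_right)
  have s: "m = 0 \<or> y \<bullet> y = x \<bullet> x"
    using weight_orth(1)[OF w] by (cases "m = 0") simp_all
  show "(B1 x - B2 y) \<bullet> (B1 x - B2 y) + (B1 y + B2 x) \<bullet> (B1 y + B2 x) = (c - m\<^sup>2 - m) * (x \<bullet> x + y \<bullet> y)"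
    using s
  proof
    assume "m = 0"
    then show ?thesis
      using n cr by (simp add: inner_add_left inner_add_right inner_diff_left inner_diff_right
        inner_commute algebra_simps)
  next
    assume "y \<bullet> y = x \<bullet> x"
    then show ?thesis
      using n cr by (simp add: inner_add_left inner_add_right inner_diff_left inner_diff_right
        inner_commute algebra_simps)
  qed
  show "(B1 x + B2 y) \<bullet> (B1 x + B2 y) + (B1 y - B2 x) \<bullet> (B1 y - B2 x) = (c - m\<^sup>2 + m) * (x \<bullet> x + y \<bullet> y)"
    using s
  proof
    assume "m = 0"
    then show ?thesis
      using n cr by (simp add: inner_add_left inner_add_right inner_diff_left inner_diff_right
        inner_commute algebra_simps)
  next
    assume "y \<bullet> y = x \<bullet> x"
    then show ?thesis
      using n cr by (simp add: inner_add_left inner_add_right inner_diff_left inner_diff_right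
        inner_commute algebra_simps)
  qed
qed

definition invariant :: "'a set \<Rightarrow> bool" where
  "invariant U \<longleftrightarrow> subspace U \<and> (\<forall>x\<in>U. B1 x \<in> U \<and> B2 x \<in> U \<and> B3 x \<in> U)"

lemma invariant_casimir: "invariant U \<Longrightarrow> x \<in> U \<Longrightarrow> casimir x \<in> U"
  unfolding invariant_def casimir_def by (metis subspace_add subspace_neg)

lemma invariant_eigenspace: "invariant U \<Longrightarrow> invariant {x \<in> U. casimir x = c *\<^sub>R x}"
  using linear_casimir
  by (auto simp: invariant_def casimir_comm lin_simps subspace_def linear_add linear_cmul linear_0 algebra_simps)

text \<open>With m^2 the largest eigenvalue of - B3^2 on \<open>U\<close>, raising would produce the
  eigenvalue (m + 1)^2, hence gives zero. The norm identity for the raised vector then forces c -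
  m^2 - m = 0.\<close>

lemma top_weight:
  assumes U: "invariant U" "U \<noteq> {0}" and c: "\<And>x. x \<in> U \<Longrightarrow> casimir x = c *\<^sub>R x"
  obtains m x y where "m \<ge> 0" "c = m * (m + 1)" "x \<in> U" "y \<in> U" "weight m x y" "x \<noteq> 0"
proof -
  have sub: "subspace U" and inv: "\<And>x. x \<in> U \<Longrightarrow> B1 x \<in> U" "\<And>x. x \<in> U \<Longrightarrow> B2 x \<in> U" "\<And>x. x \<in> U \<Longrightarrow> B3 x \<in> U"
    using U(1) by (auto simp: invariant_def)
  define S where "S x = - B3 (B3 x)" for x
  have linS: "linear S" by (rule linearI) (simp_all add: S_def lin_simps)
  have symS: "S x \<bullet> y = x \<bullet> S y" for x y by (simp add: S_def skew)
  have SU: "S x \<in> U" if "x \<in> U" for x using that inv(3) subspace_neg[OF sub] by (simp add: S_def)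
  obtain x \<mu> where x: "x \<in> U" "norm x = 1" "S x = \<mu> *\<^sub>R x" "\<And>y. y \<in> U \<Longrightarrow> S y \<bullet> y \<le> \<mu> * (y \<bullet> y)"
    using self_adjoint_max_eigenvector[OF linS symS sub U(2) SU] by blast
  have "S x \<bullet> x = B3 x \<bullet> B3 x" by (simp add: S_def skew)
  then have \<mu>: "\<mu> = B3 x \<bullet> B3 x" using x(2,3) by (simp add: dot_square_norm)
  define m where "m = sqrt \<mu>"
  have m: "m \<ge> 0" "m\<^sup>2 = \<mu>" using \<mu> by (simp_all add: m_def)
  \<comment> \<open>The partner of \<open>x\<close> in a weight pair. For \<open>m = 0\<close> the
    vector \<open>B3 x\<close> vanishes and 0 completes the pair.\<close>
  define y where "y = (if m = 0 then 0 else (1 / m) *\<^sub>R B3 x)"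
  have y: "y \<in> U" using inv(3)[OF x(1)] subspace_scale[OF sub] subspace_0[OF sub] by (simp add: y_def)
  have w: "weight m x y"
  proof (cases "m = 0")
    case True
    then have "B3 x = 0" using \<mu> m(2) by simp
    then show ?thesis using True by (simp add: weight_def y_def lin_simps)
  next
    case False
    have "B3 (B3 x) = - S x" by (simp add: S_def)
    then have "B3 (B3 x) = - (m * m) *\<^sub>R x" using x(3) m(2) by (simp add: power2_eq_square)
    then show ?thesis using False by (simp add: weight_def y_def lin_simps)
  qed
  have z: "v = 0" if "B3 (B3 v) = - ((m + 1)\<^sup>2) *\<^sub>R v" "v \<in> U" for v
  proof -
    have "(m + 1)\<^sup>2 * (v \<bullet> v) \<le> m\<^sup>2 * (v \<bullet> v)" using x(4)[OF that(2)] that(1) m(2) by (simp add: S_def)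
    moreover have "m\<^sup>2 < (m + 1)\<^sup>2" using m(1) by (simp add: power2_eq_square algebra_simps)
    ultimately have "\<not> v \<bullet> v > 0" using mult_strict_right_mono[of "m\<^sup>2" "(m + 1)\<^sup>2" "v \<bullet> v"] by linarith
    then show ?thesis by simp
  qed
  have "B1 x - B2 y = 0" "B1 y + B2 x = 0"
    using z[OF conjunct1[OF weight_square[OF weight_raise[OF w]]]
        subspace_diff[OF sub inv(1)[OF x(1)] inv(2)[OF y]]]
      z[OF conjunct2[OF weight_square[OF weight_raise[OF w]]]
        subspace_add[OF sub inv(1)[OF y] inv(2)[OF x(1)]]] by simp_all
  then have "(c - m\<^sup>2 - m) * (x \<bullet> x + y \<bullet> y) = 0"
    using weight_norms(1)[OF w c[OF x(1)] c[OF y]] by simp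
  moreover have "x \<bullet> x + y \<bullet> y > 0" using x(2) by (intro add_pos_nonneg) auto
  ultimately have "c - m\<^sup>2 - m = 0" by (metis less_irrefl mult_eq_0_iff)
  then have "c = m * (m + 1)" by (simp add: power2_eq_square algebra_simps)
  moreover have "x \<noteq> 0" using x(2) by auto
  ultimately show ?thesis using that[OF m(1) _ x(1) y w] by blast
qed

text \<open>Lowering a vector of weight m multiplies its squared norm by l (l + 1) - m^2 + m, which
  is positive for 1 \<le> m \<le> l; so the descent from weight l to weight 0 never ends in
  zero.\<close>

lemma weight_string:
  assumes U: "invariant U" and c: "\<And>x. x \<in> U \<Longrightarrow> casimir x = (real l * (real l + 1)) *\<^sub>R x"
    and top: "x0 \<in> U" "y0 \<in> U" "weight (real l) x0 y0" "x0 \<noteq> 0"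
  shows "j \<le> l \<Longrightarrow> \<exists>x\<in>U. \<exists>y\<in>U. weight (real (l - j)) x y \<and> (x \<noteq> 0 \<or> y \<noteq> 0)"
proof (induction j)
  case 0
  then show ?case using top by auto
next
  case (Suc j)
  have sub: "subspace U" and inv: "\<And>x. x \<in> U \<Longrightarrow> B1 x \<in> U" "\<And>x. x \<in> U \<Longrightarrow> B2 x \<in> U"
    using U by (auto simp: invariant_def)
  obtain x y where xy: "x \<in> U" "y \<in> U" "weight (real (l - j)) x y" "x \<noteq> 0 \<or> y \<noteq> 0"
    using Suc by auto
  let ?m = "real (l - j)"
  have m1: "?m - 1 = real (l - Suc j)" using Suc.prems by simp
  have "?m \<le> l" "?m \<ge> 1" using Suc.prems by auto
  then have "?m * ?m \<le> real l * real l" by (intro mult_mono) auto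
  then have "?m\<^sup>2 < real l * (real l + 1) + ?m"
    unfolding power2_eq_square distrib_left using \<open>?m \<ge> 1\<close> by linarith
  moreover have "x \<bullet> x + y \<bullet> y > 0" using xy(4)
    by (metis add_nonneg_pos add_pos_nonneg inner_ge_zero inner_gt_zero_iff)
  ultimately have "(B1 x + B2 y) \<bullet> (B1 x + B2 y) + (B1 y - B2 x) \<bullet> (B1 y - B2 x) > 0"
    unfolding weight_norms(2)[OF xy(3) c[OF xy(1)] c[OF xy(2)]] by simp
  then have "B1 x + B2 y \<noteq> 0 \<or> B1 y - B2 x \<noteq> 0" by auto
  moreover have "B1 x + B2 y \<in> U" "B1 y - B2 x \<in> U"
    using inv xy(1,2) subspace_add[OF sub] subspace_diff[OF sub] by auto
  ultimately show ?case using weight_lower[OF xy(3)] unfolding m1 by blast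
qed

text \<open>Each of the weights 1, ..., l contributes two orthogonal real vectors and weight 0 at
  least one. Different weights are orthogonal, so 2 l + 1 nonzero orthogonal vectors are
  found.\<close>

lemma dim_invariant_ge:
  assumes U: "invariant U" "U \<noteq> {0}" and c: "\<And>x. x \<in> U \<Longrightarrow> casimir x = (real l * (real l + 1)) *\<^sub>R x"
  shows "2 * l + 1 \<le> dim U"
proof -
  obtain m x0 y0 where m: "m \<ge> 0" "real l * (real l + 1) = m * (m + 1)" "x0 \<in> U" "y0 \<in> U"
    "weight m x0 y0" "x0 \<noteq> 0"
    using top_weight[OF U c] by blast
  have "(real l - m) * (real l + m + 1) = 0" using m(2) by (simp add: algebra_simps)
  then have "m = real l" using m(1) by auto
  then have "weight (real l) x0 y0" using m(5) by simp
  note str = weight_string[OF U(1) c m(3,4) this m(6)]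
  have "\<exists>x\<in>U. \<exists>y\<in>U. weight (real k) x y \<and> (x \<noteq> 0 \<or> y \<noteq> 0)" if "k \<le> l" for k
    using str[of "l - k"] that by simp
  then obtain X Y where XY: "\<And>k. k \<le> l \<Longrightarrow> X k \<in> U" "\<And>k. k \<le> l \<Longrightarrow> Y k \<in> U"
    "\<And>k. k \<le> l \<Longrightarrow> weight (real k) (X k) (Y k)" "\<And>k. k \<le> l \<Longrightarrow> X k \<noteq> 0 \<or> Y k \<noteq> 0"
    by metis
  \<comment> \<open>Index 0 takes a nonzero vector of weight 0; for k > 0 the indices 2 k - 1 and 2
    k take \<open>X k\<close> and \<open>Y k\<close>.\<close>
  define v where "v i = (if i = 0 then (if X 0 \<noteq> 0 then X 0 else Y 0)
      else if odd i then X (Suc i div 2) else Y (i div 2))" for i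
  define k where "k i = (if odd i then Suc i div 2 else i div 2)" for i :: nat
  have kl: "k i \<le> l" if "i \<le> 2 * l" for i using that by (auto simp: k_def elim!: oddE)
  have vk: "v i = X (k i) \<or> v i = Y (k i)" for i by (auto simp: v_def k_def)
  have XY0: "X j \<noteq> 0 \<and> Y j \<noteq> 0" if "j \<le> l" "j \<noteq> 0" for j
    using weight_orth(1)[OF XY(3)[OF that(1)]] XY(4)[OF that(1)] that(2) by auto
  have v0: "v i \<noteq> 0" if "i \<le> 2 * l" for i
  proof (cases "i = 0")
    case True
    then show ?thesis using XY(4)[of 0] by (auto simp: v_def)
  next
    case False
    then have "k i \<noteq> 0" by (auto simp: k_def elim!: oddE evenE)
    then show ?thesis using XY0[OF kl[OF that]] vk[of i] by auto
  qed
  have vU: "v i \<in> U" if "i \<le> 2 * l" for i using vk[of i] XY(1,2) kl[OF that] by auto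
  have orth: "v i \<bullet> v j = 0" if ij: "i \<le> 2 * l" "j \<le> 2 * l" "i < j" for i j
  proof (cases "k i = k j")
    case False
    then have "(real (k i))\<^sup>2 \<noteq> (real (k j))\<^sup>2" by (simp add: power2_eq_iff_nonneg)
    from weight_distinct_orth[OF XY(3)[OF kl[OF ij(1)]] XY(3)[OF kl[OF ij(2)]] this]
    show ?thesis using vk[of i] vk[of j] by metis
  next
    case True
    then have "odd i" "j = Suc i" using ij(3) by (auto simp: k_def elim!: oddE evenE split: if_splits)
    then have "v i = X (k i)" "v j = Y (k i)" "k i \<noteq> 0" by (auto simp: v_def k_def elim!: oddE)
    then show ?thesis using weight_orth(2)[OF XY(3)[OF kl[OF ij(1)]]] by simp
  qed
  have orth': "v i \<bullet> v j = 0" if "i \<le> 2 * l" "j \<le> 2 * l" "i \<noteq> j" for i j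
    using orth[of i j] orth[of j i] that by (metis inner_commute linorder_neqE_nat)
  have inj: "inj_on v {..2 * l}"
  proof (rule inj_onI)
    fix i j assume ij: "i \<in> {..2 * l}" "j \<in> {..2 * l}" "v i = v j"
    show "i = j"
    proof (rule ccontr)
      assume "i \<noteq> j"
      then have "v i \<bullet> v i = 0" using orth'[of i j] ij by simp
      then show False using v0[of i] ij by simp
    qed
  qed
  have "pairwise orthogonal (v ` {..2 * l})"
  proof (rule pairwiseI)
    fix a b assume ab: "a \<in> v ` {..2 * l}" "b \<in> v ` {..2 * l}" "a \<noteq> b"
    then obtain i j where "i \<le> 2 * l" "j \<le> 2 * l" "a = v i" "b = v j" by auto
    then show "orthogonal a b" using orth'[of i j] ab(3) by (auto simp: orthogonal_def)
  qed
  then have "independent (v ` {..2 * l})"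
    by (rule pairwise_orthogonal_independent) (use v0 in auto)
  then have "card (v ` {..2 * l}) \<le> dim U"
    by (intro independent_card_le_dim) (use vU in auto)
  then show ?thesis using card_image[OF inj] by simp
qed

end

section \<open>Matrix one-parameter groups\<close>

lemma bounded_bilinear_matrix_mult:
  "bounded_bilinear ((**) :: real^'n^'m \<Rightarrow> real^'p^'n \<Rightarrow> real^'p^'m)"
proof -
  have "bilinear ((**) :: real^'n^'m \<Rightarrow> real^'p^'n \<Rightarrow> real^'p^'m)"
    unfolding bilinear_def
    by (intro conjI allI linearI)
      (simp_all add: vec_eq_iff matrix_matrix_mult_def algebra_simps sum.distrib sum_distrib_left)
  then show ?thesis by (simp add: bilinear_conv_bounded_bilinear)
qed

lemma bounded_bilinear_matrix_vector_mult:
  "bounded_bilinear ((*v) :: real^'n^'m \<Rightarrow> real^'n \<Rightarrow> real^'m)"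
proof -
  have "bilinear ((*v) :: real^'n^'m \<Rightarrow> real^'n \<Rightarrow> real^'m)"
    unfolding bilinear_def
    by (intro conjI allI linearI) (simp_all add: matrix_vector_mult_add_rdistrib matrix_vector_right_distrib
        scaleR_matrix_vector_assoc matrix_vector_mult_scaleR)
  then show ?thesis by (simp add: bilinear_conv_bounded_bilinear)
qed

lemmas matrix_mult_simps =
  bounded_bilinear.add_left[OF bounded_bilinear_matrix_mult]
  bounded_bilinear.add_right[OF bounded_bilinear_matrix_mult]
  bounded_bilinear.diff_left[OF bounded_bilinear_matrix_mult]
  bounded_bilinear.diff_right[OF bounded_bilinear_matrix_mult]
  bounded_bilinear.minus_left[OF bounded_bilinear_matrix_mult]
  bounded_bilinear.minus_right[OF bounded_bilinear_matrix_mult]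
  bounded_bilinear.zero_left[OF bounded_bilinear_matrix_mult]
  bounded_bilinear.zero_right[OF bounded_bilinear_matrix_mult]
  bounded_bilinear.scaleR_left[OF bounded_bilinear_matrix_mult]
  bounded_bilinear.scaleR_right[OF bounded_bilinear_matrix_mult]

lemmas matrix_vector_mult_simps =
  bounded_bilinear.add_left[OF bounded_bilinear_matrix_vector_mult]
  bounded_bilinear.add_right[OF bounded_bilinear_matrix_vector_mult]
  bounded_bilinear.diff_left[OF bounded_bilinear_matrix_vector_mult]
  bounded_bilinear.diff_right[OF bounded_bilinear_matrix_vector_mult]
  bounded_bilinear.minus_left[OF bounded_bilinear_matrix_vector_mult]
  bounded_bilinear.minus_right[OF bounded_bilinear_matrix_vector_mult]
  bounded_bilinear.zero_left[OF bounded_bilinear_matrix_vector_mult]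
  bounded_bilinear.zero_right[OF bounded_bilinear_matrix_vector_mult]
  bounded_bilinear.scaleR_left[OF bounded_bilinear_matrix_vector_mult]
  bounded_bilinear.scaleR_right[OF bounded_bilinear_matrix_vector_mult]

lemmas has_vector_derivative_matrix_mult =
  bounded_bilinear.has_vector_derivative[OF bounded_bilinear_matrix_mult]
lemmas has_vector_derivative_matrix_vector_mult =
  bounded_bilinear.has_vector_derivative[OF bounded_bilinear_matrix_vector_mult]

lemma has_vector_derivative_matrix_mult_const:
  fixes f :: "real \<Rightarrow> real^'n^'n"
  assumes "(f has_vector_derivative A) (at t)"
  shows "((\<lambda>t. B ** f t) has_vector_derivative B ** A) (at t)"
    and "((\<lambda>t. f t ** B) has_vector_derivative A ** B) (at t)"
  using has_vector_derivative_matrix_mult[OF has_vector_derivative_const[of B] assms]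
    has_vector_derivative_matrix_mult[OF assms has_vector_derivative_const[of B]]
  by (simp_all add: matrix_mult_simps)

lemma continuous_on_det: "continuous_on UNIV (det :: real^'n^'n \<Rightarrow> real)"
  unfolding det_def[abs_def] by (intro continuous_intros)

text \<open>Continuity suffices by an averaging argument: \<phi> (t) times the integral of \<phi>
  over [0, h] is the integral over [t, t + h], a differentiable function of t. For small h the first
  integral is invertible and can be divided out.\<close>

lemma one_parameter_group_derivative:
  fixes \<phi> :: "real \<Rightarrow> real^'n^'n"
  assumes cont: "continuous_on UNIV \<phi>" and hom: "\<And>s t. \<phi> (s + t) = \<phi> s ** \<phi> t" and \<phi>0: "\<phi> 0 = mat 1"
  obtains A where "\<And>t. (\<phi> has_vector_derivative A ** \<phi> t) (at t)" "\<And>t. (\<phi> has_vector_derivative \<phi> t ** A) (at t)"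
proof -
  \<comment> \<open>The interval has to contain sums of two numbers of modulus below 1 in its
    interior.\<close>
  obtain \<Phi> where \<Phi>: "\<And>x. x \<in> {-3..3} \<Longrightarrow> (\<Phi> has_vector_derivative \<phi> x) (at x within {-3..3})"
    using antiderivative_continuous[of "-3" 3 \<phi>] continuous_on_subset[OF cont] by auto
  have \<Phi>': "(\<Phi> has_vector_derivative \<phi> x) (at x)" if "x \<in> {-3<..<3}" for x
    using \<Phi>[of x] that at_within_Icc_at[of "-3" x 3] by simp
  have lim: "((\<lambda>h. (1 / h) *\<^sub>R (\<Phi> h - \<Phi> 0)) \<longlongrightarrow> mat 1) (at 0)"
  proof (rule LIM_zero_cancel, rule tendsto_norm_zero_cancel, rule Lim_transform_eventually)
    show "((\<lambda>h. norm (\<Phi> (0 + h) - \<Phi> 0 - h *\<^sub>R mat 1) / norm h) \<longlongrightarrow> 0) (at 0)"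
      using \<Phi>'[of 0] unfolding has_vector_derivative_def has_derivative_at \<phi>0 by simp
    show "\<forall>\<^sub>F h in at 0. norm (\<Phi> (0 + h) - \<Phi> 0 - h *\<^sub>R mat 1) / norm h =
        norm ((1 / h) *\<^sub>R (\<Phi> h - \<Phi> 0) - mat 1)"
    proof (rule eventually_at_filter[THEN iffD2], rule always_eventually, intro allI impI)
      fix h :: real assume h: "h \<noteq> 0"
      have "(1 / h) *\<^sub>R (\<Phi> h - \<Phi> 0) - mat 1 = (1 / h) *\<^sub>R (\<Phi> h - \<Phi> 0 - h *\<^sub>R mat 1)"
        using h by (simp add: scaleR_diff_right)
      then show "norm (\<Phi> (0 + h) - \<Phi> 0 - h *\<^sub>R mat 1) / norm h =
        norm ((1 / h) *\<^sub>R (\<Phi> h - \<Phi> 0) - mat 1)" by simp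
    qed
  qed
  \<comment> \<open>The mean value of \<open>\<phi>\<close> over [0, h] tends to the identity, so
    its determinant is positive for some small \<open>h\<close>.\<close>
  have "((\<lambda>h. det ((1 / h) *\<^sub>R (\<Phi> h - \<Phi> 0))) \<longlongrightarrow> det (mat 1 :: real^'n^'n)) (at 0)"
    using continuous_on_tendsto_compose[OF continuous_on_det lim] by simp
  then have "\<forall>\<^sub>F h in at 0. det ((1 / h) *\<^sub>R (\<Phi> h - \<Phi> 0)) > 0"
    by (intro order_tendstoD) (auto simp: det_I)
  moreover have "\<forall>\<^sub>F h in at (0::real). dist h 0 < 1" unfolding eventually_at by (intro exI[of _ 1]) simp
  ultimately have "\<forall>\<^sub>F h in at (0::real). \<exists>J. \<bar>h\<bar> < 1 \<and> (\<Phi> h - \<Phi> 0) ** J = mat 1"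
  proof eventually_elim
    case (elim h)
    then have "invertible ((1 / h) *\<^sub>R (\<Phi> h - \<Phi> 0))" by (simp add: invertible_det_nz)
    then obtain J where "((1 / h) *\<^sub>R (\<Phi> h - \<Phi> 0)) ** J = mat 1" by (auto simp: invertible_def)
    then have "(\<Phi> h - \<Phi> 0) ** ((1 / h) *\<^sub>R J) = mat 1"
      by (simp add: matrix_mult_simps)
    then show ?case using elim by (auto simp: dist_real_def)
  qed
  from eventually_happens'[OF at_neq_bot this]
  obtain h J where h: "\<bar>h\<bar> < 1" "(\<Phi> h - \<Phi> 0) ** J = mat 1" by blast
  \<comment> \<open>As functions of the upper bound of the integral, both sides have the same
    derivative, by the homomorphism property.\<close>
  have key: "\<phi> t ** (\<Phi> h - \<Phi> 0) = \<Phi> (t + h) - \<Phi> t" if t: "\<bar>t\<bar> < 1" for t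
  proof -
    define g where "g s = \<phi> t ** \<Phi> s - \<Phi> (t + s)" for s
    have "(g has_vector_derivative 0) (at s within {-1<..<1})" if s: "s \<in> {-1<..<1}" for s
    proof -
      have "((\<lambda>s. \<phi> t ** \<Phi> s) has_vector_derivative \<phi> t ** \<phi> s) (at s)"
        by (rule has_vector_derivative_matrix_mult_const(1)[OF \<Phi>']) (use s in auto)
      moreover have "((\<lambda>s. \<Phi> (t + s)) has_vector_derivative \<phi> (t + s)) (at s)"
      proof -
        have "(\<Phi> has_vector_derivative \<phi> (t + s)) (at (t + s))"
          using s t by (intro \<Phi>') auto
        moreover have "((\<lambda>s. t + s) has_real_derivative 1) (at s)" by (auto intro!: derivative_eq_intros)
        ultimately show ?thesis
          using vector_diff_chain_at[of "\<lambda>s. t + s" 1 s \<Phi> "\<phi> (t + s)"]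
          by (simp add: has_real_derivative_iff_has_vector_derivative o_def)
      qed
      ultimately have "(g has_vector_derivative (\<phi> t ** \<phi> s - \<phi> (t + s))) (at s)"
        unfolding g_def by (rule has_vector_derivative_diff)
      then show ?thesis by (simp add: hom has_vector_derivative_at_within)
    qed
    then obtain c where "\<And>s. s \<in> {-1<..<1} \<Longrightarrow> g s = c"
      using has_vector_derivative_zero_constant[of "{-1<..<(1::real)}" g] by auto
    moreover have "h \<in> {-1<..<1}" "0 \<in> {-1<..<(1::real)}" using h(1) by auto
    ultimately have "g h = g 0" by metis
    then show ?thesis by (simp add: g_def matrix_mult_simps algebra_simps)
  qed
  have form: "\<phi> t = (\<Phi> (t + h) - \<Phi> t) ** J" if "\<bar>t\<bar> < 1" for t
    using key[OF that] h(2) by (metis matrix_mul_assoc matrix_mul_rid)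
  define A where "A = (\<phi> h - \<phi> 0) ** J"
  have "((\<lambda>t. (\<Phi> (t + h) - \<Phi> t) ** J) has_vector_derivative A) (at 0)"
    unfolding A_def
  proof (intro has_vector_derivative_matrix_mult_const(2) has_vector_derivative_diff)
    have "((\<lambda>s. s + h) has_real_derivative 1) (at (0::real))" by (auto intro!: derivative_eq_intros)
    then show "((\<lambda>t. \<Phi> (t + h)) has_vector_derivative \<phi> h) (at 0)"
      using vector_diff_chain_at[of "\<lambda>s. s + h" 1 0 \<Phi> "\<phi> h"] \<Phi>'[of h] h(1)
      by (auto simp: has_real_derivative_iff_has_vector_derivative o_def abs_less_iff)
    show "(\<Phi> has_vector_derivative \<phi> 0) (at 0)" by (rule \<Phi>') auto
  qed
  then have A0: "(\<phi> has_vector_derivative A) (at 0)"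
    by (rule has_vector_derivative_transform_within_open[of _ _ _ "{-1<..<1}"]) (use form in \<open>auto simp: abs_less_iff\<close>)
  have sh: "((\<lambda>s. \<phi> (s - t)) has_vector_derivative A) (at t)" for t
  proof -
    have "((\<lambda>s. s - t) has_real_derivative 1) (at t)" by (auto intro!: derivative_eq_intros)
    then show ?thesis
      using vector_diff_chain_at[of "\<lambda>s. s - t" 1 t \<phi> A] A0
      by (simp add: has_real_derivative_iff_has_vector_derivative o_def)
  qed
  have "(\<phi> has_vector_derivative A ** \<phi> t) (at t)" for t
  proof -
    have "(\<lambda>s. \<phi> (s - t) ** \<phi> t) = \<phi>" by (rule ext) (simp add: hom[symmetric])
    then show ?thesis using has_vector_derivative_matrix_mult_const(2)[OF sh[of t], where B = "\<phi> t"] by simp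
  qed
  moreover have "(\<phi> has_vector_derivative \<phi> t ** A) (at t)" for t
  proof -
    have "(\<lambda>s. \<phi> t ** \<phi> (s - t)) = \<phi>" by (rule ext) (simp add: hom[symmetric])
    then show ?thesis using has_vector_derivative_matrix_mult_const(1)[OF sh[of t], where B = "\<phi> t"] by simp
  qed
  ultimately show ?thesis using that by blast
qed

text \<open>The plane rotation w on the right solves w' = A w, so \<phi> (- s) w (s) has derivative
  zero. Uniqueness is obtained without the exponential series.\<close>

lemma one_parameter_group_rotates:
  fixes \<phi> :: "real \<Rightarrow> real^'n^'n"
  assumes hom: "\<And>s t. \<phi> (s + t) = \<phi> s ** \<phi> t" and \<phi>0: "\<phi> 0 = mat 1"
    and A: "\<And>t. (\<phi> has_vector_derivative \<phi> t ** A) (at t)"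
    and xy: "A *v x = m *\<^sub>R y" "A *v y = - m *\<^sub>R x"
  shows "\<phi> t *v x = cos (m * t) *\<^sub>R x + sin (m * t) *\<^sub>R y"
proof -
  define w where "w s = cos (m * s) *\<^sub>R x + sin (m * s) *\<^sub>R y" for s
  have w': "(w has_vector_derivative A *v w s) (at s)" for s
  proof -
    have "(w has_vector_derivative ((- sin (m * s) * m) *\<^sub>R x + (cos (m * s) * m) *\<^sub>R y)) (at s)"
      unfolding w_def by (auto intro!: derivative_eq_intros simp: has_real_derivative_iff_has_vector_derivative[symmetric])
    moreover have "A *v w s = (- sin (m * s) * m) *\<^sub>R x + (cos (m * s) * m) *\<^sub>R y"
      by (simp add: w_def matrix_vector_mult_simps xy)
    ultimately show ?thesis by simp
  qed
  have neg: "((\<lambda>s. \<phi> (- s)) has_vector_derivative - (\<phi> (- s) ** A)) (at s)" for s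
    using vector_diff_chain_at[of uminus "-1" s \<phi> "\<phi> (- s) ** A"] A[of "- s"]
    by (simp add: o_def has_vector_derivative_minus[OF has_vector_derivative_id, simplified])
  have "((\<lambda>s. \<phi> (- s) *v w s) has_vector_derivative (\<phi> (- s) *v (A *v w s) + (- (\<phi> (- s) ** A)) *v w s)) (at s)" for s
    by (rule has_vector_derivative_matrix_vector_mult[OF neg w'])
  moreover have "(\<phi> (- s) *v (A *v w s) + (- (\<phi> (- s) ** A)) *v w s) = 0" for s
    by (simp add: matrix_vector_mul_assoc matrix_vector_mult_simps)
  ultimately have "((\<lambda>s. \<phi> (- s) *v w s) has_vector_derivative 0) (at s within UNIV)" for s by simp
  then obtain c where c: "\<And>s. s \<in> UNIV \<Longrightarrow> \<phi> (- s) *v w s = c"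
    using has_vector_derivative_zero_constant[of UNIV "\<lambda>s. \<phi> (- s) *v w s"] by auto
  have "\<phi> (- t) *v w t = x" using c[of t] c[of 0] by (simp add: w_def \<phi>0)
  then have "\<phi> t *v x = (\<phi> t ** \<phi> (- t)) *v w t" by (simp add: matrix_vector_mul_assoc[symmetric])
  also have "\<dots> = w t" using hom[of t "- t", symmetric] by (simp add: \<phi>0)
  finally show ?thesis by (simp add: w_def)
qed

section \<open>The rotation group of three-space\<close>

definition rx :: "real \<Rightarrow> real^3^3" where
  "rx t = vector [vector [1, 0, 0], vector [0, cos t, - sin t], vector [0, sin t, cos t]]"
definition ry :: "real \<Rightarrow> real^3^3" where
  "ry t = vector [vector [cos t, 0, sin t], vector [0, 1, 0], vector [- sin t, 0, cos t]]"
definition rz :: "real \<Rightarrow> real^3^3" where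
  "rz t = vector [vector [cos t, - sin t, 0], vector [sin t, cos t, 0], vector [0, 0, 1]]"

lemmas mat3_simps = vec_eq_iff forall_3 matrix_matrix_mult_def sum_3 mat_def transpose_def

lemma rotation_rx: "rotation_matrix (rx t)" and rotation_ry: "rotation_matrix (ry t)"
  and rotation_rz: "rotation_matrix (rz t)"
  by (simp_all add: rotation_matrix_def orthogonal_matrix_def rx_def ry_def rz_def mat3_simps det_3
      power2_eq_square[symmetric] add.commute[of "(sin t)\<^sup>2"])

lemma rx_add: "rx (s + t) = rx s ** rx t" and ry_add: "ry (s + t) = ry s ** ry t"
  and rz_add: "rz (s + t) = rz s ** rz t"
  by (simp_all add: rx_def ry_def rz_def mat3_simps cos_add sin_add algebra_simps)

lemma rx_0: "rx 0 = mat 1" and ry_0: "ry 0 = mat 1" and rz_0: "rz 0 = mat 1"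
  by (simp_all add: rx_def ry_def rz_def mat3_simps)

lemma continuous_rx: "continuous_on UNIV rx" and continuous_ry: "continuous_on UNIV ry"
  and continuous_rz: "continuous_on UNIV rz"
proof -
  have x: "rx t = mat 1 + (cos t - 1) *\<^sub>R vector [vector [0, 0, 0], vector [0, 1, 0], vector [0, 0, 1]] +
      sin t *\<^sub>R vector [vector [0, 0, 0], vector [0, 0, -1], vector [0, 1, 0]]" for t
    by (simp add: rx_def mat3_simps)
  have y: "ry t = mat 1 + (cos t - 1) *\<^sub>R vector [vector [1, 0, 0], vector [0, 0, 0], vector [0, 0, 1]] +
      sin t *\<^sub>R vector [vector [0, 0, 1], vector [0, 0, 0], vector [-1, 0, 0]]" for t
    by (simp add: ry_def mat3_simps)
  have z: "rz t = mat 1 + (cos t - 1) *\<^sub>R vector [vector [1, 0, 0], vector [0, 1, 0], vector [0, 0, 0]] +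
      sin t *\<^sub>R vector [vector [0, -1, 0], vector [1, 0, 0], vector [0, 0, 0]]" for t
    by (simp add: rz_def mat3_simps)
  show "continuous_on UNIV rx" unfolding x[abs_def] by (intro continuous_intros)
  show "continuous_on UNIV ry" unfolding y[abs_def] by (intro continuous_intros)
  show "continuous_on UNIV rz" unfolding z[abs_def] by (intro continuous_intros)
qed

text \<open>Tait-Bryan angles for a rotation near the identity.\<close>

lemma tait_bryan:
  fixes R :: "real^3^3"
  assumes R: "rotation_matrix R" and p: "R $ 1 $ 1 > 0" "R $ 3 $ 3 > 0"
  shows "R = rx (arctan (- (R $ 2 $ 3) / R $ 3 $ 3)) ** ry (arcsin (R $ 1 $ 3)) ** rz (arctan (- (R $ 1 $ 2) / R $ 1 $ 1))"
proof -
  define a where "a = arctan (- (R $ 2 $ 3) / R $ 3 $ 3)"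
  define b where "b = arcsin (R $ 1 $ 3)"
  define c where "c = arctan (- (R $ 1 $ 2) / R $ 1 $ 1)"
  \<comment> \<open>The angles \<open>a\<close> and \<open>c\<close> are chosen to clear the entries
    (2,3) and (1,2). Orthogonality then clears (2,1) and (3,2), and the positive corner entries
    identify \<open>P\<close> as a rotation about the second axis.\<close>
  define P where "P = rx (- a) ** R ** rz (- c)"
  have cos: "cos a > 0" "cos c > 0" 
    unfolding a_def c_def by (intro cos_gt_zero_pi arctan_lbound arctan_ubound)+
  have sa: "sin a = cos a * (- (R $ 2 $ 3) / R $ 3 $ 3)"
    using tan_arctan[of "- (R $ 2 $ 3) / R $ 3 $ 3"] cos(1) by (simp add: tan_def a_def field_simps)
  have sc: "sin c = cos c * (- (R $ 1 $ 2) / R $ 1 $ 1)"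
    using tan_arctan[of "- (R $ 1 $ 2) / R $ 1 $ 1"] cos(2) by (simp add: tan_def c_def field_simps)
  have rot: "rotation_matrix P"
    using R rotation_rx[of "- a"] rotation_rz[of "- c"]
    by (simp add: P_def rotation_matrix_def orthogonal_matrix_mul det_mul)
  have e: "P $ 1 $ 3 = R $ 1 $ 3" "P $ 2 $ 3 = 0" "P $ 1 $ 2 = 0"
    "P $ 3 $ 3 = cos a * (R $ 3 $ 3 + (R $ 2 $ 3)\<^sup>2 / R $ 3 $ 3)"
    "P $ 1 $ 1 = cos c * (R $ 1 $ 1 + (R $ 1 $ 2)\<^sup>2 / R $ 1 $ 1)"
    using p by (simp_all add: P_def rx_def rz_def matrix_matrix_mult_def sum_3 sa sc field_simps power2_eq_square)
  have pos: "P $ 3 $ 3 > 0" "P $ 1 $ 1 > 0"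
    unfolding e using cos p by (auto intro!: mult_pos_pos add_pos_nonneg)
  have o: "P ** transpose P = mat 1" "transpose P ** P = mat 1" and d: "det P = 1"
    using rot by (auto simp: rotation_matrix_def orthogonal_matrix_def)
  have o1: "P $ 1 $ 1 * P $ 1 $ 1 + P $ 1 $ 3 * P $ 1 $ 3 = 1"
    "P $ 2 $ 1 * P $ 1 $ 1 = 0" "P $ 3 $ 1 * P $ 1 $ 1 + P $ 3 $ 3 * P $ 1 $ 3 = 0"
    using o(1) e by (simp_all add: mat3_simps)
  have o2: "P $ 1 $ 3 * P $ 1 $ 3 + P $ 3 $ 3 * P $ 3 $ 3 = 1" "P $ 3 $ 2 * P $ 3 $ 3 = 0"
    using o(2) e by (simp_all add: mat3_simps)
  have z: "P $ 2 $ 1 = 0" "P $ 3 $ 2 = 0" using o1(2) o2(2) pos by simp_all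
  have le: "\<bar>P $ 1 $ 3\<bar> \<le> 1" using o1(1) by (metis abs_le_square_iff abs_one le_add_same_cancel2 one_power2 power2_eq_square zero_le_square)
  have sb: "sin b = P $ 1 $ 3" using le e(1) by (simp add: b_def abs_le_iff)
  have cb0: "cos b \<ge> 0" using le e(1) by (simp add: b_def cos_arcsin abs_le_iff abs_square_le_1)
  have cb: "cos b = P $ 1 $ 1" "cos b = P $ 3 $ 3"
    using sin_cos_squared_add[of b] o1(1) o2(1) pos cb0 sb
    by (auto simp: power2_eq_square intro!: power2_eq_imp_eq[of "cos b"])
  have "P $ 3 $ 1 * cos b = - sin b * cos b" using o1(3) cb sb by (simp add: algebra_simps)
  then have p31: "P $ 3 $ 1 = - sin b" using cb pos by (metis less_irrefl mult_cancel_right)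
  have *: "cos b * (cos b * P $ 2 $ 2) + sin b * (sin b * P $ 2 $ 2) = 1"
    using d e(2,3) z p31 sb[symmetric] cb[symmetric] by (simp add: det_3 algebra_simps)
  have "P $ 2 $ 2 = P $ 2 $ 2 * ((sin b)\<^sup>2 + (cos b)\<^sup>2)" by (simp only: sin_cos_squared_add mult_1_right)
  also have "\<dots> = cos b * (cos b * P $ 2 $ 2) + sin b * (sin b * P $ 2 $ 2)"
    unfolding power2_eq_square by (simp only: algebra_simps)
  finally have p22: "P $ 2 $ 2 = 1" using * by (simp only:)
  have "P = ry b"
    using e(2,3) z p31 p22 sb cb by (simp add: vec_eq_iff forall_3 ry_def)
  moreover have "rx a ** P ** rz c = R"
  proof -
    have "rx a ** P ** rz c = (rx a ** rx (- a)) ** R ** (rz (- c) ** rz c)"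
      by (simp add: P_def matrix_mul_assoc)
    then show ?thesis by (simp add: rx_add[symmetric] rz_add[symmetric] rx_0 rz_0)
  qed
  ultimately show ?thesis by (simp add: a_def b_def c_def)
qed

lemma rotation_matrix_mult:
  fixes A B :: "real^'n^'n"
  shows "rotation_matrix A \<Longrightarrow> rotation_matrix B \<Longrightarrow> rotation_matrix (A ** B)"
  by (simp add: rotation_matrix_def orthogonal_matrix_mul det_mul)

lemma rotation_matrix_transpose: "rotation_matrix A \<Longrightarrow> rotation_matrix (transpose A)"
  by (simp add: rotation_matrix_def orthogonal_matrix_transpose det_transpose)

lemma rotation_matrix_1: "rotation_matrix (mat 1)"
  by (simp add: rotation_matrix_def orthogonal_matrix_id det_I)

lemma rotation_matrix_inverse:
  "rotation_matrix A \<Longrightarrow> A ** transpose A = mat 1" "rotation_matrix A \<Longrightarrow> transpose A ** A = mat 1"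
  by (simp_all add: rotation_matrix_def orthogonal_matrix_def)

lemma inner_matrix_mult:
  fixes A S T :: "real^'n^'n"
  shows "(A ** S) \<bullet> T = S \<bullet> (transpose A ** T)" "(S ** A) \<bullet> T = S \<bullet> (T ** transpose A)"
proof -
  have "(A ** S) \<bullet> T = (\<Sum>i\<in>UNIV. \<Sum>j\<in>UNIV. \<Sum>k\<in>UNIV. A $ i $ k * S $ k $ j * T $ i $ j)"
    by (simp add: inner_vec_def matrix_matrix_mult_def sum_distrib_right)
  also have "\<dots> = (\<Sum>i\<in>UNIV. \<Sum>k\<in>UNIV. \<Sum>j\<in>UNIV. A $ i $ k * S $ k $ j * T $ i $ j)"
    by (intro sum.cong refl sum.swap)
  also have "\<dots> = (\<Sum>k\<in>UNIV. \<Sum>i\<in>UNIV. \<Sum>j\<in>UNIV. A $ i $ k * S $ k $ j * T $ i $ j)"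
    by (rule sum.swap)
  also have "\<dots> = (\<Sum>k\<in>UNIV. \<Sum>j\<in>UNIV. \<Sum>i\<in>UNIV. A $ i $ k * S $ k $ j * T $ i $ j)"
    by (intro sum.cong refl sum.swap)
  also have "\<dots> = S \<bullet> (transpose A ** T)"
    by (simp add: inner_vec_def matrix_matrix_mult_def transpose_def sum_distrib_left mult_ac)
  finally show "(A ** S) \<bullet> T = S \<bullet> (transpose A ** T)" .
  have "(S ** A) \<bullet> T = (\<Sum>i\<in>UNIV. \<Sum>j\<in>UNIV. \<Sum>k\<in>UNIV. S $ i $ k * A $ k $ j * T $ i $ j)"
    by (simp add: inner_vec_def matrix_matrix_mult_def sum_distrib_right)
  also have "\<dots> = (\<Sum>i\<in>UNIV. \<Sum>k\<in>UNIV. \<Sum>j\<in>UNIV. S $ i $ k * A $ k $ j * T $ i $ j)"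
    by (intro sum.cong refl sum.swap)
  also have "\<dots> = S \<bullet> (T ** transpose A)"
    by (simp add: inner_vec_def matrix_matrix_mult_def transpose_def sum_distrib_left mult_ac)
  finally show "(S ** A) \<bullet> T = S \<bullet> (T ** transpose A)" .
qed

text \<open>The sign of the radius decides the sign of the last diagonal entry in the reduction by
  Euler angles.\<close>

lemma polar_nonneg: "\<exists>r\<ge>0. \<exists>t. x = r * cos t \<and> y = r * sin (t :: real)"
proof -
  obtain r a where ra: "x = r * cos a" "y = r * sin a" using polar_Ex by blast
  show ?thesis
  proof (cases "r \<ge> 0")
    case True
    then show ?thesis using ra by blast
  next
    case False
    then show ?thesis using ra by (intro exI[of _ "- r"] conjI exI[of _ "a + pi"]) auto
  qed
qed

text \<open>Euler angles: a rotation can be brought to the identity by rotations about coordinate axes.\<close>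

lemma rotation_induct:
  fixes R :: "real^3^3"
  assumes R: "rotation_matrix R"
    and x: "\<And>t. Q (rx t)" and z: "\<And>t. Q (rz t)"
    and mult: "\<And>R S. rotation_matrix R \<Longrightarrow> rotation_matrix S \<Longrightarrow> Q R \<Longrightarrow> Q S \<Longrightarrow> Q (R ** S)"
  shows "Q R"
proof -
  obtain r s where rs: "r \<ge> 0" "R $ 2 $ 3 = r * cos s" "R $ 1 $ 3 = r * sin s" using polar_nonneg by blast
  \<comment> \<open>The factor \<open>rz s\<close> clears the entry (1,3) and the factor
    \<open>rx t\<close> below clears (2,3). The third column is then the third basis vector, and a
    rotation about the third axis remains.\<close>
  define R1 where "R1 = rz s ** R"
  have R1: "rotation_matrix R1" unfolding R1_def by (rule rotation_matrix_mult[OF rotation_rz R])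
  have R1_13: "R1 $ 1 $ 3 = 0" by (simp add: R1_def rz_def matrix_matrix_mult_def sum_3 rs)
  obtain r' t where rt: "r' \<ge> 0" "R1 $ 3 $ 3 = r' * cos t" "R1 $ 2 $ 3 = r' * sin t" using polar_nonneg by blast
  define R2 where "R2 = rx t ** R1"
  have R2: "rotation_matrix R2" unfolding R2_def by (rule rotation_matrix_mult[OF rotation_rx R1])
  have R2_3: "R2 $ 1 $ 3 = 0" "R2 $ 2 $ 3 = 0" "R2 $ 3 $ 3 = r' * (cos t * cos t) + r' * (sin t * sin t)"
    by (simp_all add: R2_def rx_def matrix_matrix_mult_def sum_3 rt R1_13 algebra_simps)
  have o: "R2 ** transpose R2 = mat 1" "transpose R2 ** R2 = mat 1" and d: "det R2 = 1"
    using R2 by (auto simp: rotation_matrix_def orthogonal_matrix_def)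
  have "R2 $ 3 $ 3 * R2 $ 3 $ 3 = 1" using o(2) R2_3(1,2) by (simp add: mat3_simps)
  moreover have "R2 $ 3 $ 3 \<ge> 0" unfolding R2_3(3) using rt(1) by simp
  ultimately have "R2 $ 3 $ 3 = 1" using power2_eq_1_iff[of "R2 $ 3 $ 3"] by (auto simp: power2_eq_square)
  then have e: "R2 $ 1 $ 3 = 0" "R2 $ 2 $ 3 = 0" "R2 $ 3 $ 3 = 1" using R2_3 by auto
  have "R2 $ 3 $ 1 = 0" "R2 $ 3 $ 2 = 0" using o(1) e by (simp_all add: mat3_simps)
  moreover have sq: "(R2 $ 1 $ 1)\<^sup>2 + (R2 $ 1 $ 2)\<^sup>2 = 1"
    using o(1) e by (simp add: mat3_simps power2_eq_square)
  moreover have c: "R2 $ 1 $ 1 * R2 $ 2 $ 1 + R2 $ 1 $ 2 * R2 $ 2 $ 2 = 0"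
    "(R2 $ 1 $ 1) * (R2 $ 2 $ 2) - (R2 $ 1 $ 2) * (R2 $ 2 $ 1) = 1"
    using o(1) d e calculation by (simp_all add: mat3_simps det_3)
  moreover have "R2 $ 2 $ 1 = - R2 $ 1 $ 2"
  proof -
    have "R2 $ 2 $ 1 * ((R2 $ 1 $ 1)\<^sup>2 + (R2 $ 1 $ 2)\<^sup>2) =
      R2 $ 1 $ 1 * (R2 $ 1 $ 1 * R2 $ 2 $ 1 + R2 $ 1 $ 2 * R2 $ 2 $ 2)
      - R2 $ 1 $ 2 * (R2 $ 1 $ 1 * R2 $ 2 $ 2 - R2 $ 1 $ 2 * R2 $ 2 $ 1)"
      by (simp add: algebra_simps power2_eq_square)
    then show ?thesis using sq c by simp
  qed
  moreover have "R2 $ 2 $ 2 = R2 $ 1 $ 1"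
  proof -
    have "R2 $ 2 $ 2 * ((R2 $ 1 $ 1)\<^sup>2 + (R2 $ 1 $ 2)\<^sup>2) =
      R2 $ 1 $ 2 * (R2 $ 1 $ 1 * R2 $ 2 $ 1 + R2 $ 1 $ 2 * R2 $ 2 $ 2)
      + R2 $ 1 $ 1 * (R2 $ 1 $ 1 * R2 $ 2 $ 2 - R2 $ 1 $ 2 * R2 $ 2 $ 1)"
      by (simp add: algebra_simps power2_eq_square)
    then show ?thesis using sq c by simp
  qed
  moreover obtain u where "R2 $ 1 $ 1 = cos u" "R2 $ 1 $ 2 = sin u"
    using sincos_total_2pi[OF sq] by metis
  ultimately have "R2 = rz (- u)" using e by (simp add: vec_eq_iff forall_3 rz_def)
  then have "Q R2" using z by simp
  have "R = rz (- s) ** (rx (- t) ** R2)"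
    unfolding R2_def R1_def matrix_mul_assoc
    by (simp add: matrix_mul_assoc[symmetric] rx_add[symmetric] rx_0)
      (simp add: matrix_mul_assoc rz_add[symmetric] rz_0)
  moreover have "Q (rx (- t) ** R2)" by (rule mult[OF rotation_rx R2 x \<open>Q R2\<close>])
  ultimately show ?thesis
    using mult[OF rotation_rz rotation_matrix_mult[OF rotation_rx R2] z] by simp
qed

section \<open>Continuous representations of SO(3)\<close>

locale so3_hom =
  fixes \<rho> :: "real^3^3 \<Rightarrow> real^'n^'n"
  assumes hom_mult: "\<And>R S. rotation_matrix R \<Longrightarrow> rotation_matrix S \<Longrightarrow> \<rho> (R ** S) = \<rho> R ** \<rho> S"
    and hom_one: "\<rho> (mat 1) = mat 1"
    and hom_cont: "continuous_on {R. rotation_matrix R} \<rho>"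
    and hom_rot: "\<And>R. rotation_matrix R \<Longrightarrow> rotation_matrix (\<rho> R)"
begin

text \<open>The image of the velocity of \<open>r\<close> under the derivative of
  \<open>\<rho>\<close>. It is meaningful for one-parameter groups, along which
  \<open>\<rho>\<close> is known to be differentiable.\<close>

definition gen :: "(real \<Rightarrow> real^3^3) \<Rightarrow> real^'n^'n" where
  "gen r = vector_derivative (\<lambda>t. \<rho> (r t)) (at 0)"

definition one_param :: "(real \<Rightarrow> real^3^3) \<Rightarrow> bool" where
  "one_param r \<longleftrightarrow> (\<forall>t. rotation_matrix (r t)) \<and> (\<forall>s t. r (s + t) = r s ** r t) \<and> r 0 = mat 1 \<and> continuous_on UNIV r"

lemma one_param_axes: "one_param rx" "one_param ry" "one_param rz"
  by (simp_all add: one_param_def rotation_rx rotation_ry rotation_rz rx_add ry_add rz_add rx_0 ry_0 rz_0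
      continuous_rx continuous_ry continuous_rz)

context
  fixes r assumes r: "one_param r"
begin

lemma op: "rotation_matrix (r t)" "r (s + t) = r s ** r t" "r 0 = mat 1"
  using r by (simp_all add: one_param_def)

lemma hom_op: "\<rho> (r (s + t)) = \<rho> (r s) ** \<rho> (r t)" "\<rho> (r 0) = mat 1"
  by (simp_all add: op hom_mult hom_one)

lemma gen_derivative:
  "((\<lambda>t. \<rho> (r t)) has_vector_derivative gen r ** \<rho> (r t)) (at t)"
  "((\<lambda>t. \<rho> (r t)) has_vector_derivative \<rho> (r t) ** gen r) (at t)"
proof -
  have c: "continuous_on UNIV (\<lambda>t. \<rho> (r t))"
    by (rule continuous_on_compose2[OF hom_cont]) (use r in \<open>auto simp: one_param_def\<close>)
  obtain A where A: "\<And>t. ((\<lambda>t. \<rho> (r t)) has_vector_derivative A ** \<rho> (r t)) (at t)"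
    "\<And>t. ((\<lambda>t. \<rho> (r t)) has_vector_derivative \<rho> (r t) ** A) (at t)"
    using one_parameter_group_derivative[OF c hom_op] by blast
  have "gen r = A" using vector_derivative_at[OF A(1)[of 0]] by (simp add: gen_def hom_op)
  then show "((\<lambda>t. \<rho> (r t)) has_vector_derivative gen r ** \<rho> (r t)) (at t)"
    "((\<lambda>t. \<rho> (r t)) has_vector_derivative \<rho> (r t) ** gen r) (at t)" using A by simp_all
qed

lemma gen_derivative_0: "((\<lambda>t. \<rho> (r t)) has_vector_derivative gen r) (at 0)"
  using gen_derivative(1)[of 0] by (simp add: hom_op)

lemma gen_skew: "transpose (gen r) = - gen r"
proof -
  have bl: "bounded_linear (transpose :: real^'n^'n \<Rightarrow> real^'n^'n)"
    unfolding linear_conv_bounded_linear[symmetric]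
    by (rule linearI) (simp_all add: transpose_def vec_eq_iff)
  have "((\<lambda>t. \<rho> (r t) ** transpose (\<rho> (r t))) has_vector_derivative
      (\<rho> (r 0) ** transpose (gen r) + gen r ** transpose (\<rho> (r 0)))) (at 0)"
    by (rule has_vector_derivative_matrix_mult[OF gen_derivative_0
        bounded_linear.has_vector_derivative[OF bl gen_derivative_0]])
  moreover have "(\<lambda>t. \<rho> (r t) ** transpose (\<rho> (r t))) = (\<lambda>t. mat 1)"
    by (simp add: rotation_matrix_inverse hom_rot op)
  ultimately have "((\<lambda>t. mat 1 :: real^'n^'n) has_vector_derivative transpose (gen r) + gen r) (at 0)"
    by (simp add: hom_op transpose_mat)
  then have "transpose (gen r) + gen r = 0"
    using vector_derivative_unique_at has_vector_derivative_const by blast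
  then show ?thesis by (simp add: eq_neg_iff_add_eq_0)
qed

lemma gen_rotates:
  assumes "gen r *v x = m *\<^sub>R y" "gen r *v y = - m *\<^sub>R x"
  shows "\<rho> (r t) *v x = cos (m * t) *\<^sub>R x + sin (m * t) *\<^sub>R y"
  by (rule one_parameter_group_rotates[of "\<lambda>t. \<rho> (r t)", OF hom_op gen_derivative(2) assms])

end

text \<open>The bracket is the derivative in s of the conjugate of \<open>gen rx\<close> by \<rho>
  (rz s). To identify this conjugate, the curve rz s rx t rz (- s) must be differentiated in t after
  applying \<open>\<rho>\<close> in a second way. As \<open>\<rho>\<close> is differentiable only
  along one-parameter groups, the curve is factored into rotations about the three axes, whose
  angles are explicit functions of t.\<close>

lemma gen_comm_zx: "gen rz ** gen rx - gen rx ** gen rz = gen ry"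
proof -
  note ax = one_param_axes
  have Ad: "\<rho> (rz s) ** gen rx ** \<rho> (rz (- s)) = cos s *\<^sub>R gen rx + sin s *\<^sub>R gen ry" for s
  proof -
    define W where "W t = rz s ** rx t ** rz (- s)" for t
    have Wrot: "rotation_matrix (W t)" for t
      unfolding W_def by (intro rotation_matrix_mult rotation_rz rotation_rx)
    have \<rho>W: "\<rho> (W t) = \<rho> (rz s) ** \<rho> (rx t) ** \<rho> (rz (- s))" for t
      by (simp add: W_def hom_mult rotation_matrix_mult rotation_rz rotation_rx)
    have d1: "((\<lambda>t. \<rho> (W t)) has_vector_derivative \<rho> (rz s) ** gen rx ** \<rho> (rz (- s))) (at 0)"
      unfolding \<rho>W by (intro has_vector_derivative_matrix_mult_const gen_derivative_0 ax)
    define a where "a t = arctan (cos s * sin t / cos t)" for t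
    define b where "b t = arcsin (sin s * sin t)" for t
    define c where "c t = arctan (- (sin s * cos s * (1 - cos t)) / (cos s * cos s + sin s * sin s * cos t))" for t
    have We: "W t $ 1 $ 3 = sin s * sin t" "W t $ 2 $ 3 = - cos s * sin t" "W t $ 3 $ 3 = cos t"
      "W t $ 1 $ 1 = cos s * cos s + sin s * sin s * cos t" "W t $ 1 $ 2 = sin s * cos s * (1 - cos t)" for t
      by (simp_all add: W_def rz_def rx_def matrix_matrix_mult_def sum_3 algebra_simps)
    have cs: "cos s * cos s + sin s * sin s = 1" using sin_cos_squared_add2[of s] by (simp add: power2_eq_square)
    have \<rho>W': "\<rho> (W t) = \<rho> (rx (a t)) ** \<rho> (ry (b t)) ** \<rho> (rz (c t))" if t: "t \<in> {-pi/2<..<pi/2}" for t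
    proof -
      have ct: "cos t > 0" using t by (intro cos_gt_zero_pi) auto
      have p: "W t $ 1 $ 1 > 0"
      proof (cases "cos s = 0")
        case True
        then have "sin s * sin s = 1" using cs by simp
        then show ?thesis unfolding We using True ct by simp
      next
        case False
        then have "cos s * cos s > 0" using not_real_square_gt_zero by blast
        moreover have "sin s * sin s * cos t \<ge> 0" using ct by simp
        ultimately show ?thesis unfolding We by linarith
      qed
      have "W t = rx (a t) ** ry (b t) ** rz (c t)"
        using tait_bryan[OF Wrot p] ct unfolding We a_def b_def c_def by simp
      then show ?thesis by (simp add: hom_mult rotation_matrix_mult rotation_rz rotation_rx rotation_ry)
    qed
    \<comment> \<open>The curve rotates about the axis (cos s, sin s, 0), and its angles start with
      these components as velocities.\<close>
    have da: "(a has_real_derivative cos s) (at 0)"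
      unfolding a_def by (auto intro!: derivative_eq_intros)
    have db: "(b has_real_derivative sin s) (at 0)"
      unfolding b_def by (auto intro!: derivative_eq_intros)
    have dc: "(c has_real_derivative 0) (at 0)"
      unfolding c_def using cs by (auto intro!: derivative_eq_intros)
    have abc0: "a 0 = 0" "b 0 = 0" "c 0 = 0" by (simp_all add: a_def b_def c_def)
    have ch: "((\<lambda>t. \<rho> (r (f t))) has_vector_derivative D *\<^sub>R gen r) (at 0)"
      if "one_param r" "(f has_real_derivative D) (at 0)" "f 0 = 0" for r f D
      using vector_diff_chain_at[of f D 0 "\<lambda>t. \<rho> (r t)" "gen r"] gen_derivative_0[OF that(1)] that(2,3)
      by (simp add: has_real_derivative_iff_has_vector_derivative o_def)
    have "((\<lambda>t. \<rho> (rx (a t)) ** \<rho> (ry (b t)) ** \<rho> (rz (c t))) has_vector_derivative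
       (\<rho> (rx (a 0)) ** \<rho> (ry (b 0))) ** (0 *\<^sub>R gen rz) +
       (\<rho> (rx (a 0)) ** (sin s *\<^sub>R gen ry) + (cos s *\<^sub>R gen rx) ** \<rho> (ry (b 0))) ** \<rho> (rz (c 0))) (at 0)"
      by (intro has_vector_derivative_matrix_mult ch ax da db dc abc0)
    then have "((\<lambda>t. \<rho> (rx (a t)) ** \<rho> (ry (b t)) ** \<rho> (rz (c t))) has_vector_derivative
       cos s *\<^sub>R gen rx + sin s *\<^sub>R gen ry) (at 0)"
      by (simp add: abc0 rx_0 ry_0 rz_0 hom_one matrix_mult_simps add.commute)
    then have "((\<lambda>t. \<rho> (W t)) has_vector_derivative cos s *\<^sub>R gen rx + sin s *\<^sub>R gen ry) (at 0)"
      by (rule has_vector_derivative_transform_within_open[of _ _ _ "{-pi/2<..<pi/2}"])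
        (use \<rho>W' in auto)
    then show ?thesis by (rule vector_derivative_unique_at[OF d1])
  qed
  have neg: "((\<lambda>s. \<rho> (rz (- s))) has_vector_derivative - gen rz) (at 0)"
    using vector_diff_chain_at[of uminus "-1" 0 "\<lambda>t. \<rho> (rz t)" "gen rz"] gen_derivative_0[OF ax(3)]
    by (simp add: o_def has_vector_derivative_minus[OF has_vector_derivative_id, simplified])
  have "((\<lambda>s. \<rho> (rz s) ** gen rx ** \<rho> (rz (- s))) has_vector_derivative
      (\<rho> (rz 0) ** gen rx) ** (- gen rz) + (gen rz ** gen rx) ** \<rho> (rz (- 0))) (at 0)"
    by (intro has_vector_derivative_matrix_mult has_vector_derivative_matrix_mult_const(2)
        gen_derivative_0 ax neg)
  then have 1: "((\<lambda>s. \<rho> (rz s) ** gen rx ** \<rho> (rz (- s))) has_vector_derivative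
      (gen rz ** gen rx - gen rx ** gen rz)) (at 0)"
    by (simp add: rz_0 hom_one matrix_mult_simps)
  have "((\<lambda>s. cos s *\<^sub>R gen rx + sin s *\<^sub>R gen ry) has_vector_derivative gen ry) (at 0)"
    by (auto intro!: derivative_eq_intros simp: has_real_derivative_iff_has_vector_derivative[symmetric])
  then show ?thesis using vector_derivative_unique_at[OF 1[unfolded Ad]] by blast
qed

end

text \<open>The cyclic permutation of the axes. Composing \<open>\<rho>\<close> with conjugation by
  it turns the one bracket relation computed by hand into the two others.\<close>

definition cyc :: "real^3^3" where
  "cyc = vector [vector [0, 0, 1], vector [1, 0, 0], vector [0, 1, 0]]"

lemma cyc: "rotation_matrix cyc" "cyc ** rx t ** transpose cyc = ry t"
  "cyc ** ry t ** transpose cyc = rz t" "cyc ** rz t ** transpose cyc = rx t"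
  by (simp_all add: cyc_def rotation_matrix_def orthogonal_matrix_def mat3_simps det_3 rx_def ry_def rz_def)

context so3_hom
begin

definition \<rho>c where "\<rho>c R = \<rho> (cyc ** R ** transpose cyc)"

lemma so3_hom_cyc: "so3_hom \<rho>c"
proof
  note c = cyc(1) rotation_matrix_transpose[OF cyc(1)]
  show "\<rho>c (R ** S) = \<rho>c R ** \<rho>c S" if R: "rotation_matrix R" and S: "rotation_matrix S" for R S
  proof -
    have "cyc ** (R ** S) ** transpose cyc = cyc ** R ** (transpose cyc ** cyc) ** S ** transpose cyc"
      by (simp add: rotation_matrix_inverse(2)[OF cyc(1)] matrix_mul_assoc)
    then have "cyc ** (R ** S) ** transpose cyc = (cyc ** R ** transpose cyc) ** (cyc ** S ** transpose cyc)"
      by (simp add: matrix_mul_assoc)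
    then show ?thesis unfolding \<rho>c_def
      by (simp add: hom_mult rotation_matrix_mult c R S)
  qed
  show "\<rho>c (mat 1) = mat 1" by (simp add: \<rho>c_def rotation_matrix_inverse(1)[OF cyc(1)] hom_one)
  show "rotation_matrix (\<rho>c R)" if "rotation_matrix R" for R
    unfolding \<rho>c_def by (intro hom_rot rotation_matrix_mult c that)
  have "bounded_linear (\<lambda>R. cyc ** R ** transpose cyc)"
    by (intro bounded_linear_compose[OF bounded_bilinear.bounded_linear_left[OF bounded_bilinear_matrix_mult]
      bounded_bilinear.bounded_linear_right[OF bounded_bilinear_matrix_mult]])
  then have "continuous_on {R. rotation_matrix R} (\<lambda>R. cyc ** R ** transpose cyc)"
    by (rule linear_continuous_on)
  then show "continuous_on {R. rotation_matrix R} \<rho>c" unfolding \<rho>c_def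
    by (rule continuous_on_compose2[OF hom_cont]) (auto intro: rotation_matrix_mult c)
qed

lemma gen_cyc: "so3_hom.gen \<rho>c rx = gen ry" "so3_hom.gen \<rho>c ry = gen rz" "so3_hom.gen \<rho>c rz = gen rx"
  by (simp_all add: so3_hom.gen_def[OF so3_hom_cyc] gen_def \<rho>c_def cyc)

lemma gen_comm_xy: "gen rx ** gen ry - gen ry ** gen rx = gen rz"
  using so3_hom.gen_comm_zx[OF so3_hom_cyc] by (simp add: gen_cyc)

lemma gen_comm_yz: "gen ry ** gen rz - gen rz ** gen ry = gen rx"
  using so3_hom.gen_comm_xy[OF so3_hom_cyc] by (simp add: gen_cyc)

lemma skew_inner: "transpose A = - A \<Longrightarrow> (A *v x) \<bullet> y = - (x \<bullet> (A *v (y :: real^'n)))"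
  by (metis (no_types, opaque_lifting) dot_lmul_matrix inner_commute inner_minus_right matrix_vector_mult_simps(5) transpose_matrix_vector transpose_transpose)

sublocale vec: so3_rep "(*v) (gen rx)" "(*v) (gen ry)" "(*v) (gen rz)"
proof (rule so3_rep.intro)
  show "gen rx *v (gen ry *v x) - gen ry *v (gen rx *v x) = gen rz *v x"
    "gen ry *v (gen rz *v x) - gen rz *v (gen ry *v x) = gen rx *v x"
    "gen rz *v (gen rx *v x) - gen rx *v (gen rz *v x) = gen ry *v x" for x
    by (simp_all add: matrix_vector_mul_assoc matrix_vector_mult_simps(3)[symmetric]
        gen_comm_xy gen_comm_yz gen_comm_zx)
qed (intro matrix_vector_mul_linear skew_inner gen_skew one_param_axes)+

abbreviation ad where "ad A S \<equiv> A ** S - S ** A"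

lemma ad_inner:
  fixes A S T :: "real^'n^'n"
  assumes "transpose A = - A"
  shows "ad A S \<bullet> T = - (S \<bullet> ad A T)"
proof -
  have "(A ** S) \<bullet> T = - (S \<bullet> (A ** T))" "(S ** A) \<bullet> T = - (S \<bullet> (T ** A))"
    using inner_matrix_mult(1)[of A S T] inner_matrix_mult(2)[of S A T] assms
    by (simp_all add: matrix_mult_simps)
  then show ?thesis by (simp add: inner_diff_left inner_diff_right)
qed

lemma ad_jacobi: "ad A (ad B S) - ad B (ad A S) = ad (A ** B - B ** A) (S :: real^'n^'n)"
  by (simp add: matrix_mult_simps matrix_mul_assoc)

text \<open>The infinitesimal form of the action of \<rho> (R) on matrices by conjugation; the
  bracket relations are the Jacobi identity.\<close>

sublocale mat: so3_rep "ad (gen rx)" "ad (gen ry)" "ad (gen rz)"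
proof (rule so3_rep.intro)
  show "ad (gen rx) (ad (gen ry) S) - ad (gen ry) (ad (gen rx) S) = ad (gen rz) S"
    "ad (gen ry) (ad (gen rz) S) - ad (gen rz) (ad (gen ry) S) = ad (gen rx) S"
    "ad (gen rz) (ad (gen rx) S) - ad (gen rx) (ad (gen rz) S) = ad (gen ry) S" for S
    unfolding ad_jacobi gen_comm_xy gen_comm_yz gen_comm_zx by (rule refl)+
  show "linear (ad (gen rx))" "linear (ad (gen ry))" "linear (ad (gen rz))"
    by (rule linearI; simp add: matrix_mult_simps scaleR_diff_right)+
qed (intro ad_inner gen_skew one_param_axes)+

end

section \<open>Classification of the faithful five-dimensional representations\<close>

lemma exhaust_5: "x = 1 \<or> x = 2 \<or> x = 3 \<or> x = 4 \<or> x = (5::5)"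
proof (induct x)
  case (of_int z)
  then have "z = 0 \<or> z = 1 \<or> z = 2 \<or> z = 3 \<or> z = 4" by fastforce
  then show ?case by auto
qed

lemma forall_5: "(\<forall>i::5. P i) \<longleftrightarrow> P 1 \<and> P 2 \<and> P 3 \<and> P 4 \<and> P 5"
  by (metis exhaust_5)

lemma UNIV_5: "UNIV = {1, 2, 3, 4, 5::5}"
  using exhaust_5 by auto

lemma sum_5: "sum f (UNIV::5 set) = f 1 + f 2 + f 3 + f 4 + f 5"
  unfolding UNIV_5 by (simp add: ac_simps)

lemma prod_5: "prod f (UNIV::5 set) = f 1 * f 2 * f 3 * f 4 * f 5"
  unfolding UNIV_5 by (simp add: ac_simps)

lemma vector_5 [simp]:
  "(vector [a, b, c, d, e] :: ('a::zero)^5) $ 1 = a"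
  "(vector [a, b, c, d, e] :: ('a::zero)^5) $ 2 = b"
  "(vector [a, b, c, d, e] :: ('a::zero)^5) $ 3 = c"
  "(vector [a, b, c, d, e] :: ('a::zero)^5) $ 4 = d"
  "(vector [a, b, c, d, e] :: ('a::zero)^5) $ 5 = e"
  unfolding vector_def by simp_all

context so3_rep
begin

text \<open>The two equations say that the raising operator B1 + i B2 annihilates x + i y.\<close>

lemma casimir_of_highest_weight:
  assumes w: "weight m x y" and "B1 x = B2 y" "B1 y = - B2 x"
  shows "casimir x = (m * (m + 1)) *\<^sub>R x"
proof -
  have "B1 (B1 x) = - B2 (B2 x) - m *\<^sub>R x"
    using comm'(1)[of y] assms by (simp add: weight_def lin_simps)
  then have "B1 (B1 x) + B2 (B2 x) = - (m *\<^sub>R x)" by simp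
  then have "casimir x = - (- (m *\<^sub>R x) + B3 (B3 x))" unfolding casimir_def by (simp only:)
  then show ?thesis using weight_square[OF w] by (simp add: power2_eq_square algebra_simps)
qed

text \<open>The inequality on all of \<open>U\<close> is kept beside the eigenspace: for
  \<open>c = 0\<close> it shows, by \<open>casimir_le_0\<close>, that the generators annihilate the
  whole of \<open>U\<close>.\<close>

lemma max_casimir:
  assumes U: "invariant U" "U \<noteq> {0}"
  obtains c W where "W \<subseteq> U" "invariant W" "W \<noteq> {0}" "\<And>x. x \<in> W \<Longrightarrow> casimir x = c *\<^sub>R x"
    "\<And>y. y \<in> U \<Longrightarrow> casimir y \<bullet> y \<le> c * (y \<bullet> y)"
proof -
  have sub: "subspace U" using U(1) by (simp add: invariant_def)
  obtain x c where x: "x \<in> U" "norm x = 1" "casimir x = c *\<^sub>R x" "\<And>y. y \<in> U \<Longrightarrow> casimir y \<bullet> y \<le> c * (y \<bullet> y)"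
    using self_adjoint_max_eigenvector[OF linear_casimir casimir_self_adjoint sub U(2) invariant_casimir[OF U(1)]]
    by blast
  let ?W = "{x \<in> U. casimir x = c *\<^sub>R x}"
  have "x \<in> ?W" "x \<noteq> 0" using x(1-3) by auto
  then have "?W \<noteq> {0}" by blast
  then show ?thesis using that[of ?W c] invariant_eigenspace[OF U(1)] x(4) by blast
qed

lemma casimir_le_0:
  assumes "casimir y \<bullet> y \<le> 0"
  shows "B1 y = 0" "B2 y = 0" "B3 y = 0"
proof -
  have "B1 y \<bullet> B1 y + B2 y \<bullet> B2 y + B3 y \<bullet> B3 y \<le> 0" using assms by (simp add: casimir_inner)
  moreover have "B1 y \<bullet> B1 y \<ge> 0" "B2 y \<bullet> B2 y \<ge> 0" "B3 y \<bullet> B3 y \<ge> 0" by simp_all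
  ultimately have "B1 y \<bullet> B1 y = 0" "B2 y \<bullet> B2 y = 0" "B3 y \<bullet> B3 y = 0" by linarith+
  then show "B1 y = 0" "B2 y = 0" "B3 y = 0" by simp_all
qed

text \<open>The standard basis of the three-dimensional representation, found from a vector of weight zero.\<close>

lemma casimir_2_basis:
  assumes W: "invariant W" "W \<noteq> {0}" and c: "\<And>x. x \<in> W \<Longrightarrow> casimir x = 2 *\<^sub>R x"
  obtains x y w where "x \<in> W" "y \<in> W" "w \<in> W" "x \<bullet> x = 1" "y \<bullet> y = 1" "w \<bullet> w = 1"
    "x \<bullet> y = 0" "x \<bullet> w = 0" "y \<bullet> w = 0"
    "B1 x = 0" "B1 y = w" "B1 w = - y" "B2 x = - w" "B2 y = 0" "B2 w = x"
    "B3 x = y" "B3 y = - x" "B3 w = 0"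
proof -
  have sub: "subspace W" and inv: "\<And>x. x \<in> W \<Longrightarrow> B1 x \<in> W" "\<And>x. x \<in> W \<Longrightarrow> B2 x \<in> W" "\<And>x. x \<in> W \<Longrightarrow> B3 x \<in> W"
    using W(1) by (auto simp: invariant_def)
  obtain m a b where m: "m \<ge> 0" "2 = m * (m + 1)" "a \<in> W" "b \<in> W" "weight m a b" "a \<noteq> 0"
    using top_weight[OF W c] by blast
  have "(m - 1) * (m + 2) = 0" using m(2) by (simp add: algebra_simps)
  then have m1: "m = 1" using m(1) by auto
  have w0: "weight 0 (B1 a + B2 b) (B1 b - B2 a)" using weight_lower[OF m(5)] m1 by simp
  have "(B1 a + B2 b) \<bullet> (B1 a + B2 b) + (B1 b - B2 a) \<bullet> (B1 b - B2 a) = 2 * (a \<bullet> a + b \<bullet> b)"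
    using weight_norms(2)[OF m(5) c[OF m(3)] c[OF m(4)]] m1 by simp
  moreover have "a \<bullet> a + b \<bullet> b > 0" using m(6) by (intro add_pos_nonneg) auto
  ultimately have "B1 a + B2 b \<noteq> 0 \<or> B1 b - B2 a \<noteq> 0" by auto
  moreover have "B1 a + B2 b \<in> W" "B1 b - B2 a \<in> W"
    using inv m(3,4) subspace_add[OF sub] subspace_diff[OF sub] by auto
  moreover have "B3 (B1 a + B2 b) = 0" "B3 (B1 b - B2 a) = 0" using w0 by (simp_all add: weight_def)
  ultimately obtain u where u: "u \<in> W" "u \<noteq> 0" "B3 u = 0" by blast
  define w where "w = (1 / norm u) *\<^sub>R u"
  have w: "w \<in> W" "w \<bullet> w = 1" "B3 w = 0"
    using u subspace_scale[OF sub] by (simp_all add: w_def lin_simps dot_square_norm power2_eq_square)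
  \<comment> \<open>Modelled on the cross product with w = e3, where e2 x e3 = e1 and - (e1 x e3) =
    e2.\<close>
  define x where "x = B2 w"
  define y where "y = - B1 w"
  have xy: "x \<in> W" "y \<in> W" using inv w(1) subspace_neg[OF sub] by (simp_all add: x_def y_def)
  have B3: "B3 x = y" "B3 y = - x" using w(3) by (simp_all add: x_def y_def comm'' lin_simps)
  have wt: "weight 1 x y" using B3 by (simp add: weight_def)
  \<comment> \<open>The coefficient c - m^2 - m of the raised vector is 2 - 1 - 1 = 0.\<close>
  have "(B1 x - B2 y) \<bullet> (B1 x - B2 y) + (B1 y + B2 x) \<bullet> (B1 y + B2 x) = 0"
    using weight_norms(1)[OF wt c[OF xy(1)] c[OF xy(2)]] by simp
  then have "(B1 x - B2 y) \<bullet> (B1 x - B2 y) = 0" "(B1 y + B2 x) \<bullet> (B1 y + B2 x) = 0"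
    by (smt (verit) inner_ge_zero)+
  then have E: "B1 x = B2 y" "B1 y = - B2 x" by (simp_all add: eq_neg_iff_add_eq_0)
  have c12: "B1 (B2 w) = B2 (B1 w)" using comm'(1)[of w] w(3) by simp
  have "B1 (B2 w) = - B2 (B1 w)" using E(1) by (simp add: x_def y_def lin_simps)
  then have "B1 (B2 w) + B1 (B2 w) = 0" using c12 by (metis add.left_inverse)
  then have "2 *\<^sub>R B1 (B2 w) = 0" by (simp only: scaleR_2)
  then have z: "B1 x = 0" "B2 y = 0" using E(1) by (simp_all add: x_def)
  have "B1 (B1 w) = B2 (B2 w)" using E(2) by (simp add: x_def y_def lin_simps)
  moreover have "- (B1 (B1 w) + B2 (B2 w)) = 2 *\<^sub>R w"
    using c[OF w(1)] w(3) by (simp add: casimir_def lin_simps)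
  ultimately have "2 *\<^sub>R (- B1 (B1 w)) = 2 *\<^sub>R w" "2 *\<^sub>R (- B2 (B2 w)) = 2 *\<^sub>R w"
    by (simp_all add: scaleR_2)
  then have "- B1 (B1 w) = w" "- B2 (B2 w) = w" unfolding scaleR_cancel_left by auto
  then have BB: "B1 y = w" "B2 x = - w" by (simp_all add: x_def y_def lin_simps minus_equation_iff)
  have "x \<bullet> x = 1" using skew(2)[of w x] BB(2) w(2) by (simp add: x_def[symmetric])
  moreover have "y \<bullet> y = 1" "x \<bullet> y = 0" using weight_orth[OF wt] calculation by simp_all
  moreover have "x \<bullet> w = 0" using skew(2)[of w w] by (simp add: x_def inner_commute)
  moreover have "y \<bullet> w = 0" using skew(1)[of w w] by (simp add: y_def inner_commute)
  moreover have "B1 w = - y" "B2 w = x" by (simp_all add: x_def y_def)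
  ultimately show ?thesis using that[OF xy w(1)] w BB z B3 by blast
qed

end

context so3_hom
begin

text \<open>This is where SO(3) differs from its double cover: the rotation by 2 pi is the identity,
  hence cos (2 pi m) = 1.\<close>

lemma weight_integer:
  assumes w: "vec.weight m x y" and "x \<noteq> 0" "m \<ge> 0"
  obtains l :: nat where "m = real l"
proof (cases "m = 0")
  case True
  then show ?thesis using that[of 0] by simp
next
  case False
  have "rz (2 * pi) = mat 1" by (simp add: rz_def mat3_simps)
  then have "x = cos (m * (2 * pi)) *\<^sub>R x + sin (m * (2 * pi)) *\<^sub>R y"
    using gen_rotates[OF one_param_axes(3), of x m y "2 * pi"] w by (simp add: vec.weight_def hom_one)
  then have "x \<bullet> x = (cos (m * (2 * pi)) *\<^sub>R x + sin (m * (2 * pi)) *\<^sub>R y) \<bullet> x" by (rule arg_cong)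
  also have "\<dots> = cos (m * (2 * pi)) * (x \<bullet> x)"
    using vec.weight_orth(2)[OF w False] by (simp add: inner_add_right inner_add_left inner_commute)
  finally have "x \<bullet> x = cos (m * (2 * pi)) * (x \<bullet> x)" .
  then have "cos (m * (2 * pi)) = 1" using assms(2) by simp
  then obtain k :: int where "m * (2 * pi) = real_of_int k * 2 * pi" using cos_one_2pi_int by blast
  then have "m = real_of_int k" by simp
  then show ?thesis using that[of "nat k"] assms(3) by simp
qed

lemma max_casimir_integer:
  assumes U: "vec.invariant U" "U \<noteq> {0}"
  obtains l :: nat and W where "W \<subseteq> U" "vec.invariant W" "W \<noteq> {0}"
    "\<And>x. x \<in> W \<Longrightarrow> vec.casimir x = (real l * (real l + 1)) *\<^sub>R x"
    "\<And>y. y \<in> U \<Longrightarrow> vec.casimir y \<bullet> y \<le> (real l * (real l + 1)) * (y \<bullet> y)" "2 * l + 1 \<le> dim W"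
proof -
  obtain c W where W: "W \<subseteq> U" "vec.invariant W" "W \<noteq> {0}" "\<And>x. x \<in> W \<Longrightarrow> vec.casimir x = c *\<^sub>R x"
    "\<And>y. y \<in> U \<Longrightarrow> vec.casimir y \<bullet> y \<le> c * (y \<bullet> y)"
    by (rule vec.max_casimir[OF U]) (rule that)
  obtain m x y where m: "m \<ge> 0" "c = m * (m + 1)" "x \<in> W" "y \<in> W" "vec.weight m x y" "x \<noteq> 0"
    by (rule vec.top_weight[OF W(2,3)], erule W(4), rule that)
  obtain l :: nat where l: "m = real l" by (rule weight_integer[OF m(5,6,1)]) (rule that)
  have "2 * l + 1 \<le> dim W"
    by (rule vec.dim_invariant_ge[OF W(2,3)]) (use W(4) m(2) l in simp)
  then show ?thesis
    by (rule that[OF W(1,2,3), rotated 2]) (use W(4,5) m(2) l in simp_all)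
qed

end

lemma block3_mult: "block3 (A ** B) = block3 A ** block3 B"
  by (simp add: block3_def vec_eq_iff forall_5 matrix_matrix_mult_def sum_5 sum_3)

text \<open>A reflection that commutes with the block subgroup; it corrects the determinant of a
  conjugating orthogonal matrix.\<close>

lemma diag5_commutes:
  fixes D :: "real^5^5"
  assumes "D = (\<chi> i j. if i = j then (if i = 5 then -1 else 1) else 0)"
  shows "D ** block3 A = block3 A ** D" "orthogonal_matrix D" "det D = -1"
proof -
  show "D ** block3 A = block3 A ** D"
    by (simp add: assms block3_def vec_eq_iff forall_5 matrix_matrix_mult_def sum_5)
  show "orthogonal_matrix D"
    by (simp add: assms orthogonal_matrix_def vec_eq_iff forall_5 matrix_matrix_mult_def sum_5 mat_def transpose_def)
  have "det D = prod (\<lambda>i. D $ i $ i) UNIV" by (rule det_diagonal) (simp add: assms)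
  also have "\<dots> = -1" unfolding prod_5 by (simp add: assms)
  finally show "det D = -1" .
qed

text \<open>A five-dimensional representation contains the irreducible representation of spin \<open>l\<close> with
  \<open>c = l (l + 1)\<close> the largest Casimir eigenvalue; \<open>2 l + 1 \<le> 5\<close> leaves \<open>l = 1\<close> and \<open>l = 2\<close>.\<close>

theorem so3_hom_5_cases:
  fixes \<rho> :: "real^3^3 \<Rightarrow> real^5^5"
  assumes "so3_hom \<rho>" and inj: "inj_on \<rho> {R. rotation_matrix R}"
  shows "(\<exists>g. rotation_matrix g \<and> (\<forall>R. rotation_matrix R \<longrightarrow> \<rho> R ** g = g ** block3 R)) \<or>
    (\<forall>x. so3_rep.casimir ((*v) (so3_hom.gen \<rho> rx)) ((*v) (so3_hom.gen \<rho> ry)) ((*v) (so3_hom.gen \<rho> rz)) x = 6 *\<^sub>R x)"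
proof -
  interpret so3_hom \<rho> by fact
  have UNIV: "vec.invariant UNIV" "(UNIV :: (real^5) set) \<noteq> {0}"
    using UNIV_not_singleton by (simp_all add: vec.invariant_def)
  obtain l :: nat and W where W0: "W \<subseteq> UNIV" and W: "vec.invariant W" "W \<noteq> {0}"
    "\<And>x. x \<in> W \<Longrightarrow> vec.casimir x = (real l * (real l + 1)) *\<^sub>R x"
    "\<And>y. y \<in> UNIV \<Longrightarrow> vec.casimir y \<bullet> y \<le> (real l * (real l + 1)) * (y \<bullet> y)" "2 * l + 1 \<le> dim W"
    by (rule max_casimir_integer[OF UNIV]) (rule that)
  have dW: "dim W \<le> 5" using dim_subset_UNIV[of W] by simp
  then consider "l = 0" | "l = 1" | "l = 2" using W(5) by linarith
  then show ?thesis
  proof cases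
    case 1
    \<comment> \<open>Spin 0: the Casimir form is nonpositive everywhere, so the generators vanish
      and the half turn acts trivially, against injectivity.\<close>
    have "gen rz *v y = 0" for y using vec.casimir_le_0(3)[of y] W(4)[of y] 1 by simp
    then have "\<rho> (rz pi) *v y = y" for y
      using gen_rotates[OF one_param_axes(3), of y 0 0 pi] by (simp add: matrix_vector_mult_simps)
    then have "\<rho> (rz pi) = \<rho> (mat 1)" by (simp add: matrix_eq hom_one)
    then have "rz pi = mat 1" using inj rotation_rz rotation_matrix_1 by (auto simp: inj_on_def)
    then have "rz pi $ 1 $ 1 = (1::real)" by (simp add: mat_def)
    then show ?thesis by (simp add: rz_def)
  next
    case 2
    have c2: "vec.casimir x = 2 *\<^sub>R x" if "x \<in> W" for x using W(3)[OF that] 2 by simp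
    obtain x y w where b: "x \<in> W" "y \<in> W" "w \<in> W" "x \<bullet> x = 1" "y \<bullet> y = 1" "w \<bullet> w = 1"
      "x \<bullet> y = 0" "x \<bullet> w = 0" "y \<bullet> w = 0"
      "gen rx *v x = 0" "gen rx *v y = w" "gen rx *v w = - y" "gen ry *v x = - w" "gen ry *v y = 0"
      "gen ry *v w = x" "gen rz *v x = y" "gen rz *v y = - x" "gen rz *v w = 0"
      by (rule vec.casimir_2_basis[OF W(1,2)], erule c2, rule that)
    \<comment> \<open>The orthogonal complement of the spin 1 part; it is invariant because the
      generators are skew.\<close>
    define P where "P = {v. v \<bullet> x = 0 \<and> v \<bullet> y = 0 \<and> v \<bullet> w = 0}"
    have subP: "subspace P" unfolding P_def by (auto simp: subspace_def inner_add_left)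
    have P: "vec.invariant P" unfolding vec.invariant_def
      using subP by (auto simp: P_def vec.skew b)
    have "P = {v \<in> UNIV. \<forall>u\<in>span {x, y, w}. orthogonal u v}"
    proof (intro equalityI subsetI)
      fix v assume v: "v \<in> P"
      have "orthogonal v u" if "u \<in> span {x, y, w}" for u
        by (rule orthogonal_to_span[OF that]) (use v in \<open>auto simp: P_def orthogonal_def\<close>)
      then show "v \<in> {v \<in> UNIV. \<forall>u\<in>span {x, y, w}. orthogonal u v}" by (auto simp: orthogonal_commute)
    next
      fix v assume "v \<in> {v \<in> UNIV. \<forall>u\<in>span {x, y, w}. orthogonal u v}"
      then show "v \<in> P" using span_base[of _ "{x, y, w}"] by (auto simp: P_def orthogonal_def inner_commute)
    qed
    moreover have "dim (span {x, y, w}) = 3"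
    proof -
      have ne: "x \<noteq> y" "x \<noteq> w" "y \<noteq> w" using b(4-9) by auto
      have "pairwise orthogonal {x, y, w}"
        using b(7-9) by (auto simp: pairwise_def orthogonal_def inner_commute)
      moreover have "0 \<notin> {x, y, w}" using b(4-6) by auto
      ultimately have "independent {x, y, w}" by (rule pairwise_orthogonal_independent)
      then show ?thesis using ne by (simp add: dim_eq_card_independent)
    qed
    ultimately have dP: "dim P = 2"
      using dim_subspace_orthogonal_to_vectors[of "span {x, y, w}" "UNIV :: (real^5) set"] by simp
    then have "P \<noteq> {0}" by auto
    obtain l' :: nat and W' where W': "W' \<subseteq> P" and "vec.invariant W'" "W' \<noteq> {0}"
      "\<And>x. x \<in> W' \<Longrightarrow> vec.casimir x = (real l' * (real l' + 1)) *\<^sub>R x"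
      and W'': "\<And>y. y \<in> P \<Longrightarrow> vec.casimir y \<bullet> y \<le> (real l' * (real l' + 1)) * (y \<bullet> y)" "2 * l' + 1 \<le> dim W'"
      by (rule max_casimir_integer[OF P \<open>P \<noteq> {0}\<close>]) (rule that)
    \<comment> \<open>A constituent of spin at least 1 would have dimension at least 3, so the
      complement carries spin 0 only.\<close>
    have "dim W' \<le> 2" using dim_subset[OF W'] dP by simp
    then have "l' = 0" using W''(2) by linarith
    then have P0: "gen rx *v v = 0" "gen ry *v v = 0" "gen rz *v v = 0" if "v \<in> P" for v
      using vec.casimir_le_0[of v] W''(1)[OF that] by simp_all
    obtain B where B: "B \<subseteq> P" "pairwise orthogonal B" "\<And>v. v \<in> B \<Longrightarrow> norm v = 1" "independent B" "card B = dim P"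
      using orthonormal_basis_subspace[OF subP] by metis
    obtain p q where pq: "B = {p, q}" "p \<noteq> q" using B(5) dP by (metis card_2_iff)
    have pq': "p \<in> P" "q \<in> P" "p \<bullet> p = 1" "q \<bullet> q = 1" "p \<bullet> q = 0"
      using B(1-3) pq by (auto simp: dot_square_norm pairwise_def orthogonal_def)
    define e :: "5 \<Rightarrow> real^5" where
      "e j = (if j = 1 then x else if j = 2 then y else if j = 3 then w else if j = 4 then p else q)" for j
    have e: "e 1 = x" "e 2 = y" "e 3 = w" "e 4 = p" "e 5 = q" by (simp_all add: e_def)
    define g :: "real^5^5" where "g = (\<chi> i j. e j $ i)"
    have "transpose g ** g = (\<chi> i j. e i \<bullet> e j)"
      by (simp add: g_def vec_eq_iff matrix_matrix_mult_def transpose_def inner_vec_def)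
    also have "\<dots> = mat 1"
      using b(4-9) pq' by (simp add: vec_eq_iff forall_5 e mat_def P_def inner_commute)
    finally have og: "orthogonal_matrix g" by (simp add: orthogonal_matrix)
    \<comment> \<open>The columns of \<open>g\<close> are the vectors \<open>e j\<close>, so an
      intertwining relation may be checked on them.\<close>
    have col: "M ** g = g ** N" if "\<And>j. M *v e j = (\<Sum>k\<in>UNIV. N $ k $ j *\<^sub>R e k)" for M N :: "real^5^5"
    proof -
      have "(M ** g) $ i $ j = (M *v e j) $ i" for i j
        by (simp add: g_def matrix_matrix_mult_def matrix_vector_mult_def)
      moreover have "(g ** N) $ i $ j = (\<Sum>k\<in>UNIV. N $ k $ j *\<^sub>R e k) $ i" for i j
        by (simp add: g_def matrix_matrix_mult_def mult.commute)
      ultimately show ?thesis using that by (simp add: vec_eq_iff)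
    qed
    have fix0: "\<rho> (r t) *v v = v" if "one_param r" "gen r *v v = 0" for r t v
      using gen_rotates[OF that(1), of v 0 0 t] that(2) by (simp add: matrix_vector_mult_simps)
    have rot1: "\<rho> (r t) *v u = cos t *\<^sub>R u + sin t *\<^sub>R v" "\<rho> (r t) *v v = cos t *\<^sub>R v - sin t *\<^sub>R u"
      if "one_param r" "gen r *v u = v" "gen r *v v = - u" for r t u v
      using gen_rotates[OF that(1), of u 1 v t] gen_rotates[OF that(1), of v 1 "- u" t] that(2,3)
      by (simp_all add: matrix_vector_mult_simps)
    note ax = one_param_axes
    have gx: "\<rho> (rx t) ** g = g ** block3 (rx t)" for t
    proof (rule col)
      fix j
      have "\<forall>j. \<rho> (rx t) *v e j = (\<Sum>k\<in>UNIV. block3 (rx t) $ k $ j *\<^sub>R e k)"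
        unfolding forall_5 e sum_5
        using fix0[OF ax(1) b(10), of t] rot1[OF ax(1) b(11,12), of t]
          fix0[OF ax(1) P0(1)[OF pq'(1)], of t] fix0[OF ax(1) P0(1)[OF pq'(2)], of t]
        by (simp add: block3_def rx_def)
      then show "\<rho> (rx t) *v e j = (\<Sum>k\<in>UNIV. block3 (rx t) $ k $ j *\<^sub>R e k)" by blast
    qed
    have gz: "\<rho> (rz t) ** g = g ** block3 (rz t)" for t
    proof (rule col)
      fix j
      have "\<forall>j. \<rho> (rz t) *v e j = (\<Sum>k\<in>UNIV. block3 (rz t) $ k $ j *\<^sub>R e k)"
        unfolding forall_5 e sum_5
        using fix0[OF ax(3) b(18), of t] rot1[OF ax(3) b(16,17), of t]
          fix0[OF ax(3) P0(3)[OF pq'(1)], of t] fix0[OF ax(3) P0(3)[OF pq'(2)], of t]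
        by (simp add: block3_def rz_def)
      then show "\<rho> (rz t) *v e j = (\<Sum>k\<in>UNIV. block3 (rz t) $ k $ j *\<^sub>R e k)" by blast
    qed
    have gR: "\<rho> R ** g = g ** block3 R" if "rotation_matrix R" for R
    proof (rule rotation_induct[OF that gx gz])
      fix R S assume R: "rotation_matrix R" and S: "rotation_matrix S"
        and IH: "\<rho> R ** g = g ** block3 R" "\<rho> S ** g = g ** block3 S"
      have "\<rho> (R ** S) ** g = \<rho> R ** (\<rho> S ** g)" by (simp add: hom_mult[OF R S] matrix_mul_assoc)
      also have "\<dots> = (\<rho> R ** g) ** block3 S" by (simp add: IH(2) matrix_mul_assoc)
      finally show "\<rho> (R ** S) ** g = g ** block3 (R ** S)" by (simp add: IH(1) block3_mult matrix_mul_assoc)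
    qed
    \<comment> \<open>The orthonormal basis may have the wrong orientation; reversing its last
      vector does not disturb the block form.\<close>
    define D :: "real^5^5" where "D = (\<chi> i j. if i = j then (if i = 5 then -1 else 1) else 0)"
    note D = diag5_commutes[OF D_def]
    have "det g = 1 \<or> det g = -1" using det_orthogonal_matrix[OF og] .
    then show ?thesis
    proof
      assume "det g = 1"
      then show ?thesis using og gR by (auto simp: rotation_matrix_def)
    next
      assume "det g = -1"
      then have "rotation_matrix (g ** D)"
        using D(3) orthogonal_matrix_mul[OF og D(2)] by (simp add: rotation_matrix_def det_mul)
      moreover have "\<rho> R ** (g ** D) = (g ** D) ** block3 R" if "rotation_matrix R" for R
      proof -
        have "\<rho> R ** (g ** D) = g ** (block3 R ** D)" by (simp add: matrix_mul_assoc gR[OF that])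
        then show ?thesis by (simp add: D(1)[symmetric] matrix_mul_assoc)
      qed
      ultimately show ?thesis by blast
    qed
  next
    case 3
    \<comment> \<open>Spin 2 already needs five dimensions, and its Casimir value is 2 * 3 =
      6.\<close>
    then have "dim W = DIM(real^5)" using W(5) dW by simp
    then have "W = UNIV" using W(1) by (metis dim_eq_full span_eq_iff vec.invariant_def)
    then show ?thesis using W(3) 3 by simp
  qed
qed

section \<open>The adjoint action on skew-symmetric matrices\<close>

lemma transpose_simps:
  fixes A B :: "real^'n^'n"
  shows "transpose (A - B) = transpose A - transpose B" "transpose (A + B) = transpose A + transpose B"
    "transpose (- A) = - transpose A" "transpose (r *\<^sub>R A) = r *\<^sub>R transpose A"
  by (simp_all add: transpose_def vec_eq_iff)

definition outer :: "real^'n \<Rightarrow> real^'n \<Rightarrow> real^'n^'n" where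
  "outer a b = (\<chi> i j. a $ i * b $ j)"

text \<open>The skew matrix of the bivector a wedge b under the isomorphism of the second exterior
  power with so(n); commutation with a skew matrix acts on it as a derivation.\<close>

definition wedge :: "real^'n \<Rightarrow> real^'n \<Rightarrow> real^'n^'n" where
  "wedge a b = outer a b - outer b a"

lemma outer_mult: "A ** outer a b = outer (A *v a) b" "outer a b ** A = outer a (transpose A *v b)"
  by (simp_all add: outer_def vec_eq_iff matrix_matrix_mult_def matrix_vector_mult_def transpose_def
      sum_distrib_left sum_distrib_right mult_ac)

lemma outer_bilinear:
  "outer (a + b) c = outer a c + outer b c" "outer c (a + b) = outer c a + outer c b"
  "outer (r *\<^sub>R a) c = r *\<^sub>R outer a c" "outer c (r *\<^sub>R a) = r *\<^sub>R outer c a"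
  "outer (- a) c = - outer a c" "outer c (- a) = - outer c a"
  by (simp_all add: outer_def vec_eq_iff algebra_simps)

lemma wedge_bilinear:
  "wedge (a + b) c = wedge a c + wedge b c" "wedge c (a + b) = wedge c a + wedge c b"
  "wedge (r *\<^sub>R a) c = r *\<^sub>R wedge a c" "wedge c (r *\<^sub>R a) = r *\<^sub>R wedge c a"
  "wedge (- a) c = - wedge a c" "wedge c (- a) = - wedge c a"
  by (simp_all add: wedge_def outer_bilinear algebra_simps)

lemma outer_vector: "outer a b *v c = (b \<bullet> c) *\<^sub>R a"
  by (simp add: outer_def vec_eq_iff matrix_vector_mult_def inner_vec_def sum_distrib_left mult_ac)

lemma wedge_vector: "wedge a b *v c = (b \<bullet> c) *\<^sub>R a - (a \<bullet> c) *\<^sub>R b"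
  by (simp add: wedge_def matrix_vector_mult_simps outer_vector)

lemma wedge_skew: "transpose (wedge a b) = - wedge a b"
  by (simp add: wedge_def outer_def transpose_def vec_eq_iff)

lemma ad_wedge:
  assumes "transpose A = - A"
  shows "A ** wedge a b - wedge a b ** A = wedge (A *v a) b + wedge a (A *v b)"
  by (simp add: wedge_def matrix_mult_simps outer_mult assms matrix_vector_mult_simps outer_bilinear)

abbreviation skew5 :: "(real^5^5) set" where "skew5 \<equiv> {B. transpose B = - B}"

lemma subspace_skew: "subspace {B :: real^'n^'n. transpose B = - B}"
proof (rule subspaceI)
  fix c and B :: "real^'n^'n" assume "B \<in> {B. transpose B = - B}"
  then have "transpose B = - B" by simp
  moreover have "transpose (c *\<^sub>R B) = c *\<^sub>R transpose B" by (simp add: transpose_def vec_eq_iff)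
  ultimately show "c *\<^sub>R B \<in> {B. transpose B = - B}" by simp
qed (simp_all add: transpose_simps, simp add: transpose_def vec_eq_iff)

text \<open>The reverse inequality will come from two invariant subspaces of dimensions at least 3
  and 7.\<close>

lemma dim_skew5_le: "dim skew5 \<le> 10"
proof -
  let ?w = "\<lambda>(i, j). wedge (axis i 1) (axis j 1) :: real^5^5"
  let ?P = "{(1, 2), (1, 3), (1, 4), (1, 5), (2, 3), (2, 4), (2, 5), (3, 4), (3, 5), (4, 5 :: 5)} :: (5 \<times> 5) set"
  have "skew5 \<subseteq> span (?w ` ?P)"
  proof
    fix B assume "B \<in> skew5"
    then have T: "transpose B = - B" by simp
    have sk: "B $ j $ i = - B $ i $ j" for i j
      using arg_cong[OF T, of "\<lambda>A. A $ i $ j"] by (simp add: transpose_def)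
    have sk0: "B $ i $ i = 0" for i using sk[of i i] by linarith
    have "B = B $ 1 $ 2 *\<^sub>R ?w (1, 2) + B $ 1 $ 3 *\<^sub>R ?w (1, 3) + B $ 1 $ 4 *\<^sub>R ?w (1, 4) + B $ 1 $ 5 *\<^sub>R ?w (1, 5)
      + B $ 2 $ 3 *\<^sub>R ?w (2, 3) + B $ 2 $ 4 *\<^sub>R ?w (2, 4) + B $ 2 $ 5 *\<^sub>R ?w (2, 5)
      + B $ 3 $ 4 *\<^sub>R ?w (3, 4) + B $ 3 $ 5 *\<^sub>R ?w (3, 5) + B $ 4 $ 5 *\<^sub>R ?w (4, 5)"
      unfolding vec_eq_iff forall_5
      using sk[of 1 2] sk[of 1 3] sk[of 1 4] sk[of 1 5] sk[of 2 3] sk[of 2 4]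
        sk[of 2 5] sk[of 3 4] sk[of 3 5] sk[of 4 5]
      by (simp add: sk0 wedge_def outer_def axis_def)
    also have "\<dots> \<in> span (?w ` ?P)"
      by (intro span_add span_scale span_base imageI insertI1 insertI2)
    finally show "B \<in> span (?w ` ?P)" .
  qed
  then have "dim skew5 \<le> card (?w ` ?P)" by (rule dim_le_card) (intro finite_imageI finite.intros)
  also have "\<dots> \<le> card ?P" by (rule card_image_le) (intro finite.intros)
  also have "\<dots> \<le> 10" by (simp add: card_insert_if)
  finally show ?thesis .
qed

text \<open>6 = 2 (2 + 1): all of R^5 has spin 2, so no nonzero invariant subspace is smaller than
  R^5.\<close>

locale so3_irred5 = so3_hom \<rho> for \<rho> :: "real^3^3 \<Rightarrow> real^5^5" +
  assumes casimir6: "vec.casimir x = 6 *\<^sub>R x"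
begin

definition isotropy :: "(real^5^5) set" where
  "isotropy = span {gen rx, gen ry, gen rz}"

text \<open>12 = 3 (3 + 1): the spin 3 part of so(5), which will model the tangent space at the base
  point.\<close>

definition spin3 :: "(real^5^5) set" where
  "spin3 = {B \<in> skew5. mat.casimir B = 12 *\<^sub>R B}"

lemmas gens_skew = gen_skew[OF one_param_axes(1)] gen_skew[OF one_param_axes(2)] gen_skew[OF one_param_axes(3)]

lemma ad_skew5: "transpose A = - A \<Longrightarrow> B \<in> skew5 \<Longrightarrow> ad A B \<in> skew5" for A B :: "real^5^5"
  by (simp add: transpose_simps matrix_transpose_mul matrix_mult_simps)

lemma invariant_skew5: "mat.invariant skew5"
  unfolding mat.invariant_def using subspace_skew ad_skew5 gens_skew by blast

lemma invariant_spin3: "mat.invariant spin3"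
  unfolding spin3_def by (rule mat.invariant_eigenspace[OF invariant_skew5])

lemma isotropy_subset: "isotropy \<subseteq> skew5"
  unfolding isotropy_def by (rule span_minimal[OF _ subspace_skew]) (simp add: gens_skew)

text \<open>The generators transform among themselves as in the adjoint representation of so(3),
  which has spin 1, and 2 = 1 (1 + 1).\<close>

lemma casimir_isotropy:
  assumes "B \<in> isotropy"
  shows "mat.casimir B = 2 *\<^sub>R B"
proof -
  have c: "ad (gen rx) (gen ry) = gen rz" "ad (gen ry) (gen rz) = gen rx" "ad (gen rz) (gen rx) = gen ry"
    "ad (gen ry) (gen rx) = - gen rz" "ad (gen rz) (gen ry) = - gen rx" "ad (gen rx) (gen rz) = - gen ry"
    using gen_comm_xy gen_comm_yz gen_comm_zx by (simp_all add: algebra_simps)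
  have n: "ad A (- B) = - ad A B" for A B :: "real^5^5" by (simp add: matrix_mult_simps)
  have g: "mat.casimir (gen rx) = 2 *\<^sub>R gen rx" "mat.casimir (gen ry) = 2 *\<^sub>R gen ry"
    "mat.casimir (gen rz) = 2 *\<^sub>R gen rz"
    unfolding mat.casimir_def c n by (simp_all add: scaleR_2)
  have "subspace {B. mat.casimir B = 2 *\<^sub>R B}"
    using mat.linear_casimir by (auto simp: subspace_def linear_add linear_cmul linear_0 algebra_simps)
  then have "isotropy \<subseteq> {B. mat.casimir B = 2 *\<^sub>R B}"
    unfolding isotropy_def by (intro span_minimal) (auto simp: g)
  then show ?thesis using assms by blast
qed

lemma invariant_isotropy: "mat.invariant isotropy"
proof -
  have c: "ad (gen rx) (gen ry) = gen rz" "ad (gen ry) (gen rz) = gen rx" "ad (gen rz) (gen rx) = gen ry"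
    "ad (gen ry) (gen rx) = - gen rz" "ad (gen rz) (gen ry) = - gen rx" "ad (gen rx) (gen rz) = - gen ry"
    using gen_comm_xy gen_comm_yz gen_comm_zx by (simp_all add: algebra_simps)
  have b: "gen rx \<in> isotropy" "gen ry \<in> isotropy" "gen rz \<in> isotropy"
    unfolding isotropy_def by (simp_all add: span_base)
  have sub: "subspace isotropy" by (simp add: isotropy_def)
  have m: "f ` isotropy \<subseteq> isotropy" if "linear f" "f (gen rx) \<in> isotropy" "f (gen ry) \<in> isotropy" "f (gen rz) \<in> isotropy"
    for f :: "real^5^5 \<Rightarrow> real^5^5"
  proof -
    have "f ` isotropy = span (f ` {gen rx, gen ry, gen rz})" unfolding isotropy_def by (rule linear_span_image[OF that(1), symmetric])
    also have "\<dots> \<subseteq> isotropy" by (rule span_minimal[OF _ sub]) (use that in auto)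
    finally show ?thesis .
  qed
  have neg: "- B \<in> isotropy" if "B \<in> isotropy" for B using that sub by (simp add: subspace_neg)
  have "ad (gen rx) ` isotropy \<subseteq> isotropy" "ad (gen ry) ` isotropy \<subseteq> isotropy" "ad (gen rz) ` isotropy \<subseteq> isotropy"
    by (rule m[OF mat.lin(1)], simp_all add: c b neg subspace_0[OF sub])
      (rule m[OF mat.lin(2)], simp_all add: c b neg subspace_0[OF sub],
       rule m[OF mat.lin(3)], simp_all add: c b neg subspace_0[OF sub])
  then show ?thesis unfolding mat.invariant_def using sub by blast
qed

lemma gen_nonzero: "\<not> (gen rx = 0 \<and> gen ry = 0 \<and> gen rz = 0)"
proof
  assume "gen rx = 0 \<and> gen ry = 0 \<and> gen rz = 0"
  then have "vec.casimir (axis 1 1) = 0" unfolding vec.casimir_def by (simp add: matrix_vector_mult_simps)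
  then have "(axis 1 1 :: real^5) = 0" using casimir6 by simp
  then show False by (simp add: axis_eq_0_iff)
qed

text \<open>Independence of the generators without computation: a nonzero invariant space with
  Casimir value 2 has dimension at least 3.\<close>

lemma dim_isotropy: "3 \<le> dim isotropy"
proof -
  have "isotropy \<noteq> {0}"
    using gen_nonzero span_base[of _ "{gen rx, gen ry, gen rz}"] unfolding isotropy_def by blast
  then show ?thesis
    using mat.dim_invariant_ge[OF invariant_isotropy, of 1] casimir_isotropy by simp
qed

text \<open>The highest weight vector of \<open>\<Lambda>\<^sup>2\<close> of the spin 2 representation is \<open>v\<^sub>2 \<and> v\<^sub>1\<close>.\<close>

lemma spin3_nonzero: "spin3 \<noteq> {0}"
proof -
  have UNIV: "vec.invariant UNIV" "(UNIV :: (real^5) set) \<noteq> {0}"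
    using UNIV_not_singleton by (simp_all add: vec.invariant_def)
  obtain m x2 y2 where m: "m \<ge> 0" "6 = m * (m + 1)" "x2 \<in> UNIV" "y2 \<in> UNIV" "vec.weight m x2 y2" "x2 \<noteq> 0"
    by (rule vec.top_weight[OF UNIV casimir6]) (rule that)
  have "(m - 2) * (m + 3) = 0" using m(2) by (simp add: algebra_simps)
  then have w2: "vec.weight 2 x2 y2" using m(1,5) by auto
  define x1 where "x1 = gen rx *v x2 + gen ry *v y2"
  define y1 where "y1 = gen rx *v y2 - gen ry *v x2"
  have w1: "vec.weight 1 x1 y1" using vec.weight_lower[OF w2] by (simp add: x1_def y1_def)
  have "(gen rx *v x2 - gen ry *v y2) \<bullet> (gen rx *v x2 - gen ry *v y2)
      + (gen rx *v y2 + gen ry *v x2) \<bullet> (gen rx *v y2 + gen ry *v x2) = 0"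
    using vec.weight_norms(1)[OF w2 casimir6 casimir6] by simp
  then have "(gen rx *v x2 - gen ry *v y2) \<bullet> (gen rx *v x2 - gen ry *v y2) = 0"
    "(gen rx *v y2 + gen ry *v x2) \<bullet> (gen rx *v y2 + gen ry *v x2) = 0"
    by (smt (verit) inner_ge_zero)+
  then have E2: "gen rx *v x2 = gen ry *v y2" "gen rx *v y2 = - (gen ry *v x2)"
    by (simp_all add: eq_neg_iff_add_eq_0)
  \<comment> \<open>The factor 4 = 6 - 2^2 + 2 is the norm coefficient for lowering from weight
    2.\<close>
  have "x1 \<bullet> x1 + y1 \<bullet> y1 = 4 * (x2 \<bullet> x2 + y2 \<bullet> y2)"
    using vec.weight_norms(2)[OF w2 casimir6 casimir6] by (simp add: x1_def y1_def)
  moreover have "x1 \<bullet> x1 = y1 \<bullet> y1" using vec.weight_orth(1)[OF w1] by simp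
  moreover have "x2 \<bullet> x2 + y2 \<bullet> y2 > 0" using m(6) by (intro add_pos_nonneg) auto
  ultimately have "x1 \<bullet> x1 + x1 \<bullet> x1 > 0" by simp
  then have x1: "x1 \<bullet> x1 > 0" by linarith
  have B3: "gen rz *v x2 = 2 *\<^sub>R y2" "gen rz *v y2 = - 2 *\<^sub>R x2" "gen rz *v x1 = y1" "gen rz *v y1 = - x1"
    using w1 w2 by (simp_all add: vec.weight_def)
  have cas: "gen rx *v (gen rx *v v) + gen ry *v (gen ry *v v) = - (6 *\<^sub>R v) - gen rz *v (gen rz *v v)" for v
    unfolding casimir6[symmetric] vec.casimir_def by (simp add: algebra_simps)
  \<comment> \<open>Raising the lowered vector returns - 4 times the top vector: with z2 = x2 + i y2
    and z1 = x1 + i y1 the two equations say E z1 = - 4 z2.\<close>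
  have E1: "gen rx *v x1 - gen ry *v y1 = - 4 *\<^sub>R x2" "gen rx *v y1 + gen ry *v x1 = - 4 *\<^sub>R y2"
  proof -
    have "gen rx *v x1 - gen ry *v y1 = (gen rx *v (gen rx *v x2) + gen ry *v (gen ry *v x2)) +
        (gen rx *v (gen ry *v y2) - gen ry *v (gen rx *v y2))"
      by (simp add: x1_def y1_def matrix_vector_mult_simps algebra_simps)
    also have "\<dots> = - (6 *\<^sub>R x2) - gen rz *v (gen rz *v x2) + gen rz *v y2" unfolding cas vec.comm(1) ..
    also have "\<dots> = - 4 *\<^sub>R x2" by (simp add: B3 matrix_vector_mult_simps vec_eq_iff)
    finally show "gen rx *v x1 - gen ry *v y1 = - 4 *\<^sub>R x2" .
    have "gen rx *v y1 + gen ry *v x1 = (gen rx *v (gen rx *v y2) + gen ry *v (gen ry *v y2)) -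
        (gen rx *v (gen ry *v x2) - gen ry *v (gen rx *v x2))"
      by (simp add: x1_def y1_def matrix_vector_mult_simps algebra_simps)
    also have "\<dots> = - (6 *\<^sub>R y2) - gen rz *v (gen rz *v y2) - gen rz *v x2" unfolding cas vec.comm(1) ..
    also have "\<dots> = - 4 *\<^sub>R y2" by (simp add: B3 matrix_vector_mult_simps vec_eq_iff)
    finally show "gen rx *v y1 + gen ry *v x1 = - 4 *\<^sub>R y2" .
  qed
  \<comment> \<open>\<open>S\<close> and \<open>T\<close> are the real and the imaginary part of z2
    wedge z1, a bivector of weight 2 + 1 = 3.\<close>
  define S where "S = wedge x2 x1 - wedge y2 y1"
  define T where "T = wedge x2 y1 + wedge y2 x1"
  have adw: "ad A (wedge a b) = wedge (A *v a) b + wedge a (A *v b)" if "transpose A = - A" for A and a b :: "real^5"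
    by (rule ad_wedge[OF that])
  have add: "ad A (P + Q) = ad A P + ad A Q" "ad A (P - Q) = ad A P - ad A Q" for A P Q :: "real^5^5"
    by (simp_all add: matrix_mult_simps)
  have w3: "mat.weight 3 S T"
    unfolding mat.weight_def S_def T_def add adw[OF gens_skew(3)] B3 wedge_bilinear
    by (simp add: vec_eq_iff)
  \<comment> \<open>As E acts by the product rule, E (z2 wedge z1) = E z2 wedge z1 + z2 wedge E z1 =
    - 4 z2 wedge z2 = 0. The real part is computed here, the imaginary part below.\<close>
  have "ad (gen rx) S - ad (gen ry) T =
     wedge (gen rx *v x2 - gen ry *v y2) x1 - wedge (gen rx *v y2 + gen ry *v x2) y1
     + wedge x2 (gen rx *v x1 - gen ry *v y1) - wedge y2 (gen rx *v y1 + gen ry *v x1)"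
    unfolding S_def T_def add adw[OF gens_skew(1)] adw[OF gens_skew(2)]
    by (simp add: wedge_def outer_def vec_eq_iff algebra_simps)
  then have h1: "ad (gen rx) S = ad (gen ry) T"
    unfolding E1 E2 by (simp add: wedge_bilinear wedge_def outer_def vec_eq_iff)
  have "ad (gen rx) T + ad (gen ry) S =
     wedge (gen rx *v x2 - gen ry *v y2) y1 + wedge (gen rx *v y2 + gen ry *v x2) x1
     + wedge x2 (gen rx *v y1 + gen ry *v x1) + wedge y2 (gen rx *v x1 - gen ry *v y1)"
    unfolding S_def T_def add adw[OF gens_skew(1)] adw[OF gens_skew(2)]
    by (simp add: wedge_def outer_def vec_eq_iff algebra_simps)
  then have "ad (gen rx) T + ad (gen ry) S = 0"
    unfolding E1 E2 by (simp add: wedge_bilinear wedge_def outer_def vec_eq_iff)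
  then have h2: "ad (gen rx) T = - ad (gen ry) S" by (simp only: eq_neg_iff_add_eq_0)
  have "mat.casimir S = 12 *\<^sub>R S"
    using mat.casimir_of_highest_weight[OF w3 h1 h2] by simp
  moreover have "S \<in> skew5"
    using subspace_diff[OF subspace_skew] wedge_skew unfolding S_def by blast
  ultimately have "S \<in> spin3" by (simp add: spin3_def)
  moreover have "S \<noteq> 0"
  proof
    assume "S = 0"
    then have "S *v x1 = 0" by (simp add: matrix_vector_mult_simps)
    \<comment> \<open>The vectors \<open>x1\<close>, \<open>y1\<close>, \<open>x2\<close> and
      \<open>y2\<close> are orthogonal to each other, so one term of \<open>S\<close> survives on
      \<open>x1\<close>.\<close>
    moreover have "S *v x1 = (x1 \<bullet> x1) *\<^sub>R x2"
      unfolding S_def using vec.weight_distinct_orth[OF w2 w1] vec.weight_orth(2)[OF w1]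
      by (simp add: matrix_vector_mult_simps wedge_vector inner_commute)
    ultimately show False using x1 m(6) by simp
  qed
  ultimately show ?thesis by blast
qed

lemma dim_spin3: "7 \<le> dim spin3"
  using mat.dim_invariant_ge[OF invariant_spin3 spin3_nonzero, of 3] by (simp add: spin3_def)

lemma spin3_isotropy: "spin3 \<inter> isotropy \<subseteq> {0}"
proof
  fix B assume "B \<in> spin3 \<inter> isotropy"
  then have "12 *\<^sub>R B = 2 *\<^sub>R B" using casimir_isotropy[of B] by (simp add: spin3_def)
  then have "10 *\<^sub>R B = 0" by (simp add: algebra_simps flip: scaleR_diff_left)
  then show "B \<in> {0}" by simp
qed

lemma subspace_spin3: "subspace spin3" and subspace_isotropy: "subspace isotropy"
  using invariant_spin3 invariant_isotropy by (simp_all add: mat.invariant_def)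

text \<open>The two subspaces meet in 0 because their Casimir values differ, have dimensions at
  least 3 and 7, and lie in a space of dimension at most 10; so all three bounds are
  attained.\<close>

lemma skew5_decomposition:
  shows "skew5 = {x + y |x y. x \<in> isotropy \<and> y \<in> spin3}" and "dim spin3 \<le> 7"
proof -
  let ?S = "{x + y |x y. x \<in> isotropy \<and> y \<in> spin3}"
  have sub: "subspace ?S" by (rule subspace_sums[OF subspace_isotropy subspace_spin3])
  have "?S \<subseteq> skew5"
  proof
    fix B assume "B \<in> ?S"
    then obtain x y where "B = x + y" "x \<in> isotropy" "y \<in> spin3" by blast
    moreover have "x \<in> skew5" "y \<in> skew5" using calculation isotropy_subset by (auto simp: spin3_def)
    ultimately show "B \<in> skew5" using subspace_add[OF subspace_skew] by blast
  qed
  have "isotropy \<inter> spin3 = {0}"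
    using spin3_isotropy subspace_0[OF subspace_spin3] subspace_0[OF subspace_isotropy] by blast
  then have d: "dim ?S = dim isotropy + dim spin3"
    using dim_sums_Int[OF subspace_isotropy subspace_spin3] by simp
  have le: "dim ?S \<le> dim skew5" by (rule dim_subset) fact
  then show "dim spin3 \<le> 7" using d dim_isotropy dim_skew5_le by linarith
  have "dim skew5 \<le> dim ?S" using d dim_isotropy dim_spin3 dim_skew5_le by linarith
  then show "skew5 = ?S" using subspace_dim_equal[OF sub subspace_skew \<open>?S \<subseteq> skew5\<close>] by simp
qed

text \<open>Such a \<open>W\<close> is the sum of \<open>isotropy\<close> and its intersection with
  \<open>spin3\<close>. If the intersection is nonzero, it is invariant with Casimir value 12, hence
  has dimension at least 7 and is all of \<open>spin3\<close>.\<close>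

theorem invariant_over_isotropy:
  assumes W: "mat.invariant W" "W \<subseteq> skew5" "isotropy \<subseteq> W"
  shows "W = isotropy \<or> W = skew5"
proof -
  have subW: "subspace W" using W(1) by (simp add: mat.invariant_def)
  have inv: "mat.invariant (W \<inter> spin3)"
    using W(1) invariant_spin3 subspace_inter by (auto simp: mat.invariant_def)
  have dec: "\<exists>x y. w = x + y \<and> x \<in> isotropy \<and> y \<in> W \<inter> spin3" if "w \<in> W" for w
  proof -
    have "w \<in> skew5" using that W(2) by blast
    then obtain x y where xy: "w = x + y" "x \<in> isotropy" "y \<in> spin3" using skew5_decomposition(1) by blast
    then have "y = w - x" by simp
    then have "y \<in> W" using subspace_diff[OF subW that] xy(2) W(3) by blast
    then show ?thesis using xy by blast
  qed
  show ?thesis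
  proof (cases "W \<inter> spin3 = {0}")
    case True
    then have "W \<subseteq> isotropy" using dec by force
    then show ?thesis using W(3) by blast
  next
    case False
    have "7 \<le> dim (W \<inter> spin3)"
      using mat.dim_invariant_ge[OF inv False, of 3] by (simp add: spin3_def)
    then have "dim spin3 \<le> dim (W \<inter> spin3)" using skew5_decomposition(2) by simp
    then have "W \<inter> spin3 = spin3"
      using subspace_dim_equal[OF _ subspace_spin3, of "W \<inter> spin3"] inv by (simp add: mat.invariant_def)
    then have "skew5 \<subseteq> W" unfolding skew5_decomposition(1)
      using subspace_add[OF subW] W(3) by blast
    then show ?thesis using W(2) by blast
  qed
qed

end

section \<open>Homogeneous spaces of SO(n)\<close>

lemma carrier_SO: "carrier SO = {A. rotation_matrix A}"
  and mult_SO: "A \<otimes>\<^bsub>SO\<^esub> B = A ** B" and one_SO: "\<one>\<^bsub>SO\<^esub> = mat 1"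
  by (simp_all add: SO_def)

lemma group_SO: "group (SO :: (real^'n^'n) monoid)"
proof (rule groupI)
  fix A :: "real^'n^'n" assume "A \<in> carrier SO"
  then show "\<exists>B\<in>carrier SO. B \<otimes>\<^bsub>SO\<^esub> A = \<one>\<^bsub>SO\<^esub>"
    using rotation_matrix_transpose[of A] rotation_matrix_inverse(2)[of A]
    by (intro bexI[of _ "transpose A"]) (simp_all add: carrier_SO mult_SO one_SO)
qed (simp_all add: carrier_SO mult_SO one_SO rotation_matrix_mult rotation_matrix_1 matrix_mul_assoc)

section \<open>The Cayley transform\<close>

lemma skew_inner_self:
  fixes B :: "real^'n^'n"
  assumes "transpose B = - B"
  shows "(B *v x) \<bullet> x = 0"
proof -
  have "(B *v x) \<bullet> x = x \<bullet> (transpose B *v x)"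
    by (metis dot_lmul_matrix inner_commute transpose_matrix_vector)
  then show ?thesis using assms by (simp add: matrix_vector_mult_simps inner_commute)
qed

text \<open>The Cayley transform gives a curve in \<open>SO(n)\<close> through the identity with prescribed velocity.\<close>

definition cayley :: "real^'n^'n \<Rightarrow> real \<Rightarrow> real^'n^'n" where
  "cayley B t = matrix_inv (mat 1 - (t / 2) *\<^sub>R B) ** (mat 1 + (t / 2) *\<^sub>R B)"

lemma matrix_inv_inverse:
  fixes A :: "real^'n^'n"
  assumes "invertible A"
  shows "A ** matrix_inv A = mat 1" "matrix_inv A ** A = mat 1"
  using someI_ex[OF assms[unfolded invertible_def]] by (simp_all add: matrix_inv_def)

lemma invertible_one_minus_skew:
  fixes B :: "real^'n^'n"
  assumes "transpose B = - B"
  shows "invertible (mat 1 - s *\<^sub>R B)"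
proof -
  have "x = 0" if "(mat 1 - s *\<^sub>R B) *v x = 0" for x
  proof -
    have "x = s *\<^sub>R (B *v x)" using that by (simp add: matrix_vector_mult_simps)
    then have "x \<bullet> x = s * ((B *v x) \<bullet> x)" by (metis inner_scaleR_left)
    then show ?thesis using skew_inner_self[OF assms, of x] by simp
  qed
  then show ?thesis
    unfolding invertible_left_inverse matrix_left_invertible_ker by blast
qed

lemma cayley_props:
  fixes B :: "real^'n^'n"
  assumes B: "transpose B = - B"
  shows "(mat 1 - (t / 2) *\<^sub>R B) ** cayley B t = mat 1 + (t / 2) *\<^sub>R B"
    and "rotation_matrix (cayley B t)" and "cayley B 0 = mat 1"
proof -
  let ?P = "mat 1 - (t / 2) *\<^sub>R B" and ?Q = "mat 1 + (t / 2) *\<^sub>R B"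
  have inv: "?P ** matrix_inv ?P = mat 1" "matrix_inv ?P ** ?P = mat 1"
    using matrix_inv_inverse[OF invertible_one_minus_skew[OF B, of "t / 2"]] by simp_all
  have "?P ** cayley B t = (?P ** matrix_inv ?P) ** ?Q" by (simp add: cayley_def matrix_mul_assoc)
  then show PC: "?P ** cayley B t = ?Q" by (simp add: inv)
  have tr: "transpose ?P = ?Q" "transpose ?Q = ?P"
    by (simp_all add: transpose_simps transpose_mat B)
  have comm: "?P ** ?Q = ?Q ** ?P" by (simp add: matrix_mult_simps vec_eq_iff algebra_simps)
  have dPQ: "det ?P = det ?Q" using det_transpose[of ?P] tr by simp
  have dP: "det ?P \<noteq> 0" using invertible_one_minus_skew[OF B, of "t / 2"] by (simp add: invertible_det_nz)
  have "det ?P * det (cayley B t) = det ?Q" using PC by (metis det_mul)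
  then have dC: "det (cayley B t) = 1" using dP dPQ by simp
  have "transpose (cayley B t) ** ?Q = ?P"
    using arg_cong[OF PC, of transpose] tr by (simp add: matrix_transpose_mul)
  then have "transpose (cayley B t) ** (?P ** cayley B t) = ?P" by (simp only: PC)
  have CP: "cayley B t ** ?P = ?Q"
  proof -
    have "cayley B t ** ?P = matrix_inv ?P ** (?Q ** ?P)" by (simp add: cayley_def matrix_mul_assoc)
    also have "\<dots> = (matrix_inv ?P ** ?P) ** ?Q" by (simp add: comm[symmetric] matrix_mul_assoc)
    finally show ?thesis by (simp add: inv)
  qed
  have "transpose (cayley B t) ** cayley B t ** ?P = transpose (cayley B t) ** ?Q"
    by (simp add: matrix_mul_assoc[symmetric] CP)
  also have "\<dots> = ?P" by fact
  finally have "transpose (cayley B t) ** cayley B t ** (?P ** matrix_inv ?P) = ?P ** matrix_inv ?P"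
    by (simp add: matrix_mul_assoc)
  then have "transpose (cayley B t) ** cayley B t = mat 1" by (simp add: inv)
  then show "rotation_matrix (cayley B t)" using dC by (simp add: rotation_matrix_def orthogonal_matrix)
  have "matrix_inv (mat 1) ** mat 1 = (mat 1 :: real^'n^'n)"
    by (rule matrix_inv_inverse(2)) (auto simp: invertible_def)
  then show "cayley B 0 = mat 1" by (simp add: cayley_def)
qed

lemma rotation_matrix_norm:
  fixes R :: "real^'n^'n"
  assumes "rotation_matrix R"
  shows "(norm R)\<^sup>2 = real CARD('n)"
proof -
  have "R \<bullet> R = (mat 1 :: real^'n^'n) \<bullet> (transpose R ** R)"
    using inner_matrix_mult(1)[of R "mat 1" R] by simp
  then show ?thesis
    by (simp add: rotation_matrix_inverse(2)[OF assms] power2_norm_eq_inner)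
      (simp add: inner_vec_def mat_def if_distrib cong: if_cong)
qed

text \<open>The defining relation gives C (t) - 1 = (t / 2) B (1 + C (t)). Rotations are bounded, so
  C is continuous at 0, and dividing by t gives the velocity B. No derivative of a matrix inverse
  has to be taken.\<close>

lemma cayley_derivative:
  fixes B :: "real^'n^'n"
  assumes B: "transpose B = - B"
  shows "(cayley B has_vector_derivative B) (at 0)"
proof -
  obtain K where K: "\<And>(A :: real^'n^'n) (C :: real^'n^'n). norm (A ** C) \<le> norm A * norm C * K"
    using bounded_bilinear.bounded[OF bounded_bilinear_matrix_mult] by blast
  have eq: "cayley B t - mat 1 = t *\<^sub>R ((1 / 2) *\<^sub>R (B ** (mat 1 + cayley B t)))" for t
    using cayley_props(1)[OF B, of t] by (simp add: matrix_mult_simps algebra_simps scaleR_add_right)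
  let ?c = "norm B * (2 * sqrt (real CARD('n))) * K"
  have n: "norm (cayley B t) = sqrt (real CARD('n))" "norm (mat 1 :: real^'n^'n) = sqrt (real CARD('n))" for t
    using rotation_matrix_norm[OF cayley_props(2)[OF B, of t]]
      rotation_matrix_norm[OF rotation_matrix_1, where 'n = 'n]
    by (metis norm_ge_zero real_sqrt_unique)+
  have K0: "K \<ge> 0"
  proof (rule ccontr)
    assume "\<not> K \<ge> 0"
    moreover have "0 \<le> norm (mat 1 ** mat 1 :: real^'n^'n)" by simp
    moreover have "norm (mat 1 :: real^'n^'n) * norm (mat 1 :: real^'n^'n) > 0" by (simp add: n)
    ultimately show False using K[of "mat 1" "mat 1"] mult_pos_neg[of "norm (mat 1 :: real^'n^'n) * norm (mat 1 :: real^'n^'n)" K]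
      by linarith
  qed
  have bound: "norm (cayley B t - mat 1) \<le> \<bar>t\<bar> * ?c" for t
  proof -
    have "norm (B ** (mat 1 + cayley B t)) \<le> norm B * norm (mat 1 + cayley B t) * K" by (rule K)
    also have "\<dots> \<le> ?c"
      using norm_triangle_ineq[of "mat 1" "cayley B t"] K0 n(1)[of t] n(2)
      by (intro mult_right_mono mult_left_mono) auto
    finally have "norm (B ** (mat 1 + cayley B t)) \<le> ?c" .
    moreover have "norm ((1 / 2) *\<^sub>R (B ** (mat 1 + cayley B t))) = norm (B ** (mat 1 + cayley B t)) / 2" by simp
    ultimately have "norm ((1 / 2) *\<^sub>R (B ** (mat 1 + cayley B t))) \<le> ?c"
      using norm_ge_zero[of "B ** (mat 1 + cayley B t)"] by linarith
    then show ?thesis unfolding eq norm_scaleR by (intro mult_left_mono) auto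
  qed
  have "((\<lambda>t. \<bar>t\<bar> * ?c) \<longlongrightarrow> \<bar>0\<bar> * ?c) (at 0)"
    by (rule tendsto_mult_right[OF tendsto_rabs[OF tendsto_ident_at]])
  then have l0: "((\<lambda>t. \<bar>t\<bar> * ?c) \<longlongrightarrow> 0) (at 0)" by (simp only: abs_zero mult_zero_left)
  have "((\<lambda>t. cayley B t - mat 1) \<longlongrightarrow> 0) (at 0)"
    by (rule Lim_null_comparison[OF always_eventually l0]) (rule allI, rule bound)
  then have "(cayley B \<longlongrightarrow> mat 1) (at 0)" by (rule LIM_zero_cancel)
  note bounded_bilinear.tendsto[OF bounded_bilinear_matrix_mult tendsto_const[of B] tendsto_add[OF tendsto_const[of "mat 1"] this]]
  then have "((\<lambda>t. (1 / 2) *\<^sub>R (B ** (mat 1 + cayley B t))) \<longlongrightarrow> (1 / 2) *\<^sub>R (B ** (mat 1 + mat 1))) (at 0)"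
    by (rule tendsto_scaleR[OF tendsto_const])
  moreover have "(1 / 2) *\<^sub>R (B ** (mat 1 + mat 1)) = B" by (simp add: matrix_mult_simps flip: scaleR_2)
  ultimately have lim: "((\<lambda>t. (1 / 2) *\<^sub>R (B ** (mat 1 + cayley B t))) \<longlongrightarrow> B) (at 0)" by simp
  have lim0: "((\<lambda>t. norm ((1 / 2) *\<^sub>R (B ** (mat 1 + cayley B t)) - B)) \<longlongrightarrow> 0) (at 0)"
    by (rule tendsto_norm_zero[OF LIM_zero[OF lim]])
  show ?thesis
    unfolding has_vector_derivative_def has_derivative_at cayley_props(3)[OF B]
  proof (intro conjI)
    show "bounded_linear (\<lambda>x. x *\<^sub>R B)" by (rule bounded_linear_scaleR_left)
    show "((\<lambda>h. norm (cayley B (0 + h) - mat 1 - h *\<^sub>R B) / norm h) \<longlongrightarrow> 0) (at 0)"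
    proof (rule Lim_transform_eventually[OF lim0])
      show "\<forall>\<^sub>F h in at 0. norm ((1 / 2) *\<^sub>R (B ** (mat 1 + cayley B h)) - B) =
          norm (cayley B (0 + h) - mat 1 - h *\<^sub>R B) / norm h"
      proof (rule eventually_at_filter[THEN iffD2], rule always_eventually, intro allI impI)
        fix h :: real assume h: "h \<noteq> 0"
        have "cayley B (0 + h) - mat 1 - h *\<^sub>R B = h *\<^sub>R ((1 / 2) *\<^sub>R (B ** (mat 1 + cayley B h)) - B)"
          unfolding eq[of h, simplified] by (simp add: eq scaleR_diff_right)
        then show "norm ((1 / 2) *\<^sub>R (B ** (mat 1 + cayley B h)) - B) =
          norm (cayley B (0 + h) - mat 1 - h *\<^sub>R B) / norm h"
          using h by (simp only: norm_scaleR) simp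
      qed
    qed
  qed
qed

section \<open>Coset manifolds, and functions on them lifted to matrices\<close>

locale coset_space =
  fixes H :: "(real^'n^'n) set" and M :: "((real^'n^'n) set, 'z) mfd_scheme"
  assumes subgroup: "subgroup H SO" and coset_mfd: "coset_manifold H M"
begin

sublocale mfd M
  using coset_mfd by unfold_locales (simp add: coset_manifold_def)

abbreviation \<pi> where "\<pi> a \<equiv> a <#\<^bsub>SO\<^esub> H"

lemma coset_mfdD:
  shows points_eq: "points M = lcosets\<^bsub>SO\<^esub> H"
    and quot: "quotient_map (top_of_set (carrier SO)) (mtop M) \<pi>"
    and chart_smooth: "(U, \<phi>) \<in> charts M \<Longrightarrow> i < n \<Longrightarrow>
      smooth_on_subset {a \<in> carrier SO. \<pi> a \<in> U} (\<lambda>a. \<phi> (\<pi> a) i)"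
    and sections: "x \<in> points M \<Longrightarrow> \<exists>U \<sigma>. openin (mtop M) U \<and> x \<in> U \<and>
        (\<forall>y\<in>U. \<sigma> y \<in> carrier SO \<and> \<pi> (\<sigma> y) = y) \<and> (\<forall>i j. smooth_fun_on M U (\<lambda>y. \<sigma> y $ i $ j))"
proof -
  note c = coset_mfd[unfolded coset_manifold_def]
  show "points M = lcosets\<^bsub>SO\<^esub> H" using c by (elim conjE)
  show "quotient_map (top_of_set (carrier SO)) (mtop M) \<pi>" using c by (elim conjE)
  have 1: "\<forall>(U, \<phi>)\<in>charts M. \<forall>i<n. smooth_on_subset {a \<in> carrier SO. \<pi> a \<in> U} (\<lambda>a. \<phi> (\<pi> a) i)"
    using c by (elim conjE)
  show "(U, \<phi>) \<in> charts M \<Longrightarrow> i < n \<Longrightarrow> smooth_on_subset {a \<in> carrier SO. \<pi> a \<in> U} (\<lambda>a. \<phi> (\<pi> a) i)"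
    using bspec[OF 1, of "(U, \<phi>)"] by simp
  have 2: "\<forall>x\<in>points M. \<exists>U \<sigma>. openin (mtop M) U \<and> x \<in> U \<and>
        (\<forall>y\<in>U. \<sigma> y \<in> carrier SO \<and> \<pi> (\<sigma> y) = y) \<and> (\<forall>i j. smooth_fun_on M U (\<lambda>y. \<sigma> y $ i $ j))"
    using c by (elim conjE)
  show "x \<in> points M \<Longrightarrow> \<exists>U \<sigma>. openin (mtop M) U \<and> x \<in> U \<and>
        (\<forall>y\<in>U. \<sigma> y \<in> carrier SO \<and> \<pi> (\<sigma> y) = y) \<and> (\<forall>i j. smooth_fun_on M U (\<lambda>y. \<sigma> y $ i $ j))"
    by (rule bspec[OF 2])
qed

lemma H_rot: "h \<in> H \<Longrightarrow> rotation_matrix h"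
  using subgroup.subset[OF subgroup] by (auto simp: carrier_SO)

lemma points_image: "points M = \<pi> ` {a. rotation_matrix a}"
  by (auto simp: points_eq LCOSETS_def carrier_SO)

lemma \<pi>_points: "rotation_matrix a \<Longrightarrow> \<pi> a \<in> points M"
  by (simp add: points_image)

lemma \<pi>_mult: "rotation_matrix a \<Longrightarrow> rotation_matrix b \<Longrightarrow> a <#\<^bsub>SO\<^esub> \<pi> b = \<pi> (a ** b)"
  using group.lcos_m_assoc[OF group_SO subgroup.subset[OF subgroup], of a b] by (simp add: carrier_SO mult_SO)

lemma \<pi>_H:
  assumes "h \<in> H"
  shows "\<pi> h = \<pi> (mat 1)"
proof -
  have "\<pi> h = H" using group.coset_join3[OF group_SO _ subgroup assms] H_rot[OF assms] by (simp add: carrier_SO)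
  moreover have "\<pi> (mat 1) = H"
    using group.coset_join3[OF group_SO _ subgroup subgroup.one_closed[OF subgroup]] rotation_matrix_1
    by (simp add: carrier_SO one_SO)
  ultimately show ?thesis by simp
qed

text \<open>The lift of \<open>f\<close> lives on rotation matrices only, a set without interior.
  \<open>F\<close> extends it smoothly to an open set of matrices, where directional derivatives
  make sense.\<close>

definition lift_at :: "(real^'n^'n) set \<Rightarrow> (real^'n^'n \<Rightarrow> real) \<Rightarrow> ((real^'n^'n) set \<Rightarrow> real) \<Rightarrow> bool" where
  "lift_at W F f \<longleftrightarrow> open W \<and> smooth_on_type W F \<and> (\<forall>x\<in>W. rotation_matrix x \<longrightarrow> F x = f (\<pi> x))"

text \<open>The coordinates of the projection extend to matrices near \<open>a\<close> one by one,
  by smoothness on the subset of rotations; \<open>f\<close> in the chart is then composed with the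
  extended coordinates.\<close>

lemma lift_exists:
  assumes f: "f \<in> smooth_funs M" and a: "rotation_matrix a"
  obtains W F where "a \<in> W" "lift_at W F f"
proof -
  obtain U \<phi> where U: "(U, \<phi>) \<in> charts M" "\<pi> a \<in> U" using chart_cover[OF \<pi>_points[OF a]] by blast
  have aS: "a \<in> {a \<in> carrier SO. \<pi> a \<in> U}" using a U by (simp add: carrier_SO)
  have "\<exists>W F. open W \<and> a \<in> W \<and> smooth_on_type W F \<and>
      (\<forall>x\<in>W \<inter> {a \<in> carrier SO. \<pi> a \<in> U}. F x = \<phi> (\<pi> x) i)" if "i < n" for i
    using bspec[OF chart_smooth[OF U(1) that, unfolded smooth_on_subset_def] aS]
    unfolding smooth_on_type_def by blast
  then obtain W F where WF: "\<And>i. i < n \<Longrightarrow> open (W i)" "\<And>i. i < n \<Longrightarrow> a \<in> W i"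
    "\<And>i. i < n \<Longrightarrow> smooth_on_type (W i) (F i)"
    "\<And>i x. i < n \<Longrightarrow> x \<in> W i \<Longrightarrow> x \<in> carrier SO \<Longrightarrow> \<pi> x \<in> U \<Longrightarrow> F i x = \<phi> (\<pi> x) i"
    by (simp only: Int_iff mem_Collect_eq Ball_def) metis
  define W0 where "W0 = (\<Inter>i\<in>{..<n}. W i)"
  have W0: "open W0" "a \<in> W0" unfolding W0_def using WF(1,2) by (auto intro: open_INT)
  have W0s: "smooth_on_type W0 (F i)" if "i < n" for i
    by (rule smooth_on_type_subset[OF W0(1) WF(1)[OF that] _ WF(3)[OF that]]) (use that in \<open>auto simp: W0_def\<close>)
  define \<Phi> where "\<Phi> x = (\<lambda>i. if i < n then F i x else 0)" for x
  have \<Phi>e: "\<Phi> x = \<phi> (\<pi> x)" if "x \<in> W0" "rotation_matrix x" "\<pi> x \<in> U" for x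
  proof -
    have "\<Phi> x = (\<lambda>i. if i < n then \<phi> (\<pi> x) i else 0)"
      using WF(4)[of _ x] that by (auto simp: \<Phi>_def W0_def carrier_SO fun_eq_iff)
    then show ?thesis using chart_eta[OF U(1) that(3)] by simp
  qed
  have cont: "continuous_on W0 \<Phi>" unfolding \<Phi>_def
    by (rule continuous_on_coordinatewise_then_product, rename_tac i, case_tac "i < n")
      (use smooth_on_type_continuous[OF W0(1) W0s] in auto)
  obtain T where T: "open T" "\<phi> ` U = eucl n \<inter> T"
    using chart_image_open[OF U(1)] unfolding openin_Euclidean_space_iff by blast
  have "openin (top_of_set (carrier SO)) {x \<in> topspace (top_of_set (carrier SO)). \<pi> x \<in> U}"
    by (rule openin_continuous_map_preimage[OF quotient_imp_continuous_map[OF quot] chart_open[OF U(1)]])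
  then obtain T' where T': "open T'" "{x \<in> carrier SO. \<pi> x \<in> U} = carrier SO \<inter> T'"
    by (auto simp: openin_open)
  \<comment> \<open>Shrunk so that the extended coordinates stay in the image of the chart and the
    rotations in it project into its domain.\<close>
  define W' where "W' = (W0 \<inter> \<Phi> -` T) \<inter> T'"
  have W': "open W'" unfolding W'_def
    using continuous_open_preimage[OF cont W0(1) T(1)] T'(1) by blast
  have "\<Phi> a \<in> T" using \<Phi>e[OF W0(2) a U(2)] T(2) U(2) by blast
  then have aW': "a \<in> W'" using W0(2) T'(2) aS by (auto simp: W'_def)
  have "smooth_on_type W' (\<lambda>x. (\<lambda>y. f (inv_into U \<phi> y)) (\<lambda>j. if j < n then F j x else 0))"
  proof (rule smooth_on_type_compose_eucl[OF W' chart_image_open[OF U(1)] smooth_funs_chart[OF f U(1)]])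
    show "smooth_on_type W' (F j)" if "j < n" for j
      by (rule smooth_on_type_subset[OF W' W0(1) _ W0s[OF that]]) (auto simp: W'_def)
    show "(\<lambda>j. if j < n then F j x else 0) \<in> \<phi> ` U" if "x \<in> W'" for x
    proof -
      have "\<Phi> x \<in> eucl n" by (simp add: \<Phi>_def topspace_Euclidean_space)
      then show ?thesis using that T(2) by (auto simp: W'_def \<Phi>_def)
    qed
  qed
  moreover have "f (inv_into U \<phi> (\<lambda>j. if j < n then F j x else 0)) = f (\<pi> x)"
    if x: "x \<in> W'" "rotation_matrix x" for x
  proof -
    have "x \<in> carrier SO \<inter> T'" using x by (simp add: W'_def carrier_SO)
    then have xU: "\<pi> x \<in> U" using T'(2) by blast
    have "\<Phi> x = \<phi> (\<pi> x)" using \<Phi>e[OF _ x(2) xU] x(1) by (simp add: W'_def)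
    then show ?thesis using chart_inv[OF U(1) xU] by (simp add: \<Phi>_def)
  qed
  ultimately show ?thesis using that[OF aW'] W' unfolding lift_at_def by blast
qed

text \<open>The converse: composing the extended lift with a smooth local section recovers
  \<open>f\<close> near each point.\<close>

lemma smooth_funs_of_lift:
  assumes "\<And>x. x \<notin> points M \<Longrightarrow> f x = 0"
    and lift: "\<And>a. rotation_matrix a \<Longrightarrow> \<exists>W F. a \<in> W \<and> lift_at W F f"
  shows "f \<in> smooth_funs M"
proof (rule smooth_funsI[OF assms(1)])
  fix x assume x: "x \<in> points M"
  obtain U0 \<sigma> where s: "openin (mtop M) U0" "x \<in> U0" "\<And>y. y \<in> U0 \<Longrightarrow> \<sigma> y \<in> carrier SO"
    "\<And>y. y \<in> U0 \<Longrightarrow> \<pi> (\<sigma> y) = y" "\<And>i j. smooth_fun_on M U0 (\<lambda>y. \<sigma> y $ i $ j)"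
    using sections[OF x] by metis
  have rs: "rotation_matrix (\<sigma> y)" if "y \<in> U0" for y using s(3)[OF that] by (simp add: carrier_SO)
  obtain W F where WF: "\<sigma> x \<in> W" "lift_at W F f" using lift[OF rs[OF s(2)]] by blast
  have W: "open W" "smooth_on_type W F" "\<And>x. x \<in> W \<Longrightarrow> rotation_matrix x \<Longrightarrow> F x = f (\<pi> x)"
    using WF(2) by (auto simp: lift_at_def)
  obtain U \<phi> where U: "(U, \<phi>) \<in> charts M" "x \<in> U" using chart_cover[OF x] by blast
  have UU: "openin (mtop M) (U \<inter> U0)" using chart_open[OF U(1)] s(1) by blast
  define V where "V = \<phi> ` (U \<inter> U0)"
  have V: "openin (Euclidean_space n) V" unfolding V_def by (rule chart_image_openin[OF U(1) UU]) simp
  define g where "g v = \<sigma> (inv_into U \<phi> v)" for v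
  have gs: "smooth_on n V (\<lambda>v. g v \<bullet> b)" if bB: "b \<in> Basis" for b :: "real^'n^'n"
  proof -
    obtain i j where "b = axis i (axis j 1)" using bB by (auto simp: Basis_vec_def)
    then have "g v \<bullet> b = \<sigma> (inv_into U \<phi> v) $ i $ j" for v by (simp add: g_def inner_axis)
    moreover have "smooth_on n V (\<lambda>v. \<sigma> (inv_into U \<phi> v) $ i $ j)"
      using s(5)[of i j] U(1) unfolding smooth_fun_on_def V_def by fastforce
    ultimately show ?thesis by simp
  qed
  have gc: "continuous_on V g"
  proof -
    have "continuous_on V (\<lambda>v. g v \<bullet> b)" if "b \<in> Basis" for b
      by (rule Ck_on_imp_continuous_on[OF openin_subset[OF V] smooth_onD[OF gs[OF that]]])
    then show ?thesis by (simp add: continuous_on_componentwise[of V g])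
  qed
  define V1 where "V1 = V \<inter> g -` W"
  have "openin (top_of_set V) V1" unfolding V1_def
    by (rule continuous_openin_preimage_gen[OF gc W(1)])
  then have "openin (subtopology (Euclidean_space n) V) V1"
    by (simp add: subtopology_Euclidean_space_eq[OF openin_subset[OF V]])
  then have V1: "openin (Euclidean_space n) V1" using V by (simp add: openin_open_subtopology)
  define B where "B = {y \<in> U. \<phi> y \<in> V1}"
  have Bo: "openin (mtop M) B" unfolding B_def by (rule chart_preimage_openin[OF U(1) V1])
  have BU: "B \<subseteq> U" by (auto simp: B_def)
  have Bim: "\<phi> ` B = V1" by (auto simp: B_def V1_def V_def)
  have xB: "x \<in> B" using U s(2) WF(1) by (simp add: B_def V1_def V_def g_def chart_inv[OF U(1)])
  have "smooth_on n V1 (\<lambda>v. F (g v))"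
  proof (rule smooth_on_compose_type[OF W(1) V1 W(2)])
    show "smooth_on n V1 (\<lambda>v. g v \<bullet> b)" if "b \<in> Basis" for b
      by (rule smooth_on_subset[OF V1 V _ gs[OF that]]) (simp add: V1_def)
    show "g v \<in> W" if "v \<in> V1" for v using that by (simp add: V1_def)
  qed
  then have "smooth_on n (\<phi> ` B) (\<lambda>v. f (inv_into U \<phi> v))" unfolding Bim
  proof (rule smooth_on_cong[OF V1, rotated])
    fix v assume v: "v \<in> V1"
    then obtain y where y: "y \<in> U" "y \<in> U0" "v = \<phi> y" by (auto simp: V1_def V_def)
    have "g v = \<sigma> y" using y chart_inv[OF U(1)] by (simp add: g_def)
    then show "F (g v) = f (inv_into U \<phi> v)"
      using W(3)[of "\<sigma> y"] v rs[OF y(2)] s(4)[OF y(2)] y chart_inv[OF U(1)] by (simp add: V1_def)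
  qed
  then show "\<exists>U \<phi> B. (U, \<phi>) \<in> charts M \<and> openin (mtop M) B \<and> x \<in> B \<and> B \<subseteq> U \<and>
      smooth_on n (\<phi> ` B) (\<lambda>y. f (inv_into U \<phi> y))"
    using U(1) Bo xB BU by blast
qed

lemma lift_curve:
  assumes WF: "lift_at W F f" and c: "c 0 \<in> W" "\<forall>\<^sub>F s in nhds 0. rotation_matrix (c s)"
    and d: "(c has_vector_derivative v) (at 0)"
  shows "((\<lambda>s. f (\<pi> (c s))) has_real_derivative
    (\<Sum>b\<in>Basis. deriv (\<lambda>t. F (c 0 + t *\<^sub>R b)) 0 * (v \<bullet> b))) (at 0)"
proof -
  have W: "open W" "smooth_on_type W F" "\<And>x. x \<in> W \<Longrightarrow> rotation_matrix x \<Longrightarrow> F x = f (\<pi> x)"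
    using WF by (auto simp: lift_at_def)
  have "isCont c 0" using d has_vector_derivative_continuous by blast
  then have "(c \<longlongrightarrow> c 0) (nhds 0)" by (simp add: isCont_def tendsto_at_iff_tendsto_nhds)
  then have "\<forall>\<^sub>F s in nhds 0. c s \<in> W" using topological_tendstoD[OF _ W(1) c(1)] by blast
  with c(2) have ev: "\<forall>\<^sub>F s in nhds 0. F (c s) = f (\<pi> (c s))"
    by eventually_elim (rule W(3))
  show ?thesis
    by (rule iffD1[OF DERIV_cong_ev[OF refl ev refl] smooth_on_type_chain_curve[OF W(1,2) c(1) d]])
qed

section \<open>Fundamental vector fields\<close>

abbreviation skew :: "(real^'n^'n) set" where "skew \<equiv> {B. transpose B = - B}"

text \<open>The fundamental vector field of \<open>B\<close> for the action by left translation,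
  with the Cayley curve in place of the exponential.\<close>

definition xi :: "real^'n^'n \<Rightarrow> (real^'n^'n) set vfield" where
  "xi B q f = (if q \<in> points M \<and> f \<in> smooth_funs M then deriv (\<lambda>t. f (cayley B t <#\<^bsub>SO\<^esub> q)) 0 else 0)"

lemma xi_lift:
  assumes WF: "lift_at W F f" "a \<in> W" and a: "rotation_matrix a" and B: "B \<in> skew" and f: "f \<in> smooth_funs M"
  shows "xi B (\<pi> a) f = (\<Sum>b\<in>Basis. deriv (\<lambda>t. F (a + t *\<^sub>R b)) 0 * ((B ** a) \<bullet> b))"
proof -
  have B': "transpose B = - B" using B by simp
  have "((\<lambda>t. f (\<pi> (cayley B t ** a))) has_real_derivative
     (\<Sum>b\<in>Basis. deriv (\<lambda>t. F (cayley B 0 ** a + t *\<^sub>R b)) 0 * ((B ** a) \<bullet> b))) (at 0)"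
    by (rule lift_curve[OF WF(1)])
      (simp_all add: cayley_props[OF B'] WF(2) a rotation_matrix_mult
        has_vector_derivative_matrix_mult_const(2)[OF cayley_derivative[OF B']])
  moreover have "f (cayley B t <#\<^bsub>SO\<^esub> \<pi> a) = f (\<pi> (cayley B t ** a))" for t
    using \<pi>_mult[OF cayley_props(2)[OF B'] a] by simp
  ultimately show ?thesis
    using f \<pi>_points[OF a] by (simp add: xi_def DERIV_imp_deriv cayley_props[OF B'])
qed

text \<open>By \<open>lift_curve\<close> the derivative depends on the velocity only, so any curve
  of rotations with the same starting point and velocity computes the field. Curves inside
  \<open>H\<close> and translated curves will be used.\<close>

lemma xi_curve:
  assumes f: "f \<in> smooth_funs M" and B: "B \<in> skew" and c: "\<forall>\<^sub>F s in nhds 0. rotation_matrix (c s)"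
    and d: "(c has_vector_derivative B ** c 0) (at 0)"
  shows "((\<lambda>s. f (\<pi> (c s))) has_real_derivative xi B (\<pi> (c 0)) f) (at 0)"
proof -
  have a: "rotation_matrix (c 0)" using eventually_nhds_x_imp_x[OF c] .
  obtain W F where WF: "c 0 \<in> W" "lift_at W F f" using lift_exists[OF f a] by blast
  show ?thesis using lift_curve[OF WF(2,1) c d] unfolding xi_lift[OF WF(2,1) a B f] .
qed

lemma xi_cayley:
  assumes f: "f \<in> smooth_funs M" and B: "B \<in> skew" and a: "rotation_matrix a"
  shows "((\<lambda>t. f (\<pi> (cayley B t ** a))) has_real_derivative xi B (\<pi> a) f) (at 0)"
proof -
  have B': "transpose B = - B" using B by simp
  show ?thesis
    using xi_curve[OF f B, of "\<lambda>t. cayley B t ** a"]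
      has_vector_derivative_matrix_mult_const(2)[OF cayley_derivative[OF B'], of a]
    by (simp add: cayley_props[OF B'] rotation_matrix_mult a)
qed

lemma points_cases: "q \<in> points M \<Longrightarrow> (\<And>a. rotation_matrix a \<Longrightarrow> q = \<pi> a \<Longrightarrow> P) \<Longrightarrow> P"
  by (auto simp: points_image)

lemma xi_nonsmooth: "f \<notin> smooth_funs M \<Longrightarrow> xi B q f = 0" "q \<notin> points M \<Longrightarrow> xi B q = 0"
  by (auto simp: xi_def fun_eq_iff)

lemma xi_tangent:
  assumes B: "B \<in> skew" and q: "q \<in> points M"
  shows "xi B q \<in> tangent_space M q"
proof -
  have B': "transpose B = - B" using B by simp
  obtain a where a: "rotation_matrix a" "q = \<pi> a" using points_cases[OF q] by blast
  note d = xi_cayley[OF _ B a(1), folded a(2)]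
  have uniq: "xi B q f = D" if "f \<in> smooth_funs M" "((\<lambda>t. f (\<pi> (cayley B t ** a))) has_real_derivative D) (at 0)" for f D
    using DERIV_unique[OF d[OF that(1)] that(2)] .
  have q0: "\<pi> (cayley B 0 ** a) = q" using a by (simp add: cayley_props[OF B'])
  show ?thesis
  proof (rule tangent_spaceI)
    fix f g assume f: "f \<in> smooth_funs M" and g: "g \<in> smooth_funs M"
    show "xi B q (\<lambda>x. f x + g x) = xi B q f + xi B q g"
      by (rule uniq[OF smooth_funs_add[OF f g] DERIV_add[OF d[OF f] d[OF g]]])
    show "xi B q (\<lambda>x. f x * g x) = f q * xi B q g + g q * xi B q f"
      using uniq[OF smooth_funs_mult[OF f g] DERIV_mult[OF d[OF f] d[OF g]]] unfolding q0 by simp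
  next
    fix c f assume f: "f \<in> smooth_funs M"
    show "xi B q (\<lambda>x. c * f x) = c * xi B q f"
      by (rule uniq[OF smooth_funs_cmult[OF f] DERIV_cmult[OF d[OF f]]])
  qed (rule xi_nonsmooth)
qed

text \<open>The formula of \<open>xi_lift\<close> is smooth in the matrix, so it is itself an
  extended lift of the function to be shown smooth.\<close>

lemma xi_vfields:
  assumes B: "B \<in> skew"
  shows "xi B \<in> vfields M"
proof (rule vfieldsI)
  fix f assume f: "f \<in> smooth_funs M"
  show "(\<lambda>q. xi B q f) \<in> smooth_funs M"
  proof (rule smooth_funs_of_lift)
    show "xi B x f = 0" if "x \<notin> points M" for x using xi_nonsmooth(2)[OF that] by simp
    fix a :: "real^'n^'n" assume a: "rotation_matrix a"
    obtain W F where WF: "a \<in> W" "lift_at W F f" using lift_exists[OF f a] by blast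
    have W: "open W" "smooth_on_type W F" using WF(2) by (auto simp: lift_at_def)
    have lin: "linear (\<lambda>x. (B ** x) \<bullet> b)" for b :: "real^'n^'n"
      by (rule linearI) (simp_all add: matrix_mult_simps inner_add_left)
    have "smooth_on_type W (\<lambda>x. \<Sum>b\<in>Basis. deriv (\<lambda>t. F (x + t *\<^sub>R b)) 0 * ((B ** x) \<bullet> b))"
      by (rule smooth_on_type_sum[OF W(1)], rule smooth_on_type_mult[OF W(1)])
        (simp_all add: smooth_on_type_deriv[OF W(1) W(2)] smooth_on_type_linear[OF W(1) lin])
    then have "lift_at W (\<lambda>x. \<Sum>b\<in>Basis. deriv (\<lambda>t. F (x + t *\<^sub>R b)) 0 * ((B ** x) \<bullet> b)) (\<lambda>q. xi B q f)"
      using xi_lift[OF WF(2) _ _ B f] W(1) by (simp add: lift_at_def)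
    then show "\<exists>W F. a \<in> W \<and> lift_at W F (\<lambda>q. xi B q f)" using WF(1) by blast
  qed
qed (simp_all add: xi_tangent[OF B] xi_nonsmooth)

lemma xi_add:
  assumes B: "B \<in> skew" and C: "C \<in> skew" and q: "q \<in> points M"
  shows "xi (B + C) q = xi B q + xi C q"
proof
  fix f
  have BC: "B + C \<in> skew" using B C by (simp add: transpose_simps)
  obtain a where a: "rotation_matrix a" "q = \<pi> a" using points_cases[OF q] by blast
  show "xi (B + C) q f = (xi B q + xi C q) f"
  proof (cases "f \<in> smooth_funs M")
    case True
    obtain W F where WF: "a \<in> W" "lift_at W F f" using lift_exists[OF True a(1)] by blast
    show ?thesis
      unfolding a(2) plus_fun_apply xi_lift[OF WF(2,1) a(1) BC True] xi_lift[OF WF(2,1) a(1) B True]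
        xi_lift[OF WF(2,1) a(1) C True]
      by (simp add: matrix_mult_simps inner_add_left distrib_left sum.distrib)
  qed (simp add: xi_nonsmooth)
qed

lemma xi_scale:
  assumes B: "B \<in> skew" and q: "q \<in> points M"
  shows "xi (r *\<^sub>R B) q = tscale r (xi B q)"
proof
  fix f
  have BC: "r *\<^sub>R B \<in> skew" using B by (simp add: transpose_simps)
  obtain a where a: "rotation_matrix a" "q = \<pi> a" using points_cases[OF q] by blast
  show "xi (r *\<^sub>R B) q f = tscale r (xi B q) f"
  proof (cases "f \<in> smooth_funs M")
    case True
    obtain W F where WF: "a \<in> W" "lift_at W F f" using lift_exists[OF True a(1)] by blast
    show ?thesis
      unfolding a(2) tscale_def xi_lift[OF WF(2,1) a(1) BC True] xi_lift[OF WF(2,1) a(1) B True]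
      by (simp add: matrix_mult_simps sum_distrib_left mult_ac)
  qed (simp add: xi_nonsmooth tscale_def)
qed

text \<open>A curve inside \<open>H\<close> projects to a constant curve in the coset space.\<close>

lemma xi_stabilizer:
  assumes A: "A \<in> skew" and c: "\<And>s. c s \<in> H" "c 0 = mat 1" and d: "(c has_vector_derivative A) (at 0)"
  shows "xi A (\<pi> (mat 1)) = 0"
proof
  fix f
  show "xi A (\<pi> (mat 1)) f = 0 f"
  proof (cases "f \<in> smooth_funs M")
    case True
    have "((\<lambda>s. f (\<pi> (c s))) has_real_derivative xi A (\<pi> (c 0)) f) (at 0)"
      by (rule xi_curve[OF True A]) (use H_rot[OF c(1)] c(2) d in simp_all)
    moreover have "(\<lambda>s. f (\<pi> (c s))) = (\<lambda>s. f (\<pi> (mat 1)))" using \<pi>_H[OF c(1)] by simp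
    ultimately have "((\<lambda>s. f (\<pi> (mat 1))) has_real_derivative xi A (\<pi> (mat 1)) f) (at 0)"
      using c(2) by simp
    then show ?thesis using DERIV_unique[OF _ DERIV_const] by simp
  qed (simp add: xi_nonsmooth)
qed

lemma conj_skew: "B \<in> skew \<Longrightarrow> g ** B ** transpose g \<in> skew"
  by (simp add: matrix_transpose_mul matrix_mul_assoc matrix_mult_simps)

text \<open>Translating a curve with velocity B a by g gives a curve from g a with velocity g B a =
  (g B g^T) g a.\<close>

lemma xi_dmap:
  assumes B: "B \<in> skew" and g: "rotation_matrix g" and q: "q \<in> points M"
    and sm: "smooth_map M M (\<lambda>x. g <#\<^bsub>SO\<^esub> x)"
  shows "dmap (\<lambda>x. g <#\<^bsub>SO\<^esub> x) (xi B q) = xi (g ** B ** transpose g) (g <#\<^bsub>SO\<^esub> q)"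
proof
  fix f
  have B': "transpose B = - B" using B by simp
  obtain a where a: "rotation_matrix a" "q = \<pi> a" using points_cases[OF q] by blast
  show "dmap (\<lambda>x. g <#\<^bsub>SO\<^esub> x) (xi B q) f = xi (g ** B ** transpose g) (g <#\<^bsub>SO\<^esub> q) f"
  proof (cases "f \<in> smooth_funs M")
    case True
    let ?p = "pull (\<lambda>x. g <#\<^bsub>SO\<^esub> x) f"
    have p: "?p \<in> smooth_funs M" by (rule smooth_map_pull[OF sm True])
    have "((\<lambda>t. ?p (\<pi> (cayley B t ** a))) has_real_derivative xi B q ?p) (at 0)"
      using xi_cayley[OF p B a(1)] a(2) by simp
    moreover have "?p (\<pi> (cayley B t ** a)) = f (\<pi> (g ** (cayley B t ** a)))" for t
      using \<pi>_mult[OF g rotation_matrix_mult[OF cayley_props(2)[OF B'] a(1)]]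
        \<pi>_points[OF rotation_matrix_mult[OF cayley_props(2)[OF B'] a(1)]] by (simp add: pull_def)
    ultimately have 1: "((\<lambda>t. f (\<pi> (g ** (cayley B t ** a)))) has_real_derivative xi B q ?p) (at 0)" by simp
    let ?c = "\<lambda>t. g ** (cayley B t ** a)"
    have "((\<lambda>s. f (\<pi> (?c s))) has_real_derivative xi (g ** B ** transpose g) (\<pi> (?c 0)) f) (at 0)"
    proof (rule xi_curve[OF True conj_skew[OF B]])
      show "\<forall>\<^sub>F s in nhds 0. rotation_matrix (?c s)"
        by (simp add: rotation_matrix_mult g a(1) cayley_props[OF B'])
      have "(g ** B ** transpose g) ** ?c 0 = g ** B ** (transpose g ** g) ** a"
        by (simp add: cayley_props[OF B'] matrix_mul_assoc)
      then have "(g ** B ** transpose g) ** ?c 0 = g ** (B ** a)"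
        by (simp add: rotation_matrix_inverse(2)[OF g] matrix_mul_assoc)
      then show "(?c has_vector_derivative (g ** B ** transpose g) ** ?c 0) (at 0)"
        using has_vector_derivative_matrix_mult_const(1)[OF
            has_vector_derivative_matrix_mult_const(2)[OF cayley_derivative[OF B'], of a], of g] by simp
    qed
    then have "xi B q ?p = xi (g ** B ** transpose g) (\<pi> (?c 0)) f"
      by (rule DERIV_unique[OF 1])
    then show ?thesis
      using \<pi>_mult[OF g a(1)] by (simp add: dmap_apply[OF True] cayley_props[OF B'] a(2))
  next
    case False
    then show ?thesis by (simp add: dmap_nonsmooth xi_nonsmooth)
  qed
qed

text \<open>A coordinate line through \<open>q\<close> is lifted to a curve of rotations by a smooth
  local section. Its velocity is a skew matrix times its starting point, so each coordinate vector
  is the value of a fundamental field.\<close>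

lemma tangent_space_xi:
  assumes q: "q \<in> points M"
  shows "tangent_space M q = (\<lambda>B. xi B q) ` skew"
proof
  show "(\<lambda>B. xi B q) ` skew \<subseteq> tangent_space M q" using xi_tangent[OF _ q] by blast
  have sub: "tv.subspace ((\<lambda>B. xi B q) ` skew)"
  proof (rule tv.subspaceI)
    have 0: "(0 :: real^'n^'n) \<in> skew" by (simp add: transpose_def vec_eq_iff)
    have "xi 0 q = 0" using xi_scale[OF 0 q, of 0] by (simp add: tscale_def zero_fun_def)
    then show "0 \<in> (\<lambda>B. xi B q) ` skew" by (intro image_eqI[OF _ 0]) simp
    fix u assume "u \<in> (\<lambda>B. xi B q) ` skew"
    then obtain B where B: "B \<in> skew" "u = xi B q" by blast
    have "r *\<^sub>R B \<in> skew" for r using B(1) by (simp add: transpose_simps)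
    then show "tscale r u \<in> (\<lambda>B. xi B q) ` skew" for r
      using xi_scale[OF B(1) q, of r] unfolding B(2) by (intro image_eqI[where x = "r *\<^sub>R B"]) simp_all
    fix v assume "v \<in> (\<lambda>B. xi B q) ` skew"
    then obtain C where C: "C \<in> skew" "v = xi C q" by blast
    have "B + C \<in> skew" using B(1) C(1) by (simp add: transpose_simps)
    then show "u + v \<in> (\<lambda>B. xi B q) ` skew" using xi_add[OF B(1) C(1) q] unfolding B(2) C(2)
      by (intro image_eqI[where x = "B + C"]) simp_all
  qed
  obtain U \<phi> where U: "(U, \<phi>) \<in> charts M" "q \<in> U" using chart_cover[OF q] by blast
  obtain U0 \<sigma> where s: "openin (mtop M) U0" "q \<in> U0" "\<And>y. y \<in> U0 \<Longrightarrow> \<sigma> y \<in> carrier SO"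
    "\<And>y. y \<in> U0 \<Longrightarrow> \<pi> (\<sigma> y) = y" "\<And>i j. smooth_fun_on M U0 (\<lambda>y. \<sigma> y $ i $ j)"
    using sections[OF q] by metis
  have UU: "openin (mtop M) (U \<inter> U0)" using chart_open[OF U(1)] s(1) by blast
  define V where "V = \<phi> ` (U \<inter> U0)"
  have V: "openin (Euclidean_space n) V" unfolding V_def by (rule chart_image_openin[OF U(1) UU]) simp
  have qV: "\<phi> q \<in> V" using U s(2) by (simp add: V_def)
  have "chartvec U \<phi> q k \<in> (\<lambda>B. xi B q) ` skew" if k: "k < n" for k
  proof -
    let ?u = "\<lambda>t. (\<phi> q)(k := \<phi> q k + t)"
    define c where "c t = \<sigma> (inv_into U \<phi> (?u t))" for t
    have ev0: "\<forall>\<^sub>F t in nhds 0. ?u t \<in> V"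
    proof -
      have "((\<lambda>t. \<phi> q k + t) \<longlongrightarrow> \<phi> q k + 0) (nhds (0::real))" by (intro tendsto_intros) (simp add: filterlim_ident)
      then have "filterlim (\<lambda>t. \<phi> q k + t) (nhds (\<phi> q k)) (nhds 0)" by simp
      from eventually_compose_filterlim[OF eventually_upd[OF V qV k] this] show ?thesis .
    qed
    have uV: "c t \<in> carrier SO \<and> \<pi> (c t) = inv_into U \<phi> (?u t)" if ut: "?u t \<in> V" for t
    proof -
      obtain y where y: "y \<in> U" "y \<in> U0" "?u t = \<phi> y" using ut unfolding V_def by blast
      then have "inv_into U \<phi> (?u t) = y" using chart_inv[OF U(1) y(1)] by simp
      then show ?thesis using s(3,4)[OF y(2)] by (simp add: c_def)
    qed
    define v where "v = (\<chi> i j. partial_deriv k (\<lambda>x. \<sigma> (inv_into U \<phi> x) $ i $ j) (\<phi> q))"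
    have dc: "(c has_vector_derivative v) (at 0)"
      unfolding has_vector_derivative_def has_derivative_componentwise_within[of c]
    proof
      fix b :: "real^'n^'n" assume "b \<in> Basis"
      then obtain i j where b: "b = axis i (axis j 1)" by (auto simp: Basis_vec_def)
      have sij: "smooth_on n V (\<lambda>x. \<sigma> (inv_into U \<phi> x) $ i $ j)"
        using s(5)[of i j] U(1) unfolding smooth_fun_on_def V_def by fastforce
      have "((\<lambda>t. \<sigma> (inv_into U \<phi> ((\<phi> q)(k := t))) $ i $ j) has_real_derivative v $ i $ j) (at (\<phi> q k))"
        using Ck_on_SucD(2)[OF smooth_onD[OF sij] k qV] by (simp only: v_def vec_lambda_beta)
      then have "((\<lambda>t. c t $ i $ j) has_real_derivative v $ i $ j) (at 0)"
        using DERIV_shift[of "\<lambda>t. \<sigma> (inv_into U \<phi> ((\<phi> q)(k := t))) $ i $ j" "v $ i $ j" 0 "\<phi> q k"]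
        by (simp add: c_def add.commute)
      then show "((\<lambda>x. c x \<bullet> b) has_derivative (\<lambda>x. (x *\<^sub>R v) \<bullet> b)) (at 0)"
        by (simp add: b inner_axis has_field_derivative_def mult.commute[of _ "v $ i $ j"] mult_commute_abs)
    qed
    define a where "a = c 0"
    have inv0: "inv_into U \<phi> (?u 0) = q" using chart_inv[OF U] by simp
    have a: "rotation_matrix a" "\<pi> a = q" using uV[of 0] qV inv0 by (auto simp: a_def carrier_SO)
    have evr: "\<forall>\<^sub>F t in nhds 0. rotation_matrix (c t)"
      using ev0 by (rule eventually_mono) (use uV in \<open>auto simp: carrier_SO\<close>)
    have bl: "bounded_linear (transpose :: real^'n^'n \<Rightarrow> real^'n^'n)"
      unfolding linear_conv_bounded_linear[symmetric]
      by (rule linearI) (simp_all add: transpose_def vec_eq_iff)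
    have 1: "((\<lambda>t. c t ** transpose (c t)) has_vector_derivative (c 0 ** transpose v + v ** transpose (c 0))) (at 0)"
      by (rule has_vector_derivative_matrix_mult[OF dc bounded_linear.has_vector_derivative[OF bl dc]])
    have "((\<lambda>t. mat 1 :: real^'n^'n) has_vector_derivative (c 0 ** transpose v + v ** transpose (c 0))) (at 0)"
    proof (rule iffD1[OF has_vector_derivative_cong_ev 1])
      show "\<forall>\<^sub>F t in nhds 0. t \<in> UNIV \<longrightarrow> c t ** transpose (c t) = mat 1"
        using evr by (rule eventually_mono) (simp add: rotation_matrix_inverse(1))
      show "c 0 ** transpose (c 0) = mat 1"
        using a(1) by (simp add: a_def[symmetric] rotation_matrix_inverse(1))
    qed
    then have sk: "a ** transpose v + v ** transpose a = 0"
      using vector_derivative_unique_at has_vector_derivative_const unfolding a_def by blast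
    \<comment> \<open>Differentiating c c^T = 1 at 0 shows that v a^T is skew.\<close>
    define B where "B = v ** transpose a"
    have "transpose B = a ** transpose v" by (simp add: B_def matrix_transpose_mul)
    then have Bs: "B \<in> skew" using sk by (simp add: B_def eq_neg_iff_add_eq_0)
    have Ba: "B ** a = v" using rotation_matrix_inverse(2)[OF a(1)] by (simp add: B_def matrix_mul_assoc[symmetric])
    have "chartvec U \<phi> q k = xi B q"
    proof
      fix f
      show "chartvec U \<phi> q k f = xi B q f"
      proof (cases "f \<in> smooth_funs M")
        case True
        have x: "((\<lambda>s. f (\<pi> (c s))) has_real_derivative xi B q f) (at 0)"
          using xi_curve[OF True Bs evr] dc a(2) by (simp add: a_def[symmetric] Ba)
        have e: "\<forall>\<^sub>F t in nhds 0. f (\<pi> (c t)) = f (inv_into U \<phi> (?u t))"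
          using ev0 by (rule eventually_mono) (use uV in auto)
        have "((\<lambda>t. f (inv_into U \<phi> (?u t))) has_real_derivative xi B q f) (at 0)"
          by (rule iffD1[OF DERIV_cong_ev[OF refl e refl] x])
        then have "((\<lambda>t. f (inv_into U \<phi> ((\<phi> q)(k := t)))) has_real_derivative xi B q f) (at (\<phi> q k))"
          using DERIV_shift[of "\<lambda>t. f (inv_into U \<phi> ((\<phi> q)(k := t)))" "xi B q f" 0 "\<phi> q k"]
          by (simp add: add.commute)
        then show ?thesis by (rule chartvec_eqI[OF U True])
      qed (simp add: chartvec_def xi_nonsmooth)
    qed
    then show ?thesis using Bs by blast
  qed
  then show "tangent_space M q \<subseteq> (\<lambda>B. xi B q) ` skew"
    unfolding tangent_space_chartvec_span[OF U] by (intro tv.span_minimal[OF _ sub]) auto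
qed

end

section \<open>The irreducible case\<close>

lemma riesz_functional:
  fixes F :: "'a::euclidean_space \<Rightarrow> real"
  assumes "linear F"
  shows "(\<Sum>b\<in>Basis. F b *\<^sub>R b) \<bullet> x = F x"
proof -
  have "F x = F (\<Sum>b\<in>Basis. (x \<bullet> b) *\<^sub>R b)" by (simp add: euclidean_representation)
  also have "\<dots> = (\<Sum>b\<in>Basis. (x \<bullet> b) * F b)" by (simp add: linear_sum[OF assms] linear_cmul[OF assms])
  finally show ?thesis by (simp add: inner_sum_left inner_commute[of x] mult.commute)
qed

text \<open>The sum is the inner product of the vectors that represent the two functionals, and
  \<open>L\<close> is orthogonal. The frame identity at the base point is moved to other points by
  this.\<close>

lemma sum_Basis_orthogonal_change:
  fixes F G :: "'a::euclidean_space \<Rightarrow> real"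
  assumes F: "linear F" and G: "linear G" and L: "\<And>x y. L x \<bullet> y = x \<bullet> L' y" "\<And>y. L (L' y) = y"
  shows "(\<Sum>b\<in>Basis. F (L b) * G (L b)) = (\<Sum>b\<in>Basis. F b * G b)"
proof -
  define f where "f = (\<Sum>b\<in>Basis. F b *\<^sub>R b)"
  define g where "g = (\<Sum>b\<in>Basis. G b *\<^sub>R b)"
  have f: "F x = f \<bullet> x" "G x = g \<bullet> x" for x
    using riesz_functional[OF F, of x] riesz_functional[OF G, of x] by (simp_all add: f_def g_def)
  have Lf: "f \<bullet> L x = L' f \<bullet> x" "g \<bullet> L x = L' g \<bullet> x" for x
    using L(1)[of x f] L(1)[of x g] by (simp_all add: inner_commute)
  have "L' f \<bullet> L' g = f \<bullet> g" using L(1)[of "L' g" f] L(2)[of g] by (simp add: inner_commute)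
  moreover have "(\<Sum>b\<in>Basis. F (L b) * G (L b)) = L' f \<bullet> L' g"
    unfolding f Lf by (rule euclidean_inner[symmetric])
  moreover have "(\<Sum>b\<in>Basis. F b * G b) = f \<bullet> g" unfolding f by (rule euclidean_inner[symmetric])
  ultimately show ?thesis by (simp only:)
qed

text \<open>Invariance under \<open>Ad\<close> implies invariance under \<open>ad\<close>, since a curve in a subspace has its
  velocity in the subspace.\<close>

lemma (in so3_hom) invariant_of_conj:
  assumes W: "subspace W"
    and conj: "\<And>R B. rotation_matrix R \<Longrightarrow> B \<in> W \<Longrightarrow> \<rho> R ** B ** transpose (\<rho> R) \<in> W"
  shows "mat.invariant W"
proof -
  have bl: "bounded_linear (transpose :: real^'n^'n \<Rightarrow> real^'n^'n)"
    unfolding linear_conv_bounded_linear[symmetric]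
    by (rule linearI) (simp_all add: transpose_def vec_eq_iff)
  have "ad (gen r) B \<in> W" if r: "one_param r" and B: "B \<in> W" for r B
  proof -
    let ?c = "\<lambda>t. \<rho> (r t) ** B ** transpose (\<rho> (r t))"
    have "(?c has_vector_derivative (\<rho> (r 0) ** B) ** transpose (gen r) + (gen r ** B) ** transpose (\<rho> (r 0))) (at 0)"
      by (rule has_vector_derivative_matrix_mult[OF
            has_vector_derivative_matrix_mult_const(2)[OF gen_derivative_0[OF r]]
            bounded_linear.has_vector_derivative[OF bl gen_derivative_0[OF r]]])
    then have d: "(?c has_vector_derivative ad (gen r) B) (at 0)"
      by (simp add: hom_op[OF r] gen_skew[OF r] matrix_mult_simps transpose_mat)
    \<comment> \<open>The curve stays in \<open>W\<close>, hence orthogonal to \<open>z\<close>, and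
      so does its velocity; but \<open>z\<close> is the component of the velocity orthogonal to
      \<open>W\<close>.\<close>
    obtain y z where yz: "y \<in> span W" "\<And>w. w \<in> span W \<Longrightarrow> orthogonal z w" "ad (gen r) B = y + z"
      using orthogonal_subspace_decomp_exists[of W "ad (gen r) B"] by metis
    have sW: "span W = W" using W by simp
    have "?c t \<bullet> z = 0" for t
      using yz(2)[of "?c t"] conj[OF op(1)[OF r] B, of t] by (simp add: sW orthogonal_def inner_commute)
    then have "(\<lambda>t. ?c t \<bullet> z) = (\<lambda>t. 0)" by simp
    moreover have "((\<lambda>t. ?c t \<bullet> z) has_vector_derivative ad (gen r) B \<bullet> z) (at 0)"
      by (rule bounded_linear.has_vector_derivative[OF bounded_linear_inner_left d])
    ultimately have "((\<lambda>t. 0) has_vector_derivative ad (gen r) B \<bullet> z) (at (0::real))" by simp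
    then have "ad (gen r) B \<bullet> z = 0"
      using vector_derivative_unique_at[OF _ has_vector_derivative_const] by blast
    moreover have "y \<bullet> z = 0" using yz(2)[OF yz(1)] by (simp add: orthogonal_def inner_commute)
    ultimately have "z = 0" by (simp add: yz(3) inner_add_left)
    then show ?thesis using yz(1,3) by (simp add: sW)
  qed
  then show ?thesis unfolding mat.invariant_def using W one_param_axes by blast
qed

lemma inner_transpose: "transpose A \<bullet> B = A \<bullet> transpose (B :: real^'n^'n)"
  by (simp add: inner_vec_def transpose_def) (rule sum.swap)

lemma inner_conj:
  fixes g B C :: "real^'n^'n"
  shows "(g ** B ** transpose g) \<bullet> C = B \<bullet> (transpose g ** C ** g)"
  by (simp only: inner_matrix_mult(2)[of "g ** B"] inner_matrix_mult(1)[of g B] transpose_transpose matrix_mul_assoc)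

text \<open>The orthogonal projection onto skew matrices. It allows the frame of fundamental fields
  to be indexed by the standard basis of all matrices, with no basis of so(5) to be chosen.\<close>

definition skew_part :: "real^'n^'n \<Rightarrow> real^'n^'n" where
  "skew_part B = (1 / 2) *\<^sub>R (B - transpose B)"

lemma skew_part:
  fixes B C :: "real^'n^'n"
  shows skew_part_skew: "transpose (skew_part B) = - skew_part B"
    and skew_part_add: "skew_part (B + C) = skew_part B + skew_part C"
    and skew_part_scale: "skew_part (r *\<^sub>R B) = r *\<^sub>R skew_part B"
    and skew_part_transpose: "skew_part (transpose B) = (- 1) *\<^sub>R skew_part B"
    and skew_part_conj: "skew_part (g ** B ** transpose g) = g ** skew_part B ** transpose g"
  by (simp_all add: skew_part_def transpose_simps matrix_mult_simps matrix_transpose_mul matrix_mul_assoc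
      vec_eq_iff algebra_simps)

lemma skew_part_id: "transpose B = - B \<Longrightarrow> skew_part B = (B :: real^'n^'n)"
  by (simp add: skew_part_def flip: scaleR_2)

lemma tdim_0: "tdim {0} = 0"
  unfolding tdim_def by (rule tv.dim_unique[of "{}"]) (simp_all add: tv.independent_empty)

text \<open>Positive dimension excludes that the stabilizer algebra is all of so(5), the other
  alternative in \<open>invariant_over_isotropy\<close>.\<close>

locale irreducible_coset = so3_irred5 \<rho> + coset_space H M + riem M
  for \<rho> :: "real^3^3 \<Rightarrow> real^5^5" and H :: "(real^5^5) set" and M :: "((real^5^5) set) rmfd" +
  assumes H_image: "H = \<rho> ` {R. rotation_matrix R}"
    and invariant_metric: "SO_invariant_metric M"
    and n_pos: "0 < mdim M"
begin

abbreviation "base \<equiv> \<pi> (mat 1)"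

abbreviation "act a \<equiv> (\<lambda>x. a <#\<^bsub>SO\<^esub> x)"

definition \<xi> :: "real^5^5 \<Rightarrow> ((real^5^5) set) vfield" where "\<xi> B = xi (skew_part B)"

lemma base_points: "base \<in> points M" by (rule \<pi>_points[OF rotation_matrix_1])

lemma skew_part_in: "skew_part B \<in> skew" by (simp add: skew_part_skew)

lemma \<xi>_vfields: "\<xi> B \<in> vfields M"
  unfolding \<xi>_def by (rule xi_vfields[OF skew_part_in])

lemma \<xi>_tangent: "q \<in> points M \<Longrightarrow> \<xi> B q \<in> tangent_space M q"
  unfolding \<xi>_def by (rule xi_tangent[OF skew_part_in])

lemma \<xi>_add: "q \<in> points M \<Longrightarrow> \<xi> (B + C) q = \<xi> B q + \<xi> C q"
  unfolding \<xi>_def skew_part_add by (rule xi_add[OF skew_part_in skew_part_in])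

lemma \<xi>_scale: "q \<in> points M \<Longrightarrow> \<xi> (r *\<^sub>R B) q = tscale r (\<xi> B q)"
  unfolding \<xi>_def skew_part_scale by (rule xi_scale[OF skew_part_in])

lemma \<xi>_0: "q \<in> points M \<Longrightarrow> \<xi> 0 q = 0"
  using \<xi>_scale[of q 0 0] by (simp add: tscale_def zero_fun_def)

lemma \<xi>_skew_part: "\<xi> (skew_part B) = \<xi> B"
  unfolding \<xi>_def skew_part_id[OF skew_part_skew] ..

lemma tangent_space_\<xi>:
  assumes q: "q \<in> points M" and v: "v \<in> tangent_space M q"
  obtains B where "B \<in> skew" "v = \<xi> B q"
proof -
  obtain B where B: "B \<in> skew" "v = xi B q" using v unfolding tangent_space_xi[OF q] by (rule imageE) (rule that)
  then have "v = \<xi> B q" by (simp add: \<xi>_def skew_part_id)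
  then show ?thesis using B(1) by (rule that[rotated])
qed

lemma isometry_act: "rotation_matrix a \<Longrightarrow> isometry_pair M (act a) (inv_into (points M) (act a))"
  using isometry_imp_isometry_pair[OF riem] invariant_metric
  by (simp add: SO_invariant_metric_def carrier_SO)

lemma \<xi>_act:
  assumes a: "rotation_matrix a" and q: "q \<in> points M"
  shows "dmap (act a) (\<xi> B q) = \<xi> (a ** B ** transpose a) (a <#\<^bsub>SO\<^esub> q)"
proof -
  interpret L: isometry_pair M "act a" "inv_into (points M) (act a)" by (rule isometry_act[OF a])
  show ?thesis
    unfolding \<xi>_def skew_part_conj by (rule xi_dmap[OF skew_part_in a q L.smooth(1)])
qed

lemma act_base: "rotation_matrix R \<Longrightarrow> \<rho> R <#\<^bsub>SO\<^esub> base = base"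
  using \<pi>_mult[OF hom_rot rotation_matrix_1] \<pi>_H[of "\<rho> R"] by (simp add: H_image)

lemma \<xi>_conj:
  assumes R: "rotation_matrix R"
  shows "\<xi> (\<rho> R ** B ** transpose (\<rho> R)) base = dmap (act (\<rho> R)) (\<xi> B base)"
  using \<xi>_act[OF hom_rot[OF R] base_points, of B] act_base[OF R] by simp

section \<open>The metric at the base point as an operator on matrices\<close>

definition gm :: "real^5^5 \<Rightarrow> real^5^5 \<Rightarrow> real" where
  "gm B C = metric M base (\<xi> B base) (\<xi> C base)"

lemma linear_metric_\<xi>: "q \<in> points M \<Longrightarrow> v \<in> tangent_space M q \<Longrightarrow> linear (\<lambda>B. metric M q v (\<xi> B q))"
  by (rule linearI) (simp_all add: \<xi>_add \<xi>_scale \<xi>_tangent metric_add_right metric_scale_right)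

lemma gm_sym: "gm B C = gm C B"
  unfolding gm_def by (rule metric_sym[OF base_points \<xi>_tangent[OF base_points] \<xi>_tangent[OF base_points]])

lemma linear_gm: "linear (gm B)"
  unfolding gm_def[abs_def] by (rule linear_metric_\<xi>[OF base_points \<xi>_tangent[OF base_points]])

lemma gm_conj:
  assumes R: "rotation_matrix R"
  shows "gm (\<rho> R ** B ** transpose (\<rho> R)) (\<rho> R ** C ** transpose (\<rho> R)) = gm B C"
proof -
  interpret L: isometry_pair M "act (\<rho> R)" "inv_into (points M) (act (\<rho> R))"
    by (rule isometry_act[OF hom_rot[OF R]])
  show ?thesis
    using L.metric_preserved[OF base_points \<xi>_tangent[OF base_points] \<xi>_tangent[OF base_points], of B C]
    by (simp only: gm_def \<xi>_conj[OF R] act_base[OF R])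
qed

text \<open>The symmetric operator of the form \<open>gm\<close>. Applying \<open>\<xi>\<close>
  turns it into the frame operator v \<mapsto> \<Sum> g(v, \<xi> b) \<xi> b of the tangent space, so
  an eigenvalue statement for it is a tight frame statement.\<close>

definition \<Gamma> :: "real^5^5 \<Rightarrow> real^5^5" where "\<Gamma> B = (\<Sum>b\<in>Basis. gm B b *\<^sub>R b)"

lemma \<Gamma>_inner: "\<Gamma> B \<bullet> C = gm B C"
  unfolding \<Gamma>_def by (rule riesz_functional[OF linear_gm])

lemma linear_\<Gamma>: "linear \<Gamma>"
proof (rule linearI)
  show "\<Gamma> (B + C) = \<Gamma> B + \<Gamma> C" for B C
    by (rule vector_eq_rdot[THEN iffD1])
      (simp add: \<Gamma>_inner inner_add_left gm_sym[of _ B] gm_sym[of "_ + _"] gm_sym[of C] linear_add[OF linear_gm])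
  show "\<Gamma> (r *\<^sub>R B) = r *\<^sub>R \<Gamma> B" for r B
    by (rule vector_eq_rdot[THEN iffD1])
      (simp add: \<Gamma>_inner gm_sym[of "_ *\<^sub>R _"] gm_sym[of B] linear_cmul[OF linear_gm])
qed

lemma \<Gamma>_symmetric: "\<Gamma> B \<bullet> C = B \<bullet> \<Gamma> C"
  using \<Gamma>_inner[of B C] \<Gamma>_inner[of C B] gm_sym[of B C] by (simp add: inner_commute)

lemma \<Gamma>_conj:
  assumes R: "rotation_matrix R"
  shows "\<Gamma> (\<rho> R ** B ** transpose (\<rho> R)) = \<rho> R ** \<Gamma> B ** transpose (\<rho> R)"
proof (rule vector_eq_rdot[THEN iffD1], rule allI)
  fix C
  let ?C = "transpose (\<rho> R) ** C ** \<rho> R"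
  have "\<rho> R ** ?C ** transpose (\<rho> R) = (\<rho> R ** transpose (\<rho> R)) ** C ** (\<rho> R ** transpose (\<rho> R))"
    by (simp add: matrix_mul_assoc)
  then have C: "\<rho> R ** ?C ** transpose (\<rho> R) = C" by (simp add: rotation_matrix_inverse(1)[OF hom_rot[OF R]])
  have "\<Gamma> (\<rho> R ** B ** transpose (\<rho> R)) \<bullet> C = \<Gamma> B \<bullet> ?C"
    using gm_conj[OF R, of B ?C] unfolding C \<Gamma>_inner .
  also have "\<dots> = (\<rho> R ** \<Gamma> B ** transpose (\<rho> R)) \<bullet> C"
    by (rule inner_conj[symmetric])
  finally show "\<Gamma> (\<rho> R ** B ** transpose (\<rho> R)) \<bullet> C = (\<rho> R ** \<Gamma> B ** transpose (\<rho> R)) \<bullet> C" .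
qed

text \<open>The form \<open>gm\<close> changes sign when its second argument is transposed.\<close>

lemma \<Gamma>_skew: "\<Gamma> B \<in> skew5"
proof -
  have "transpose (\<Gamma> B) \<bullet> C = - \<Gamma> B \<bullet> C" for C
  proof -
    have "\<xi> (transpose C) base = tscale (- 1) (\<xi> C base)"
      using xi_scale[OF skew_part_in base_points, of "- 1" C] by (simp only: \<xi>_def skew_part_transpose)
    then have "gm B (transpose C) = - 1 * gm B C"
      unfolding gm_def using metric_scale_right[OF base_points \<xi>_tangent[OF base_points] \<xi>_tangent[OF base_points]]
      by (simp only:)
    then show ?thesis by (simp add: inner_transpose \<Gamma>_inner)
  qed
  then have "transpose (\<Gamma> B) = - \<Gamma> B" using vector_eq_rdot by blast
  then show ?thesis by simp
qed

definition stab :: "(real^5^5) set" where "stab = {B \<in> skew5. \<xi> B base = 0}"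

lemma subspace_preimage:
  assumes "tv.subspace T"
  shows "subspace {B \<in> skew5. \<xi> B base \<in> T}"
proof (rule subspaceI)
  show "0 \<in> {B \<in> skew5. \<xi> B base \<in> T}"
    using subspace_0[OF subspace_skew] tv.subspace_0[OF assms] by (simp add: \<xi>_0[OF base_points])
  show "x + y \<in> {B \<in> skew5. \<xi> B base \<in> T}" if "x \<in> {B \<in> skew5. \<xi> B base \<in> T}" "y \<in> {B \<in> skew5. \<xi> B base \<in> T}" for x y
    using that subspace_add[OF subspace_skew, of x y] tv.subspace_add[OF assms, of "\<xi> x base" "\<xi> y base"]
    by (simp add: \<xi>_add[OF base_points])
  show "r *\<^sub>R x \<in> {B \<in> skew5. \<xi> B base \<in> T}" if "x \<in> {B \<in> skew5. \<xi> B base \<in> T}" for r x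
    using that subspace_scale[OF subspace_skew, of x r] tv.subspace_scale[OF assms, of "\<xi> x base" r]
    by (simp add: \<xi>_scale[OF base_points])
qed

text \<open>The bridge from geometry to algebra: a subspace of the tangent space invariant under the
  isotropy group becomes an invariant subspace of so(5) that contains the stabilizer
  algebra.\<close>

lemma invariant_preimage:
  assumes T: "tv.subspace T"
    and inv: "\<And>(R :: real^3^3) v. rotation_matrix R \<Longrightarrow> v \<in> T \<Longrightarrow> dmap (act (\<rho> R)) v \<in> T"
  shows "mat.invariant {B \<in> skew5. \<xi> B base \<in> T}"
proof (rule invariant_of_conj[OF subspace_preimage[OF T]])
  fix R :: "real^3^3" and B assume R: "rotation_matrix R" and B: "B \<in> {B \<in> skew5. \<xi> B base \<in> T}"
  then show "\<rho> R ** B ** transpose (\<rho> R) \<in> {B \<in> skew5. \<xi> B base \<in> T}"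
    using conj_skew[of B "\<rho> R"] inv[OF R, of "\<xi> B base"] by (simp add: \<xi>_conj[OF R])
qed

lemma stab_preimage: "stab = {B \<in> skew5. \<xi> B base \<in> {0}}"
  by (simp add: stab_def)

lemma subspace_stab: "subspace stab"
  unfolding stab_preimage by (rule subspace_preimage[OF tv.subspace_single_0])

lemma stab_conj:
  assumes R: "rotation_matrix R" and B: "B \<in> stab"
  shows "\<rho> R ** B ** transpose (\<rho> R) \<in> stab"
  using B conj_skew[of B "\<rho> R"] dmap_scale[of "act (\<rho> R)" 0 0]
  by (simp add: stab_def \<xi>_conj[OF R] tscale_def zero_fun_def)

lemma isotropy_stab: "isotropy \<subseteq> stab"
proof -
  have "gen r \<in> stab" if r: "one_param r" for r
  proof -
    have g: "gen r \<in> skew" using gen_skew[OF r] by simp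
    have "xi (gen r) base = 0"
      by (rule xi_stabilizer[OF g _ _ gen_derivative_0[OF r]])
        (simp_all add: H_image op(1)[OF r] hom_op[OF r])
    then show ?thesis using g by (simp add: stab_def \<xi>_def skew_part_id)
  qed
  then show ?thesis
    unfolding isotropy_def using one_param_axes by (intro span_minimal[OF _ subspace_stab]) simp
qed

lemma tangent_base_nonzero: "tangent_space M base \<noteq> {0}"
proof
  assume T: "tangent_space M base = {0}"
  have "mdim M = 0" using tdim_tangent_space[OF base_points] unfolding T tdim_0 by (rule sym)
  then show False using n_pos by simp
qed

text \<open>Of the two possibilities for an invariant subspace over \<open>isotropy\<close>, the
  larger one would make the tangent space zero.\<close>

lemma stab_isotropy: "stab = isotropy"
proof -
  have "stab \<noteq> skew5"
  proof
    assume "stab = skew5"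
    then have s: "\<xi> B base = 0" if "B \<in> skew5" for B using that unfolding stab_def by blast
    have "v = 0" if v: "v \<in> tangent_space M base" for v
    proof -
      obtain B where "B \<in> skew" "v = \<xi> B base" by (rule tangent_space_\<xi>[OF base_points v])
      then show ?thesis using s by simp
    qed
    then show False using tangent_base_nonzero tangent_space_0[of base] by blast
  qed
  then show ?thesis
    using invariant_over_isotropy[OF invariant_of_conj[OF subspace_stab stab_conj] _ isotropy_stab]
    unfolding stab_def by blast
qed

lemma \<Gamma>_stab: "B \<in> stab \<Longrightarrow> \<Gamma> B = 0"
  by (rule vector_eq_rdot[THEN iffD1]) 
    (simp add: \<Gamma>_inner gm_def stab_def metric_zero_left[OF base_points \<xi>_tangent[OF base_points]])

text \<open>Schur's lemma for \<open>\<Gamma>\<close> on \<open>so(5)\<close> modulo the isotropy algebra: the set of \<open>B\<close> on which \<open>\<Gamma>\<close> acts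
  as \<open>\<mu>\<close> modulo this algebra is invariant.\<close>

lemma eigenvalue: obtains \<mu> where "\<mu> > 0" "\<And>B. \<xi> (\<Gamma> B) base = tscale \<mu> (\<xi> B base)"
proof -
  obtain v where v: "v \<in> tangent_space M base" "v \<noteq> 0"
    using tangent_base_nonzero tangent_space_0[of base] by blast
  obtain B1 where B1: "B1 \<in> skew" "v = \<xi> B1 base" by (rule tangent_space_\<xi>[OF base_points v(1)])
  \<comment> \<open>The left side is the squared length of the nonzero vector \<open>v\<close>; so
    the largest eigenvalue of \<open>\<Gamma>\<close> is positive.\<close>
  have pos: "\<Gamma> B1 \<bullet> B1 > 0"
    using metric_pos[OF base_points v(1,1,2)] by (simp add: \<Gamma>_inner gm_def B1(2))
  then have "B1 \<noteq> 0" by auto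
  then have ne: "skew5 \<noteq> {0}" using B1(1) by blast
  obtain B0 \<mu> where B0: "B0 \<in> skew5" "norm B0 = 1" "\<Gamma> B0 = \<mu> *\<^sub>R B0"
    "\<And>y. y \<in> skew5 \<Longrightarrow> \<Gamma> y \<bullet> y \<le> \<mu> * (y \<bullet> y)"
    by (rule self_adjoint_max_eigenvector[OF linear_\<Gamma> \<Gamma>_symmetric subspace_skew ne \<Gamma>_skew]) (rule that)
  have "0 < \<mu> * (B1 \<bullet> B1)" using pos B0(4)[OF B1(1)] by linarith
  then have \<mu>: "\<mu> > 0" using inner_ge_zero[of B1] by (simp add: zero_less_mult_iff)
  let ?W = "{B \<in> skew5. \<Gamma> B - \<mu> *\<^sub>R B \<in> stab}"
  have subW: "subspace ?W"
  proof (rule subspaceI)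
    show "0 \<in> ?W" using subspace_0[OF subspace_stab] subspace_0[OF subspace_skew] by (simp add: linear_0[OF linear_\<Gamma>])
    show "x + y \<in> ?W" if "x \<in> ?W" "y \<in> ?W" for x y
    proof -
      have "\<Gamma> (x + y) - \<mu> *\<^sub>R (x + y) = (\<Gamma> x - \<mu> *\<^sub>R x) + (\<Gamma> y - \<mu> *\<^sub>R y)"
        by (simp add: linear_add[OF linear_\<Gamma>] scaleR_add_right)
      then show ?thesis using that subspace_add[OF subspace_stab, of "\<Gamma> x - \<mu> *\<^sub>R x" "\<Gamma> y - \<mu> *\<^sub>R y"]
          subspace_add[OF subspace_skew, of x y] by simp
    qed
    show "r *\<^sub>R x \<in> ?W" if "x \<in> ?W" for r x
    proof -
      have "\<Gamma> (r *\<^sub>R x) - \<mu> *\<^sub>R (r *\<^sub>R x) = r *\<^sub>R (\<Gamma> x - \<mu> *\<^sub>R x)"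
        by (simp add: linear_cmul[OF linear_\<Gamma>] scaleR_diff_right)
      then show ?thesis using that subspace_scale[OF subspace_stab, of "\<Gamma> x - \<mu> *\<^sub>R x" r]
          subspace_scale[OF subspace_skew, of x r] by simp
    qed
  qed
  have inv: "mat.invariant ?W"
  proof (rule invariant_of_conj[OF subW])
    fix R :: "real^3^3" and B assume R: "rotation_matrix R" and B: "B \<in> ?W"
    let ?c = "\<lambda>B. \<rho> R ** B ** transpose (\<rho> R)"
    have "\<Gamma> (?c B) - \<mu> *\<^sub>R ?c B = ?c (\<Gamma> B - \<mu> *\<^sub>R B)" by (simp add: \<Gamma>_conj[OF R] matrix_mult_simps)
    then show "?c B \<in> ?W" using B stab_conj[OF R, of "\<Gamma> B - \<mu> *\<^sub>R B"] conj_skew[of B "\<rho> R"] by simp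
  qed
  have "stab \<subseteq> ?W"
    using subspace_scale[OF subspace_stab, of _ "- \<mu>"] by (auto simp: \<Gamma>_stab) (simp add: stab_def)
  moreover have "B0 \<in> ?W" using B0(1,3) subspace_0[OF subspace_stab] by simp
  \<comment> \<open>\<open>\<Gamma>\<close> kills \<open>stab\<close> but multiplies
    \<open>B0\<close> by a positive number. Hence the invariant set is strictly larger than
    \<open>stab\<close> and must be everything.\<close>
  moreover have "B0 \<notin> stab"
  proof
    assume "B0 \<in> stab"
    then have "\<mu> *\<^sub>R B0 = 0" using \<Gamma>_stab B0(3) by simp
    then show False using \<mu> B0(2) by auto
  qed
  ultimately have "?W = skew5"
    using invariant_over_isotropy[OF inv] unfolding stab_isotropy by blast
  then have W: "\<Gamma> B - \<mu> *\<^sub>R B \<in> stab" if "B \<in> skew5" for B using that by blast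
  have "\<xi> (\<Gamma> B) base = tscale \<mu> (\<xi> B base)" for B
  proof -
    let ?P = "skew_part B"
    \<comment> \<open>\<open>gm\<close> sees its arguments only through \<open>\<xi>\<close>, hence
      only their skew parts; this extends the claim from skew matrices to all.\<close>
    have "\<Gamma> B = \<Gamma> ?P"
      by (rule vector_eq_rdot[THEN iffD1]) (simp add: \<Gamma>_inner gm_def \<xi>_skew_part)
    then have "\<xi> (\<Gamma> B) base = \<xi> ((\<Gamma> ?P - \<mu> *\<^sub>R ?P) + \<mu> *\<^sub>R ?P) base" by simp
    also have "\<dots> = \<xi> (\<Gamma> ?P - \<mu> *\<^sub>R ?P) base + \<xi> (\<mu> *\<^sub>R ?P) base" by (rule \<xi>_add[OF base_points])
    also have "\<xi> (\<Gamma> ?P - \<mu> *\<^sub>R ?P) base = 0" using W[OF skew_part_in] by (simp add: stab_def)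
    finally show ?thesis by (simp add: \<xi>_scale[OF base_points] \<xi>_skew_part)
  qed
  with \<mu> show ?thesis by (rule that)
qed

text \<open>At the base point the frame operator is the scalar of \<open>eigenvalue\<close>. Another
  point is reached by an isometry a, which carries \<open>\<xi> B\<close> to \<open>\<xi>\<close> of
  the conjugate of B by a; conjugation is orthogonal on matrices, so the frame identity persists
  with the same constant.\<close>

lemma levi_civita: "\<exists>D. is_levi_civita M D"
proof -
  obtain \<mu> where \<mu>: "\<mu> > 0" "\<And>B. \<xi> (\<Gamma> B) base = tscale \<mu> (\<xi> B base)" by (rule eigenvalue) (rule that)
  have \<xi>_sum: "\<xi> (\<Sum>b\<in>A. f b *\<^sub>R b) base = (\<Sum>b\<in>A. tscale (f b) (\<xi> b base))" for A f
    by (induction A rule: infinite_finite_induct) (simp_all add: \<xi>_0 \<xi>_add \<xi>_scale base_points)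
  \<comment> \<open>The eigenvalue equation for \<open>\<Gamma> B\<close>, expanded in the standard
    basis and paired with \<open>\<xi> C\<close>.\<close>
  have base: "(\<Sum>b\<in>Basis. metric M base (\<xi> B base) (\<xi> b base) * metric M base (\<xi> b base) (\<xi> C base)) =
      \<mu> * metric M base (\<xi> B base) (\<xi> C base)" for B C
  proof -
    note t = \<xi>_tangent[OF base_points]
    have "metric M base (\<xi> (\<Gamma> B) base) (\<xi> C base) =
        (\<Sum>b\<in>Basis. metric M base (tscale (gm B b) (\<xi> b base)) (\<xi> C base))"
      unfolding \<Gamma>_def \<xi>_sum by (rule metric_sum_left[OF base_points t]) (rule tangent_space_scale[OF t])
    then show ?thesis
      unfolding \<mu>(2) metric_scale_left[OF base_points t t] gm_def by simp
  qed
  show ?thesis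
  proof (rule levi_civita_exists[OF finite_Basis, where \<xi> = \<xi> and c = "1 / \<mu>"])
    show "\<xi> b \<in> vfields M" for b by (rule \<xi>_vfields)
    fix q Z assume q: "q \<in> points M" and Z: "Z \<in> tangent_space M q"
    note t = \<xi>_tangent[OF q] and t0 = \<xi>_tangent[OF base_points]
    obtain a where a: "rotation_matrix a" "q = \<pi> a" by (rule points_cases[OF q])
    have qa: "a <#\<^bsub>SO\<^esub> base = q" using \<pi>_mult[OF a(1) rotation_matrix_1] a(2) by simp
    let ?L = "\<lambda>B. a ** B ** transpose a" and ?L' = "\<lambda>B. transpose a ** B ** a"
    have LL': "?L (?L' B) = B" for B
    proof -
      have "?L (?L' B) = (a ** transpose a) ** B ** (a ** transpose a)" by (simp add: matrix_mul_assoc)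
      then show ?thesis by (simp add: rotation_matrix_inverse(1)[OF a(1)])
    qed
    have LL: "?L x \<bullet> y = x \<bullet> ?L' y" for x y by (rule inner_conj)
    interpret L: isometry_pair M "act a" "inv_into (points M) (act a)" by (rule isometry_act[OF a(1)])
    have push: "dmap (act a) (\<xi> B base) = \<xi> (?L B) q" for B using \<xi>_act[OF a(1) base_points, of B] qa by simp
    have m: "metric M q (\<xi> (?L B) q) (\<xi> (?L C) q) = metric M base (\<xi> B base) (\<xi> C base)" for B C
      using L.metric_preserved[OF base_points t0 t0, of B C] by (simp only: push qa)
    \<comment> \<open>The basis elements are replaced by their conjugates, after which every entry
      can be pulled back to the base point by \<open>m\<close>.\<close>
    have "(\<Sum>b\<in>Basis. metric M q (\<xi> (?L B) q) (\<xi> b q) * metric M q (\<xi> (?L C) q) (\<xi> b q)) =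
        (\<Sum>b\<in>Basis. metric M q (\<xi> (?L B) q) (\<xi> (?L b) q) * metric M q (\<xi> (?L C) q) (\<xi> (?L b) q))" for B C
      by (rule sum_Basis_orthogonal_change[OF linear_metric_\<xi>[OF q t] linear_metric_\<xi>[OF q t] LL LL', symmetric])
    then have sum: "(\<Sum>b\<in>Basis. metric M q (\<xi> (?L B) q) (\<xi> b q) * metric M q (\<xi> (?L C) q) (\<xi> b q)) =
        \<mu> * metric M q (\<xi> (?L B) q) (\<xi> (?L C) q)" for B C
      unfolding m by (simp only: base[symmetric] metric_sym[OF base_points t0 t0, of C])
    obtain B where B: "Z = \<xi> B q" by (rule tangent_space_\<xi>[OF q Z])
    have S: "(\<Sum>b\<in>Basis. tscale (1 / \<mu> * metric M q Z (\<xi> b q)) (\<xi> b q)) \<in> tangent_space M q"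
      by (rule tangent_space_sum) (rule tangent_space_scale[OF t])
    show "Z = (\<Sum>b\<in>Basis. tscale (1 / \<mu> * metric M q Z (\<xi> b q)) (\<xi> b q))"
    proof (rule metric_eqI[OF q Z S])
      fix v assume v: "v \<in> tangent_space M q"
      obtain C where C: "v = \<xi> C q" by (rule tangent_space_\<xi>[OF q v])
      have "metric M q (\<Sum>b\<in>Basis. tscale (1 / \<mu> * metric M q Z (\<xi> b q)) (\<xi> b q)) v =
          (\<Sum>b\<in>Basis. metric M q (tscale (1 / \<mu> * metric M q Z (\<xi> b q)) (\<xi> b q)) v)"
        by (rule metric_sum_left[OF q v]) (rule tangent_space_scale[OF t])
      also have "\<dots> = (\<Sum>b\<in>Basis. 1 / \<mu> * (metric M q Z (\<xi> b q) * metric M q v (\<xi> b q)))"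
        by (simp only: metric_scale_left[OF q t v] metric_sym[OF q t v] mult.assoc)
      also have "\<dots> = 1 / \<mu> * (\<Sum>b\<in>Basis. metric M q Z (\<xi> b q) * metric M q v (\<xi> b q))"
        by (simp only: sum_distrib_left)
      also have "\<dots> = metric M q Z v"
        using sum[of "?L' B" "?L' C"] \<mu>(1) unfolding LL' B C by simp
      finally show "metric M q Z v = metric M q (\<Sum>b\<in>Basis. tscale (1 / \<mu> * metric M q Z (\<xi> b q)) (\<xi> b q)) v" by simp
    qed
  qed
qed

text \<open>Left translations are isometries and act transitively, so the dimension is constant and
  the definite description is resolved.\<close>

lemma index: "index_of_symmetry M = tdim (symmetry_subspace M base)"
  unfolding index_of_symmetry_def
proof (rule the_equality)
  have "tdim (symmetry_subspace M q) = tdim (symmetry_subspace M base)" if q: "q \<in> points M" for q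
  proof -
    obtain a where a: "rotation_matrix a" "q = \<pi> a" by (rule points_cases[OF q])
    have "a <#\<^bsub>SO\<^esub> base = q" using \<pi>_mult[OF a(1) rotation_matrix_1] a(2) by simp
    then show ?thesis
      using isometry_pair.tdim_symmetry_subspace[OF isometry_act[OF a(1)] levi_civita base_points] by simp
  qed
  then show "\<forall>q\<in>points M. tdim (symmetry_subspace M q) = tdim (symmetry_subspace M base)" by blast
  show "k = tdim (symmetry_subspace M base)" if "\<forall>q\<in>points M. tdim (symmetry_subspace M q) = k" for k
    using bspec[OF that base_points] by simp
qed

lemma symmetry_subspace_cases:
  "symmetry_subspace M base = {0} \<or> symmetry_subspace M base = tangent_space M base"
proof -
  let ?S = "symmetry_subspace M base" and ?W = "{B \<in> skew5. \<xi> B base \<in> symmetry_subspace M base}"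
  note sub = subspace_symmetry_subspace[OF riem levi_civita base_points]
  have "dmap (act (\<rho> R)) v \<in> ?S" if R: "rotation_matrix R" and v: "v \<in> ?S" for R v
  proof -
    have *: "?S = dmap (act (\<rho> R)) ` ?S"
      using isometry_pair.symmetry_subspace_image[OF isometry_act[OF hom_rot[OF R]] levi_civita base_points]
      by (simp only: act_base[OF R])
    show ?thesis by (subst *) (rule imageI[OF v])
  qed
  then have "mat.invariant ?W" by (rule invariant_preimage[OF sub(1)])
  moreover have "isotropy \<subseteq> ?W"
    using isotropy_stab tv.subspace_0[OF sub(1)] by (auto simp: stab_def)
  ultimately consider "?W = isotropy" | "?W = skew5" using invariant_over_isotropy[of ?W] by blast
  then show ?thesis
  proof cases
    case 1
    have "v = 0" if v: "v \<in> ?S" for v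
    proof -
      have "v \<in> tangent_space M base" using sub(2) v by blast
      then obtain B where B: "B \<in> skew" "v = \<xi> B base" by (rule tangent_space_\<xi>[OF base_points]) (rule that)
      then have "B \<in> stab" using v 1 isotropy_stab by blast
      then show ?thesis using B(2) by (simp add: stab_def)
    qed
    then show ?thesis using tv.subspace_0[OF sub(1)] by blast
  next
    case 2
    have "v \<in> ?S" if v: "v \<in> tangent_space M base" for v
    proof -
      obtain B where B: "B \<in> skew" "v = \<xi> B base" by (rule tangent_space_\<xi>[OF base_points v])
      then show ?thesis using 2 by blast
    qed
    then show ?thesis using sub(2) by blast
  qed
qed

text \<open>The kernel of evaluation at the base point is \<open>isotropy\<close>, which meets
  \<open>spin3\<close> in 0, so \<open>spin3\<close> embeds in the tangent space. A lower bound
  above 4 is all that the conclusion requires.\<close>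

lemma dim_ge: "7 \<le> mdim M"
proof -
  let ?f = "\<lambda>B. \<xi> B base"
  interpret p: vector_space_pair "scaleR :: real \<Rightarrow> real^5^5 \<Rightarrow> real^5^5" "tscale :: real \<Rightarrow> (real^5^5) set tvec \<Rightarrow> _"
    by (intro vector_space_pair.intro vector_space_tscale) unfold_locales
  have lin: "Vector_Spaces.linear scaleR tscale ?f"
    by (intro Vector_Spaces.linear.intro vector_space_tscale module_hom.intro module_hom_axioms.intro)
      (simp_all add: vector_space_tscale module_iff_vector_space real_vector.vector_space_axioms \<xi>_add \<xi>_scale base_points)
  obtain b where b: "b \<subseteq> spin3" "independent b" "card b = dim spin3"
    using basis_exists[of spin3] by metis
  have "x = 0" if "x \<in> span b" "?f x = 0" for x
  proof -
    have "x \<in> spin3" using that(1) span_minimal[OF b(1) subspace_spin3] by blast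
    moreover have "x \<in> isotropy" using calculation that(2) by (simp add: stab_isotropy[symmetric] stab_def spin3_def)
    ultimately show ?thesis using spin3_isotropy by blast
  qed
  then have inj: "inj_on ?f (span b)"
    by (subst p.linear_inj_on_iff_eq_0[OF lin]) (simp_all flip: subspace_raw_def)
  have "tv.independent (?f ` b)" by (rule p.linear_independent_injective_image[OF lin])
      (simp_all add: b(2) inj flip: dependent_raw_def span_raw_def)
  have c: "card (?f ` b) = card b" by (rule card_image[OF inj_on_subset[OF inj span_superset]])
  obtain U \<phi> where U: "(U, \<phi>) \<in> charts M" "base \<in> U" using chart_cover[OF base_points] by blast
  have "?f ` b \<subseteq> tv.span (chartvec U \<phi> base ` {..<mdim M})"
    using \<xi>_tangent[OF base_points] unfolding tangent_space_chartvec_span[OF U] by blast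
  then have "card (?f ` b) \<le> card (chartvec U \<phi> base ` {..<mdim M})"
    using tv.independent_span_bound[of "chartvec U \<phi> base ` {..<mdim M}" "?f ` b"] \<open>tv.independent (?f ` b)\<close> by blast
  also have "\<dots> \<le> mdim M" using card_image_le[of "{..<mdim M}" "chartvec U \<phi> base"] by simp
  finally show ?thesis using c b(3) dim_spin3 by simp
qed

theorem coindex: "coindex_of_symmetry M = 0 \<or> 7 \<le> coindex_of_symmetry M"
  using symmetry_subspace_cases
proof
  assume "symmetry_subspace M base = {0}"
  then have "index_of_symmetry M = 0" unfolding index by (simp only: tdim_0)
  then show ?thesis using dim_ge by (simp add: coindex_of_symmetry_def)
next
  assume "symmetry_subspace M base = tangent_space M base"
  then have "index_of_symmetry M = mdim M"
    unfolding index by (simp only: tdim_tangent_space[OF base_points])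
  then show ?thesis by (simp add: coindex_of_symmetry_def)
qed

end

lemma rotation_matrix_inv: "rotation_matrix g \<Longrightarrow> matrix_inv g = transpose (g :: real^'n^'n)"
proof -
  assume g: "rotation_matrix g"
  have "invertible g" using rotation_matrix_inverse[OF g] unfolding invertible_def by blast
  then have "matrix_inv g ** g ** transpose g = transpose g" by (simp add: matrix_inv_inverse)
  then show ?thesis by (simp add: matrix_mul_assoc[symmetric] rotation_matrix_inverse(1)[OF g])
qed

theorem theorem4p1:
  fixes H :: "(real^5^5) set"
    and M :: "((real^5^5) set) rmfd"
    and N :: "'u rmfd"
    and p :: "'u \<Rightarrow> (real^5^5) set"
  assumes "subgroup H SO" and "closed H"
    and "lie_group_isomorphic (SO\<lparr>carrier := H\<rparr>) (SO :: (real^3^3) monoid)"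
    and "riemannian_manifold M" and "coset_manifold H M" and "SO_invariant_metric M"
    and "coindex_of_symmetry M = 4"
    and "riemannian_universal_cover N M p"
    and "\<not> has_symmetric_factor N"
  shows "\<exists>g\<in>carrier SO. H = {g ** block3 A ** matrix_inv g | A. A \<in> carrier SO}"
proof -
  obtain \<theta> where \<theta>: "\<theta> \<in> iso (SO\<lparr>carrier := H\<rparr>) (SO :: (real^3^3) monoid)"
    "homeomorphic_map (top_of_set H) (top_of_set {R. rotation_matrix R}) \<theta>"
    using assms(3) by (auto simp: lie_group_isomorphic_def carrier_SO)
  \<comment> \<open>The representation is the inverse of the given isomorphism, so that
    \<open>H\<close> is its image.\<close>
  obtain \<rho> where hm: "homeomorphic_maps (top_of_set H) (top_of_set {R. rotation_matrix R}) \<theta> \<rho>"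
    using \<theta>(2) unfolding homeomorphic_map_maps by blast
  have \<rho>: "continuous_on {R. rotation_matrix R} \<rho>" "\<And>R. rotation_matrix R \<Longrightarrow> \<rho> R \<in> H"
    "\<And>R. rotation_matrix R \<Longrightarrow> \<theta> (\<rho> R) = R" "\<And>h. h \<in> H \<Longrightarrow> \<rho> (\<theta> h) = h"
    "\<And>h. h \<in> H \<Longrightarrow> rotation_matrix (\<theta> h)"
    using hm by (auto simp: homeomorphic_maps_def Pi_iff continuous_map_in_subtopology image_subset_iff)
  have \<theta>_mult: "\<theta> (h ** k) = \<theta> h ** \<theta> k" if "h \<in> H" "k \<in> H" for h k
    using \<theta>(1) that by (auto simp: iso_def hom_def mult_SO)
  have H_mult: "h ** k \<in> H" if "h \<in> H" "k \<in> H" for h k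
    using subgroup.m_closed[OF assms(1) that] by (simp add: mult_SO)
  have H_rot: "rotation_matrix h" if "h \<in> H" for h
    using subgroup.subset[OF assms(1)] that by (auto simp: carrier_SO)
  have mult: "\<rho> (R ** S) = \<rho> R ** \<rho> S" if R: "rotation_matrix R" and S: "rotation_matrix S" for R S
    using \<rho>(4)[OF H_mult[OF \<rho>(2)[OF R] \<rho>(2)[OF S]]] \<theta>_mult[OF \<rho>(2)[OF R] \<rho>(2)[OF S]] \<rho>(3) R S by simp
  interpret so3_hom \<rho>
  proof
    show "\<rho> (mat 1) = mat 1"
    proof -
      have r: "rotation_matrix (\<rho> (mat 1))" by (rule H_rot[OF \<rho>(2)[OF rotation_matrix_1]])
      \<comment> \<open>An idempotent among invertible matrices is the identity.\<close>
      have "\<rho> (mat 1) ** \<rho> (mat 1) = \<rho> (mat 1)"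
        using mult[OF rotation_matrix_1 rotation_matrix_1] by simp
      then have "transpose (\<rho> (mat 1)) ** (\<rho> (mat 1) ** \<rho> (mat 1)) = transpose (\<rho> (mat 1)) ** \<rho> (mat 1)" by (simp only:)
      then show ?thesis by (simp add: matrix_mul_assoc rotation_matrix_inverse(2)[OF r])
    qed
  qed (simp_all add: mult \<rho>(1) H_rot \<rho>(2))
  have H: "H = \<rho> ` {R. rotation_matrix R}"
  proof
    show "H \<subseteq> \<rho> ` {R. rotation_matrix R}" using \<rho>(4,5) by (metis (mono_tags, lifting) imageI mem_Collect_eq subsetI)
  qed (use \<rho>(2) in auto)
  have inj: "inj_on \<rho> {R. rotation_matrix R}"
    by (rule inj_on_inverseI[of _ \<theta>]) (simp add: \<rho>(3))
  from so3_hom_5_cases[OF so3_hom_axioms inj] show ?thesis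
  proof
    assume "\<exists>g. rotation_matrix g \<and> (\<forall>R. rotation_matrix R \<longrightarrow> \<rho> R ** g = g ** block3 R)"
    then obtain g where g: "rotation_matrix g" "\<And>R. rotation_matrix R \<Longrightarrow> \<rho> R ** g = g ** block3 R" by blast
    have "\<rho> R = g ** block3 R ** matrix_inv g" if "rotation_matrix R" for R
    proof -
      have "g ** block3 R ** matrix_inv g = \<rho> R ** (g ** transpose g)"
        by (simp add: g(2)[OF that, symmetric] rotation_matrix_inv[OF g(1)] matrix_mul_assoc)
      then show ?thesis by (simp add: rotation_matrix_inverse(1)[OF g(1)])
    qed
    then have "H = {g ** block3 A ** matrix_inv g | A. A \<in> carrier SO}"
      unfolding H by (auto simp: carrier_SO)
    then show ?thesis using g(1) by (auto simp: carrier_SO)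
  next
    assume "\<forall>x. vec.casimir x = 6 *\<^sub>R x"
    then have c: "vec.casimir x = 6 *\<^sub>R x" for x by blast
    \<comment> \<open>With truncated subtraction a co-index of 4 is possible only in positive
      dimension.\<close>
    have n: "0 < mdim M" using assms(7) by (simp add: coindex_of_symmetry_def)
    interpret irreducible_coset \<rho> H M
      by (intro irreducible_coset.intro so3_irred5.intro so3_irred5_axioms.intro so3_hom_axioms
          coset_space.intro riem.intro irreducible_coset_axioms.intro c assms(1,4,5,6) H n)
    show ?thesis using coindex assms(7) by simp
  qed
qed

end
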